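(* Let $\alpha$ be a given irrational number. Then, for any $0<\theta<6/17$, there are infinitely many $Y$-smooth numbers $n$ (i.e. positive integers $n$ with $P^+(n)\leq Y$) such that \[\|n\alpha\|<n^{-\theta},\] where $(\log n)^C\leq Y\leq n$ for some large absolute constant $C>0$.
   Context: For a real number $x$, $\|x\|$ denotes the distance from $x$ to the nearest integer. For a positive integer $n$, $P^+(n)$ denotes the largest prime divisor of $n$, with the convention $P^+(1)=1$. *)

theory Defs
  imports Complex_Main "HOL-Computational_Algebra.Primes"
begin

definition dist_nearest_int :: "real \<Rightarrow> real" where
  "dist_nearest_int x = \<bar>x - of_int (round x)\<bar>"

text \<open>Only meaningful for \<open>n > 0\<close>.\<close>

definition largest_prime_divisor :: "nat \<Rightarrow> nat" where
  "largest_prime_divisor n = (if n = 1 then 1 else Max {p. prime p \<and> p dvd n})"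

definition smooth_number :: "real \<Rightarrow> nat \<Rightarrow> bool" where
  "smooth_number Y n \<longleftrightarrow> n > 0 \<and> real (largest_prime_divisor n) \<le> Y"

end

theory Submission
  imports Defs "HOL-Analysis.Analysis" "HOL-Number_Theory.Number_Theory"
    "HOL-Computational_Algebra.Squarefree" "HOL-Real_Asymp.Real_Asymp"
begin

text \<open>
  Take a reduced fraction \<open>a/q\<close> with \<open>|\<alpha> - a/q| < 1/q^2\<close>, write \<open>q = u^46000\<close>, and look for \<open>n = k l\<close> with
  \<open>k \<le> M = u^43940\<close> smooth and \<open>l = s t t'\<close> a product of three pairwise coprime squarefree smooth numbers of sizes
  \<open>u^6020, u^9020, u^9020\<close>. Let \<open>c(k)\<close> be the number of such \<open>l\<close> with \<open>||k l \<alpha>|| \<le> \<delta> = u^(-24000)\<close>; note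
  \<open>24000/68000 = 6/17\<close>. Smooth \<open>k\<close> have density at least \<open>1/u\<close>, so if \<open>c\<close> vanished on them, Cauchy's inequality
  would contradict the asymptotics of the first two moments of \<open>c\<close> over all \<open>k \<le> M\<close>, which
  hold with relative error \<open>O(1/u^2)\<close>.

  For the second moment, let \<open>l x\<close> and \<open>l' x\<close>, where \<open>x = k \<alpha>\<close>, be close to the integers \<open>b\<close> and \<open>b'\<close>, and put
  \<open>g = gcd l l'\<close>, \<open>j = (b l' - b' l)/g\<close>. The case \<open>j = 0\<close> is rare because \<open>g x\<close> is then very close to an integer;
  for \<open>j \<noteq> 0\<close> the number \<open>g x\<close> is close to \<open>j (l'/g)^(-1) / (l/g)\<close> modulo 1. Erdos--Turan
  turns this into a bilinear form with Kloosterman fractions modulo \<open>l/g\<close>. After Cauchy and completion one needs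
  Kloosterman sums only on average over moduli that split into three coprime factors; there the elementary
  fourth moment of Kloosterman sums replaces Weil's bound.
\<close>


section \<open>Exponential sums and distance to the nearest integer\<close>

text \<open>Let L be the size of l and S, T, T those of its factors; small powers of u are ignored.
  The pairs with j = 0 are harmless if (M/q)^2 and (\<delta> q/L)^2 are at most \<delta>^2 M, that
  is, M \<le> (\<delta> q)^2 and q^2 \<le> M L^2. With \<delta> = 1/L both conditions meet at q^2 =
  M L^2, as for the exponents 24000, 44000, 46000 of L, M, q; moving u^60 from M to L gives a margin
  in both. Frequencies r g up to L/\<delta> occur, so the squared Kloosterman error is about L T^2
  S^3 T^3 (L^2)^2 = u^183000, below (M L^2)^2 = u^184000.

  For a single Kloosterman sum the fourth moment gives only the exponent 3/4. Square-root
  cancellation appears on average over twists of both arguments by a common unit, and factorable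
  moduli supply such twists for free: in a sum modulo \<sigma> t t' each factor is twisted by the
  inverse of the others. The factor t is averaged over t', and \<sigma>, which comes from two values
  of s and can be as large as S^2, over the product t t'. Hence the condition that S is at most
  T.\<close>

definition ee :: "real \<Rightarrow> complex" where "ee x = cis (2 * pi * x)"

lemma ee_add: "ee (x + y) = ee x * ee y"
  by (simp add: ee_def cis_mult distrib_left)

lemma ee_0 [simp]: "ee 0 = 1"
  by (simp add: ee_def)

lemma ee_minus: "ee (- x) = cnj (ee x)"
  by (simp add: ee_def cis_cnj)

lemma norm_ee [simp]: "norm (ee x) = 1"
  by (simp add: ee_def)

lemma ee_int: "n \<in> \<int> \<Longrightarrow> ee n = 1"
  by (auto simp: ee_def elim!: Ints_cases intro: cis_multiple_2pi)

lemma ee_add_int: "n \<in> \<int> \<Longrightarrow> ee (x + n) = ee x"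
  by (simp add: ee_add ee_int)

lemma ee_cong: "x - y \<in> \<int> \<Longrightarrow> ee x = ee y"
  using ee_add_int[of "x - y" y] by simp

lemma ee_power: "ee x ^ n = ee (real n * x)"
  by (simp add: ee_def Complex.DeMoivre algebra_simps)

lemma ee_eq_1_iff: "ee x = 1 \<longleftrightarrow> x \<in> \<int>"
proof
  assume "ee x = 1"
  hence "cos (2 * pi * x) = 1" by (simp add: ee_def complex_eq_iff)
  then obtain n :: int where "2 * pi * x = n * 2 * pi"
    by (auto simp: cos_one_2pi_int)
  hence "x = n" by simp
  thus "x \<in> \<int>" by simp
qed (rule ee_int)

abbreviation (input) dn :: "real \<Rightarrow> real" where "dn \<equiv> dist_nearest_int"

lemma dn_nonneg: "0 \<le> dn x"
  by (simp add: dist_nearest_int_def)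

lemma dn_le: "dn x \<le> \<bar>x - of_int n\<bar>"
  unfolding dist_nearest_int_def using round_diff_minimal[of x n] by simp

lemma dn_le_half: "dn x \<le> 1/2"
  unfolding dist_nearest_int_def using of_int_round_abs_le[of x] by (simp add: abs_minus_commute)

lemma dn_obtain: obtains n :: int where "dn x = \<bar>x - of_int n\<bar>"
  by (auto simp: dist_nearest_int_def)

lemma dn_add_int: "m \<in> \<int> \<Longrightarrow> dn (x + m) = dn x"
proof (rule antisym)
  assume "m \<in> \<int>"
  then obtain k where k: "m = of_int k" by (auto elim: Ints_cases)
  obtain n where n: "dn x = \<bar>x - of_int n\<bar>" by (rule dn_obtain)
  show "dn (x + m) \<le> dn x" using dn_le[of "x+m" "n+k"] n k by simp
  obtain n' where n': "dn (x+m) = \<bar>x + m - of_int n'\<bar>" by (rule dn_obtain)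
  show "dn x \<le> dn (x + m)" using dn_le[of x "n'-k"] n' k by (simp add: algebra_simps)
qed

lemma dn_cong: "x - y \<in> \<int> \<Longrightarrow> dn x = dn y"
  using dn_add_int[of "x - y" y] by simp

lemma dn_minus: "dn (- x) = dn x"
proof -
  have "dn (-x) \<le> dn x" for x
  proof -
    obtain n where n: "dn x = \<bar>x - of_int n\<bar>" by (rule dn_obtain)
    show ?thesis using dn_le[of "-x" "-n"] n by simp
  qed
  from this[of x] this[of "-x"] show ?thesis by simp
qed

lemma dn_triangle: "dn (x + y) \<le> dn x + \<bar>y\<bar>"
proof -
  obtain n where n: "dn x = \<bar>x - of_int n\<bar>" by (rule dn_obtain)
  show ?thesis using dn_le[of "x+y" n] n by linarith
qed

lemma dn_triangle2: "dn (x + y) \<le> dn x + dn y"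
proof -
  obtain n where n: "dn x = \<bar>x - of_int n\<bar>" by (rule dn_obtain)
  obtain m where m: "dn y = \<bar>y - of_int m\<bar>" by (rule dn_obtain)
  show ?thesis using dn_le[of "x+y" "n+m"] n m by simp
qed

lemma dn_eq_0_iff: "dn x = 0 \<longleftrightarrow> x \<in> \<int>"
proof
  assume "dn x = 0"
  hence "x = of_int (round x)" by (simp add: dist_nearest_int_def)
  thus "x \<in> \<int>" by (metis Ints_of_int)
next
  assume "x \<in> \<int>"
  then obtain n where "x = of_int n" by (auto elim: Ints_cases)
  thus "dn x = 0" by (simp add: dist_nearest_int_def)
qed

text \<open>Jordan's inequality: sine is concave on [0, pi], so it lies above its chord from 0 to
  pi/2.\<close>

lemma sin_pi_ge: assumes "0 \<le> x" "x \<le> 1/2" shows "sin (pi * x) \<ge> 2 * x"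
proof -
  have "concave_on {0..pi} sin"
  proof (rule f''_le0_imp_concave[where f' = cos and f'' = "\<lambda>x. - sin x"])
  qed (auto intro!: derivative_eq_intros sin_ge_zero)
  hence "sin ((1 - 2*x) *\<^sub>R 0 + (2*x) *\<^sub>R (pi/2)) \<ge> (1 - 2*x) * sin 0 + (2*x) * sin (pi/2)"
    using assms by (intro concave_onD) auto
  thus ?thesis by (simp add: mult.commute)
qed

lemma norm_1_minus_ee: "norm (1 - ee x) \<ge> 4 * dn x"
proof -
  obtain n where n: "dn x = \<bar>x - of_int n\<bar>" by (rule dn_obtain)
  define y where "y = x - of_int n"
  have eq: "ee x = ee y" by (rule ee_cong) (simp add: y_def)
  have "(norm (1 - ee y))\<^sup>2 = (1 - cos (2*pi*y))\<^sup>2 + (sin (2*pi*y))\<^sup>2"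
    by (simp add: ee_def cmod_power2)
  also have "\<dots> = 2 - 2 * cos (2*(pi*y))"
    using sin_cos_squared_add[of "2*pi*y"] by (simp add: power2_eq_square algebra_simps)
  also have "\<dots> = (2 * sin (pi * \<bar>y\<bar>))\<^sup>2"
    by (subst cos_double_sin) (simp add: power_mult_distrib abs_if)
  finally have "(norm (1 - ee y))\<^sup>2 = (2 * sin (pi * \<bar>y\<bar>))\<^sup>2" .
  moreover have s: "sin (pi * \<bar>y\<bar>) \<ge> 2 * \<bar>y\<bar>"
    using dn_le_half[of x] n by (intro sin_pi_ge) (auto simp: y_def)
  ultimately have "norm (1 - ee y) = 2 * sin (pi * \<bar>y\<bar>)"
    by (intro power2_eq_imp_eq[of "norm (1 - ee y)"]) auto
  thus ?thesis using s n eq by (simp add: y_def)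
qed

lemma geometric_ee_bound: 
  assumes "dn x > 0"
  shows "norm (\<Sum>k<n. ee (real k * x)) \<le> 1 / (2 * dn x)"
proof -
  have ne: "ee x \<noteq> 1" using assms dn_eq_0_iff[of x] by (auto simp: ee_eq_1_iff)
  have "(\<Sum>k<n. ee (real k * x)) = (\<Sum>k<n. ee x ^ k)" by (simp add: ee_power)
  also have "\<dots> = (ee x ^ n - 1) / (ee x - 1)" using ne by (simp add: geometric_sum)
  finally have "norm (\<Sum>k<n. ee (real k * x)) = norm (ee x ^ n - 1) / norm (1 - ee x)"
    by (simp add: norm_divide norm_minus_commute)
  also have "\<dots> \<le> 2 / (4 * dn x)"
  proof (rule frac_le)
    show "norm (ee x ^ n - 1) \<le> 2"
      using norm_triangle_ineq4[of "ee x ^ n" 1] by (simp add: norm_power)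
  qed (use norm_1_minus_ee[of x] assms in auto)
  finally show ?thesis by simp
qed

lemma geometric_ee_bound1: 
  assumes "dn x > 0"
  shows "norm (\<Sum>k\<in>{1..n}. ee (real k * x)) \<le> 1 / (2 * dn x)"
proof -
  have "(\<Sum>k\<in>{1..n}. ee (real k * x)) = (\<Sum>k<n. ee (real (Suc k) * x))"
    by (rule sum.reindex_bij_witness[of _ Suc "\<lambda>k. k - 1"]) auto
  also have "\<dots> = ee x * (\<Sum>k<n. ee (real k * x))"
    by (simp add: sum_distrib_left distrib_right flip: ee_add)
  finally show ?thesis using geometric_ee_bound[OF assms, of n] by (simp add: norm_mult)
qed

lemma sum_ee_residues:
  fixes r :: int
  assumes "c > (0::nat)"
  shows "(\<Sum>k<c. ee (real k * real_of_int r / real c)) = (if int c dvd r then of_nat c else 0)"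
proof (cases "int c dvd r")
  case True
  then obtain m where m: "r = int c * m" by auto
  have "ee (real k * real_of_int r / real c) = 1" for k
    using assms by (intro ee_int) (simp add: m)
  thus ?thesis using True by simp
next
  case False
  define x where "x = real_of_int r / real c"
  have "x \<notin> \<int>"
  proof
    assume "x \<in> \<int>"
    then obtain m :: int where "x = m" by (auto elim: Ints_cases)
    hence "real_of_int r = real_of_int (int c * m)" using assms by (simp add: x_def field_simps)
    hence "r = int c * m" by linarith
    with False show False by simp
  qed
  hence ne: "ee x \<noteq> 1" by (simp add: ee_eq_1_iff)
  have "(\<Sum>k<c. ee (real k * real_of_int r / real c)) = (\<Sum>k<c. ee x ^ k)"
    by (simp add: ee_power x_def)
  also have "\<dots> = (ee x ^ c - 1) / (ee x - 1)" using ne by (simp add: geometric_sum)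
  also have "ee x ^ c = 1" using assms by (simp add: ee_power x_def ee_int)
  finally show ?thesis using False by simp
qed

section \<open>Integers in intervals and grid points on the circle\<close>

lemma card_int_interval_le:
  fixes a b :: real
  assumes "a \<le> b"
  shows "finite {i::int. a \<le> of_int i \<and> of_int i \<le> b}" "real (card {i::int. a \<le> of_int i \<and> of_int i \<le> b}) \<le> b - a + 1"
proof -
  have eq: "{i::int. a \<le> of_int i \<and> of_int i \<le> b} = {\<lceil>a\<rceil>..\<lfloor>b\<rfloor>}"
    by (auto simp: ceiling_le_iff le_floor_iff)
  show "finite {i::int. a \<le> of_int i \<and> of_int i \<le> b}" by (simp add: eq)
  show "real (card {i::int. a \<le> of_int i \<and> of_int i \<le> b}) \<le> b - a + 1"
    unfolding eq using assms by (simp add: of_nat_nat) linarith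
qed

lemma card_int_interval_ge:
  fixes a b :: real
  shows "real (card {i::int. a \<le> of_int i \<and> of_int i \<le> b}) \<ge> b - a - 1"
proof -
  have eq: "{i::int. a \<le> of_int i \<and> of_int i \<le> b} = {\<lceil>a\<rceil>..\<lfloor>b\<rfloor>}"
    by (auto simp: ceiling_le_iff le_floor_iff)
  show ?thesis unfolding eq by simp linarith
qed

text \<open>Subtracting \<open>G\<close> times the integer nearest to i/G - y lifts the counted grid
  points injectively to integers in an interval of length 2 \<rho> G.\<close>

lemma card_grid_le:
  assumes "G > (0::nat)" "\<rho> \<ge> 0"
  shows "real (card {i\<in>{..<G}. dn (real i / real G - y) \<le> \<rho>}) \<le> 2 * \<rho> * real G + 1"
proof -
  define f where "f i = int i - int G * round (real i / real G - y)" for i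
  let ?A = "{i\<in>{..<G}. dn (real i / real G - y) \<le> \<rho>}"
  let ?B = "{i::int. y*G - \<rho>*G \<le> of_int i \<and> of_int i \<le> y*G + \<rho>*G}"
  have "inj_on f ?A"
  proof (rule inj_onI)
    fix i j assume ij: "i \<in> ?A" "j \<in> ?A" "f i = f j"
    have m: "f i mod int G = int i mod int G" for i
      unfolding f_def by (simp add: mod_eq_dvd_iff)
    have "int i mod int G = int j mod int G" using m[of i] m[of j] ij(3) by simp
    thus "i = j" using ij(1,2) by simp
  qed
  moreover have "f ` ?A \<subseteq> ?B"
  proof safe
    fix i assume i: "i < G" "dn (real i / real G - y) \<le> \<rho>"
    hence "\<bar>real i / real G - y - of_int (round (real i / real G - y))\<bar> * G \<le> \<rho> * G"
      using assms by (simp add: dist_nearest_int_def)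
    hence "\<bar>(real i / real G - y - of_int (round (real i / real G - y))) * G\<bar> \<le> \<rho> * G"
      by (simp add: abs_mult)
    also have "(real i / real G - y - of_int (round (real i / real G - y))) * G = of_int (f i) - y * G"
      using assms by (simp add: f_def algebra_simps)
    finally show "y*G - \<rho>*G \<le> of_int (f i)" "of_int (f i) \<le> y*G + \<rho>*G" by linarith+
  qed
  ultimately have "card ?A \<le> card ?B"
    using card_int_interval_le(1)[of "y*G - \<rho>*G" "y*G + \<rho>*G"] assms
    by (intro card_inj_on_le[of f]) auto
  also have "real (card ?B) \<le> y*G + \<rho>*G - (y*G - \<rho>*G) + 1"
    using assms by (intro card_int_interval_le) auto
  finally show ?thesis by simp
qed

text \<open>Reduction modulo \<open>G\<close> maps the integers in an interval of length 2 \<rho> G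
  to counted grid points; \<rho> < 1/2 makes that interval shorter than \<open>G\<close>, so the map
  is injective.\<close>

lemma card_grid_ge:
  assumes "G > (0::nat)" "\<rho> < 1/2"
  shows "real (card {i\<in>{..<G}. dn (real i / real G - y) \<le> \<rho>}) \<ge> 2 * \<rho> * real G - 1"
proof -
  let ?A = "{i\<in>{..<G}. dn (real i / real G - y) \<le> \<rho>}"
  let ?B = "{i::int. y*G - \<rho>*G \<le> of_int i \<and> of_int i \<le> y*G + \<rho>*G}"
  define f where "f i = nat (i mod int G)" for i
  have "inj_on f ?B"
  proof (rule inj_onI)
    fix i j assume ij: "i \<in> ?B" "j \<in> ?B" "f i = f j"
    hence "i mod int G = j mod int G" using assms by (simp add: f_def nat_eq_iff)
    hence d: "int G dvd i - j" by (simp add: mod_eq_dvd_iff)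
    have "\<bar>real_of_int (i - j)\<bar> \<le> 2 * \<rho> * G" using ij by auto
    also have "\<dots> < real G" using assms by simp
    finally have "\<bar>i - j\<bar> < int G" by linarith
    with d have "i - j = 0" using zdvd_imp_le[of "int G" "\<bar>i-j\<bar>"] by force
    thus "i = j" by simp
  qed
  moreover have "f ` ?B \<subseteq> ?A"
  proof safe
    fix i assume i: "y*G - \<rho>*G \<le> of_int i" "of_int i \<le> y*G + \<rho>*G"
    show "f i < G" using assms by (simp add: f_def nat_less_iff)
    have "real (f i) = of_int (i mod int G)" using assms by (simp add: f_def)
    also have "\<dots> = of_int i - of_int (i div int G) * G"
      by (simp flip: minus_div_mult_eq_mod)
    finally have e: "real (f i) / real G - y = (of_int i / G - y) + (- of_int (i div int G))"
      using assms by (simp add: field_simps)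
    have "dn (real (f i) / real G - y) = dn (of_int i / G - y)"
      unfolding e by (rule dn_add_int) simp
    also have "\<dots> \<le> \<bar>of_int i / G - y\<bar>" using dn_le[of _ 0] by simp
    also have "\<dots> \<le> \<rho>" using i assms by (simp add: field_simps abs_le_iff)
    finally show "dn (real (f i) / real G - y) \<le> \<rho>" .
  qed
  ultimately have "card ?B \<le> card ?A"
    by (intro card_inj_on_le[of f]) auto
  moreover have "real (card ?B) \<ge> y*G + \<rho>*G - (y*G - \<rho>*G) - 1"
    by (rule card_int_interval_ge)
  ultimately show ?thesis by simp
qed

section \<open>A smoothed Erdos--Turan inequality\<close>

text \<open>Each further factor convolves the coefficients with a block of length \<open>B\<close>.
  Their sign and their total are all that the normalisation of the kernel and the bound on its
  Fourier coefficients use.\<close>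

lemma dirichlet_kernel_power_expansion:
  fixes B m :: nat
  assumes "B > 0"
  shows "\<exists>a :: nat \<Rightarrow> real. (\<forall>s. 0 \<le> a s) \<and> sum a {..<m * B + 1} = real B ^ m \<and>
           (\<forall>x. (\<Sum>b<B. ee (real b * x)) ^ m = (\<Sum>s<m * B + 1. of_real (a s) * ee (real s * x)))"
proof (induction m)
  case 0
  show ?case by (rule exI[of _ "\<lambda>_. 1"]) simp
next
  case (Suc m)
  then obtain a where a: "\<And>s. 0 \<le> a s" "sum a {..<m * B + 1} = real B ^ m"
    "\<And>x. (\<Sum>b<B. ee (real b * x)) ^ m = (\<Sum>s<m * B + 1. of_real (a s) * ee (real s * x))"
    by blast
  define I where "I = {..<B} \<times> {..<m*B+1}"
  define J where "J = {..<Suc m * B + 1}"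
  define a' where "a' s = (\<Sum>(b,t) | (b,t) \<in> I \<and> b + t = s. a t)" for s
  have fin: "finite I" "finite J" by (auto simp: I_def J_def)
  have img: "(\<lambda>(b,t). b + t) ` I \<subseteq> J" by (auto simp: I_def J_def)
  have grp: "(\<Sum>s\<in>J. \<Sum>(b,t) | (b,t) \<in> I \<and> b + t = s. h b t) = (\<Sum>(b,t)\<in>I. h b t)" for h :: "nat \<Rightarrow> nat \<Rightarrow> 'a::comm_monoid_add"
  proof -
    have "(\<Sum>s\<in>J. \<Sum>x | x \<in> I \<and> (\<lambda>(b,t). b + t) x = s. (\<lambda>(b,t). h b t) x) = (\<Sum>x\<in>I. (\<lambda>(b,t). h b t) x)"
      by (rule sum.group[OF fin img])
    moreover have "{x. x \<in> I \<and> (\<lambda>(b,t). b + t) x = s} = {(b,t). (b,t) \<in> I \<and> b + t = s}" for s by auto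
    ultimately show ?thesis by simp
  qed
  show ?case
  proof (intro exI[of _ a'] conjI allI)
    show "0 \<le> a' s" for s unfolding a'_def using a(1) by (intro sum_nonneg) auto
    have "sum a' J = (\<Sum>(b,t)\<in>I. a t)" unfolding a'_def by (rule grp)
    also have "\<dots> = real B ^ Suc m" using a(2) by (simp add: I_def sum.cartesian_product[symmetric])
    finally show "sum a' {..<Suc m * B + 1} = real B ^ Suc m" by (simp add: J_def)
    fix x
    have "(\<Sum>b<B. ee (real b * x)) ^ Suc m = (\<Sum>b<B. ee (real b * x)) * (\<Sum>s<m * B + 1. of_real (a s) * ee (real s * x))"
      by (simp add: a(3))
    also have "\<dots> = (\<Sum>(b,t)\<in>I. of_real (a t) * ee (real (b + t) * x))"
      unfolding I_def sum_product sum.cartesian_product[symmetric]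
      by (intro sum.cong refl) (simp add: ring_distribs ee_add mult_ac)
    also have "\<dots> = (\<Sum>s\<in>J. \<Sum>(b,t) | (b,t) \<in> I \<and> b + t = s. of_real (a t) * ee (real (b + t) * x))"
      by (rule grp[symmetric])
    also have "\<dots> = (\<Sum>s\<in>J. of_real (a' s) * ee (real s * x))"
      unfolding a'_def of_real_sum sum_distrib_right by (intro sum.cong refl) auto
    finally show "(\<Sum>b<B. ee (real b * x)) ^ Suc m = (\<Sum>s<Suc m * B + 1. of_real (a' s) * ee (real s * x))"
      by (simp add: J_def)
  qed
qed

text \<open>A power of the Fejer kernel: the \<open>2 * m\<close>-th power of the modulus of a
  Dirichlet kernel, divided by the sum \<open>C\<close> of the squared coefficients so that its mean
  value is 1. Cauchy's inequality bounds \<open>C\<close> below by B^(2m)/(mB + 1), whence the decay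
  away from the integers: \<open>m\<close> buys decay of order 2m while the degree grows only by the
  factor \<open>m\<close>.\<close>

lemma smoothing_kernel:
  fixes B m :: nat
  assumes "B > 0" "m > 0"
  shows "\<exists>(\<kappa> :: real \<Rightarrow> real) (c :: int \<Rightarrow> real). 
      (\<forall>x. 0 \<le> \<kappa> x) \<and> c 0 = 1 \<and> (\<forall>r. \<bar>c r\<bar> \<le> 1) \<and>
      (\<forall>x. dn x > 0 \<longrightarrow> \<kappa> x \<le> (real m * real B + 1) / (2 * dn x * real B) ^ (2 * m)) \<and>
      (\<forall>x. complex_of_real (\<kappa> x) = (\<Sum>r\<in>{- int (m*B)..int (m*B)}. of_real (c r) * ee (of_int r * x)))"
proof -
  define N where "N = m * B + 1"
  obtain a :: "nat \<Rightarrow> real" where a: "\<And>s. 0 \<le> a s" "sum a {..<N} = real B ^ m"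
    "\<And>x. (\<Sum>b<B. ee (real b * x)) ^ m = (\<Sum>s<N. of_real (a s) * ee (real s * x))"
    using dirichlet_kernel_power_expansion[OF assms(1), of m] unfolding N_def by blast
  define C where "C = (\<Sum>s<N. a s ^ 2)"
  have "(sum a {..<N})\<^sup>2 \<le> C * real N"
    using Cauchy_Schwarz_ineq_sum[of a "\<lambda>_. 1" "{..<N}"] by (simp add: C_def)
  hence Cge: "real B ^ (2*m) \<le> C * real N" by (simp add: a(2) power_mult[symmetric] mult.commute)
  have "0 < real B ^ (2*m)" using assms by simp
  hence "0 < C * real N" using Cge by linarith
  hence Cpos: "C > 0" by (simp add: zero_less_mult_iff)
  define I where "I = {..<N} \<times> {..<N}"
  define J where "J = {- int (m*B)..int (m*B)}"
  define c where "c r = (\<Sum>(s,t) | (s,t) \<in> I \<and> int s - int t = r. a s * a t) / C" for r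
  define \<kappa> where "\<kappa> x = (norm ((\<Sum>b<B. ee (real b * x)) ^ m))\<^sup>2 / C" for x
  have fin: "finite I" "finite J" by (auto simp: I_def J_def)
  have img: "(\<lambda>(s,t). int s - int t) ` I \<subseteq> J"
  proof safe
    fix s t assume "(s,t) \<in> I"
    hence "s \<le> m * B" "t \<le> m * B" by (auto simp: I_def N_def)
    thus "int s - int t \<in> J" unfolding J_def atLeastAtMost_iff by linarith
  qed
  have grp: "(\<Sum>r\<in>J. \<Sum>(s,t) | (s,t) \<in> I \<and> int s - int t = r. h s t) = (\<Sum>(s,t)\<in>I. h s t)" for h :: "nat \<Rightarrow> nat \<Rightarrow> complex"
  proof -
    have "(\<Sum>r\<in>J. \<Sum>x | x \<in> I \<and> (\<lambda>(s,t). int s - int t) x = r. (\<lambda>(b,t). h b t) x) = (\<Sum>x\<in>I. (\<lambda>(b,t). h b t) x)"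
      by (rule sum.group[OF fin img])
    moreover have "{x. x \<in> I \<and> (\<lambda>(s,t). int s - int t) x = r} = {(s,t). (s,t) \<in> I \<and> int s - int t = r}" for r by auto
    ultimately show ?thesis by simp
  qed
  show ?thesis
  proof (intro exI[of _ \<kappa>] exI[of _ c] conjI allI impI)
    show "0 \<le> \<kappa> x" for x using Cpos by (simp add: \<kappa>_def)
    have "(\<Sum>(s,t) | (s,t) \<in> I \<and> int s - int t = 0. a s * a t) = C" unfolding C_def
      by (rule sum.reindex_bij_witness[of _ "\<lambda>s. (s,s)" fst]) (auto simp: I_def power2_eq_square)
    thus "c 0 = 1" using Cpos by (simp add: c_def)
    \<comment> \<open>The correlation of a sequence with a shift of itself is at most the sum of its
      squares.\<close>
    show "\<bar>c r\<bar> \<le> 1" for r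
    proof -
      let ?A = "{(s,t). (s,t) \<in> I \<and> int s - int t = r}"
      have fA: "finite ?A" by (rule finite_subset[OF _ fin(1)]) auto
      have "(\<Sum>(s,t)\<in>?A. a s * a t) \<le> (\<Sum>(s,t)\<in>?A. (a s ^ 2 + a t ^ 2) / 2)"
      proof (intro sum_mono)
        fix p show "(case p of (s,t) \<Rightarrow> a s * a t) \<le> (case p of (s,t) \<Rightarrow> (a s ^ 2 + a t ^ 2) / 2)"
          using sum_squares_bound[of "a (fst p)" "a (snd p)"] by (simp add: case_prod_beta)
      qed
      also have "\<dots> = ((\<Sum>p\<in>?A. a (fst p) ^ 2) + (\<Sum>p\<in>?A. a (snd p) ^ 2)) / 2"
        by (simp add: case_prod_beta sum.distrib flip: sum_divide_distrib)
      also have "(\<Sum>p\<in>?A. a (fst p) ^ 2) = (\<Sum>s\<in>fst ` ?A. a s ^ 2)"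
        by (subst sum.reindex) (auto simp: inj_on_def)
      also have "\<dots> \<le> C" unfolding C_def by (intro sum_mono2) (auto simp: I_def)
      also have "(\<Sum>p\<in>?A. a (snd p) ^ 2) = (\<Sum>s\<in>snd ` ?A. a s ^ 2)"
        by (subst sum.reindex) (auto simp: inj_on_def)
      also have "\<dots> \<le> C" unfolding C_def by (intro sum_mono2) (auto simp: I_def)
      finally have "(\<Sum>(s,t)\<in>?A. a s * a t) \<le> C" by simp
      moreover have "0 \<le> (\<Sum>(s,t)\<in>?A. a s * a t)" using a(1) by (intro sum_nonneg) auto
      ultimately show ?thesis using Cpos by (simp add: c_def)
    qed
    show "\<kappa> x \<le> (real m * real B + 1) / (2 * dn x * real B) ^ (2 * m)" if "dn x > 0" for x
    proof -
      have "norm (\<Sum>b<B. ee (real b * x)) \<le> 1 / (2 * dn x)" by (rule geometric_ee_bound[OF that])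
      hence "norm (\<Sum>b<B. ee (real b * x)) ^ (2*m) \<le> (1 / (2 * dn x)) ^ (2*m)" by (intro power_mono) auto
      hence "\<kappa> x \<le> (1 / (2 * dn x)) ^ (2*m) / C"
      proof -
        have "(norm ((\<Sum>b<B. ee (real b * x)) ^ m))\<^sup>2 = norm (\<Sum>b<B. ee (real b * x)) ^ (2*m)"
          by (simp only: norm_power power_mult[symmetric] mult.commute[of 2])
        thus ?thesis using Cpos \<open>norm (\<Sum>b<B. ee (real b * x)) ^ (2*m) \<le> _\<close> by (simp only: \<kappa>_def) (intro divide_right_mono, auto)
      qed
      also have "\<dots> \<le> (1 / (2 * dn x)) ^ (2*m) / (real B ^ (2*m) / real N)"
      proof (intro divide_left_mono)
        have "N > 0" by (simp add: N_def)
        hence "real N > 0" by simp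
        thus "real B ^ (2*m) / real N \<le> C" using Cge by (simp add: divide_le_eq)
        show "0 < C * (real B ^ (2*m) / real N)"
          using \<open>real N > 0\<close> Cpos assms by (intro mult_pos_pos divide_pos_pos) auto
      qed (use that in auto)
      also have "\<dots> = (real m * real B + 1) / (2 * dn x * real B) ^ (2 * m)"
      proof -
        have "real N = real m * real B + 1" by (simp add: N_def)
        thus ?thesis by (simp only: power_mult_distrib power_divide) simp
      qed
      finally show ?thesis .
    qed
    fix x
    define D where "D = (\<Sum>s<N. of_real (a s) * ee (real s * x))"
    have "complex_of_real (\<kappa> x) = D * cnj D / of_real C"
      unfolding \<kappa>_def by (simp add: a(3) D_def complex_norm_square del: of_real_power flip: of_real_power)
    also have "D * cnj D = (\<Sum>(s,t)\<in>I. of_real (a s * a t) * ee (of_int (int s - int t) * x))"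
    proof -
      have "cnj D = (\<Sum>s<N. of_real (a s) * ee (- (real s * x)))"
        by (simp add: D_def ee_minus)
      thus ?thesis unfolding I_def D_def sum.cartesian_product[symmetric]
        by (simp add: sum_product left_diff_distrib algebra_simps flip: ee_add)
    qed
    also have "\<dots> = (\<Sum>r\<in>J. \<Sum>(s,t) | (s,t) \<in> I \<and> int s - int t = r. of_real (a s * a t) * ee (of_int (int s - int t) * x))"
      by (rule grp[symmetric])
    also have "\<dots> = (\<Sum>r\<in>J. of_real (C * c r) * ee (of_int r * x))"
    proof (intro sum.cong refl)
      fix r
      have "C * c r = (\<Sum>(s,t) | (s,t) \<in> I \<and> int s - int t = r. a s * a t)" using Cpos by (simp add: c_def)
      thus "(\<Sum>(s,t) | (s,t) \<in> I \<and> int s - int t = r. of_real (a s * a t) * ee (of_int (int s - int t) * x)) = of_real (C * c r) * ee (of_int r * x)"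
        by (simp only: of_real_sum sum_distrib_right) (auto intro!: sum.cong)
    qed
    finally show "complex_of_real (\<kappa> x) = (\<Sum>r\<in>{- int (m*B)..int (m*B)}. of_real (c r) * ee (of_int r * x))"
      using Cpos by (simp add: J_def sum_divide_distrib)
  qed
qed

text \<open>The frequencies carry no weight such as 1/|r|: the kernels in use have Fourier
  coefficients of modulus at most 1, and the density of the target arc will stand in front of the
  sum instead.\<close>

definition fourier_error :: "nat \<Rightarrow> ('i \<Rightarrow> real) \<Rightarrow> 'i set \<Rightarrow> real" where
  "fourier_error D z Z = (\<Sum>r\<in>{- int D..int D} - {0}. norm (\<Sum>i\<in>Z. ee (of_int r * z i)))"

text \<open>The smooth approximation to an arc is a finite average of translates of the kernel over
  the grid points in \<open>A\<close>, in place of an integral. As \<open>G\<close> exceeds the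
  degree, the average over all grid points equals 1 identically. So the tail of the kernel bounds
  \<Phi> far from \<open>A\<close>, and it bounds 1 - \<Phi>, the average over the other grid
  points, far from the complement.\<close>

lemma smoothed_indicator:
  fixes B m G :: nat and A :: "nat set"
  assumes "B > 0" "m > 0" "G > m * B" "A \<subseteq> {..<G}"
  obtains \<Phi> :: "real \<Rightarrow> real" where 
    "\<And>x. 0 \<le> \<Phi> x" "\<And>x. \<Phi> x \<le> 1"
    "\<And>x \<eta>. \<eta> > 0 \<Longrightarrow> (\<And>i. i < G \<Longrightarrow> i \<notin> A \<Longrightarrow> dn (x - real i / real G) \<ge> \<eta>) \<Longrightarrow> 
        \<Phi> x \<ge> 1 - (real m * real B + 1) / (2 * \<eta> * real B) ^ (2 * m)"
    "\<And>x \<eta>. \<eta> > 0 \<Longrightarrow> (\<And>i. i \<in> A \<Longrightarrow> dn (x - real i / real G) \<ge> \<eta>) \<Longrightarrow> 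
        \<Phi> x \<le> (real m * real B + 1) / (2 * \<eta> * real B) ^ (2 * m)"
    "\<And>(z :: 'i \<Rightarrow> real) Z. finite Z \<Longrightarrow> 
        \<bar>(\<Sum>i\<in>Z. \<Phi> (z i)) - real (card A) / real G * real (card Z)\<bar> \<le> real (card A) / real G * fourier_error (m * B) z Z"
proof -
  obtain \<kappa> c where k: "\<And>x. 0 \<le> \<kappa> x" "c 0 = 1" "\<And>r. \<bar>c r\<bar> \<le> 1"
    "\<And>x. dn x > 0 \<Longrightarrow> \<kappa> x \<le> (real m * real B + 1) / (2 * dn x * real B) ^ (2 * m)"
    "\<And>x. complex_of_real (\<kappa> x) = (\<Sum>r\<in>{- int (m*B)..int (m*B)}. of_real (c r) * ee (of_int r * x))"
    using smoothing_kernel[OF assms(1,2)] by blast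
  define J where "J = {- int (m*B)..int (m*B)}"
  have G0: "G > 0" using assms by auto
  define \<Phi> where "\<Phi> x = (\<Sum>i\<in>A. \<kappa> (x - real i / real G)) / real G" for x
  have finA: "finite A" using assms(4) finite_subset by blast
  \<comment> \<open>The grid is an exact quadrature rule for trigonometric polynomials of degree
    below \<open>G\<close>: every nonzero frequency cancels and \<open>c 0 = 1\<close>
    remains.\<close>
  have full: "(\<Sum>i<G. \<kappa> (x - real i / real G)) = real G" for x
  proof -
    have "complex_of_real (\<Sum>i<G. \<kappa> (x - real i / real G)) = 
          (\<Sum>r\<in>J. \<Sum>i<G. of_real (c r) * ee (of_int r * (x - real i / real G)))"
      unfolding of_real_sum k(5) J_def by (rule sum.swap)
    also have "\<dots> = (\<Sum>r\<in>J. of_real (c r) * ee (of_int r * x) * (\<Sum>i<G. ee (real i * of_int (-r) / real G)))"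
      by (intro sum.cong refl) (simp add: sum_distrib_left right_diff_distrib mult_ac flip: ee_add)
    also have "\<dots> = (\<Sum>r\<in>J. if r = 0 then of_nat G else 0)"
    proof (intro sum.cong refl)
      fix r assume r: "r \<in> J"
      have "\<bar>r\<bar> \<le> int (m * B)" using r by (auto simp: J_def)
      also have "\<dots> < int G" using assms(3) by linarith
      finally have "\<bar>r\<bar> < int G" .
      hence "int G dvd - r \<longleftrightarrow> r = 0" using zdvd_imp_le[of "int G" "\<bar>r\<bar>"] by auto
      thus "of_real (c r) * ee (of_int r * x) * (\<Sum>i<G. ee (real i * of_int (-r) / real G)) = (if r = 0 then of_nat G else 0)"
        using sum_ee_residues[OF G0, of "-r"] k(2) by (auto)
    qed
    also have "\<dots> = of_nat G" by (simp add: J_def)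
    finally show ?thesis by (metis of_real_eq_iff of_real_of_nat_eq)
  qed
  have tail: "(\<Sum>i\<in>A'. \<kappa> (x - real i / real G)) \<le> real G * ((real m * real B + 1) / (2 * \<eta> * real B) ^ (2 * m))"
    if "A' \<subseteq> {..<G}" "\<eta> > 0" "\<And>i. i \<in> A' \<Longrightarrow> dn (x - real i / real G) \<ge> \<eta>" for A' x \<eta>
  proof -
    have "(\<Sum>i\<in>A'. \<kappa> (x - real i / real G)) \<le> (\<Sum>i\<in>A'. (real m * real B + 1) / (2 * \<eta> * real B) ^ (2 * m))"
    proof (intro sum_mono)
      fix i assume i: "i \<in> A'"
      let ?d = "dn (x - real i / real G)"
      have d: "?d \<ge> \<eta>" by (rule that(3)[OF i])
      hence "\<kappa> (x - real i / real G) \<le> (real m * real B + 1) / (2 * ?d * real B) ^ (2 * m)"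
        using that(2) by (intro k(4)) auto
      also have "\<dots> \<le> (real m * real B + 1) / (2 * \<eta> * real B) ^ (2 * m)"
        using d that(2) assms(1) by (intro divide_left_mono power_mono mult_mono mult_pos_pos zero_less_power) auto
      finally show "\<kappa> (x - real i / real G) \<le> (real m * real B + 1) / (2 * \<eta> * real B) ^ (2 * m)" .
    qed
    also have "\<dots> \<le> real G * ((real m * real B + 1) / (2 * \<eta> * real B) ^ (2 * m))"
    proof -
      have "card A' \<le> G" using that(1) card_mono[of "{..<G}" A'] by simp
      thus ?thesis using that(2) assms(1) by (simp only: sum_constant) (intro mult_right_mono, auto)
    qed
    finally show ?thesis .
  qed
  show ?thesis
  proof (rule that[of \<Phi>])
    show "0 \<le> \<Phi> x" for x using k(1) by (simp add: \<Phi>_def sum_nonneg)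
    show "\<Phi> x \<le> 1" for x
    proof -
      have "(\<Sum>i\<in>A. \<kappa> (x - real i / real G)) \<le> (\<Sum>i<G. \<kappa> (x - real i / real G))"
        using k(1) assms(4) by (intro sum_mono2) auto
      thus ?thesis using full[of x] G0 by (simp add: \<Phi>_def)
    qed
    show "\<Phi> x \<ge> 1 - (real m * real B + 1) / (2 * \<eta> * real B) ^ (2 * m)"
      if "\<eta> > 0" "\<And>i. i < G \<Longrightarrow> i \<notin> A \<Longrightarrow> dn (x - real i / real G) \<ge> \<eta>" for x \<eta>
    proof -
      have "real G = (\<Sum>i\<in>A. \<kappa> (x - real i / real G)) + (\<Sum>i\<in>{..<G} - A. \<kappa> (x - real i / real G))"
        using full[of x] assms(4) by (metis add.commute finite_lessThan sum.subset_diff)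
      also have "\<dots> \<le> (\<Sum>i\<in>A. \<kappa> (x - real i / real G)) + real G * ((real m * real B + 1) / (2 * \<eta> * real B) ^ (2 * m))"
        using that by (intro add_left_mono tail) auto
      finally show ?thesis using G0 by (simp add: \<Phi>_def field_simps)
    qed
    show "\<Phi> x \<le> (real m * real B + 1) / (2 * \<eta> * real B) ^ (2 * m)"
      if "\<eta> > 0" "\<And>i. i \<in> A \<Longrightarrow> dn (x - real i / real G) \<ge> \<eta>" for x \<eta>
      using tail[of A \<eta> x] that assms(4) G0 by (simp add: \<Phi>_def field_simps)
    fix z :: "'i \<Rightarrow> real" and Z :: "'i set" assume Z: "finite Z"
    define h where "h r = (\<Sum>i\<in>A. ee (- (of_int r * (real i / real G))))" for r
    define E where "E r = (\<Sum>i\<in>Z. ee (of_int r * z i))" for r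
    have "complex_of_real (\<Sum>i\<in>Z. \<Phi> (z i)) = 
       (\<Sum>i\<in>Z. (\<Sum>k\<in>A. \<Sum>r\<in>J. of_real (c r) * ee (of_int r * (z i - real k / real G))) / of_nat G)"
      by (simp add: \<Phi>_def k(5) J_def)
    also have "\<dots> = (\<Sum>i\<in>Z. \<Sum>k\<in>A. \<Sum>r\<in>J. of_real (c r) * ee (of_int r * (z i - real k / real G))) / of_nat G"
      by (simp add: sum_divide_distrib)
    also have "(\<Sum>i\<in>Z. \<Sum>k\<in>A. \<Sum>r\<in>J. of_real (c r) * ee (of_int r * (z i - real k / real G)))
       = (\<Sum>i\<in>Z. \<Sum>r\<in>J. \<Sum>k\<in>A. of_real (c r) * ee (of_int r * (z i - real k / real G)))"
      by (intro sum.cong refl sum.swap)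
    also have "\<dots> = (\<Sum>r\<in>J. \<Sum>i\<in>Z. \<Sum>k\<in>A. of_real (c r) * ee (of_int r * (z i - real k / real G)))"
      by (rule sum.swap)
    also have "\<dots> = (\<Sum>r\<in>J. of_real (c r) * (E r * h r))"
    proof (intro sum.cong refl)
      fix r
      have "E r * h r = (\<Sum>i\<in>Z. \<Sum>k\<in>A. ee (of_int r * (z i - real k / real G)))"
        unfolding E_def h_def sum_product
        by (intro sum.cong refl) (simp add: right_diff_distrib flip: ee_add)
      thus "(\<Sum>i\<in>Z. \<Sum>k\<in>A. of_real (c r) * ee (of_int r * (z i - real k / real G))) = of_real (c r) * (E r * h r)"
        by (simp add: sum_distrib_left)
    qed
    also have "\<dots> = of_nat (card Z) * of_nat (card A) + (\<Sum>r\<in>J - {0}. of_real (c r) * (E r * h r))"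
      by (subst sum.remove[of J 0]) (auto simp: J_def k(2) E_def h_def)
    finally have eq: "complex_of_real ((\<Sum>i\<in>Z. \<Phi> (z i)) - real (card A) / real G * real (card Z)) =
        (\<Sum>r\<in>J - {0}. of_real (c r) * (E r * h r)) / of_nat G"
      by (simp add: add_divide_distrib mult.commute)
    have "\<bar>(\<Sum>i\<in>Z. \<Phi> (z i)) - real (card A) / real G * real (card Z)\<bar> = norm ((\<Sum>r\<in>J - {0}. of_real (c r) * (E r * h r)) / of_nat G)"
      unfolding eq[symmetric] norm_of_real ..
    also have "\<dots> \<le> (\<Sum>r\<in>J - {0}. norm (E r) * real (card A)) / real G"
    proof -
      have "norm (\<Sum>r\<in>J - {0}. of_real (c r) * (E r * h r)) \<le> (\<Sum>r\<in>J - {0}. norm (E r) * real (card A))"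
      proof (rule sum_norm_le)
        fix r
        have "norm (h r) \<le> real (card A)"
          unfolding h_def by (rule order_trans[OF norm_sum]) simp
        hence "\<bar>c r\<bar> * (norm (E r) * norm (h r)) \<le> 1 * (norm (E r) * real (card A))"
          using k(3)[of r] by (intro mult_mono) auto
        thus "norm (of_real (c r) * (E r * h r)) \<le> norm (E r) * real (card A)"
          by (simp add: norm_mult)
      qed
      thus ?thesis using G0 by (simp add: norm_divide divide_right_mono)
    qed
    also have "\<dots> = real (card A) / real G * fourier_error (m * B) z Z"
      by (simp add: fourier_error_def E_def J_def sum_distrib_left sum_divide_distrib mult.commute)
    finally show "\<bar>(\<Sum>i\<in>Z. \<Phi> (z i)) - real (card A) / real G * real (card Z)\<bar> \<le> real (card A) / real G * fourier_error (m * B) z Z" .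
  qed
qed

text \<open>The grid arc is taken wider by \<eta>, so every counted point has distance at least
  \<eta> from all grid points outside it, and \<Phi> is nearly 1 there. Widening and discretisation
  together cost at most 4 \<eta> in density.\<close>

lemma erdos_turan_upper:
  fixes z :: "'i \<Rightarrow> real"
  assumes "finite Z" "B > 0" "m > 0" "\<eta> > 0" "\<rho> \<ge> 0"
  shows "(1 - (real m * real B + 1) / (2 * \<eta> * real B) ^ (2 * m)) * real (card {i\<in>Z. dn (z i - y) \<le> \<rho>})
     \<le> (2 * \<rho> + 4 * \<eta>) * (real (card Z) + fourier_error (m * B) z Z)"
proof -
  define \<tau> where "\<tau> = (real m * real B + 1) / (2 * \<eta> * real B) ^ (2 * m)"
  \<comment> \<open>Large enough both for exact quadrature and for a grid spacing of at most
    \<eta>.\<close>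
  define G where "G = m * B + nat \<lceil>1/\<eta>\<rceil> + 1"
  have G: "G > m * B" "G > 0" "real G \<ge> 1/\<eta>" unfolding G_def by (auto intro: order_trans[OF real_nat_ceiling_ge])
  define A where "A = {i\<in>{..<G}. dn (real i / real G - y) \<le> \<rho> + \<eta>}"
  obtain \<Phi> where P: "\<And>x. 0 \<le> \<Phi> x" "\<And>x. \<Phi> x \<le> (1::real)"
    "\<And>x \<eta>. \<eta> > 0 \<Longrightarrow> (\<And>i. i < G \<Longrightarrow> i \<notin> A \<Longrightarrow> dn (x - real i / real G) \<ge> \<eta>) \<Longrightarrow> 
        \<Phi> x \<ge> 1 - (real m * real B + 1) / (2 * \<eta> * real B) ^ (2 * m)"
    "\<And>(z :: 'i \<Rightarrow> real) Z. finite Z \<Longrightarrow> 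
        \<bar>(\<Sum>i\<in>Z. \<Phi> (z i)) - real (card A) / real G * real (card Z)\<bar> \<le> real (card A) / real G * fourier_error (m * B) z Z"
    by (rule smoothed_indicator[OF assms(2,3) G(1), of A]) (auto simp: A_def)
  have "real (card A) \<le> 2 * (\<rho> + \<eta>) * real G + 1"
    unfolding A_def using assms by (intro card_grid_le G) auto
  hence cA: "real (card A) / real G \<le> 2 * \<rho> + 4 * \<eta>"
    using G assms by (simp add: field_simps)
  let ?Z = "{i\<in>Z. dn (z i - y) \<le> \<rho>}"
  have "(1 - \<tau>) * real (card ?Z) = (\<Sum>i\<in>?Z. 1 - \<tau>)" by simp
  also have "\<dots> \<le> (\<Sum>i\<in>?Z. \<Phi> (z i))"
  proof (rule sum_mono)
    fix i assume i: "i \<in> ?Z"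
    show "1 - \<tau> \<le> \<Phi> (z i)" unfolding \<tau>_def
    proof (rule P(3)[OF assms(4)])
      fix j assume j: "j < G" "j \<notin> A"
      have "dn (real j / real G - y) \<le> dn (z i - y) + dn (real j / real G - z i)"
        using dn_triangle2[of "z i - y" "real j / real G - z i"] by simp
      also have "dn (real j / real G - z i) = dn (z i - real j / real G)"
        using dn_minus[of "real j / real G - z i"] by simp
      finally show "\<eta> \<le> dn (z i - real j / real G)" using i j by (auto simp: A_def)
    qed
  qed
  also have "\<dots> \<le> (\<Sum>i\<in>Z. \<Phi> (z i))" using P(1) assms(1) by (intro sum_mono2) auto
  also have "\<dots> \<le> real (card A) / real G * (real (card Z) + fourier_error (m * B) z Z)"
    using P(4)[OF assms(1), of z] by (simp add: algebra_simps)
  also have "\<dots> \<le> (2 * \<rho> + 4 * \<eta>) * (real (card Z) + fourier_error (m * B) z Z)"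
    by (intro mult_right_mono cA add_nonneg_nonneg) (auto simp: fourier_error_def intro: sum_nonneg)
  finally show ?thesis by (simp add: \<tau>_def)
qed

text \<open>Here the grid arc is narrower by \<eta>: an uncounted point has distance at least \<eta>
  from it, so only the tail of the kernel contributes. The comparison of densities multiplies by the
  number of points minus the Fourier error, which the last hypothesis keeps nonnegative.\<close>

lemma erdos_turan_lower:
  fixes z :: "'i \<Rightarrow> real"
  assumes "finite Z" "B > 0" "m > 0" "\<eta> > 0" "\<rho> \<ge> 2 * \<eta>" "\<rho> < 1/2"
    and "fourier_error (m * B) z Z \<le> real (card Z)"
  shows "real (card {i\<in>Z. dn (z i - y) \<le> \<rho>}) + (real m * real B + 1) / (2 * \<eta> * real B) ^ (2 * m) * real (card Z)
     \<ge> (2 * \<rho> - 4 * \<eta>) * (real (card Z) - fourier_error (m * B) z Z)"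
proof -
  define \<tau> where "\<tau> = (real m * real B + 1) / (2 * \<eta> * real B) ^ (2 * m)"
  have \<tau>0: "\<tau> \<ge> 0" using assms unfolding \<tau>_def by (intro divide_nonneg_nonneg) auto
  define G where "G = m * B + nat \<lceil>1/\<eta>\<rceil> + 1"
  have G: "G > m * B" "G > 0" "real G \<ge> 1/\<eta>" unfolding G_def by (auto intro: order_trans[OF real_nat_ceiling_ge])
  define A where "A = {i\<in>{..<G}. dn (real i / real G - y) \<le> \<rho> - \<eta>}"
  obtain \<Phi> where P: "\<And>x. 0 \<le> \<Phi> x" "\<And>x. \<Phi> x \<le> (1::real)"
    "\<And>x \<eta>. \<eta> > 0 \<Longrightarrow> (\<And>i. i \<in> A \<Longrightarrow> dn (x - real i / real G) \<ge> \<eta>) \<Longrightarrow> 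
        \<Phi> x \<le> (real m * real B + 1) / (2 * \<eta> * real B) ^ (2 * m)"
    "\<And>(z :: 'i \<Rightarrow> real) Z. finite Z \<Longrightarrow> 
        \<bar>(\<Sum>i\<in>Z. \<Phi> (z i)) - real (card A) / real G * real (card Z)\<bar> \<le> real (card A) / real G * fourier_error (m * B) z Z"
    by (rule smoothed_indicator[OF assms(2,3) G(1), of A]) (auto simp: A_def)
  have "real (card A) \<ge> 2 * (\<rho> - \<eta>) * real G - 1"
    unfolding A_def using assms by (intro card_grid_ge G) auto
  hence cA: "real (card A) / real G \<ge> 2 * \<rho> - 4 * \<eta>"
    using G assms by (simp add: field_simps)
  let ?Z = "{i\<in>Z. dn (z i - y) \<le> \<rho>}"
  have "(2 * \<rho> - 4 * \<eta>) * (real (card Z) - fourier_error (m * B) z Z) \<le> real (card A) / real G * (real (card Z) - fourier_error (m * B) z Z)"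
    using assms(7) by (intro mult_right_mono cA) auto
  also have "\<dots> \<le> (\<Sum>i\<in>Z. \<Phi> (z i))"
    using P(4)[OF assms(1), of z] by (simp add: algebra_simps)
  also have "\<dots> \<le> (\<Sum>i\<in>Z. (if i \<in> ?Z then 1 else 0) + \<tau>)"
  proof (rule sum_mono)
    fix i assume i: "i \<in> Z"
    show "\<Phi> (z i) \<le> (if i \<in> ?Z then 1 else 0) + \<tau>"
    proof (cases "i \<in> ?Z")
      case True thus ?thesis using P(2)[of "z i"] \<tau>0 by simp
    next
      case False
      have "\<Phi> (z i) \<le> \<tau>" unfolding \<tau>_def
      proof (rule P(3)[OF assms(4)])
        fix j assume j: "j \<in> A"
        have "dn (z i - y) \<le> dn (real j / real G - y) + dn (z i - real j / real G)"
          using dn_triangle2[of "real j / real G - y" "z i - real j / real G"] by simp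
        thus "\<eta> \<le> dn (z i - real j / real G)" using i j False by (auto simp: A_def)
      qed
      thus ?thesis using False by simp
    qed
  qed
  also have "\<dots> = real (card ?Z) + \<tau> * real (card Z)"
    using assms(1) by (simp add: sum.distrib sum.If_cases Int_def)
  finally show ?thesis by (simp add: \<tau>_def)
qed

section \<open>Kloosterman sums to squarefree moduli\<close>

definition ec :: "nat \<Rightarrow> int \<Rightarrow> complex" where "ec c n = ee (of_int n / of_nat c)"

lemma norm_ec [simp]: "norm (ec c n) = 1" by (simp add: ec_def)

lemma ec_0 [simp]: "ec c 0 = 1" by (simp add: ec_def)

lemma ec_add: "ec c (m + n) = ec c m * ec c n"
  by (simp add: ec_def add_divide_distrib flip: ee_add)

lemma ec_minus: "ec c (- n) = cnj (ec c n)"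
  by (simp add: ec_def flip: ee_minus)

lemma ec_diff: "ec c (m - n) = ec c m * cnj (ec c n)"
  using ec_add[of c m "-n"] by (simp add: ec_minus)

lemma ec_cong:
  assumes "[m = n] (mod int c)"
  shows "ec c m = ec c n"
proof (cases "c = 0")
  case False
  from assms have "int c dvd m - n" by (simp add: cong_iff_dvd_diff)
  then obtain k where "m - n = int c * k" by (rule dvdE)
  hence "m = n + int c * k" by simp
  hence "of_int m / real c - of_int n / real c = of_int k" using False by (simp add: field_simps)
  thus ?thesis unfolding ec_def by (intro ee_cong) simp
qed (simp add: ec_def)

lemma ec_sum:
  assumes "c > 0"
  shows "(\<Sum>k\<in>{0..<int c}. ec c (k * r)) = (if int c dvd r then of_nat c else 0)"
proof -
  have "(\<Sum>k\<in>{0..<int c}. ec c (k * r)) = (\<Sum>k<c. ee (real k * of_int r / real c))"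
    by (rule sum.reindex_bij_witness[of _ int nat]) (auto simp: ec_def)
  also have "\<dots> = (if int c dvd r then of_nat c else 0)" by (rule sum_ee_residues[OF assms])
  finally show ?thesis .
qed

text \<open>The combination \<open>c2 * e2 + c1 * e1\<close> is 1 modulo both factors, hence modulo
  their product.\<close>

lemma ec_split:
  assumes "[int c2 * e2 = 1] (mod int c1)" "[int c1 * e1 = 1] (mod int c2)" "coprime c1 c2" "c1 > 0" "c2 > 0"
  shows "ec (c1 * c2) n = ec c1 (n * e2) * ec c2 (n * e1)"
proof -
  have "[int c2 * e2 + int c1 * e1 = 1 + 0] (mod int c1)" using assms(1) by (intro cong_add) (auto simp: cong_0_iff)
  moreover have "[int c2 * e2 + int c1 * e1 = 0 + 1] (mod int c2)" using assms(2) by (intro cong_add) (auto simp: cong_0_iff)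
  ultimately have "[int c2 * e2 + int c1 * e1 = 1] (mod int c1 * int c2)"
    using assms(3) by (intro coprime_cong_mult) auto
  hence "[n * (int c2 * e2 + int c1 * e1) = n * 1] (mod int c1 * int c2)" by (rule cong_mult[OF cong_refl])
  hence "[n = n * (int c2 * e2 + int c1 * e1)] (mod int (c1 * c2))" by (simp add: cong_sym_eq)
  hence "ec (c1 * c2) n = ec (c1 * c2) (n * (int c2 * e2 + int c1 * e1))" by (rule ec_cong)
  also have "\<dots> = ec (c1 * c2) (int c2 * (n * e2)) * ec (c1 * c2) (int c1 * (n * e1))"
    by (simp add: algebra_simps flip: ec_add)
  also have "\<dots> = ec c1 (n * e2) * ec c2 (n * e1)" using assms by (simp add: ec_def)
  finally show ?thesis .
qed

text \<open>A unit travels together with its inverse, so that inversion is the exchange of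
  coordinates and products are taken componentwise. Modulo 1 the only pair is (0, 0).\<close>

definition unit_pairs :: "nat \<Rightarrow> (int \<times> int) set" where
  "unit_pairs c = {(x, x'). x \<in> {0..<int c} \<and> x' \<in> {0..<int c} \<and> [x * x' = 1] (mod int c)}"

lemma finite_unit_pairs [simp]: "finite (unit_pairs c)"
  by (rule finite_subset[of _ "{0..<int c} \<times> {0..<int c}"]) (auto simp: unit_pairs_def)

lemma unit_pairsD:
  assumes "(x, x') \<in> unit_pairs c"
  shows "0 \<le> x" "x < int c" "0 \<le> x'" "x' < int c" "[x * x' = 1] (mod int c)" "coprime x (int c)" "coprime x' (int c)"
  using assms unfolding unit_pairs_def
  by (auto simp: coprime_iff_invertible_int intro: exI[of _ x'], metis mult.commute)

lemma cong_range_eq: "[x = y] (mod int c) \<Longrightarrow> 0 \<le> x \<Longrightarrow> x < int c \<Longrightarrow> 0 \<le> y \<Longrightarrow> y < int c \<Longrightarrow> x = y"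
  by (simp add: cong_def)

lemma unit_pairs_inverse_unique:
  assumes "[x * y = 1] (mod int c)" "[x * z = 1] (mod int c)"
  shows "[y = z] (mod int c)"
proof -
  have "[y * (x * z) = y * 1] (mod int c)" using assms(2) by (rule cong_mult[OF cong_refl])
  moreover have "[z * (x * y) = z * 1] (mod int c)" using assms(1) by (rule cong_mult[OF cong_refl])
  moreover have "y * (x * z) = z * (x * y)" by simp
  ultimately show ?thesis by (metis cong_sym cong_trans mult.right_neutral)
qed

lemma inj_on_fst_unit_pairs: "inj_on fst (unit_pairs c)"
proof (rule inj_onI)
  fix p q assume pq: "p \<in> unit_pairs c" "q \<in> unit_pairs c" "fst p = fst q"
  obtain x y z where xyz: "p = (x,y)" "q = (x,z)" using pq by (cases p; cases q) auto
  hence "[y = z] (mod int c)" using pq unit_pairsD(5) unit_pairs_inverse_unique by blast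
  hence "y = z" using pq xyz by (auto intro: cong_range_eq dest: unit_pairsD)
  thus "p = q" using xyz by simp
qed

lemma inj_on_snd_unit_pairs: "inj_on snd (unit_pairs c)"
proof (rule inj_onI)
  fix p q assume pq: "p \<in> unit_pairs c" "q \<in> unit_pairs c" "snd p = snd q"
  obtain x y z where xyz: "p = (y,x)" "q = (z,x)" using pq by (cases p; cases q) auto
  have "[x * y = 1] (mod int c)" "[x * z = 1] (mod int c)" using pq xyz by (auto dest: unit_pairsD simp: mult.commute)
  hence "[y = z] (mod int c)" by (rule unit_pairs_inverse_unique)
  hence "y = z" using pq xyz by (auto intro: cong_range_eq dest: unit_pairsD)
  thus "p = q" using xyz by simp
qed

lemma unit_pairsI:
  assumes "c > 0" "[x * x' = 1] (mod int c)"
  shows "(x mod int c, x' mod int c) \<in> unit_pairs c"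
  using assms by (auto simp: unit_pairs_def cong_def mod_mult_eq)

lemma fst_unit_pairs:
  assumes "c > 0"
  shows "fst ` unit_pairs c = {x\<in>{0..<int c}. coprime x (int c)}"
proof safe
  fix x x' assume "(x, x') \<in> unit_pairs c"
  thus "fst (x,x') \<in> {0..<int c}" "coprime (fst (x,x')) (int c)" by (auto dest: unit_pairsD)
next
  fix x assume x: "x \<in> {0..<int c}" "coprime x (int c)"
  then obtain y where "[x * y = 1] (mod int c)" using coprime_iff_invertible_int by blast
  hence "(x mod int c, y mod int c) \<in> unit_pairs c" by (rule unit_pairsI[OF assms])
  thus "x \<in> fst ` unit_pairs c" using x by (auto simp: image_iff intro!: bexI)
qed

lemma card_unit_pairs: "c > 0 \<Longrightarrow> card (unit_pairs c) = totient c"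
proof -
  assume c: "c > 0"
  have "card (unit_pairs c) = card {x\<in>{0..<int c}. coprime x (int c)}"
    using card_image[OF inj_on_fst_unit_pairs, of c] fst_unit_pairs[OF c] by simp
  also have "\<dots> = card {x\<in>{0..<c}. coprime x c}"
    by (rule bij_betw_same_card[of nat], rule bij_betw_byWitness[of _ int])
       (auto simp: nat_less_iff simp flip: coprime_int_iff)
  also have "\<dots> = totient c"
  proof (cases "c = 1")
    case True
    have "{x\<in>{0..<1::nat}. coprime x 1} = {0}" by auto
    thus ?thesis using True by simp
  next
    case False
    have "{x\<in>{0..<c}. coprime x c} = totatives c"
      using c False by (auto simp: totatives_def intro!: Nat.gr0I le_neq_implies_less)
    thus ?thesis by (simp add: totient_def)
  qed
  finally show ?thesis .
qed

lemma card_unit_pairs_le: "card (unit_pairs c) \<le> c"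
proof -
  have "card (unit_pairs c) = card (fst ` unit_pairs c)" by (simp add: card_image inj_on_fst_unit_pairs)
  also have "\<dots> \<le> card {0..<int c}" by (intro card_mono) (auto dest: unit_pairsD)
  finally show ?thesis by simp
qed

definition kloosterman :: "int \<Rightarrow> int \<Rightarrow> nat \<Rightarrow> complex" where
  "kloosterman a b c = (\<Sum>(x, x')\<in>unit_pairs c. ec c (a * x + b * x'))"

lemma kloosterman_bound: "norm (kloosterman a b c) \<le> real c"
proof -
  have "norm (kloosterman a b c) \<le> (\<Sum>p\<in>unit_pairs c. 1)"
    unfolding kloosterman_def by (rule sum_norm_le) auto
  thus ?thesis using card_unit_pairs_le[of c] by simp
qed

text \<open>Multiplication by a unit pair permutes \<open>unit_pairs c\<close>.\<close>

lemma kloosterman_scale: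
  assumes "(w, w') \<in> unit_pairs c"
  shows "kloosterman (a * w) (b * w') c = kloosterman a b c"
proof -
  have c: "c > 0" using assms unit_pairsD(1,2)[OF assms] by (intro Nat.gr0I) auto
  have w: "[w * w' = 1] (mod int c)" using assms by (rule unit_pairsD)
  define f where "f = (\<lambda>(v, v'). \<lambda>(x, x'). ((v * x) mod int c, (v' * x') mod int c))"
  have mem: "f p q \<in> unit_pairs c" if "p \<in> unit_pairs c" "q \<in> unit_pairs c" for p q
  proof -
    have "[(fst p * snd p) * (fst q * snd q) = 1 * 1] (mod int c)"
      using that by (intro cong_mult) (auto simp: unit_pairs_def)
    thus ?thesis unfolding f_def case_prod_beta by (intro unit_pairsI c) (simp add: mult_ac)
  qed
  have sw: "(w', w) \<in> unit_pairs c" using assms by (auto simp: unit_pairs_def mult.commute)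
  have inv: "f (w', w) (f (w, w') q) = q" "f (w, w') (f (w', w) q) = q" if "q \<in> unit_pairs c" for q
  proof -
    obtain x x' where q: "q = (x,x')" by (cases q)
    have r: "(w * w') mod int c = 1 mod int c" using w by (simp add: cong_def)
    have e: "(w' * (w * y mod int c)) mod int c = y" "(w * (w' * y mod int c)) mod int c = y" if "0 \<le> y" "y < int c" for y
    proof -
      have "(w' * (w * y mod int c)) mod int c = ((w * w') mod int c * y) mod int c"
        by (simp add: mod_simps mult_ac)
      thus "(w' * (w * y mod int c)) mod int c = y" using that by (simp add: r mod_simps)
      have "(w * (w' * y mod int c)) mod int c = ((w * w') mod int c * y) mod int c"
        by (simp add: mod_simps mult_ac)
      thus "(w * (w' * y mod int c)) mod int c = y" using that by (simp add: r mod_simps)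
    qed
    show "f (w', w) (f (w, w') q) = q" "f (w, w') (f (w', w) q) = q"
      using that e unit_pairsD[of x x' c] by (simp_all add: f_def q)
  qed
  show ?thesis unfolding kloosterman_def
  proof (rule sum.reindex_bij_witness[of _ "f (w', w)" "f (w, w')"])
    fix q assume q: "q \<in> unit_pairs c"
    show "f (w', w) (f (w, w') q) = q" "f (w, w') q \<in> unit_pairs c" using inv mem q assms by auto
    obtain x x' where qq: "q = (x,x')" by (cases q)
    show "(case f (w, w') q of (x, x') \<Rightarrow> ec c (a * x + b * x')) = (case q of (x, x') \<Rightarrow> ec c (a * w * x + b * w' * x'))"
    proof -
      have "[a * ((w * x) mod int c) + b * ((w' * x') mod int c) = a * (w * x) + b * (w' * x')] (mod int c)"
        by (intro cong_add cong_mult[OF cong_refl]) (simp_all add: cong_def)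
      hence "ec c (a * ((w * x) mod int c) + b * ((w' * x') mod int c)) = ec c (a * (w * x) + b * (w' * x'))"
        by (rule ec_cong)
      thus ?thesis by (simp add: qq f_def mult.assoc)
    qed
  next
    fix q assume q: "q \<in> unit_pairs c"
    show "f (w, w') (f (w', w) q) = q" "f (w', w) q \<in> unit_pairs c" using inv mem q sw by auto
  qed
qed

definition red :: "nat \<Rightarrow> int \<times> int \<Rightarrow> int \<times> int" where
  "red c = (\<lambda>(x, x'). (x mod int c, x' mod int c))"

lemma red_mem: "p \<in> unit_pairs (c1 * c2) \<Longrightarrow> c1 > 0 \<Longrightarrow> red c1 p \<in> unit_pairs c1"
  "p \<in> unit_pairs (c1 * c2) \<Longrightarrow> c2 > 0 \<Longrightarrow> red c2 p \<in> unit_pairs c2"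
  unfolding red_def case_prod_beta
  by (intro unit_pairsI; auto dest!: unit_pairsD(5)[of "fst p" "snd p", simplified] intro: cong_modulus_mult simp: mult.commute)+

lemma crt_eq:
  assumes "coprime c1 c2" "x mod int c1 = y mod int c1" "x mod int c2 = y mod int c2"
     "x \<in> {0..<int (c1*c2)}" "y \<in> {0..<int (c1*c2)}"
  shows "x = y"
proof -
  have "[x = y] (mod int c1 * int c2)" using assms by (intro coprime_cong_mult) (auto simp: cong_def)
  thus ?thesis using assms by (intro cong_range_eq[of x y "c1*c2"]) auto
qed

lemma red_inj:
  assumes "coprime c1 c2" "p \<in> unit_pairs (c1 * c2)" "q \<in> unit_pairs (c1 * c2)"
    "red c1 p = red c1 q" "red c2 p = red c2 q"
  shows "p = q"
proof -
  have "fst p = fst q"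
    by (rule crt_eq[OF assms(1)]) (use assms in \<open>auto simp: red_def case_prod_beta prod_eq_iff unit_pairs_def\<close>)
  moreover have "snd p = snd q"
    by (rule crt_eq[OF assms(1)]) (use assms in \<open>auto simp: red_def case_prod_beta prod_eq_iff unit_pairs_def\<close>)
  ultimately show ?thesis by (simp add: prod_eq_iff)
qed

text \<open>Injectivity is the Chinese remainder theorem; surjectivity follows by counting, as the
  totient function is multiplicative.\<close>

lemma red_bij:
  assumes "coprime c1 c2" "c1 > 0" "c2 > 0"
  shows "bij_betw (\<lambda>p. (red c1 p, red c2 p)) (unit_pairs (c1 * c2)) (unit_pairs c1 \<times> unit_pairs c2)"
proof -
  have inj: "inj_on (\<lambda>p. (red c1 p, red c2 p)) (unit_pairs (c1 * c2))"
    by (rule inj_onI, rule red_inj[OF assms(1)]) auto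
  moreover have "(\<lambda>p. (red c1 p, red c2 p)) ` unit_pairs (c1 * c2) \<subseteq> unit_pairs c1 \<times> unit_pairs c2"
    using assms by (auto intro: red_mem)
  moreover have "card (unit_pairs c1 \<times> unit_pairs c2) = card (unit_pairs (c1 * c2))"
    using assms by (simp add: card_cartesian_product card_unit_pairs totient_mult_coprime)
  ultimately have "(\<lambda>p. (red c1 p, red c2 p)) ` unit_pairs (c1 * c2) = unit_pairs c1 \<times> unit_pairs c2"
    by (intro card_subset_eq) (simp_all add: card_image)
  thus ?thesis using inj by (simp add: bij_betw_def)
qed

text \<open>Twisted multiplicativity: each factor sees both arguments multiplied by the inverse of
  the other modulus. These twists, usually a nuisance, later provide the averaging.\<close>

lemma kloosterman_mult:
  assumes "coprime c1 c2" "c1 > 0" "c2 > 0" "[int c2 * e2 = 1] (mod int c1)" "[int c1 * e1 = 1] (mod int c2)"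
  shows "kloosterman a b (c1 * c2) = kloosterman (a * e2) (b * e2) c1 * kloosterman (a * e1) (b * e1) c2"
proof -
  have "kloosterman (a * e2) (b * e2) c1 * kloosterman (a * e1) (b * e1) c2 =
      (\<Sum>(p,q)\<in>unit_pairs c1 \<times> unit_pairs c2. ec c1 (a * e2 * fst p + b * e2 * snd p) * ec c2 (a * e1 * fst q + b * e1 * snd q))"
    unfolding kloosterman_def sum_product sum.cartesian_product[symmetric] by (simp add: case_prod_beta)
  also have "\<dots> = (\<Sum>r\<in>unit_pairs (c1 * c2). case (red c1 r, red c2 r) of (p,q) \<Rightarrow>
       ec c1 (a * e2 * fst p + b * e2 * snd p) * ec c2 (a * e1 * fst q + b * e1 * snd q))"
    by (rule sum.reindex_bij_betw[OF red_bij[OF assms(1-3)], symmetric])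
  also have "\<dots> = kloosterman a b (c1 * c2)"
    unfolding kloosterman_def
  proof (intro sum.cong refl)
    fix r assume "r \<in> unit_pairs (c1 * c2)"
    obtain x x' where r: "r = (x, x')" by (cases r)
    have "[a * e2 * (x mod int c1) + b * e2 * (x' mod int c1) = a * e2 * x + b * e2 * x'] (mod int c1)"
      by (intro cong_add cong_mult cong_refl) (simp_all add: cong_def)
    hence 1: "ec c1 (a * e2 * (x mod int c1) + b * e2 * (x' mod int c1)) = ec c1 ((a * x + b * x') * e2)"
      by (intro ec_cong) (simp add: algebra_simps)
    have "[a * e1 * (x mod int c2) + b * e1 * (x' mod int c2) = a * e1 * x + b * e1 * x'] (mod int c2)"
      by (intro cong_add cong_mult cong_refl) (simp_all add: cong_def)
    hence 2: "ec c2 (a * e1 * (x mod int c2) + b * e1 * (x' mod int c2)) = ec c2 ((a * x + b * x') * e1)"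
      by (intro ec_cong) (simp add: algebra_simps)
    show "(case (red c1 r, red c2 r) of (p,q) \<Rightarrow>
       ec c1 (a * e2 * fst p + b * e2 * snd p) * ec c2 (a * e1 * fst q + b * e1 * snd q)) = (case r of (x,x') \<Rightarrow> ec (c1*c2) (a * x + b * x'))"
      by (simp add: r red_def 1 2 ec_split[OF assms(4,5,1,2,3), of "a * x + b * x'"])
  qed
  finally show ?thesis ..
qed

text \<open>Lets bounds that are proved by hand modulo a prime pass to squarefree moduli by coprime
  multiplication.\<close>

lemma squarefree_nat_induct [consumes 1, case_names one mult]:
  fixes n :: nat
  assumes "squarefree n" "P 1"
    "\<And>p c. prime p \<Longrightarrow> coprime p c \<Longrightarrow> squarefree c \<Longrightarrow> c > 0 \<Longrightarrow> P c \<Longrightarrow> P (p * c)"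
  shows "P n"
  using assms(1)
proof (induction n rule: less_induct)
  case (less n)
  have n0: "n > 0" using less.prems not_squarefree_0 by (intro Nat.gr0I) auto
  show ?case
  proof (cases "n = 1")
    case True thus ?thesis using assms(2) by simp
  next
    case False
    then obtain p where p: "prime p" "p dvd n" using prime_factor_nat by blast
    then obtain c where c: "n = p * c" by auto
    have "\<not> p dvd c"
    proof
      assume "p dvd c"
      hence "p\<^sup>2 dvd n" by (auto simp: c power2_eq_square)
      hence "is_unit p" using less.prems by (auto simp: squarefree_def)
      thus False using p by auto
    qed
    hence "coprime p c" using p prime_imp_coprime by blast
    moreover have "squarefree c" using less.prems unfolding c squarefree_def by (meson dvd_mult)
    moreover have "c > 0" "c < n" using n0 p prime_gt_1_nat[of p] by (auto simp: c)
    ultimately show ?thesis using less.IH[of c] p assms(3) c by auto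
  qed
qed

section \<open>Ramanujan sums and square roots modulo squarefree numbers\<close>

definition omg :: "nat \<Rightarrow> nat" where "omg c = card (prime_factors c)"

lemma omg_1 [simp]: "omg (Suc 0) = 0" by (simp add: omg_def)

lemma omg_mult: "prime p \<Longrightarrow> coprime p c \<Longrightarrow> c > 0 \<Longrightarrow> omg (p * c) = Suc (omg c)"
proof -
  assume a: "prime p" "coprime p c" "c > 0"
  have "prime_factors (p * c) = insert p (prime_factors c)"
    using a by (subst prime_factors_product) (auto simp: prime_prime_factors)
  moreover have "p \<notin> prime_factors c" using a by (auto simp: coprime_absorb_left dest: in_prime_factors_imp_dvd)
  ultimately show ?thesis by (simp add: omg_def)
qed

lemma gcd_mult_coprime_le:
  fixes a :: int
  assumes "coprime p c" "p > 0" "c > (0::nat)"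
  shows "gcd a (int p) * gcd a (int c) \<le> gcd a (int (p * c))"
proof -
  have "gcd a (int p) * gcd a (int c) dvd gcd a (int (p * c))"
  proof (rule divides_mult)
    show "coprime (gcd a (int p)) (gcd a (int c))" using assms(1)
      by (meson coprime_divisors coprime_int_iff gcd_dvd2)
  qed auto
  thus ?thesis using assms by (intro zdvd_imp_le) auto
qed

text \<open>Each prime p loses at most the factor p/(p - 1) \<le> 2.\<close>

lemma c_le_totient: "squarefree c \<Longrightarrow> real c \<le> 2 ^ omg c * real (totient c)"
proof (induction c rule: squarefree_nat_induct)
  case (mult p c)
  have "real p \<le> 2 * real (totient p)" using prime_gt_1_nat[OF mult.hyps(1)] by (simp add: totient_prime[OF mult.hyps(1)] of_nat_diff)
  hence "real p * real c \<le> (2 * real (totient p)) * (2 ^ omg c * real (totient c))"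
    using mult by (intro mult_mono) auto
  also have "\<dots> = 2 ^ omg (p * c) * real (totient (p * c))"
    using mult by (simp add: omg_mult totient_mult_coprime)
  finally show ?case by simp
qed simp

text \<open>With second argument 0 the sum is Ramanujan's, which modulo a prime is -1 unless the
  prime divides \<open>a\<close>. Unit twists leave the gcd unchanged, so the bound survives twisted
  multiplicativity.\<close>

lemma ramanujan_bound: "squarefree c \<Longrightarrow> norm (kloosterman a 0 c) \<le> of_int (gcd a (int c))"
proof (induction c arbitrary: a rule: squarefree_nat_induct)
  case one
  show ?case using kloosterman_bound[of a 0 1] by simp
next
  case (mult p c)
  have p: "p > 0" "p > 1" using mult.hyps(1) prime_gt_0_nat prime_gt_1_nat by auto
  obtain e2 where e2: "[int c * e2 = 1] (mod int p)" using mult.hyps(2) coprime_iff_invertible_int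
    by (metis coprime_commute coprime_int_iff)
  obtain e1 where e1: "[int p * e1 = 1] (mod int c)" using mult.hyps(2) coprime_iff_invertible_int
    by (metis coprime_int_iff)
  have eq: "kloosterman a 0 (p * c) = kloosterman (a * e2) 0 p * kloosterman (a * e1) 0 c"
    using kloosterman_mult[OF mult.hyps(2) p(1) mult.hyps(4) e2 e1, of a 0] by simp
  have g: "gcd (a * e) (int n) = gcd a (int n)" if "[int k * e = 1] (mod int n)" for e k n
  proof -
    have "[e * int k = 1] (mod int n)" using that by (simp add: mult.commute)
    hence "coprime e (int n)" using coprime_iff_invertible_int by blast
    thus ?thesis by (intro gcd_mult_left_right_cancel) (simp add: coprime_commute)
  qed
  have "norm (kloosterman (a * e2) 0 p) \<le> of_int (gcd (a * e2) (int p))"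
  proof (cases "int p dvd a * e2")
    case True
    hence "gcd (a * e2) (int p) = int p" by (simp add: gcd_proj2_iff)
    thus ?thesis using kloosterman_bound[of "a * e2" 0 p] by simp
  next
    case False
    have "kloosterman (a * e2) 0 p = (\<Sum>x\<in>fst ` unit_pairs p. ec p (a * e2 * x))"
      unfolding kloosterman_def by (subst sum.reindex[OF inj_on_fst_unit_pairs]) (simp add: case_prod_beta)
    also have "fst ` unit_pairs p = {0..<int p} - {0}"
    proof -
      have "coprime x (int p) \<longleftrightarrow> x \<noteq> 0" if "0 \<le> x" "x < int p" for x
      proof
        assume "coprime x (int p)" thus "x \<noteq> 0" using p by auto
      next
        assume "x \<noteq> 0"
        hence "\<not> int p dvd x" using that zdvd_not_zless by fastforce
        thus "coprime x (int p)" using mult.hyps(1) prime_imp_coprime[of "int p" x] by (simp add: coprime_commute)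
      qed
      thus ?thesis using fst_unit_pairs[OF p(1)] by auto
    qed
    also have "(\<Sum>x\<in>{0..<int p} - {0}. ec p (a * e2 * x)) = (\<Sum>x\<in>{0..<int p}. ec p (x * (a * e2))) - 1"
      using p by (subst sum_diff1) (auto simp: mult_ac)
    also have "\<dots> = - 1" using ec_sum[OF p(1), of "a*e2"] False by simp
    finally have "norm (kloosterman (a * e2) 0 p) = 1" by simp
    moreover have "gcd (a * e2) (int p) > 0" using p by simp
    ultimately show ?thesis by linarith
  qed
  hence "norm (kloosterman a 0 (p * c)) \<le> of_int (gcd (a * e2) (int p)) * of_int (gcd (a * e1) (int c))"
    unfolding eq norm_mult using mult.IH by (intro mult_mono) auto
  also have "\<dots> = of_int (gcd a (int p) * gcd a (int c))" using g[OF e2] g[OF e1] by simp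
  also have "\<dots> \<le> of_int (gcd a (int (p * c)))" 
    using gcd_mult_coprime_le[OF mult.hyps(2) p(1) mult.hyps(4), of a] by (simp only: of_int_le_iff)
  finally show ?case .
qed

definition sqrts :: "int \<Rightarrow> nat \<Rightarrow> int set" where
  "sqrts a c = {u\<in>{0..<int c}. [u * u = a] (mod int c)}"

lemma finite_sqrts [simp]: "finite (sqrts a c)" by (rule finite_subset[of _ "{0..<int c}"]) (auto simp: sqrts_def)

text \<open>Modulo a prime there are at most two square roots, v and -v; the Chinese remainder
  theorem combines the primes.\<close>

lemma card_sqrts: "squarefree c \<Longrightarrow> card (sqrts a c) \<le> 2 ^ omg c"
proof (induction c rule: squarefree_nat_induct)
  case one
  have "sqrts a 1 \<subseteq> {0}" by (auto simp: sqrts_def)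
  from card_mono[OF _ this] show ?case by simp
next
  case (mult p c)
  have p: "p > 0" using mult.hyps(1) prime_gt_0_nat by auto
  have "card (sqrts a p) \<le> 2"
  proof (cases "sqrts a p = {}")
    case False
    then obtain v where v: "v \<in> sqrts a p" by blast
    have "sqrts a p \<subseteq> {v, (- v) mod int p}"
    proof
      fix w assume w: "w \<in> sqrts a p"
      have "[v * v = w * w] (mod int p)" using v w by (auto simp: sqrts_def intro: cong_trans cong_sym)
      hence "int p dvd w * w - v * v" by (simp add: cong_iff_dvd_diff dvd_diff_commute)
      hence "int p dvd (w - v) * (w + v)" by (simp add: algebra_simps)
      hence "int p dvd w - v \<or> int p dvd w + v" using mult.hyps(1) by (simp add: prime_dvd_mult_iff)
      thus "w \<in> {v, (- v) mod int p}"
      proof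
        assume "int p dvd w - v"
        hence "[w = v] (mod int p)" by (simp add: cong_iff_dvd_diff)
        hence "w = v" using v w by (intro cong_range_eq) (auto simp: sqrts_def)
        thus ?thesis by simp
      next
        assume "int p dvd w + v"
        hence "w mod int p = (- v) mod int p" by (simp add: mod_eq_dvd_iff)
        thus ?thesis using w by (simp add: sqrts_def)
      qed
    qed
    hence "card (sqrts a p) \<le> card {v, (- v) mod int p}" by (intro card_mono) auto
    also have "\<dots> \<le> 2" by (simp add: card_insert_if)
    finally show ?thesis .
  qed simp
  moreover have "card (sqrts a (p * c)) \<le> card (sqrts a p \<times> sqrts a c)"
  proof (rule card_inj_on_le[of "\<lambda>x. (x mod int p, x mod int c)"])
    show "inj_on (\<lambda>x. (x mod int p, x mod int c)) (sqrts a (p * c))"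
      by (rule inj_onI) (auto simp: sqrts_def intro: crt_eq[OF mult.hyps(2)])
    show "(\<lambda>x. (x mod int p, x mod int c)) ` sqrts a (p * c) \<subseteq> sqrts a p \<times> sqrts a c"
      using p mult.hyps(4) by (auto simp: sqrts_def cong_def mod_mult_eq intro: cong_modulus_mult[unfolded cong_def])
        (metis cong_def cong_modulus_mult mult.commute)+
  qed simp
  ultimately have "card (sqrts a (p * c)) \<le> 2 * 2 ^ omg c"
    using mult.IH by (simp add: card_cartesian_product) (meson le_trans mult_le_mono)
  thus ?case using mult.hyps by (simp add: omg_mult)
qed

section \<open>The fourth moment of Kloosterman sums\<close>

lemma complex_norm_square_sum:
  "complex_of_real ((norm (\<Sum>i\<in>I. f i))\<^sup>2) = (\<Sum>i\<in>I. \<Sum>j\<in>I. f i * cnj (f j))"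
  by (simp only: complex_norm_square cnj_sum sum_product)

text \<open>Opening the square and summing over both frequencies is orthogonality in each
  coordinate: only pairs whose two phases agree survive.\<close>

lemma second_moment_residues:
  assumes "finite I" "c > 0"
  shows "(\<Sum>\<alpha>\<in>{0..<int c}. \<Sum>\<beta>\<in>{0..<int c}. (norm (\<Sum>i\<in>I. ec c (\<alpha> * A i + \<beta> * B i)))\<^sup>2)
    = (real c)\<^sup>2 * real (card {(i,j)\<in>I\<times>I. [A i = A j] (mod int c) \<and> [B i = B j] (mod int c)})"
proof -
  let ?R = "{0..<int c}"
  have "complex_of_real (\<Sum>\<alpha>\<in>?R. \<Sum>\<beta>\<in>?R. (norm (\<Sum>i\<in>I. ec c (\<alpha> * A i + \<beta> * B i)))\<^sup>2)
     = (\<Sum>\<alpha>\<in>?R. \<Sum>\<beta>\<in>?R. \<Sum>i\<in>I. \<Sum>j\<in>I. ec c (\<alpha> * (A i - A j)) * ec c (\<beta> * (B i - B j)))"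
    unfolding of_real_sum complex_norm_square_sum
    by (intro sum.cong refl) (simp add: algebra_simps flip: ec_diff ec_add)
  also have "\<dots> = (\<Sum>\<alpha>\<in>?R. \<Sum>i\<in>I. \<Sum>\<beta>\<in>?R. \<Sum>j\<in>I. ec c (\<alpha> * (A i - A j)) * ec c (\<beta> * (B i - B j)))"
    by (intro sum.cong refl sum.swap)
  also have "\<dots> = (\<Sum>i\<in>I. \<Sum>\<alpha>\<in>?R. \<Sum>\<beta>\<in>?R. \<Sum>j\<in>I. ec c (\<alpha> * (A i - A j)) * ec c (\<beta> * (B i - B j)))"
    by (rule sum.swap)
  also have "\<dots> = (\<Sum>i\<in>I. \<Sum>\<alpha>\<in>?R. \<Sum>j\<in>I. \<Sum>\<beta>\<in>?R. ec c (\<alpha> * (A i - A j)) * ec c (\<beta> * (B i - B j)))"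
    by (intro sum.cong refl sum.swap)
  also have "\<dots> = (\<Sum>i\<in>I. \<Sum>j\<in>I. \<Sum>\<alpha>\<in>?R. \<Sum>\<beta>\<in>?R. ec c (\<alpha> * (A i - A j)) * ec c (\<beta> * (B i - B j)))"
    by (intro sum.cong refl sum.swap)
  also have "\<dots> = (\<Sum>i\<in>I. \<Sum>j\<in>I. (\<Sum>\<alpha>\<in>?R. ec c (\<alpha> * (A i - A j))) * (\<Sum>\<beta>\<in>?R. ec c (\<beta> * (B i - B j))))"
    by (simp add: sum_product)
  also have "\<dots> = (\<Sum>i\<in>I. \<Sum>j\<in>I. if [A i = A j] (mod int c) \<and> [B i = B j] (mod int c) then (of_nat c)\<^sup>2 else 0)"
    by (intro sum.cong refl) (simp add: ec_sum[OF assms(2)] cong_iff_dvd_diff power2_eq_square)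
  also have "\<dots> = (\<Sum>p\<in>I\<times>I. if [A (fst p) = A (snd p)] (mod int c) \<and> [B (fst p) = B (snd p)] (mod int c) then (of_nat c)\<^sup>2 else 0)"
    unfolding sum.cartesian_product by (intro sum.cong refl) auto
  also have "\<dots> = (\<Sum>p\<in>{p \<in> I\<times>I. [A (fst p) = A (snd p)] (mod int c) \<and> [B (fst p) = B (snd p)] (mod int c)}. (of_nat c)\<^sup>2)"
    using assms(1) by (intro sum.inter_filter[symmetric]) auto
  also have "{p \<in> I\<times>I. [A (fst p) = A (snd p)] (mod int c) \<and> [B (fst p) = B (snd p)] (mod int c)} =
      {(i,j)\<in>I\<times>I. [A i = A j] (mod int c) \<and> [B i = B j] (mod int c)}" by auto
  also have "(\<Sum>p\<in>{(i,j)\<in>I\<times>I. [A i = A j] (mod int c) \<and> [B i = B j] (mod int c)}. (of_nat c)\<^sup>2)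
     = of_nat (card {(i,j)\<in>I\<times>I. [A i = A j] (mod int c) \<and> [B i = B j] (mod int c)}) * (of_nat c)\<^sup>2"
    by simp
  also have "\<dots> = complex_of_real ((real c)\<^sup>2 * real (card {(i,j)\<in>I\<times>I. [A i = A j] (mod int c) \<and> [B i = B j] (mod int c)}))"
    by simp
  finally show ?thesis unfolding of_real_eq_iff .
qed

text \<open>For units \<open>a\<close> and \<open>b\<close> these are the solutions of x1 + x2 = x3
  + x4 and 1/x1 + 1/x2 = 1/x3 + 1/x4. In general the two equations are weakened by the factors that
  \<open>a\<close> and \<open>b\<close> share with the modulus.\<close>

definition klquads :: "int \<Rightarrow> int \<Rightarrow> nat \<Rightarrow> (((int \<times> int) \<times> (int \<times> int)) \<times> ((int \<times> int) \<times> (int \<times> int))) set" where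
  "klquads a b c = {(i, j) \<in> (unit_pairs c \<times> unit_pairs c) \<times> (unit_pairs c \<times> unit_pairs c).
     [a * (fst (fst i) + fst (snd i)) = a * (fst (fst j) + fst (snd j))] (mod int c) \<and>
     [b * (snd (fst i) + snd (snd i)) = b * (snd (fst j) + snd (snd j))] (mod int c)}"

lemma finite_klquads [simp]: "finite (klquads a b c)"
  by (rule finite_subset[of _ "(unit_pairs c \<times> unit_pairs c) \<times> (unit_pairs c \<times> unit_pairs c)"])
     (auto simp: klquads_def)

text \<open>The square of a Kloosterman sum is an exponential sum over pairs of units, to which the
  second moment applies.\<close>

lemma kloosterman_fourth_moment:
  assumes "c > 0"
  shows "(\<Sum>\<alpha>\<in>{0..<int c}. \<Sum>\<beta>\<in>{0..<int c}. norm (kloosterman (a * \<alpha>) (b * \<beta>) c) ^ 4)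
     = (real c)\<^sup>2 * real (card (klquads a b c))"
proof -
  have sq: "norm (kloosterman (a * \<alpha>) (b * \<beta>) c) ^ 4 = (norm (\<Sum>i\<in>unit_pairs c \<times> unit_pairs c. 
       ec c (\<alpha> * (a * (fst (fst i) + fst (snd i))) + \<beta> * (b * (snd (fst i) + snd (snd i))))))\<^sup>2" for \<alpha> \<beta>
  proof -
    have "kloosterman (a * \<alpha>) (b * \<beta>) c ^ 2 = (\<Sum>p\<in>unit_pairs c. \<Sum>q\<in>unit_pairs c. 
        ec c (a * \<alpha> * fst p + b * \<beta> * snd p) * ec c (a * \<alpha> * fst q + b * \<beta> * snd q))"
      unfolding kloosterman_def power2_eq_square sum_product by (simp add: case_prod_beta)
    also have "\<dots> = (\<Sum>i\<in>unit_pairs c \<times> unit_pairs c. 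
       ec c (\<alpha> * (a * (fst (fst i) + fst (snd i))) + \<beta> * (b * (snd (fst i) + snd (snd i)))))"
      unfolding sum.cartesian_product by (intro sum.cong refl) (auto simp: algebra_simps simp flip: ec_add)
    finally have e: "kloosterman (a * \<alpha>) (b * \<beta>) c ^ 2 = \<dots>" .
    have "norm (kloosterman (a * \<alpha>) (b * \<beta>) c) ^ 4 = (norm (kloosterman (a * \<alpha>) (b * \<beta>) c ^ 2))\<^sup>2"
      by (simp add: norm_power)
    thus ?thesis unfolding e .
  qed
  show ?thesis unfolding sq klquads_def
    by (subst second_moment_residues) (use assms in \<open>auto simp: case_prod_beta\<close>)
qed

text \<open>Reduction modulo both factors is injective on quadruples and preserves the equations,
  which suffices for an upper bound.\<close>

lemma card_klquads_mult:
  assumes "coprime c1 c2" "c1 > 0" "c2 > 0"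
  shows "card (klquads a b (c1 * c2)) \<le> card (klquads a b c1) * card (klquads a b c2)"
proof -
  define R where "R c = (\<lambda>((p1,p2),(p3,p4)). ((red c p1, red c p2), (red c p3, red c p4)))" for c
  have "card (klquads a b (c1 * c2)) \<le> card (klquads a b c1 \<times> klquads a b c2)"
  proof (rule card_inj_on_le[of "\<lambda>q. (R c1 q, R c2 q)"])
    show "inj_on (\<lambda>q. (R c1 q, R c2 q)) (klquads a b (c1 * c2))"
    proof (rule inj_onI)
      fix p q assume pq: "p \<in> klquads a b (c1 * c2)" "q \<in> klquads a b (c1 * c2)" "(R c1 p, R c2 p) = (R c1 q, R c2 q)"
      obtain p1 p2 p3 p4 where p: "p = ((p1,p2),(p3,p4))" by (metis surj_pair)
      obtain q1 q2 q3 q4 where q: "q = ((q1,q2),(q3,q4))" by (metis surj_pair)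
      have "p1 = q1" "p2 = q2" "p3 = q3" "p4 = q4"
        using pq by (auto simp: p q R_def klquads_def intro!: red_inj[OF assms(1)])
      thus "p = q" by (simp add: p q)
    qed
    show "(\<lambda>q. (R c1 q, R c2 q)) ` klquads a b (c1 * c2) \<subseteq> klquads a b c1 \<times> klquads a b c2"
    proof (rule image_subsetI)
      fix q assume q: "q \<in> klquads a b (c1 * c2)"
      obtain p1 p2 p3 p4 where qq: "q = ((p1,p2),(p3,p4))" by (metis surj_pair)
      have p: "((p1,p2),(p3,p4)) \<in> klquads a b (c1 * c2)" using q qq by simp
      have R: "R c ((p1,p2),(p3,p4)) \<in> klquads a b c" if c: "c = c1 \<or> c = c2" for c
      proof -
        have mem: "red c p1 \<in> unit_pairs c" "red c p2 \<in> unit_pairs c" "red c p3 \<in> unit_pairs c" "red c p4 \<in> unit_pairs c"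
          using p c assms by (auto simp: klquads_def intro: red_mem)
        have cg: "[x = y] (mod int c)" if "[x = y] (mod int (c1 * c2))" for x y
          using that c by (auto intro: cong_modulus_mult simp: mult.commute[of "int c1"])
        have r: "[fst (red c q) = fst q] (mod int c)" "[snd (red c q) = snd q] (mod int c)" for q
          by (simp_all add: red_def case_prod_beta cong_def)
        have "[a * (fst (red c p1) + fst (red c p2)) = a * (fst p1 + fst p2)] (mod int c)"
          by (intro cong_mult[OF cong_refl] cong_add r)
        also have "[a * (fst p1 + fst p2) = a * (fst p3 + fst p4)] (mod int c)"
          using p by (intro cg) (auto simp: klquads_def)
        also have "[a * (fst p3 + fst p4) = a * (fst (red c p3) + fst (red c p4))] (mod int c)"
          by (intro cong_mult[OF cong_refl] cong_add cong_sym[OF r(1)])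
        finally have 1: "[a * (fst (red c p1) + fst (red c p2)) = a * (fst (red c p3) + fst (red c p4))] (mod int c)" .
        have "[b * (snd (red c p1) + snd (red c p2)) = b * (snd p1 + snd p2)] (mod int c)"
          by (intro cong_mult[OF cong_refl] cong_add r)
        also have "[b * (snd p1 + snd p2) = b * (snd p3 + snd p4)] (mod int c)"
          using p by (intro cg) (auto simp: klquads_def)
        also have "[b * (snd p3 + snd p4) = b * (snd (red c p3) + snd (red c p4))] (mod int c)"
          by (intro cong_mult[OF cong_refl] cong_add cong_sym[OF r(2)])
        finally have 2: "[b * (snd (red c p1) + snd (red c p2)) = b * (snd (red c p3) + snd (red c p4))] (mod int c)" .
        show ?thesis using mem 1 2 by (simp add: R_def klquads_def)
      qed
      show "(R c1 q, R c2 q) \<in> klquads a b c1 \<times> klquads a b c2" using R by (auto simp: qq)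
    qed
  qed simp
  thus ?thesis by (simp add: card_cartesian_product)
qed

lemma card_unit_pairs_tuple_le:
  assumes "inj_on f Q" "finite Q" "\<And>q. q \<in> Q \<Longrightarrow> f q \<in> unit_pairs c \<times> unit_pairs c"
  shows "card Q \<le> c\<^sup>2"
proof -
  have "card Q \<le> card (unit_pairs c \<times> unit_pairs c)"
    by (rule card_inj_on_le[OF assms(1) image_subsetI[OF assms(3)]]) simp_all
  also have "\<dots> \<le> c * c" using card_unit_pairs_le[of c] by (simp add: card_cartesian_product mult_le_mono)
  finally show ?thesis by (simp add: power2_eq_square)
qed

text \<open>If p divides neither coefficient, two pairs with equal sums and equal sums of
  reciprocals either agree up to order or both have sum 0: three families with two free parameters
  each. If p divides just one coefficient, three elements determine the fourth. If it divides both,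
  the trivial count p^4 is matched by the two gcds.\<close>

lemma card_klquads_prime:
  assumes "prime p"
  shows "real (card (klquads a b p)) \<le> 3 * (real p)\<^sup>2 * of_int (gcd a (int p)) * of_int (gcd b (int p))"
proof -
  let ?U = "unit_pairs p"
  have p0: "p > 0" using assms prime_gt_0_nat by auto
  have pint: "prime (int p)" using assms by simp
  have gge: "gcd a (int p) \<ge> 1" "gcd b (int p) \<ge> 1" using p0 by (simp_all add: Suc_leI int_one_le_iff_zero_less)
  have canc: "[x = y] (mod int p)" if "[k * x = k * y] (mod int p)" "\<not> int p dvd k" for k x y
    using that pint cong_mult_lcancel[of k "int p" x y] prime_imp_coprime[of "int p" k] by (simp add: coprime_commute)
  have fsteq: "i = j" if "i \<in> ?U" "j \<in> ?U" "[fst i = fst j] (mod int p)" for i j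
  proof -
    have "fst i = fst j" using that by (intro cong_range_eq) (auto simp: unit_pairs_def)
    thus ?thesis using inj_on_fst_unit_pairs that by (auto dest: inj_onD)
  qed
  have sndeq: "i = j" if "i \<in> ?U" "j \<in> ?U" "[snd i = snd j] (mod int p)" for i j
  proof -
    have "snd i = snd j" using that by (intro cong_range_eq) (auto simp: unit_pairs_def)
    thus ?thesis using inj_on_snd_unit_pairs that by (auto dest: inj_onD)
  qed
  have cardU3: "card (?U \<times> ?U \<times> ?U) \<le> p ^ 3"
    using card_unit_pairs_le[of p] by (simp only: card_cartesian_product power3_eq_cube mult.assoc) (intro mult_le_mono)
  have one: "card (klquads a b p) \<le> p ^ 3" if "\<not> (int p dvd a \<and> int p dvd b)"
  proof -
    have "card (klquads a b p) \<le> card (?U \<times> ?U \<times> ?U)"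
    proof (rule card_inj_on_le[of "\<lambda>((p1,p2),(p3,p4)). (p1,p2,p3)"])
      show "inj_on (\<lambda>((p1,p2),(p3,p4)). (p1,p2,p3)) (klquads a b p)"
      proof (rule inj_onI)
        fix q q' assume q: "q \<in> klquads a b p" "q' \<in> klquads a b p"
          "(\<lambda>((p1,p2),(p3,p4)). (p1,p2,p3)) q = (\<lambda>((p1,p2),(p3,p4)). (p1,p2,p3)) q'"
        obtain p1 p2 p3 p4 where qq: "q = ((p1,p2),(p3,p4))" by (metis surj_pair)
        obtain r1 r2 r3 p5 where "q' = ((r1,r2),(r3,p5))" by (metis surj_pair)
        hence qq': "q' = ((p1,p2),(p3,p5))" using q(3) qq by simp
        have "p4 = p5"
        proof (cases "int p dvd a")
          case False
          have "[a * (fst p3 + fst p4) = a * (fst p3 + fst p5)] (mod int p)"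
            using q(1,2) by (auto simp: klquads_def qq qq' intro: cong_trans cong_sym)
          hence "[fst p3 + fst p4 = fst p3 + fst p5] (mod int p)" by (rule canc[OF _ False])
          hence "[fst p4 = fst p5] (mod int p)" by (simp add: cong_add_lcancel)
          thus ?thesis using q(1,2) by (intro fsteq) (auto simp: klquads_def qq qq')
        next
          case True
          hence F: "\<not> int p dvd b" using that by blast
          have "[b * (snd p3 + snd p4) = b * (snd p3 + snd p5)] (mod int p)"
            using q(1,2) by (auto simp: klquads_def qq qq' intro: cong_trans cong_sym)
          hence "[snd p3 + snd p4 = snd p3 + snd p5] (mod int p)" by (rule canc[OF _ F])
          hence "[snd p4 = snd p5] (mod int p)" by (simp add: cong_add_lcancel)
          thus ?thesis using q(1,2) by (intro sndeq) (auto simp: klquads_def qq qq')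
        qed
        thus "q = q'" by (simp add: qq qq')
      qed
    qed (auto simp: klquads_def)
    thus ?thesis using cardU3 by simp
  qed
  consider "int p dvd a \<and> int p dvd b" | "int p dvd a \<and> \<not> int p dvd b" | "\<not> int p dvd a \<and> int p dvd b"
    | "\<not> int p dvd a \<and> \<not> int p dvd b" by blast
  thus ?thesis
  proof cases
    case 1
    hence g: "gcd a (int p) = int p" "gcd b (int p) = int p" by (simp_all add: gcd_proj2_iff)
    have "card (klquads a b p) \<le> card ((?U \<times> ?U) \<times> (?U \<times> ?U))"
      by (intro card_mono) (auto simp: klquads_def)
    also have "\<dots> \<le> (p * p) * (p * p)" using card_unit_pairs_le[of p] by (simp only: card_cartesian_product) (intro mult_le_mono)
    finally have "real (card (klquads a b p)) \<le> real ((p * p) * (p * p))" by (simp only: of_nat_le_iff)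
    also have "\<dots> \<le> 3 * real ((p * p) * (p * p))" by simp
    finally show ?thesis by (simp add: g power2_eq_square mult_ac)
  next
    case 2
    hence g: "gcd a (int p) = int p" by (simp add: gcd_proj2_iff)
    have "real (card (klquads a b p)) \<le> real (p ^ 3)" using one 2 by (simp only: of_nat_le_iff) blast
    also have "\<dots> \<le> 3 * (real p)\<^sup>2 * real p * 1" by (simp add: power2_eq_square power3_eq_cube)
    also have "\<dots> \<le> 3 * (real p)\<^sup>2 * real p * of_int (gcd b (int p))" using gge by (intro mult_left_mono) auto
    finally show ?thesis by (simp add: g)
  next
    case 3
    hence g: "gcd b (int p) = int p" by (simp add: gcd_proj2_iff)
    have "real (card (klquads a b p)) \<le> real (p ^ 3)" using one 3 by (simp only: of_nat_le_iff) blast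
    also have "\<dots> \<le> 3 * (real p)\<^sup>2 * real p * 1" by (simp add: power2_eq_square power3_eq_cube)
    also have "\<dots> \<le> 3 * (real p)\<^sup>2 * real p * of_int (gcd a (int p))" using gge by (intro mult_left_mono) auto
    finally show ?thesis by (simp add: g mult_ac)
  next
    case 4
    define Q1 where "Q1 = {((p1,p2),(p3,p4)) \<in> klquads a b p. p1 = p3 \<and> p2 = p4}"
    define Q2 where "Q2 = {((p1,p2),(p3,p4)) \<in> klquads a b p. p1 = p4 \<and> p2 = p3}"
    define Q3 where "Q3 = {((p1,p2),(p3,p4)) \<in> klquads a b p. [fst p1 + fst p2 = 0] (mod int p) \<and> [fst p3 + fst p4 = 0] (mod int p)}"
    have fin: "finite Q1" "finite Q2" "finite Q3"
      by (rule finite_subset[OF _ finite_klquads[of a b p]]; auto simp: Q1_def Q2_def Q3_def)+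
    have c1: "card Q1 \<le> p\<^sup>2"
      by (rule card_unit_pairs_tuple_le[of "\<lambda>((p1,p2),(p3,p4)). (p1,p2)", OF _ fin(1)]) (auto simp: Q1_def inj_on_def klquads_def)
    have c2: "card Q2 \<le> p\<^sup>2"
      by (rule card_unit_pairs_tuple_le[of "\<lambda>((p1,p2),(p3,p4)). (p1,p2)", OF _ fin(2)]) (auto simp: Q2_def inj_on_def klquads_def)
    have c3: "card Q3 \<le> p\<^sup>2"
    proof (rule card_unit_pairs_tuple_le[of "\<lambda>((p1,p2),(p3,p4)). (p1,p3)", OF _ fin(3)])
      show "inj_on (\<lambda>((p1,p2),(p3,p4)). (p1,p3)) Q3"
      proof (rule inj_onI)
        fix q q' assume q: "q \<in> Q3" "q' \<in> Q3"
          "(\<lambda>((p1,p2),(p3,p4)). (p1,p3)) q = (\<lambda>((p1,p2),(p3,p4)). (p1,p3)) q'"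
        obtain p1 p2 p3 p4 where qq: "q = ((p1,p2),(p3,p4))" by (metis surj_pair)
        obtain r1 r3 p5 p6 where "q' = ((r1,p5),(r3,p6))" by (metis surj_pair)
        hence qq': "q' = ((p1,p5),(p3,p6))" using q(3) qq by simp
        have "[fst p1 + fst p2 = fst p1 + fst p5] (mod int p)" "[fst p3 + fst p4 = fst p3 + fst p6] (mod int p)"
          using q(1,2) by (auto simp: Q3_def qq qq' intro: cong_trans cong_sym)
        hence "[fst p2 = fst p5] (mod int p)" "[fst p4 = fst p6] (mod int p)" by (simp_all add: cong_add_lcancel)
        hence "p2 = p5" "p4 = p6" using q(1,2) by (auto intro!: fsteq simp: Q3_def klquads_def qq qq')
        thus "q = q'" by (simp add: qq qq')
      qed
    qed (auto simp: Q3_def klquads_def)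
    have "klquads a b p \<subseteq> Q1 \<union> Q2 \<union> Q3"
    proof
      fix q assume q: "q \<in> klquads a b p"
      obtain x1 y1 x2 y2 x3 y3 x4 y4 where qq: "q = (((x1,y1),(x2,y2)),((x3,y3),(x4,y4)))" by (metis surj_pair)
      have U: "(x1,y1) \<in> ?U" "(x2,y2) \<in> ?U" "(x3,y3) \<in> ?U" "(x4,y4) \<in> ?U" using q by (auto simp: qq klquads_def)
      have sx: "[x1 + x2 = x3 + x4] (mod int p)" by (rule canc[of a]) (use q 4 in \<open>auto simp: qq klquads_def\<close>)
      have sy: "[y1 + y2 = y3 + y4] (mod int p)" by (rule canc[of b]) (use q 4 in \<open>auto simp: qq klquads_def\<close>)
      have u: "int p dvd x1 * y1 - 1" "int p dvd x2 * y2 - 1" "int p dvd x3 * y3 - 1" "int p dvd x4 * y4 - 1"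
        using U by (auto dest!: unit_pairsD(5) simp: cong_iff_dvd_diff)
      have dx: "int p dvd x1 + x2 - (x3 + x4)" and dy: "int p dvd y1 + y2 - (y3 + y4)" using sx sy by (auto simp: cong_iff_dvd_diff)
      \<comment> \<open>With common sum s, the sums of reciprocals are s/(x1 x2) and s/(x3 x4), so s
        = 0 or the products agree as well; in the latter case x1 is a root of (X - x3)(X - x4). The
        division is avoided by carrying explicit multiples of p.\<close>
      have key: "int p dvd (x1 + x2) * ((x1 - x3) * (x1 - x4))"
      proof -
        define s where "s = x1 + x2"
        obtain k1 where "x1 * y1 - 1 = int p * k1" using u(1) by (rule dvdE)
        hence k1: "x1 * y1 = 1 + int p * k1" by simp
        obtain k2 where "x2 * y2 - 1 = int p * k2" using u(2) by (rule dvdE)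
        hence k2: "x2 * y2 = 1 + int p * k2" by simp
        obtain k3 where "x3 * y3 - 1 = int p * k3" using u(3) by (rule dvdE)
        hence k3: "x3 * y3 = 1 + int p * k3" by simp
        obtain k4 where "x4 * y4 - 1 = int p * k4" using u(4) by (rule dvdE)
        hence k4: "x4 * y4 = 1 + int p * k4" by simp
        obtain k5 where "x1 + x2 - (x3 + x4) = int p * k5" using dx by (rule dvdE)
        hence k5: "x3 + x4 = x1 + x2 - int p * k5" by simp
        obtain k6 where "y1 + y2 - (y3 + y4) = int p * k6" using dy by (rule dvdE)
        hence k6: "y3 + y4 = y1 + y2 - int p * k6" by simp
        have A: "x1 * x2 * (y1 + y2) = s + int p * (k1 * x2 + k2 * x1)"
        proof -
          have "x1 * x2 * (y1 + y2) = (x1 * y1) * x2 + (x2 * y2) * x1" by (simp add: algebra_simps)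
          thus ?thesis unfolding k1 k2 by (simp add: s_def algebra_simps)
        qed
        have Bq: "x3 * x4 * (y3 + y4) = s + int p * (k3 * x4 + k4 * x3 - k5)"
        proof -
          have "x3 * x4 * (y3 + y4) = (x3 * y3) * x4 + (x4 * y4) * x3" by (simp add: algebra_simps)
          thus ?thesis unfolding k3 k4 using k5 by (simp add: s_def algebra_simps)
        qed
        have "x1 * x2 * (x3 * x4 * (y3 + y4)) = x3 * x4 * (x1 * x2 * (y1 + y2)) - int p * (k6 * x1 * x2 * x3 * x4)"
          unfolding k6 by (simp add: algebra_simps)
        hence "x1 * x2 * (s + int p * (k3 * x4 + k4 * x3 - k5)) = x3 * x4 * (s + int p * (k1 * x2 + k2 * x1)) - int p * (k6 * x1 * x2 * x3 * x4)"
          unfolding A Bq .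
        hence C: "s * (x3 * x4 - x1 * x2) = int p * (x1 * x2 * (k3 * x4 + k4 * x3 - k5) - x3 * x4 * (k1 * x2 + k2 * x1) + k6 * x1 * x2 * x3 * x4)"
          by (simp add: algebra_simps)
        have "(x1 - x3) * (x1 - x4) = x1 * x1 - x1 * (x3 + x4) + x3 * x4" by (simp add: algebra_simps)
        also have "\<dots> = (x3 * x4 - x1 * x2) + int p * (x1 * k5)" unfolding k5 by (simp add: algebra_simps)
        finally have f: "(x1 - x3) * (x1 - x4) = (x3 * x4 - x1 * x2) + int p * (x1 * k5)" .
        have "s * ((x1 - x3) * (x1 - x4)) = s * (x3 * x4 - x1 * x2) + int p * (s * (x1 * k5))"
          unfolding f by (simp only: distrib_left mult.left_commute)
        thus ?thesis unfolding C by (simp add: s_def)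
      qed
      hence "int p dvd x1 + x2 \<or> int p dvd x1 - x3 \<or> int p dvd x1 - x4"
        using pint by (simp add: prime_dvd_mult_iff)
      thus "q \<in> Q1 \<union> Q2 \<union> Q3"
      proof (elim disjE)
        assume d: "int p dvd x1 + x2"
        moreover have "int p dvd (x1 + x2) - (x1 + x2 - (x3 + x4))" using d dx by (rule dvd_diff)
        hence "int p dvd x3 + x4" by simp
        ultimately show ?thesis using q by (simp add: Q3_def qq cong_0_iff)
      next
        assume "int p dvd x1 - x3"
        hence c: "[x1 = x3] (mod int p)" by (simp add: cong_iff_dvd_diff)
        hence e: "(x1,y1) = (x3,y3)" using U by (intro fsteq) auto
        have "[x2 = x4] (mod int p)" using sx e by (simp add: cong_add_lcancel)
        hence "(x2,y2) = (x4,y4)" using U by (intro fsteq) auto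
        thus ?thesis using q e by (simp add: Q1_def qq)
      next
        assume "int p dvd x1 - x4"
        hence c: "[x1 = x4] (mod int p)" by (simp add: cong_iff_dvd_diff)
        hence e: "(x1,y1) = (x4,y4)" using U by (intro fsteq) auto
        have "[x2 = x3] (mod int p)" using sx e by (simp add: cong_add_lcancel add.commute[of x3])
        hence "(x2,y2) = (x3,y3)" using U by (intro fsteq) auto
        thus ?thesis using q e by (simp add: Q2_def qq)
      qed
    qed
    hence "card (klquads a b p) \<le> card (Q1 \<union> Q2 \<union> Q3)" using fin by (intro card_mono) auto
    also have "\<dots> \<le> card Q1 + card Q2 + card Q3" by (meson card_Un_le add_le_mono1 le_trans)
    also have "\<dots> \<le> 3 * p\<^sup>2" using c1 c2 c3 by simp
    finally have "real (card (klquads a b p)) \<le> real (3 * p\<^sup>2)" by (simp only: of_nat_le_iff)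
    also have "\<dots> = 3 * (real p)\<^sup>2 * 1 * 1" by simp
    also have "\<dots> \<le> 3 * (real p)\<^sup>2 * of_int (gcd a (int p)) * of_int (gcd b (int p))"
      using gge by (intro mult_mono) auto
    finally show ?thesis .
  qed
qed

lemma card_klquads_squarefree:
  "squarefree c \<Longrightarrow> real (card (klquads a b c)) \<le> 3 ^ omg c * (real c)\<^sup>2 * of_int (gcd a (int c)) * of_int (gcd b (int c))"
proof (induction c rule: squarefree_nat_induct)
  case one
  have "klquads a b 1 \<subseteq> {(((0,0),(0,0)),((0,0),(0,0)))}" by (auto simp: klquads_def unit_pairs_def)
  from card_mono[OF _ this] show ?case by simp
next
  case (mult p c)
  have p: "p > 0" using mult.hyps(1) prime_gt_0_nat by auto
  have "real (card (klquads a b (p * c))) \<le> real (card (klquads a b p)) * real (card (klquads a b c))"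
    using card_klquads_mult[OF mult.hyps(2) p mult.hyps(4), of a b] by (simp only: of_nat_le_iff flip: of_nat_mult)
  also have "\<dots> \<le> (3 * (real p)\<^sup>2 * of_int (gcd a (int p)) * of_int (gcd b (int p))) * (3 ^ omg c * (real c)\<^sup>2 * of_int (gcd a (int c)) * of_int (gcd b (int c)))"
    by (intro mult_mono card_klquads_prime mult) auto
  also have "\<dots> = 3 ^ omg (p * c) * (real (p * c))\<^sup>2 * (of_int (gcd a (int p) * gcd a (int c)) * of_int (gcd b (int p) * gcd b (int c)))"
    using mult.hyps by (simp add: omg_mult power_mult_distrib)
  also have "\<dots> \<le> 3 ^ omg (p * c) * (real (p * c))\<^sup>2 * (of_int (gcd a (int (p * c))) * of_int (gcd b (int (p * c))))"
    using gcd_mult_coprime_le[OF mult.hyps(2) p mult.hyps(4)]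
    by (intro mult_left_mono mult_mono) (simp_all only: of_int_le_iff of_int_0_le_iff zero_le_mult_iff gcd_ge_0_int zero_le_power of_nat_0_le_iff zero_le_numeral, auto)
  finally show ?case by (simp only: mult.assoc)
qed

text \<open>This is a sum over a one-parameter family of twists, while the full fourth moment has
  two parameters. As the sum is unchanged when its arguments are multiplied by w and 1/w, a unit v
  can be spread over all pairs (v w, v/w). Such a pair (\<alpha>, \<beta>) satisfies \<alpha>
  \<beta> = v^2, so it is reached at most as often as there are square roots. For each prime factor
  of c, the 12 is composed of 2 for these roots, 3 from \<open>card_klquads_squarefree\<close> and 2
  from \<open>c_le_totient\<close>.\<close>

lemma kloosterman_unit_fourth_moment:
  assumes "squarefree c"
  shows "(\<Sum>p\<in>unit_pairs c. norm (kloosterman (a * fst p) (b * fst p) c) ^ 4)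
      \<le> 12 ^ omg c * real c ^ 3 * of_int (gcd a (int c)) * of_int (gcd b (int c))"
proof -
  let ?U = "unit_pairs c" and ?R = "{0..<int c} \<times> {0..<int c}"
  have c: "c > 0" using assms by (intro Nat.gr0I) auto
  define F where "F = (\<lambda>(\<alpha>, \<beta>). norm (kloosterman (a * \<alpha>) (b * \<beta>) c) ^ 4)"
  define h :: "(int \<times> int) \<times> (int \<times> int) \<Rightarrow> int \<times> int" where "h = (\<lambda>(p, q). ((fst p * fst q) mod int c, (fst p * snd q) mod int c))"
  have "real (totient c) * (\<Sum>p\<in>?U. norm (kloosterman (a * fst p) (b * fst p) c) ^ 4)
     = (\<Sum>p\<in>?U. \<Sum>q\<in>?U. norm (kloosterman (a * fst p) (b * fst p) c) ^ 4)"
    by (simp add: card_unit_pairs[OF c] sum_distrib_left)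
  also have "\<dots> = (\<Sum>x\<in>?U \<times> ?U. F (h x))"
    unfolding sum.cartesian_product
  proof (intro sum.cong refl)
    fix x assume x: "x \<in> ?U \<times> ?U"
    obtain u u' w w' where xx: "x = ((u,u'),(w,w'))" by (metis surj_pair)
    have "kloosterman (a * ((u * w) mod int c)) (b * ((u * w') mod int c)) c = kloosterman (a * u * w) (b * u * w') c"
      unfolding kloosterman_def
    proof (intro sum.cong refl, clarify, intro ec_cong)
      fix y y'
      show "[a * (u * w mod int c) * y + b * (u * w' mod int c) * y' = a * u * w * y + b * u * w' * y'] (mod int c)"
        unfolding mult.assoc[of a] mult.assoc[of b] by (intro cong_add cong_mult[OF cong_refl])
           (simp_all add: cong_def mod_simps mult.assoc)
    qed
    also have "\<dots> = kloosterman (a * u) (b * u) c" using x by (intro kloosterman_scale) (auto simp: xx)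
    finally show "(case x of (p, q) \<Rightarrow> norm (kloosterman (a * fst p) (b * fst p) c) ^ 4) = F (h x)"
      by (simp add: F_def h_def xx)
  qed
  also have "\<dots> = (\<Sum>y\<in>?R. \<Sum>x | x \<in> ?U \<times> ?U \<and> h x = y. F (h x))"
    by (rule sum.group[symmetric]) (use c in \<open>auto simp: h_def\<close>)
  also have "\<dots> \<le> (\<Sum>y\<in>?R. 2 ^ omg c * F y)"
  proof (intro sum_mono)
    fix y assume y: "y \<in> ?R"
    obtain \<alpha> \<beta> where yy: "y = (\<alpha>, \<beta>)" by (cases y)
    let ?S = "{x. x \<in> ?U \<times> ?U \<and> h x = y}"
    have "card ?S \<le> card (sqrts (\<alpha> * \<beta>) c)"
    proof (rule card_inj_on_le[of "\<lambda>x. fst (fst x)"])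
      show "inj_on (\<lambda>x. fst (fst x)) ?S"
      proof (rule inj_onI)
        fix x x' assume xx: "x \<in> ?S" "x' \<in> ?S" "fst (fst x) = fst (fst x')"
        obtain p q where x: "x = (p,q)" by (cases x)
        obtain p' q' where x': "x' = (p',q')" by (cases x')
        have p: "p = p'" using xx inj_on_fst_unit_pairs[of c] by (auto simp: x x' dest: inj_onD)
        have "[fst p * fst q = fst p * fst q'] (mod int c)" using xx by (auto simp: x x' h_def yy p cong_def)
        moreover have "coprime (fst p) (int c)" using xx unit_pairsD(6)[of "fst p" "snd p" c] by (auto simp: x)
        ultimately have "[fst q = fst q'] (mod int c)" by (simp add: cong_mult_lcancel)
        hence "fst q = fst q'" using xx by (intro cong_range_eq) (auto simp: x x' unit_pairs_def)
        hence "q = q'" using xx inj_on_fst_unit_pairs[of c] by (auto simp: x x' dest: inj_onD)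
        thus "x = x'" by (simp add: x x' p)
      qed
      show "(\<lambda>x. fst (fst x)) ` ?S \<subseteq> sqrts (\<alpha> * \<beta>) c"
      proof (rule image_subsetI)
        fix x assume x: "x \<in> ?S"
        obtain u u' w w' where xx: "x = ((u,u'),(w,w'))" by (metis surj_pair)
        have a: "h ((u,u'),(w,w')) = y" "(u,u') \<in> ?U" "(w,w') \<in> ?U" using x by (auto simp: xx)
        have "\<alpha> = (u * w) mod int c" "\<beta> = (u * w') mod int c" using a by (auto simp: h_def yy)
        hence "[\<alpha> * \<beta> = (u * w) * (u * w')] (mod int c)" by (intro cong_mult) (simp_all add: cong_def)
        also have "(u * w) * (u * w') = (u * u) * (w * w')" by simp
        also have "[(u * u) * (w * w') = (u * u) * 1] (mod int c)" using a by (intro cong_mult[OF cong_refl]) (auto dest: unit_pairsD)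
        finally show "fst (fst x) \<in> sqrts (\<alpha> * \<beta>) c" using a by (auto simp: xx sqrts_def cong_sym_eq dest: unit_pairsD)
      qed
    qed simp
    also have "\<dots> \<le> 2 ^ omg c" by (rule card_sqrts[OF assms])
    finally have "real (card ?S) \<le> real (2 ^ omg c)" by (simp only: of_nat_le_iff)
    moreover have "(\<Sum>x\<in>?S. F (h x)) = real (card ?S) * F y" by simp
    moreover have "F y \<ge> 0" by (simp add: F_def yy)
    ultimately show "(\<Sum>x\<in>?S. F (h x)) \<le> 2 ^ omg c * F y" by (simp add: mult_right_mono)
  qed
  also have "\<dots> = 2 ^ omg c * (\<Sum>\<alpha>\<in>{0..<int c}. \<Sum>\<beta>\<in>{0..<int c}. norm (kloosterman (a * \<alpha>) (b * \<beta>) c) ^ 4)"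
    unfolding sum.cartesian_product F_def by (simp add: sum_distrib_left)
  also have "\<dots> = 2 ^ omg c * ((real c)\<^sup>2 * real (card (klquads a b c)))"
    by (simp only: kloosterman_fourth_moment[OF c])
  also have "\<dots> \<le> 2 ^ omg c * ((real c)\<^sup>2 * (3 ^ omg c * (real c)\<^sup>2 * of_int (gcd a (int c)) * of_int (gcd b (int c))))"
    by (intro mult_left_mono card_klquads_squarefree assms) auto
  also have "\<dots> = (6 ^ omg c * real c ^ 3 * of_int (gcd a (int c)) * of_int (gcd b (int c))) * real c"
    by (simp add: power2_eq_square power3_eq_cube power_mult_distrib[symmetric] mult_ac)
  also have "\<dots> \<le> (6 ^ omg c * real c ^ 3 * of_int (gcd a (int c)) * of_int (gcd b (int c))) * (2 ^ omg c * real (totient c))"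
    by (intro mult_left_mono c_le_totient assms) auto
  also have "\<dots> = real (totient c) * ((6 ^ omg c * 2 ^ omg c) * real c ^ 3 * of_int (gcd a (int c)) * of_int (gcd b (int c)))"
    by (simp add: mult_ac)
  also have "(6::real) ^ omg c * 2 ^ omg c = 12 ^ omg c" by (simp flip: power_mult_distrib)
  finally have "real (totient c) * (\<Sum>p\<in>?U. norm (kloosterman (a * fst p) (b * fst p) c) ^ 4) \<le>
     real (totient c) * (12 ^ omg c * real c ^ 3 * of_int (gcd a (int c)) * of_int (gcd b (int c)))" .
  thus ?thesis using c by (simp add: mult_le_cancel_left)
qed

section \<open>Twisted moments and completion\<close>

definition minv :: "nat \<Rightarrow> nat \<Rightarrow> int" where "minv c k = modular_inverse (int c) (int k)"

lemma minv_cong: "coprime k c \<Longrightarrow> [int k * minv c k = 1] (mod int c)"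
  unfolding minv_def by (rule cong_modular_inverse1) simp

lemma kloosterman_cong:
  assumes "[a = a'] (mod int c)" "[b = b'] (mod int c)"
  shows "kloosterman a b c = kloosterman a' b' c"
  unfolding kloosterman_def
  by (intro sum.cong refl, clarify, intro ec_cong cong_add cong_mult assms cong_refl)

lemma unit_pairs_swap: "bij_betw prod.swap (unit_pairs c) (unit_pairs c)"
  by (rule bij_betw_byWitness[of _ prod.swap]) (auto simp: unit_pairs_def mult.commute)

lemma kloosterman_commute: "kloosterman a b c = kloosterman b a c"
  unfolding kloosterman_def
  by (subst sum.reindex_bij_betw[OF unit_pairs_swap, symmetric]) (simp add: case_prod_beta add.commute)

text \<open>An outer twist by the inverse of \<open>k\<close> is included so that the splitting can
  be iterated: it merges with the inverse of the complementary modulus into a single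
  inverse.\<close>

lemma kloosterman_mult_minv:
  assumes "coprime c1 c2" "c1 > 0" "c2 > 0" "coprime k (c1 * c2)"
  shows "norm (kloosterman (a * minv (c1 * c2) k) (b * minv (c1 * c2) k) (c1 * c2)) =
     norm (kloosterman (a * minv c1 (k * c2)) (b * minv c1 (k * c2)) c1) *
     norm (kloosterman (a * minv c2 (k * c1)) (b * minv c2 (k * c1)) c2)"
proof -
  have cop: "coprime k c1" "coprime k c2" using assms(4) by (auto simp: coprime_mult_right_iff)
  have e: "[minv (c1 * c2) k * minv c1 c2 = minv c1 (k * c2)] (mod int c1)"
    "[minv (c1 * c2) k * minv c2 c1 = minv c2 (k * c1)] (mod int c2)"
  proof -
    have k: "[int k * minv (c1 * c2) k = 1] (mod int c1 * int c2)" using minv_cong[OF assms(4)] by simp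
    have "[int k * minv (c1 * c2) k = 1] (mod int c1)" "[int k * minv (c1 * c2) k = 1] (mod int c2)"
      using cong_modulus_mult[OF k] cong_modulus_mult[of _ _ "int c2" "int c1"] k by (simp_all add: mult.commute)
    hence "[(int k * minv (c1 * c2) k) * (int c2 * minv c1 c2) = 1 * 1] (mod int c1)"
      "[(int k * minv (c1 * c2) k) * (int c1 * minv c2 c1) = 1 * 1] (mod int c2)"
      using assms(1) by (intro cong_mult minv_cong; simp add: coprime_commute)+
    hence "[int (k * c2) * (minv (c1 * c2) k * minv c1 c2) = 1] (mod int c1)"
      "[int (k * c1) * (minv (c1 * c2) k * minv c2 c1) = 1] (mod int c2)" by (simp_all add: mult_ac)
    moreover have "[int (k * c2) * minv c1 (k * c2) = 1] (mod int c1)" "[int (k * c1) * minv c2 (k * c1) = 1] (mod int c2)"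
      using cop assms(1) by (intro minv_cong; simp add: coprime_commute)+
    ultimately show "[minv (c1 * c2) k * minv c1 c2 = minv c1 (k * c2)] (mod int c1)"
    "[minv (c1 * c2) k * minv c2 c1 = minv c2 (k * c1)] (mod int c2)" by (auto intro: unit_pairs_inverse_unique)
  qed
  have "kloosterman (a * minv (c1 * c2) k) (b * minv (c1 * c2) k) (c1 * c2) =
     kloosterman (a * minv (c1 * c2) k * minv c1 c2) (b * minv (c1 * c2) k * minv c1 c2) c1 *
     kloosterman (a * minv (c1 * c2) k * minv c2 c1) (b * minv (c1 * c2) k * minv c2 c1) c2"
    by (rule kloosterman_mult) (use assms in \<open>auto intro!: minv_cong simp: coprime_commute\<close>)
  also have "kloosterman (a * minv (c1 * c2) k * minv c1 c2) (b * minv (c1 * c2) k * minv c1 c2) c1 = 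
     kloosterman (a * minv c1 (k * c2)) (b * minv c1 (k * c2)) c1"
    unfolding mult.assoc[of a] mult.assoc[of b] by (intro kloosterman_cong cong_mult[OF cong_refl] e)
  also have "kloosterman (a * minv (c1 * c2) k * minv c2 c1) (b * minv (c1 * c2) k * minv c2 c1) c2 = 
     kloosterman (a * minv c2 (k * c1)) (b * minv c2 (k * c1)) c2"
    unfolding mult.assoc[of a] mult.assoc[of b] by (intro kloosterman_cong cong_mult[OF cong_refl] e)
  finally show ?thesis by (simp add: norm_mult)
qed

lemma kloosterman_minv_1: "kloosterman (a * minv c 1) (b * minv c 1) c = kloosterman a b c"
proof -
  have "[minv c 1 = 1] (mod int c)" using minv_cong[of 1 c] by simp
  hence "[a * minv c 1 = a * 1] (mod int c)" "[b * minv c 1 = b * 1] (mod int c)" by (intro cong_mult[OF cong_refl]; simp)+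
  thus ?thesis by (intro kloosterman_cong) auto
qed

text \<open>In the application \<open>d\<close> is a gcd of two moduli that stays fixed during the
  averaging, so its factor is estimated trivially. Each other factor keeps its twist by the product
  of the remaining moduli.\<close>

lemma kloosterman_factor4:
  assumes "d > 0" "\<sigma> > 0" "t1 > 0" "t2 > 0"
    "coprime d \<sigma>" "coprime d t1" "coprime d t2" "coprime \<sigma> t1" "coprime \<sigma> t2" "coprime t1 t2"
  shows "norm (kloosterman a b (d * \<sigma> * (t1 * t2))) \<le> real d *
     norm (kloosterman (a * minv \<sigma> (d * (t1 * t2))) (b * minv \<sigma> (d * (t1 * t2))) \<sigma>) *
     norm (kloosterman (a * minv t1 (d * \<sigma> * t2)) (b * minv t1 (d * \<sigma> * t2)) t1) *
     norm (kloosterman (a * minv t2 (d * \<sigma> * t1)) (b * minv t2 (d * \<sigma> * t1)) t2)"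
proof -
  have "norm (kloosterman a b (d * \<sigma> * (t1 * t2))) = norm (kloosterman (a * minv (d * \<sigma> * (t1 * t2)) 1) (b * minv (d * \<sigma> * (t1 * t2)) 1) (d * \<sigma> * (t1 * t2)))"
    by (simp only: kloosterman_minv_1)
  also have "\<dots> = norm (kloosterman (a * minv (d * \<sigma>) (t1 * t2)) (b * minv (d * \<sigma>) (t1 * t2)) (d * \<sigma>)) *
     norm (kloosterman (a * minv (t1 * t2) (d * \<sigma>)) (b * minv (t1 * t2) (d * \<sigma>)) (t1 * t2))"
    using assms by (subst kloosterman_mult_minv) auto
  also have "norm (kloosterman (a * minv (t1 * t2) (d * \<sigma>)) (b * minv (t1 * t2) (d * \<sigma>)) (t1 * t2)) = 
     norm (kloosterman (a * minv t1 (d * \<sigma> * t2)) (b * minv t1 (d * \<sigma> * t2)) t1) *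
     norm (kloosterman (a * minv t2 (d * \<sigma> * t1)) (b * minv t2 (d * \<sigma> * t1)) t2)"
    using assms by (intro kloosterman_mult_minv) auto
  also have "norm (kloosterman (a * minv (d * \<sigma>) (t1 * t2)) (b * minv (d * \<sigma>) (t1 * t2)) (d * \<sigma>)) =
     norm (kloosterman (a * minv d (t1 * t2 * \<sigma>)) (b * minv d (t1 * t2 * \<sigma>)) d) *
     norm (kloosterman (a * minv \<sigma> (t1 * t2 * d)) (b * minv \<sigma> (t1 * t2 * d)) \<sigma>)"
    using assms by (intro kloosterman_mult_minv) (auto simp: coprime_commute)
  also have "\<dots> \<le> real d * norm (kloosterman (a * minv \<sigma> (t1 * t2 * d)) (b * minv \<sigma> (t1 * t2 * d)) \<sigma>)"
    by (intro mult_right_mono kloosterman_bound) auto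
  finally show ?thesis by (simp add: mult_ac mult_right_mono)
qed

text \<open>Members of one class have equal residues, so the quotients by \<open>c\<close>
  distinguish them.\<close>

lemma card_residue_class_le:
  assumes "finite I" "inj_on f I" "\<And>i. i \<in> I \<Longrightarrow> real (f i) \<le> X" "coprime e c" "c > 0" "X \<ge> 0"
  shows "real (card {i\<in>I. [int (e * f i) = x] (mod int c)}) \<le> X / real c + 1"
proof -
  let ?A = "{i\<in>I. [int (e * f i) = x] (mod int c)}"
  define D where "D = nat \<lfloor>X / real c\<rfloor>"
  have "card ?A \<le> card {..D}"
  proof (rule card_inj_on_le[of "\<lambda>i. f i div c"])
    show "inj_on (\<lambda>i. f i div c) ?A"
    proof (rule inj_onI)
      fix i j assume ij: "i \<in> ?A" "j \<in> ?A" "f i div c = f j div c"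
      have "[int e * int (f i) = int e * int (f j)] (mod int c)" using ij by (auto intro: cong_trans cong_sym)
      hence "[int (f i) = int (f j)] (mod int c)" using assms(4) by (simp add: cong_mult_lcancel)
      hence "[f i = f j] (mod c)" by (simp only: cong_int_iff)
      hence "f i mod c = f j mod c" by (simp add: cong_def)
      hence "f i = f j" using ij(3) by (metis div_mult_mod_eq)
      thus "i = j" using ij assms(2) by (auto dest: inj_onD)
    qed
    show "(\<lambda>i. f i div c) ` ?A \<subseteq> {..D}"
    proof (rule image_subsetI)
      fix i assume i: "i \<in> ?A"
      have "real (f i div c) \<le> real (f i) / real c" by (rule of_nat_div_le_of_nat)
      also have "\<dots> \<le> X / real c" using assms i by (intro divide_right_mono) auto
      finally show "f i div c \<in> {..D}" unfolding D_def by (simp add: le_nat_iff le_floor_iff)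
    qed
  qed simp
  hence "real (card ?A) \<le> real D + 1" by simp
  also have "real D \<le> X / real c" unfolding D_def using assms(5,6) by (simp add: of_nat_nat)
  finally show ?thesis by simp
qed

text \<open>The twists \<open>e * f i\<close> are sorted into residue classes; injectivity of
  \<open>f\<close> puts at most X/c + 1 of them into each class. What remains is a fourth moment
  over all units, where the inverse of a unit may be replaced by the unit.\<close>

lemma twisted_fourth_moment:
  assumes "finite I" "inj_on f I" "\<And>i. i \<in> I \<Longrightarrow> real (f i) \<le> X" "coprime e c" "X \<ge> 0" "squarefree c"
    "\<And>i. i \<in> I \<Longrightarrow> coprime (f i) c"
  shows "(\<Sum>i\<in>I. norm (kloosterman (a * minv c (e * f i)) (b * minv c (e * f i)) c) ^ 4)
    \<le> (X / real c + 1) * (12 ^ omg c * real c ^ 3 * of_int (gcd a (int c)) * of_int (gcd b (int c)))"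
proof -
  let ?U = "unit_pairs c"
  have c: "c > 0" using assms(6) by (intro Nat.gr0I) auto
  define G where "G x = norm (kloosterman (a * x) (b * x) c) ^ 4" for x
  define h where "h i = (int (e * f i) mod int c, minv c (e * f i) mod int c)" for i
  have cop: "coprime (e * f i) c" if "i \<in> I" for i using assms(4,7) that by simp
  have hU: "h i \<in> ?U" if "i \<in> I" for i unfolding h_def by (intro unit_pairsI c minv_cong cop that)
  have "(\<Sum>i\<in>I. norm (kloosterman (a * minv c (e * f i)) (b * minv c (e * f i)) c) ^ 4) = (\<Sum>i\<in>I. G (snd (h i)))"
  proof (intro sum.cong refl)
    fix i assume "i \<in> I"
    have "kloosterman (a * minv c (e * f i)) (b * minv c (e * f i)) c = kloosterman (a * snd (h i)) (b * snd (h i)) c"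
      by (intro kloosterman_cong cong_mult[OF cong_refl]) (simp_all add: h_def cong_def)
    thus "norm (kloosterman (a * minv c (e * f i)) (b * minv c (e * f i)) c) ^ 4 = G (snd (h i))" by (simp add: G_def)
  qed
  also have "\<dots> = (\<Sum>p\<in>?U. \<Sum>i | i \<in> I \<and> h i = p. G (snd (h i)))"
    by (rule sum.group[symmetric]) (use assms hU in auto)
  also have "\<dots> \<le> (\<Sum>p\<in>?U. (X / real c + 1) * G (snd p))"
  proof (intro sum_mono)
    fix p assume "p \<in> ?U"
    have "(\<Sum>i | i \<in> I \<and> h i = p. G (snd (h i))) = real (card {i. i \<in> I \<and> h i = p}) * G (snd p)" by simp
    also have "\<dots> \<le> (X / real c + 1) * G (snd p)"
    proof (rule mult_right_mono)
      have "card {i. i \<in> I \<and> h i = p} \<le> card {i\<in>I. [int (e * f i) = fst p] (mod int c)}"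
        using assms(1) by (intro card_mono) (auto simp: h_def cong_def)
      also have "real \<dots> \<le> X / real c + 1" by (rule card_residue_class_le[OF assms(1-4) c assms(5)])
      finally show "real (card {i. i \<in> I \<and> h i = p}) \<le> X / real c + 1" by simp
    qed (simp add: G_def)
    finally show "(\<Sum>i | i \<in> I \<and> h i = p. G (snd (h i))) \<le> (X / real c + 1) * G (snd p)" .
  qed
  also have "\<dots> = (X / real c + 1) * (\<Sum>p\<in>?U. G (snd p))" by (simp add: sum_distrib_left)
  also have "(\<Sum>p\<in>?U. G (snd p)) = (\<Sum>p\<in>?U. G (fst p))"
    by (subst sum.reindex_bij_betw[OF unit_pairs_swap, symmetric]) simp
  also have "(X / real c + 1) * (\<Sum>p\<in>?U. G (fst p)) \<le> (X / real c + 1) * (12 ^ omg c * real c ^ 3 * of_int (gcd a (int c)) * of_int (gcd b (int c)))"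
    using kloosterman_unit_fourth_moment[OF assms(6), of a b] assms(5) by (intro mult_left_mono) (auto simp: G_def)
  finally show ?thesis .
qed

text \<open>The congruence between v and a unit is detected by additive characters. Frequency 0
  leaves a Ramanujan sum, and the geometric sum over v at frequency y is at most c/(2y) + c/(2(c -
  y)). The range of y is extended to a bound \<open>C\<close> independent of \<open>c\<close>, so
  that the sum over y can later be exchanged with a sum over moduli.\<close>

lemma kloosterman_completion:
  assumes "c > 0" "c \<le> C"
  shows "norm (\<Sum>v\<in>{v\<in>{1..V}. coprime v c}. ec c (b * minv c v)) \<le>
     real V / real c * norm (kloosterman b 0 c) + 
     (\<Sum>y\<in>{1..C}. 1 / (2 * real y) * (norm (kloosterman b (int y) c) + norm (kloosterman b (- int y) c)))"
proof -
  let ?U = "unit_pairs c" and ?R = "{0..<int c}"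
  define D where "D y = (\<Sum>v\<in>{1..V}. ec c (- (y * int v)))" for y
  have "(\<Sum>y\<in>?R. D y * kloosterman b y c) = of_nat c * (\<Sum>v\<in>{v\<in>{1..V}. coprime v c}. ec c (b * minv c v))"
  proof -
    have K: "kloosterman b y c = (\<Sum>p\<in>?U. ec c (y * fst p + b * snd p))" for y
      by (subst kloosterman_commute) (simp add: kloosterman_def case_prod_beta)
    have "(\<Sum>y\<in>?R. D y * kloosterman b y c) = (\<Sum>y\<in>?R. \<Sum>v\<in>{1..V}. \<Sum>p\<in>?U. ec c (b * snd p) * ec c (y * (fst p - int v)))"
      unfolding D_def K sum_product
      by (intro sum.cong refl) (auto simp: algebra_simps simp flip: ec_add)
    also have "\<dots> = (\<Sum>v\<in>{1..V}. \<Sum>y\<in>?R. \<Sum>p\<in>?U. ec c (b * snd p) * ec c (y * (fst p - int v)))" by (rule sum.swap)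
    also have "\<dots> = (\<Sum>v\<in>{1..V}. \<Sum>p\<in>?U. \<Sum>y\<in>?R. ec c (b * snd p) * ec c (y * (fst p - int v)))" by (intro sum.cong refl sum.swap)
    also have "\<dots> = (\<Sum>v\<in>{1..V}. \<Sum>p\<in>?U. if int c dvd fst p - int v then of_nat c * ec c (b * snd p) else 0)"
      by (intro sum.cong refl) (simp add: ec_sum[OF assms(1)] flip: sum_distrib_left)
    also have "\<dots> = (\<Sum>v\<in>{1..V}. if coprime v c then of_nat c * ec c (b * minv c v) else 0)"
    proof (intro sum.cong refl)
      fix v
      show "(\<Sum>p\<in>?U. if int c dvd fst p - int v then of_nat c * ec c (b * snd p) else 0) = (if coprime v c then of_nat c * ec c (b * minv c v) else 0)"
      proof (cases "coprime v c")
        case True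
        define p0 where "p0 = (int v mod int c, minv c v mod int c)"
        have p0: "p0 \<in> ?U" unfolding p0_def by (intro unit_pairsI assms minv_cong True)
        have iff: "int c dvd fst p - int v \<longleftrightarrow> p = p0" if "p \<in> ?U" for p
        proof
          assume "int c dvd fst p - int v"
          hence "[fst p = fst p0] (mod int c)" by (simp add: p0_def cong_iff_dvd_diff[symmetric] cong_def)
          hence "fst p = fst p0" using that p0 by (intro cong_range_eq) (auto simp: unit_pairs_def)
          thus "p = p0" using that p0 inj_on_fst_unit_pairs by (auto dest: inj_onD)
        next
          assume "p = p0" thus "int c dvd fst p - int v" by (simp add: p0_def cong_iff_dvd_diff[symmetric] cong_def)
        qed
        have "(\<Sum>p\<in>?U. if int c dvd fst p - int v then of_nat c * ec c (b * snd p) else 0) = (\<Sum>p\<in>?U. if p = p0 then of_nat c * ec c (b * snd p0) else 0)"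
          by (intro sum.cong refl) (use iff in auto)
        also have "\<dots> = of_nat c * ec c (b * snd p0)" using p0 by simp
        also have "ec c (b * snd p0) = ec c (b * minv c v)"
          by (intro ec_cong cong_mult[OF cong_refl]) (simp add: p0_def cong_def)
        finally show ?thesis using True by simp
      next
        case False
        have "\<not> int c dvd fst p - int v" if "p \<in> ?U" for p
        proof
          assume "int c dvd fst p - int v"
          hence "[fst p = int v] (mod int c)" by (simp add: cong_iff_dvd_diff)
          moreover have "coprime (fst p) (int c)" using that unit_pairsD(6)[of "fst p" "snd p" c] by simp
          ultimately have "coprime (int v) (int c)" using cong_imp_coprime by blast
          thus False using False by simp
        qed
        thus ?thesis using False by simp
      qed
    qed
    also have "\<dots> = (\<Sum>v\<in>{v\<in>{1..V}. coprime v c}. of_nat c * ec c (b * minv c v))"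
      by (rule sum.inter_filter[symmetric]) simp
    finally show ?thesis by (simp add: sum_distrib_left)
  qed
  hence "norm (\<Sum>v\<in>{v\<in>{1..V}. coprime v c}. ec c (b * minv c v)) = norm (\<Sum>y\<in>?R. D y * kloosterman b y c) / real c"
    using assms by (simp add: norm_mult)
  also have "\<dots> \<le> (\<Sum>y\<in>?R. norm (D y) * norm (kloosterman b y c)) / real c"
    by (intro divide_right_mono sum_norm_le) (auto simp: norm_mult)
  also have "(\<Sum>y\<in>?R. norm (D y) * norm (kloosterman b y c)) = norm (D 0) * norm (kloosterman b 0 c) + (\<Sum>y\<in>?R - {0}. norm (D y) * norm (kloosterman b y c))"
    using assms by (intro sum.remove) auto
  also have "D 0 = of_nat V" by (simp add: D_def)
  also have "(\<Sum>y\<in>?R - {0}. norm (D y) * norm (kloosterman b y c)) = (\<Sum>y\<in>{1..<c}. norm (D (int y)) * norm (kloosterman b (int y) c))"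
    by (rule sum.reindex_bij_witness[of _ int nat]) auto
  also have "\<dots> \<le> (\<Sum>y\<in>{1..<c}. real c * (1 / (2 * real y) + 1 / (2 * real (c - y))) * norm (kloosterman b (int y) c))"
  proof (intro sum_mono mult_right_mono)
    fix y assume y: "y \<in> {1..<c}"
    define x where "x = - (real y / real c)"
    have D: "D (int y) = (\<Sum>v\<in>{1..V}. ee (real v * x))" by (simp add: D_def ec_def x_def mult.commute)
    have lb: "dn x \<ge> min (real y) (real (c - y)) / real c"
    proof -
      obtain n where n: "dn x = \<bar>x - of_int n\<bar>" by (rule dn_obtain)
      have "x - of_int n = - (of_int (int y + n * int c) / real c)" using assms by (simp add: x_def field_simps)
      hence n': "dn x = \<bar>real_of_int (int y + n * int c)\<bar> / real c" unfolding n by simp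
      have "int y \<le> \<bar>int y + n * int c\<bar> \<or> int (c - y) \<le> \<bar>int y + n * int c\<bar>"
      proof (cases "n \<ge> 0")
        case True thus ?thesis by simp
      next
        case False
        hence "n * int c \<le> (-1) * int c" by (intro mult_right_mono) auto
        thus ?thesis using y by auto
      qed
      hence "min (real y) (real (c - y)) \<le> \<bar>real_of_int (int y + n * int c)\<bar>" by linarith
      thus ?thesis unfolding n' by (intro divide_right_mono) auto
    qed
    have mpos: "min (real y) (real (c - y)) > 0" using y by auto
    hence "0 < min (real y) (real (c - y)) / real c" using assms by auto
    hence "norm (D (int y)) \<le> 1 / (2 * dn x)" unfolding D using lb by (intro geometric_ee_bound1) linarith
    also have "\<dots> \<le> 1 / (2 * (min (real y) (real (c - y)) / real c))"
    proof -
      define w where "w = min (real y) (real (c - y)) / real c"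
      have "0 < w" "w \<le> dn x" using lb \<open>0 < min (real y) (real (c - y)) / real c\<close> by (simp_all only: w_def)
      hence "1 / (2 * dn x) \<le> 1 / (2 * w)" by (intro divide_left_mono mult_pos_pos) auto
      thus ?thesis by (simp only: w_def)
    qed
    also have "\<dots> = real c * (1 / (2 * min (real y) (real (c - y))))" by simp
    also have "\<dots> \<le> real c * (1 / (2 * real y) + 1 / (2 * real (c - y)))"
      by (intro mult_left_mono) (auto simp: min_def)
    finally show "norm (D (int y)) \<le> real c * (1 / (2 * real y) + 1 / (2 * real (c - y)))" .
  qed auto
  also have "\<dots> = real c * ((\<Sum>y\<in>{1..<c}. 1 / (2 * real y) * norm (kloosterman b (int y) c)) + (\<Sum>y\<in>{1..<c}. 1 / (2 * real (c - y)) * norm (kloosterman b (int y) c)))"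
    by (simp add: sum_distrib_left algebra_simps flip: sum.distrib)
  \<comment> \<open>Frequency c - y is the same as -y, so this half becomes the negative
    frequencies.\<close>
  also have "(\<Sum>y\<in>{1..<c}. 1 / (2 * real (c - y)) * norm (kloosterman b (int y) c)) = (\<Sum>y\<in>{1..<c}. 1 / (2 * real y) * norm (kloosterman b (- int y) c))"
  proof (rule sum.reindex_bij_witness[of _ "\<lambda>y. c - y" "\<lambda>y. c - y"])
    fix y assume y: "y \<in> {1..<c}"
    have "kloosterman b (- int (c - y)) c = kloosterman b (int y) c" using y by (intro kloosterman_cong) (auto simp: cong_iff_dvd_diff of_nat_diff)
    thus "1 / (2 * real (c - y)) * norm (kloosterman b (- int (c - y)) c) = 1 / (2 * real (c - y)) * norm (kloosterman b (int y) c)" by simp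
  qed auto
  also have "(\<Sum>y\<in>{1..<c}. 1 / (2 * real y) * norm (kloosterman b (int y) c)) + (\<Sum>y\<in>{1..<c}. 1 / (2 * real y) * norm (kloosterman b (- int y) c))
     \<le> (\<Sum>y\<in>{1..C}. 1 / (2 * real y) * (norm (kloosterman b (int y) c) + norm (kloosterman b (- int y) c)))"
  proof -
    have "(\<Sum>y\<in>{1..<c}. 1 / (2 * real y) * norm (kloosterman b (int y) c)) + (\<Sum>y\<in>{1..<c}. 1 / (2 * real y) * norm (kloosterman b (- int y) c))
      = (\<Sum>y\<in>{1..<c}. 1 / (2 * real y) * (norm (kloosterman b (int y) c) + norm (kloosterman b (- int y) c)))"
      by (simp add: algebra_simps flip: sum.distrib)
    also have "\<dots> \<le> (\<Sum>y\<in>{1..C}. 1 / (2 * real y) * (norm (kloosterman b (int y) c) + norm (kloosterman b (- int y) c)))"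
      using assms by (intro sum_mono2) auto
    finally show ?thesis .
  qed
  finally show ?thesis using assms by (simp add: add_divide_distrib divide_right_mono mult_left_mono)
qed

section \<open>Averages of Kloosterman sums over factorable moduli\<close>

definition sfp :: "nat set \<Rightarrow> nat \<Rightarrow> bool" where
  "sfp P d \<longleftrightarrow> squarefree d \<and> prime_factors d \<subseteq> P"

lemma sfp_pos: "sfp P d \<Longrightarrow> d > 0"
  by (auto simp: sfp_def intro!: Nat.gr0I)

lemma sfp_dvd: "sfp P c \<Longrightarrow> d dvd c \<Longrightarrow> sfp P d"
proof -
  assume a: "sfp P c" "d dvd c"
  have "squarefree d" using a unfolding sfp_def squarefree_def by (meson dvd_trans)
  moreover have "prime_factors d \<subseteq> prime_factors c" using a sfp_pos[OF a(1)] by (intro dvd_prime_factors) auto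
  ultimately show ?thesis using a by (auto simp: sfp_def)
qed

lemma gcd_mult_dvd_mult_gcd:
  fixes b x y :: int
  shows "gcd b (x * y) dvd gcd b x * gcd b y"
proof -
  let ?g = "gcd b (x * y)"
  have "?g dvd x * b" by (rule dvd_mult) simp
  hence "?g dvd gcd (x * b) (x * y)" by (rule gcd_greatest) simp
  hence "?g dvd \<bar>x\<bar> * gcd b y" by (simp only: gcd_mult_distrib_int)
  hence "?g dvd \<bar>x * gcd b y\<bar>" by (simp only: abs_mult abs_gcd_int)
  hence 1: "?g dvd gcd b y * x" by (simp only: dvd_abs_iff mult.commute)
  have "?g dvd gcd b y * b" by (rule dvd_mult) simp
  hence "?g dvd gcd (gcd b y * b) (gcd b y * x)" using 1 by (rule gcd_greatest)
  also have "\<dots> = \<bar>gcd b y\<bar> * gcd b x" by (simp only: gcd_mult_distrib_int)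
  finally show ?thesis by (simp only: abs_gcd_int mult.commute)
qed

text \<open>The inequality of arithmetic and geometric means for A/sqrt \<sigma>, B/sqrt \<tau>,
  C/sqrt \<tau> and 1. Each factor is measured against its expected square-root size, and it appears
  to the fourth power because fourth moments are what can be averaged.\<close>

lemma product3_le:
  fixes A B C \<sigma> \<tau> :: real
  assumes "A \<ge> 0" "B \<ge> 0" "C \<ge> 0" "\<sigma> > 0" "\<tau> > 0"
  shows "A * B * C \<le> sqrt \<sigma> * \<tau> * (A ^ 4 / \<sigma>\<^sup>2 + B ^ 4 / \<tau>\<^sup>2 + C ^ 4 / \<tau>\<^sup>2 + 1)"
proof -
  define x y z where "x = A / sqrt \<sigma>" and "y = B / sqrt \<tau>" and "z = C / sqrt \<tau>"
  have p4: "sqrt s ^ 4 = s\<^sup>2" if "s > 0" for s :: real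
  proof -
    have "sqrt s ^ 4 = ((sqrt s)\<^sup>2)\<^sup>2" by (simp flip: power_mult)
    thus ?thesis using that by simp
  qed
  have xyz: "x \<ge> 0" "y \<ge> 0" "z \<ge> 0" using assms by (simp_all add: x_def y_def z_def)
  have "x * y * z \<le> ((x*y)\<^sup>2 + z\<^sup>2) / 2" using sum_squares_bound[of "x*y" z] by simp
  also have "\<dots> \<le> ((x^4 + y^4)/2 + (z^4 + 1)/2) / 2"
  proof -
    have "(x*y)\<^sup>2 \<le> (x^4 + y^4)/2" using sum_squares_bound[of "x\<^sup>2" "y\<^sup>2"] by (simp add: power_mult_distrib)
    moreover have "z\<^sup>2 \<le> (z^4 + 1)/2" using sum_squares_bound[of "z\<^sup>2" 1] by simp
    ultimately show ?thesis by (simp only: divide_right_mono add_mono)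
  qed
  also have "\<dots> \<le> x^4 + y^4 + z^4 + 1"
  proof -
    have "((a + b)/2 + (c + 1)/2) / 2 \<le> a + b + c + 1" if "0 \<le> a" "0 \<le> b" "0 \<le> c" for a b c :: real
    proof -
      have "((a + b)/2 + (c + 1)/2) / 2 = (a + b + c + 1) / 4" by (simp add: field_simps)
      also have "\<dots> \<le> a + b + c + 1" using that by (simp add: field_simps)
      finally show ?thesis .
    qed
    thus ?thesis using xyz by (simp only: zero_le_power)
  qed
  finally have "x * y * z \<le> x^4 + y^4 + z^4 + 1" .
  hence "(sqrt \<sigma> * \<tau>) * (x * y * z) \<le> (sqrt \<sigma> * \<tau>) * (x^4 + y^4 + z^4 + 1)"
    using assms by (intro mult_left_mono) auto
  also have "(sqrt \<sigma> * \<tau>) * (x * y * z) = A * B * C"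
  proof -
    have "\<tau> = sqrt \<tau> * sqrt \<tau>" using assms by simp
    hence "(sqrt \<sigma> * \<tau>) * (x * y * z) = (sqrt \<sigma> * x) * (sqrt \<tau> * y) * (sqrt \<tau> * z)" by (metis mult.assoc mult.commute)
    thus ?thesis using assms by (simp add: x_def y_def z_def)
  qed
  finally show ?thesis using assms by (simp add: x_def y_def z_def power_divide p4)
qed

text \<open>Here \<open>u\<close> plays the role of an \<open>x^o(1)\<close> that absorbs divisor functions. Counting only divisors composed
  of primes from \<open>P\<close>, which will be large, is what makes a fixed power of a logarithm sufficient for smoothness.\<close>

locale divisor_bounded =
  fixes P :: "nat set" and u Bd :: real
  assumes u_ge_1: "u \<ge> 1"
    and div_bound: "\<And>b::nat. b > 0 \<Longrightarrow> real b \<le> Bd \<Longrightarrow> real (card {d. d dvd b \<and> sfp P d}) \<le> u"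
    and omg_bound: "\<And>c. sfp P c \<Longrightarrow> real c \<le> Bd \<Longrightarrow> 12 ^ omg c \<le> u"
    and harm_bound: "\<And>n::nat. real n \<le> Bd \<Longrightarrow> (\<Sum>k\<in>{1..n}. 1 / real k) \<le> u"
begin

text \<open>Group by the value f of the gcd: it is a divisor of \<open>b\<close> composed of primes
  from \<open>P\<close>, so at most \<open>u\<close> values occur, and the sparsity of the multiples
  of f, expressed by the last hypothesis, compensates the factor f.\<close>

lemma gcd_weighted_sum:
  fixes t :: "'i \<Rightarrow> nat"
  assumes "finite I" "\<And>i. i \<in> I \<Longrightarrow> sfp P (t i)" "b \<noteq> 0" "real_of_int \<bar>b\<bar> \<le> Bd"
    "\<And>i. i \<in> I \<Longrightarrow> w i \<ge> 0" "\<And>f. f > 0 \<Longrightarrow> (\<Sum>i\<in>{i\<in>I. f dvd t i}. real f * w i) \<le> X"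
  shows "(\<Sum>i\<in>I. of_int (gcd b (int (t i))) * w i) \<le> u * X"
proof -
  define F where "F = {d. d dvd nat \<bar>b\<bar> \<and> sfp P d}"
  define g where "g i = gcd (nat \<bar>b\<bar>) (t i)" for i
  have F: "real (card F) \<le> u" unfolding F_def using assms(3,4) by (intro div_bound) auto
  have finF: "finite F" unfolding F_def using assms(3) by (intro finite_subset[OF _ finite_divisors_nat[of "nat \<bar>b\<bar>"]]) auto
  have gF: "g i \<in> F" if "i \<in> I" for i unfolding F_def g_def using sfp_dvd[OF assms(2)[OF that], of "gcd (nat \<bar>b\<bar>) (t i)"]
    by (simp only: mem_Collect_eq gcd_dvd1 gcd_dvd2 simp_thms)
  have gdvd: "g i dvd t i" for i by (simp only: g_def gcd_dvd2)
  have geq: "gcd b (int (t i)) = int (g i)" for i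
    by (simp add: g_def gcd_int_int_eq[symmetric] del: gcd_int_int_eq)
  have "(\<Sum>i\<in>I. of_int (gcd b (int (t i))) * w i) = (\<Sum>i\<in>I. real (g i) * w i)" by (simp add: geq)
  also have "\<dots> = (\<Sum>f\<in>F. \<Sum>i | i \<in> I \<and> g i = f. real (g i) * w i)"
    by (rule sum.group[symmetric]) (use assms finF gF in auto)
  also have "\<dots> \<le> (\<Sum>f\<in>F. X)"
  proof (intro sum_mono)
    fix f assume f: "f \<in> F"
    have "(\<Sum>i | i \<in> I \<and> g i = f. real (g i) * w i) = (\<Sum>i | i \<in> I \<and> g i = f. real f * w i)" by (intro sum.cong) auto
    also have "\<dots> \<le> (\<Sum>i\<in>{i\<in>I. f dvd t i}. real f * w i)"
      using assms(1,5) gdvd by (intro sum_mono2) auto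
    also have "\<dots> \<le> X" using f sfp_pos by (intro assms(6)) (auto simp: F_def)
    finally show "(\<Sum>i | i \<in> I \<and> g i = f. real (g i) * w i) \<le> X" .
  qed
  also have "\<dots> = real (card F) * X" by simp
  also have "\<dots> \<le> u * X"
  proof (rule mult_right_mono[OF F])
    have "0 \<le> (\<Sum>i\<in>{i\<in>I. 1 dvd t i}. real 1 * w i)" using assms(5) by (intro sum_nonneg) auto
    also have "\<dots> \<le> X" by (rule assms(6)) simp
    finally show "0 \<le> X" .
  qed
  finally show ?thesis .
qed

lemma gcd_sum:
  assumes "finite T" "\<And>t. t \<in> T \<Longrightarrow> sfp P t" "\<And>t. t \<in> T \<Longrightarrow> real t \<le> \<tau>" "b \<noteq> 0" "real_of_int \<bar>b\<bar> \<le> Bd" "\<tau> \<ge> 0"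
  shows "(\<Sum>t\<in>T. of_int (gcd b (int t))) \<le> u * \<tau>"
proof -
  have "(\<Sum>t\<in>T. of_int (gcd b (int t)) * 1) \<le> u * \<tau>"
  proof (rule gcd_weighted_sum)
    fix f :: nat assume f: "f > 0"
    let ?A = "{t\<in>T. f dvd t}"
    have "card ?A \<le> card {1..nat \<lfloor>\<tau> / real f\<rfloor>}"
    proof (rule card_inj_on_le[of "\<lambda>t. t div f"])
      show "inj_on (\<lambda>t. t div f) ?A" by (rule inj_onI) (auto simp: f elim!: dvdE)
      show "(\<lambda>t. t div f) ` ?A \<subseteq> {1..nat \<lfloor>\<tau> / real f\<rfloor>}"
      proof (rule image_subsetI)
        fix t assume t: "t \<in> ?A"
        then obtain k where k: "t = f * k" by auto
        have "k > 0" using sfp_pos[OF assms(2), of t] t k by (auto intro!: Nat.gr0I)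
        moreover have "real k \<le> \<tau> / real f" using assms(3)[of t] t k f by (simp add: field_simps)
        ultimately show "t div f \<in> {1..nat \<lfloor>\<tau> / real f\<rfloor>}" using f k by (simp add: le_nat_iff le_floor_iff)
      qed
    qed simp
    hence "real (card ?A) \<le> real (nat \<lfloor>\<tau> / real f\<rfloor>)" by simp
    also have "\<dots> \<le> \<tau> / real f" using assms(6) by (simp add: of_nat_nat)
    finally show "(\<Sum>i\<in>?A. real f * 1) \<le> \<tau>" using f by (simp add: field_simps)
  qed (use assms in auto)
  thus ?thesis by simp
qed

text \<open>The quotients by \<open>f\<close> are distinct positive integers, so a harmonic sum
  dominates.\<close>

lemma reciprocal_multiples_sum:
  assumes "finite I" "inj_on t I" "\<And>i. i \<in> I \<Longrightarrow> t i > 0" "\<And>i. i \<in> I \<Longrightarrow> real (t i) \<le> Bd" "f > 0"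
  shows "(\<Sum>i\<in>{i\<in>I. f dvd t i}. real f * (1 / real (t i))) \<le> u"
proof (cases "I = {}")
  case True thus ?thesis using u_ge_1 by simp
next
  case False
  then obtain i0 where "i0 \<in> I" by blast
  hence Bd: "Bd \<ge> 0" using assms(4)[of i0] by linarith
  let ?A = "{i\<in>I. f dvd t i}"
  have "(\<Sum>i\<in>?A. real f * (1 / real (t i))) = (\<Sum>i\<in>?A. 1 / real (t i div f))"
  proof (intro sum.cong refl)
    fix i assume "i \<in> ?A"
    then obtain k where "t i = f * k" by auto
    thus "real f * (1 / real (t i)) = 1 / real (t i div f)" using assms(5) by simp
  qed
  also have "\<dots> = (\<Sum>n\<in>(\<lambda>i. t i div f) ` ?A. 1 / real n)"
  proof (subst sum.reindex)
    show "inj_on (\<lambda>i. t i div f) ?A"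
    proof (rule inj_onI)
      fix i j assume "i \<in> ?A" "j \<in> ?A" "t i div f = t j div f"
      hence "t i = t j" by (metis (lifting) dvd_div_mult_self mem_Collect_eq)
      thus "i = j" using \<open>i \<in> ?A\<close> \<open>j \<in> ?A\<close> assms(2) by (auto dest: inj_onD)
    qed
  qed simp
  also have "\<dots> \<le> (\<Sum>n\<in>{1..nat \<lfloor>Bd\<rfloor>}. 1 / real n)"
  proof (intro sum_mono2)
    show "(\<lambda>i. t i div f) ` ?A \<subseteq> {1..nat \<lfloor>Bd\<rfloor>}"
    proof (rule image_subsetI)
      fix i assume i: "i \<in> ?A"
      have "t i div f > 0" using i assms(3,5) by (auto simp: div_greater_zero_iff dvd_imp_le)
      moreover have "real (t i div f) \<le> real (t i)" by (simp only: of_nat_le_iff div_le_dividend)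
      hence "real (t i div f) \<le> Bd" using assms(4)[of i] i order_trans by blast
      ultimately show "t i div f \<in> {1..nat \<lfloor>Bd\<rfloor>}" by (simp add: le_nat_iff le_floor_iff)
    qed
  qed auto
  also have "\<dots> \<le> u" using Bd by (intro harm_bound) (simp add: of_nat_nat)
  finally show ?thesis .
qed

lemma gcd_reciprocal_sum:
  assumes "finite I" "inj_on t I" "\<And>i. i \<in> I \<Longrightarrow> sfp P (t i)" "\<And>i. i \<in> I \<Longrightarrow> real (t i) \<le> Bd" 
    "b \<noteq> 0" "real_of_int \<bar>b\<bar> \<le> Bd"
  shows "(\<Sum>i\<in>I. of_int (gcd b (int (t i))) / real (t i)) \<le> u\<^sup>2"
proof -
  have "(\<Sum>i\<in>I. of_int (gcd b (int (t i))) * (1 / real (t i))) \<le> u * u"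
    by (rule gcd_weighted_sum[OF assms(1,3,5,6)])
       (auto intro!: reciprocal_multiples_sum[simplified] assms sfp_pos[OF assms(3)])
  thus ?thesis by (simp add: power2_eq_square)
qed

text \<open>The roles are exchanged: the modulus is fixed and the argument y varies. Grouped by
  divisors of \<open>c\<close>, each group is a harmonic sum.\<close>

lemma gcd_frequency_sum:
  fixes \<epsilon> :: int
  assumes "sfp P c" "real c \<le> Bd" "real C \<le> Bd" "\<epsilon> = 1 \<or> \<epsilon> = -1"
  shows "(\<Sum>y\<in>{1..C}. 1 / (2 * real y) * of_int (gcd (\<epsilon> * int y) (int c))) \<le> u\<^sup>2"
proof -
  define F where "F = {d. d dvd c}"
  have c: "c > 0" using sfp_pos[OF assms(1)] .
  have "F = {d. d dvd c \<and> sfp P d}" unfolding F_def using sfp_dvd[OF assms(1)] by auto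
  hence F: "real (card F) \<le> u" using div_bound[OF c assms(2)] by simp
  have finF: "finite F" unfolding F_def using c by (intro finite_divisors_nat)
  have e: "gcd (\<epsilon> * int y) (int c) = int (gcd y c)" for y using assms(4) by (auto simp: gcd_int_int_eq[symmetric] simp del: gcd_int_int_eq)
  have "(\<Sum>y\<in>{1..C}. 1 / (2 * real y) * of_int (gcd (\<epsilon> * int y) (int c))) \<le> (\<Sum>y\<in>{1..C}. real (gcd y c) * (1 / real y))"
  proof (intro sum_mono)
    fix y assume "y \<in> {1..C}"
    thus "1 / (2 * real y) * of_int (gcd (\<epsilon> * int y) (int c)) \<le> real (gcd y c) * (1 / real y)"
      unfolding e by (simp add: field_simps)
  qed
  also have "\<dots> = (\<Sum>f\<in>F. \<Sum>y | y \<in> {1..C} \<and> gcd y c = f. real (gcd y c) * (1 / real y))"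
    by (rule sum.group[symmetric]) (use finF in \<open>auto simp: F_def\<close>)
  also have "\<dots> \<le> (\<Sum>f\<in>F. u)"
  proof (intro sum_mono)
    fix f assume f: "f \<in> F"
    have "(\<Sum>y | y \<in> {1..C} \<and> gcd y c = f. real (gcd y c) * (1 / real y)) = (\<Sum>y | y \<in> {1..C} \<and> gcd y c = f. real f * (1 / real y))" by (intro sum.cong) auto
    also have "\<dots> \<le> (\<Sum>y\<in>{y\<in>{1..C}. f dvd y}. real f * (1 / real y))"
      by (intro sum_mono2) auto
    also have "\<dots> \<le> u" by (rule reciprocal_multiples_sum) (use assms(3) f c in \<open>auto simp: F_def intro!: Nat.gr0I\<close>)
    finally show "(\<Sum>y | y \<in> {1..C} \<and> gcd y c = f. real (gcd y c) * (1 / real y)) \<le> u" .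
  qed
  also have "\<dots> \<le> u * u" using F u_ge_1 by (simp add: mult_right_mono)
  finally show ?thesis by (simp add: power2_eq_square)
qed

text \<open>Each of the three factors is averaged over its twists by the others: \<sigma> over the
  products t1 t2, then t1 over t2, and t2 over t1. The ranges of the twists are at least as long as
  the moduli, since \<sigma> \<le> \<tau>^2 and t \<le> \<tau>, so the fourth moments give the
  square-root size sqrt \<sigma> * \<tau> on average over at most \<tau>^2 moduli. The sign
  \<epsilon> serves the positive and the negative frequencies of the completion.\<close>

lemma kloosterman_average_one_sign:
  fixes \<epsilon> :: int
  assumes fin: "finite T1" "finite T2"
    and sf: "\<And>t. t \<in> T1 \<Longrightarrow> sfp P t" "\<And>t. t \<in> T2 \<Longrightarrow> sfp P t" "sfp P \<sigma>" "d > 0"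
    and le: "\<And>t. t \<in> T1 \<Longrightarrow> real t \<le> \<tau>" "\<And>t. t \<in> T2 \<Longrightarrow> real t \<le> \<tau>" "real \<sigma> \<le> \<tau>\<^sup>2" "\<tau> \<ge> 1"
    and le2: "real \<sigma> \<le> Bd" "\<tau> \<le> Bd"
    and cop: "coprime d \<sigma>" "\<And>t. t \<in> T1 \<union> T2 \<Longrightarrow> coprime d t" "\<And>t. t \<in> T1 \<union> T2 \<Longrightarrow> coprime \<sigma> t"
       "\<And>t1 t2. t1 \<in> T1 \<Longrightarrow> t2 \<in> T2 \<Longrightarrow> coprime t1 t2"
    and inj: "inj_on (\<lambda>(t1,t2). t1 * t2) (T1 \<times> T2)"
    and b: "b \<noteq> 0" "real_of_int \<bar>b\<bar> \<le> Bd" and \<epsilon>: "\<epsilon> = 1 \<or> \<epsilon> = -1" and C: "real C \<le> Bd"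
  shows "(\<Sum>(t1,t2)\<in>T1\<times>T2. \<Sum>y\<in>{1..C}. 1 / (2 * real y) * norm (kloosterman b (\<epsilon> * int y) (d * \<sigma> * (t1 * t2))))
     \<le> 7 * u ^ 4 * real d * sqrt (real \<sigma>) * \<tau> ^ 3 * of_int (gcd b (int \<sigma>))"
proof -
  define g where "g = real_of_int (gcd b (int \<sigma>))"
  have \<sigma>0: "\<sigma> > 0" using sfp_pos[OF sf(3)] .
  have tpos: "t > 0" if "t \<in> T1 \<union> T2" for t using that sf(1,2) sfp_pos by blast
  have "gcd b (int \<sigma>) > 0" using \<sigma>0 by simp
  hence g1: "g \<ge> 1" unfolding g_def by linarith
  have Bd1: "Bd \<ge> 1" using le(4) le2 by linarith
  define A where "A y t1 t2 = norm (kloosterman (b * minv \<sigma> (d * (t1 * t2))) (\<epsilon> * int y * minv \<sigma> (d * (t1 * t2))) \<sigma>) ^ 4" for y t1 t2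
  define B1 where "B1 y t1 t2 = norm (kloosterman (b * minv t1 (d * \<sigma> * t2)) (\<epsilon> * int y * minv t1 (d * \<sigma> * t2)) t1) ^ 4" for y t1 t2
  define B2 where "B2 y t1 t2 = norm (kloosterman (b * minv t2 (d * \<sigma> * t1)) (\<epsilon> * int y * minv t2 (d * \<sigma> * t1)) t2) ^ 4" for y t1 t2
  have pt: "norm (kloosterman b (\<epsilon> * int y) (d * \<sigma> * (t1 * t2))) \<le> 
      real d * (sqrt (real \<sigma>) * \<tau> * (A y t1 t2 / (real \<sigma>)\<^sup>2 + B1 y t1 t2 / \<tau>\<^sup>2 + B2 y t1 t2 / \<tau>\<^sup>2 + 1))"
    if "t1 \<in> T1" "t2 \<in> T2" for y t1 t2
  proof -
    have "norm (kloosterman b (\<epsilon> * int y) (d * \<sigma> * (t1 * t2))) \<le> real d *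
       (norm (kloosterman (b * minv \<sigma> (d * (t1 * t2))) (\<epsilon> * int y * minv \<sigma> (d * (t1 * t2))) \<sigma>) *
        norm (kloosterman (b * minv t1 (d * \<sigma> * t2)) (\<epsilon> * int y * minv t1 (d * \<sigma> * t2)) t1) *
        norm (kloosterman (b * minv t2 (d * \<sigma> * t1)) (\<epsilon> * int y * minv t2 (d * \<sigma> * t1)) t2))"
      using kloosterman_factor4[of d \<sigma> t1 t2 b "\<epsilon> * int y"] that sf(4) \<sigma>0 tpos cop by (simp add: mult.assoc)
    also have "\<dots> \<le> real d * (sqrt (real \<sigma>) * \<tau> * (A y t1 t2 / (real \<sigma>)\<^sup>2 + B1 y t1 t2 / \<tau>\<^sup>2 + B2 y t1 t2 / \<tau>\<^sup>2 + 1))"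
      unfolding A_def B1_def B2_def using \<sigma>0 le(4) by (intro mult_left_mono product3_le) auto
    finally show ?thesis .
  qed
  have SA: "(\<Sum>(t1,t2)\<in>T1\<times>T2. A y t1 t2 / (real \<sigma>)\<^sup>2) \<le> 2 * \<tau>\<^sup>2 * u * g * of_int (gcd (\<epsilon> * int y) (int \<sigma>))" for y
  proof -
    have "(\<Sum>t\<in>T1\<times>T2. norm (kloosterman (b * minv \<sigma> (d * (\<lambda>(t1,t2). t1 * t2) t)) (\<epsilon> * int y * minv \<sigma> (d * (\<lambda>(t1,t2). t1 * t2) t)) \<sigma>) ^ 4)
      \<le> (\<tau>\<^sup>2 / real \<sigma> + 1) * (12 ^ omg \<sigma> * real \<sigma> ^ 3 * of_int (gcd b (int \<sigma>)) * of_int (gcd (\<epsilon> * int y) (int \<sigma>)))"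
    proof (rule twisted_fourth_moment)
      fix t assume t: "t \<in> T1 \<times> T2"
      show "real ((\<lambda>(t1,t2). t1 * t2) t) \<le> \<tau>\<^sup>2" using t le(1,2) le(4) by (auto simp: power2_eq_square intro!: mult_mono)
      show "coprime ((\<lambda>(t1,t2). t1 * t2) t) \<sigma>" using t cop(3) by (auto simp: coprime_commute)
    qed (use fin inj cop sf in \<open>auto simp: sfp_def\<close>)
    also have "\<dots> \<le> (\<tau>\<^sup>2 / real \<sigma> + 1) * (u * real \<sigma> ^ 3 * g * of_int (gcd (\<epsilon> * int y) (int \<sigma>)))"
      unfolding g_def by (intro mult_left_mono mult_right_mono omg_bound[OF sf(3) le2(1)]) auto
    finally have "(\<Sum>(t1,t2)\<in>T1\<times>T2. A y t1 t2) \<le> (\<tau>\<^sup>2 / real \<sigma> + 1) * (u * real \<sigma> ^ 3 * g * of_int (gcd (\<epsilon> * int y) (int \<sigma>)))"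
      by (simp add: A_def case_prod_beta)
    hence "(\<Sum>(t1,t2)\<in>T1\<times>T2. A y t1 t2) / (real \<sigma>)\<^sup>2 \<le> (\<tau>\<^sup>2 / real \<sigma> + 1) * (u * real \<sigma> ^ 3 * g * of_int (gcd (\<epsilon> * int y) (int \<sigma>))) / (real \<sigma>)\<^sup>2"
      by (intro divide_right_mono) auto
    also have "\<dots> = (\<tau>\<^sup>2 + real \<sigma>) * (u * g * of_int (gcd (\<epsilon> * int y) (int \<sigma>)))"
      using \<sigma>0 by (simp add: field_simps power2_eq_square power3_eq_cube)
    also have "\<dots> \<le> (2 * \<tau>\<^sup>2) * (u * g * of_int (gcd (\<epsilon> * int y) (int \<sigma>)))"
      using le(3) u_ge_1 g1 by (intro mult_right_mono) auto
    finally show ?thesis by (simp add: case_prod_beta sum_divide_distrib mult_ac)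
  qed
  \<comment> \<open>After normalisation by \<tau>^2, the fourth moment over up to \<tau> twists
    leaves about \<tau> for each modulus, as square-root cancellation predicts.\<close>
  have cube: "(\<tau> / real t + 1) * (12 ^ omg t * real t ^ 3 * x * y) / \<tau>\<^sup>2 \<le> 2 * \<tau> * u * (x * y)"
    if t: "t \<in> T1 \<union> T2" and xy: "x \<ge> 0" "y \<ge> 0" for t x y
  proof -
    have tt: "sfp P t" "real t \<le> \<tau>" "real t > 0" using t sf(1,2) le(1,2) tpos by auto
    have om: "12 ^ omg t \<le> u" using tt le2 by (intro omg_bound) auto
    have "(\<tau> / real t + 1) * (12 ^ omg t * real t ^ 3 * x * y) \<le> (\<tau> / real t + 1) * (u * real t ^ 3 * x * y)"
      using om xy le(4) by (intro mult_left_mono mult_right_mono) auto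
    also have "\<dots> = (\<tau> * (real t)\<^sup>2 + real t * (real t)\<^sup>2) * (u * (x * y))"
      using tt(3) by (simp add: field_simps power2_eq_square power3_eq_cube)
    also have "\<dots> \<le> (\<tau> * \<tau>\<^sup>2 + \<tau> * \<tau>\<^sup>2) * (u * (x * y))"
      using tt le(4) u_ge_1 xy by (intro mult_right_mono add_mono mult_mono power_mono) auto
    finally have "(\<tau> / real t + 1) * (12 ^ omg t * real t ^ 3 * x * y) / \<tau>\<^sup>2 \<le> (\<tau> * \<tau>\<^sup>2 + \<tau> * \<tau>\<^sup>2) * (u * (x * y)) / \<tau>\<^sup>2"
      by (intro divide_right_mono) auto
    also have "\<dots> = 2 * \<tau> * u * (x * y)" using le(4) by (simp add: field_simps)
    finally show ?thesis .
  qed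
  have SB1: "(\<Sum>(t1,t2)\<in>T1\<times>T2. B1 y t1 t2 / \<tau>\<^sup>2) \<le> (\<Sum>t\<in>T1. 2 * \<tau> * u * (of_int (gcd b (int t)) * of_int (gcd (\<epsilon> * int y) (int t))))" for y
  proof -
    have "(\<Sum>(t1,t2)\<in>T1\<times>T2. B1 y t1 t2 / \<tau>\<^sup>2) = (\<Sum>t1\<in>T1. (\<Sum>t2\<in>T2. B1 y t1 t2) / \<tau>\<^sup>2)"
      by (simp add: sum.cartesian_product[symmetric] sum_divide_distrib)
    also have "\<dots> \<le> (\<Sum>t\<in>T1. 2 * \<tau> * u * (of_int (gcd b (int t)) * of_int (gcd (\<epsilon> * int y) (int t))))"
    proof (intro sum_mono)
      fix t1 assume t1: "t1 \<in> T1"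
      have "(\<Sum>t2\<in>T2. B1 y t1 t2) \<le> (\<tau> / real t1 + 1) * (12 ^ omg t1 * real t1 ^ 3 * of_int (gcd b (int t1)) * of_int (gcd (\<epsilon> * int y) (int t1)))"
        unfolding B1_def
      proof (rule twisted_fourth_moment)
        show "coprime (d * \<sigma>) t1" using cop t1 by auto
        show "squarefree t1" using sf t1 by (auto simp: sfp_def)
        show "coprime t2 t1" if "t2 \<in> T2" for t2 using cop(4)[OF t1 that] by (simp add: coprime_commute)
      qed (use fin le in auto)
      hence "(\<Sum>t2\<in>T2. B1 y t1 t2) / \<tau>\<^sup>2 \<le> (\<tau> / real t1 + 1) * (12 ^ omg t1 * real t1 ^ 3 * of_int (gcd b (int t1)) * of_int (gcd (\<epsilon> * int y) (int t1))) / \<tau>\<^sup>2"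
        by (intro divide_right_mono) auto
      also have "\<dots> \<le> 2 * \<tau> * u * (of_int (gcd b (int t1)) * of_int (gcd (\<epsilon> * int y) (int t1)))"
        using t1 by (intro cube) auto
      finally show "(\<Sum>t2\<in>T2. B1 y t1 t2) / \<tau>\<^sup>2 \<le> 2 * \<tau> * u * (of_int (gcd b (int t1)) * of_int (gcd (\<epsilon> * int y) (int t1)))" .
    qed
    finally show ?thesis .
  qed
  have SB2: "(\<Sum>(t1,t2)\<in>T1\<times>T2. B2 y t1 t2 / \<tau>\<^sup>2) \<le> (\<Sum>t\<in>T2. 2 * \<tau> * u * (of_int (gcd b (int t)) * of_int (gcd (\<epsilon> * int y) (int t))))" for y
  proof -
    have "(\<Sum>(t1,t2)\<in>T1\<times>T2. B2 y t1 t2 / \<tau>\<^sup>2) = (\<Sum>t1\<in>T1. \<Sum>t2\<in>T2. B2 y t1 t2 / \<tau>\<^sup>2)"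
      by (simp add: sum.cartesian_product[symmetric])
    also have "\<dots> = (\<Sum>t2\<in>T2. \<Sum>t1\<in>T1. B2 y t1 t2 / \<tau>\<^sup>2)" by (rule sum.swap)
    also have "\<dots> = (\<Sum>t2\<in>T2. (\<Sum>t1\<in>T1. B2 y t1 t2) / \<tau>\<^sup>2)" by (simp add: sum_divide_distrib)
    also have "\<dots> \<le> (\<Sum>t\<in>T2. 2 * \<tau> * u * (of_int (gcd b (int t)) * of_int (gcd (\<epsilon> * int y) (int t))))"
    proof (intro sum_mono)
      fix t1 assume t1: "t1 \<in> T2"
      have "(\<Sum>t2\<in>T1. B2 y t2 t1) \<le> (\<tau> / real t1 + 1) * (12 ^ omg t1 * real t1 ^ 3 * of_int (gcd b (int t1)) * of_int (gcd (\<epsilon> * int y) (int t1)))"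
        unfolding B2_def
      proof (rule twisted_fourth_moment)
        show "coprime (d * \<sigma>) t1" using cop t1 by auto
        show "squarefree t1" using sf t1 by (auto simp: sfp_def)
      qed (use fin le cop t1 in auto)
      hence "(\<Sum>t2\<in>T1. B2 y t2 t1) / \<tau>\<^sup>2 \<le> (\<tau> / real t1 + 1) * (12 ^ omg t1 * real t1 ^ 3 * of_int (gcd b (int t1)) * of_int (gcd (\<epsilon> * int y) (int t1))) / \<tau>\<^sup>2"
        by (intro divide_right_mono) auto
      also have "\<dots> \<le> 2 * \<tau> * u * (of_int (gcd b (int t1)) * of_int (gcd (\<epsilon> * int y) (int t1)))"
        using t1 by (intro cube) auto
      finally show "(\<Sum>t2\<in>T1. B2 y t2 t1) / \<tau>\<^sup>2 \<le> 2 * \<tau> * u * (of_int (gcd b (int t1)) * of_int (gcd (\<epsilon> * int y) (int t1)))" .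
    qed
    finally show ?thesis .
  qed
  have cardle: "real (card T) \<le> \<tau>" if "finite T" "\<And>t. t \<in> T \<Longrightarrow> real t \<le> \<tau>" "T \<subseteq> T1 \<union> T2" for T
  proof -
    have "T \<subseteq> {1..nat \<lfloor>\<tau>\<rfloor>}" 
    proof
      fix x assume x: "x \<in> T"
      have "x > 0" using x that(3) tpos by blast
      moreover have "x \<le> nat \<lfloor>\<tau>\<rfloor>" using that(2)[OF x] le(4) by (simp add: le_nat_iff le_floor_iff)
      ultimately show "x \<in> {1..nat \<lfloor>\<tau>\<rfloor>}" by simp
    qed
    hence "card T \<le> nat \<lfloor>\<tau>\<rfloor>" using card_mono[of "{1..nat \<lfloor>\<tau>\<rfloor>}" T] by simp
    hence "real (card T) \<le> real (nat \<lfloor>\<tau>\<rfloor>)" by simp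
    also have "\<dots> \<le> \<tau>" using le(4) by (simp add: of_nat_nat)
    finally show ?thesis .
  qed
  have card12: "real (card (T1 \<times> T2)) \<le> \<tau>\<^sup>2"
    unfolding card_cartesian_product power2_eq_square of_nat_mult using fin le
    by (intro mult_mono cardle) auto
  define w where "w y = 1 / (2 * real y)" for y
  have wsum: "(\<Sum>y\<in>{1..C}. w y) \<le> u"
  proof -
    have "(\<Sum>y\<in>{1..C}. w y) \<le> (\<Sum>y\<in>{1..C}. 1 / real y)" unfolding w_def by (intro sum_mono) (auto simp: field_simps)
    also have "\<dots> \<le> u" using C by (rule harm_bound)
    finally show ?thesis .
  qed
  have freq: "(\<Sum>y\<in>{1..C}. w y * of_int (gcd (\<epsilon> * int y) (int t))) \<le> u\<^sup>2" if "sfp P t" "real t \<le> Bd" for t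
    unfolding w_def using gcd_frequency_sum[OF that C \<epsilon>] .
  have SB: "(\<Sum>y\<in>{1..C}. w y * (\<Sum>t\<in>T. 2 * \<tau> * u * (of_int (gcd b (int t)) * of_int (gcd (\<epsilon> * int y) (int t))))) \<le> 2 * \<tau>\<^sup>2 * u ^ 4"
    if T: "finite T" "\<And>t. t \<in> T \<Longrightarrow> sfp P t" "\<And>t. t \<in> T \<Longrightarrow> real t \<le> \<tau>" for T
  proof -
    have "(\<Sum>y\<in>{1..C}. w y * (\<Sum>t\<in>T. 2 * \<tau> * u * (of_int (gcd b (int t)) * of_int (gcd (\<epsilon> * int y) (int t)))))
      = (\<Sum>t\<in>T. \<Sum>y\<in>{1..C}. w y * (2 * \<tau> * u * (of_int (gcd b (int t)) * of_int (gcd (\<epsilon> * int y) (int t)))))"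
      unfolding sum_distrib_left by (rule sum.swap)
    also have "\<dots> = (\<Sum>t\<in>T. 2 * \<tau> * u * of_int (gcd b (int t)) * (\<Sum>y\<in>{1..C}. w y * of_int (gcd (\<epsilon> * int y) (int t))))"
      unfolding sum_distrib_left by (intro sum.cong refl) (simp add: mult_ac)
    also have "\<dots> \<le> (\<Sum>t\<in>T. 2 * \<tau> * u * of_int (gcd b (int t)) * u\<^sup>2)"
      using T le(4) le2 u_ge_1 by (intro sum_mono mult_left_mono freq) (force)+
    also have "\<dots> = 2 * \<tau> * u ^ 3 * (\<Sum>t\<in>T. of_int (gcd b (int t)))"
      by (simp add: sum_distrib_left mult_ac power2_eq_square power3_eq_cube)
    also have "\<dots> \<le> 2 * \<tau> * u ^ 3 * (u * \<tau>)"
      using T b le(4) u_ge_1 by (intro mult_left_mono gcd_sum) auto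
    also have "\<dots> = 2 * \<tau>\<^sup>2 * u ^ 4" by (simp add: power2_eq_square power3_eq_cube power4_eq_xxxx)
    finally show ?thesis .
  qed
  define Kf where "Kf = real d * (sqrt (real \<sigma>) * \<tau>)"
  have Kf0: "Kf \<ge> 0" unfolding Kf_def using le(4) by simp
  have "(\<Sum>(t1,t2)\<in>T1\<times>T2. \<Sum>y\<in>{1..C}. w y * norm (kloosterman b (\<epsilon> * int y) (d * \<sigma> * (t1 * t2))))
     = (\<Sum>y\<in>{1..C}. w y * (\<Sum>(t1,t2)\<in>T1\<times>T2. norm (kloosterman b (\<epsilon> * int y) (d * \<sigma> * (t1 * t2)))))"
    unfolding sum_distrib_left case_prod_beta by (rule sum.swap)
  also have "\<dots> \<le> (\<Sum>y\<in>{1..C}. w y * (Kf * (2 * \<tau>\<^sup>2 * u * g * of_int (gcd (\<epsilon> * int y) (int \<sigma>))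
      + (\<Sum>t\<in>T1. 2 * \<tau> * u * (of_int (gcd b (int t)) * of_int (gcd (\<epsilon> * int y) (int t))))
      + (\<Sum>t\<in>T2. 2 * \<tau> * u * (of_int (gcd b (int t)) * of_int (gcd (\<epsilon> * int y) (int t)))) + \<tau>\<^sup>2)))"
  proof (intro sum_mono mult_left_mono)
    fix y
    have "(\<Sum>(t1,t2)\<in>T1\<times>T2. norm (kloosterman b (\<epsilon> * int y) (d * \<sigma> * (t1 * t2)))) \<le>
        (\<Sum>(t1,t2)\<in>T1\<times>T2. Kf * (A y t1 t2 / (real \<sigma>)\<^sup>2 + B1 y t1 t2 / \<tau>\<^sup>2 + B2 y t1 t2 / \<tau>\<^sup>2 + 1))"
      unfolding Kf_def mult.assoc[of "real d"] by (intro sum_mono) (use pt in auto)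
    also have "\<dots> = Kf * ((\<Sum>(t1,t2)\<in>T1\<times>T2. A y t1 t2 / (real \<sigma>)\<^sup>2) + (\<Sum>(t1,t2)\<in>T1\<times>T2. B1 y t1 t2 / \<tau>\<^sup>2)
        + (\<Sum>(t1,t2)\<in>T1\<times>T2. B2 y t1 t2 / \<tau>\<^sup>2) + real (card (T1 \<times> T2)))"
      by (simp add: case_prod_beta sum.distrib flip: sum_distrib_left)
    also have "\<dots> \<le> Kf * (2 * \<tau>\<^sup>2 * u * g * of_int (gcd (\<epsilon> * int y) (int \<sigma>))
      + (\<Sum>t\<in>T1. 2 * \<tau> * u * (of_int (gcd b (int t)) * of_int (gcd (\<epsilon> * int y) (int t))))
      + (\<Sum>t\<in>T2. 2 * \<tau> * u * (of_int (gcd b (int t)) * of_int (gcd (\<epsilon> * int y) (int t)))) + \<tau>\<^sup>2)"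
      by (intro mult_left_mono add_mono SA SB1 SB2 card12 Kf0)
    finally show "(\<Sum>(t1,t2)\<in>T1\<times>T2. norm (kloosterman b (\<epsilon> * int y) (d * \<sigma> * (t1 * t2)))) \<le> Kf * (2 * \<tau>\<^sup>2 * u * g * of_int (gcd (\<epsilon> * int y) (int \<sigma>))
      + (\<Sum>t\<in>T1. 2 * \<tau> * u * (of_int (gcd b (int t)) * of_int (gcd (\<epsilon> * int y) (int t))))
      + (\<Sum>t\<in>T2. 2 * \<tau> * u * (of_int (gcd b (int t)) * of_int (gcd (\<epsilon> * int y) (int t)))) + \<tau>\<^sup>2)" .
  qed (auto simp: w_def)
  also have "\<dots> = Kf * (2 * \<tau>\<^sup>2 * u * g * (\<Sum>y\<in>{1..C}. w y * of_int (gcd (\<epsilon> * int y) (int \<sigma>)))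
      + (\<Sum>y\<in>{1..C}. w y * (\<Sum>t\<in>T1. 2 * \<tau> * u * (of_int (gcd b (int t)) * of_int (gcd (\<epsilon> * int y) (int t)))))
      + (\<Sum>y\<in>{1..C}. w y * (\<Sum>t\<in>T2. 2 * \<tau> * u * (of_int (gcd b (int t)) * of_int (gcd (\<epsilon> * int y) (int t))))) + \<tau>\<^sup>2 * (\<Sum>y\<in>{1..C}. w y))"
    unfolding sum_distrib_left[of "2 * \<tau>\<^sup>2 * u * g"] sum_distrib_left[of "\<tau>\<^sup>2"] sum.distrib[symmetric] sum_distrib_left[of Kf]
    by (intro sum.cong refl) (simp add: algebra_simps)
  also have "\<dots> \<le> Kf * (2 * \<tau>\<^sup>2 * u * g * u\<^sup>2 + 2 * \<tau>\<^sup>2 * u ^ 4 + 2 * \<tau>\<^sup>2 * u ^ 4 + \<tau>\<^sup>2 * u)"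
    using fin sf le le2 u_ge_1 g1 by (intro mult_left_mono add_mono freq SB wsum Kf0) auto
  \<comment> \<open>All powers of \<open>u\<close> are raised to the fourth and \<sigma>'s gcd
    \<open>g\<close> is inserted everywhere; then 7 = 2 + 2 + 2 + 1.\<close>
  also have "\<dots> \<le> Kf * (7 * \<tau>\<^sup>2 * u ^ 4 * g)"
  proof (rule mult_left_mono[OF _ Kf0])
    have 1: "u ^ 3 \<le> u ^ 4" "u \<le> u ^ 4" using u_ge_1 power_increasing[of 3 4 u] power_increasing[of 1 4 u] by auto
    have "2 * u * g * u\<^sup>2 + 2 * u ^ 4 + 2 * u ^ 4 + u = 2 * (u ^ 3 * g) + 4 * u ^ 4 + u" by (simp add: power2_eq_square power3_eq_cube)
    also have "\<dots> \<le> 2 * (u ^ 4 * g) + 4 * (u ^ 4 * g) + u ^ 4 * g"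
    proof -
      have "u ^ 3 * g \<le> u ^ 4 * g" using 1 g1 by (intro mult_right_mono) auto
      moreover have "u ^ 4 * 1 \<le> u ^ 4 * g" using g1 u_ge_1 by (intro mult_left_mono) auto
      ultimately show ?thesis using 1 by linarith
    qed
    finally have "\<tau>\<^sup>2 * (2 * u * g * u\<^sup>2 + 2 * u ^ 4 + 2 * u ^ 4 + u) \<le> \<tau>\<^sup>2 * (7 * (u ^ 4 * g))"
      by (intro mult_left_mono) (simp_all add: mult.commute[of g "u ^ 4"])
    thus "2 * \<tau>\<^sup>2 * u * g * u\<^sup>2 + 2 * \<tau>\<^sup>2 * u ^ 4 + 2 * \<tau>\<^sup>2 * u ^ 4 + \<tau>\<^sup>2 * u \<le> 7 * \<tau>\<^sup>2 * u ^ 4 * g" by (simp add: algebra_simps)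
  qed
  finally show ?thesis by (simp add: w_def Kf_def g_def power2_eq_square power3_eq_cube mult_ac)
qed

lemma sfp_mult: "sfp P a \<Longrightarrow> sfp P b \<Longrightarrow> coprime a b \<Longrightarrow> sfp P (a * b)"
  using sfp_pos[of P a] sfp_pos[of P b] by (auto simp: sfp_def prime_factors_product squarefree_mult_coprime)

text \<open>The zero frequency contributes V times a sum of gcd(b, t1 t2)/(t1 t2), at most u^2; the
  part of the gcd in common with d \<sigma> is bounded by d \<sigma> and cancels against the
  modulus. The other frequencies give the preceding average once for each sign.\<close>

lemma kloosterman_average:
  assumes fin: "finite T1" "finite T2"
    and sf: "\<And>t. t \<in> T1 \<Longrightarrow> sfp P t" "\<And>t. t \<in> T2 \<Longrightarrow> sfp P t" "sfp P \<sigma>" "sfp P d"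
    and le: "\<And>t. t \<in> T1 \<Longrightarrow> real t \<le> \<tau>" "\<And>t. t \<in> T2 \<Longrightarrow> real t \<le> \<tau>" "real \<sigma> \<le> \<tau>\<^sup>2" "\<tau> \<ge> 1"
    and le2: "real (d * \<sigma>) * \<tau>\<^sup>2 \<le> Bd"
    and cop: "coprime d \<sigma>" "\<And>t. t \<in> T1 \<union> T2 \<Longrightarrow> coprime d t" "\<And>t. t \<in> T1 \<union> T2 \<Longrightarrow> coprime \<sigma> t"
       "\<And>t1 t2. t1 \<in> T1 \<Longrightarrow> t2 \<in> T2 \<Longrightarrow> coprime t1 t2"
    and inj: "inj_on (\<lambda>(t1,t2). t1 * t2) (T1 \<times> T2)"
    and b: "b \<noteq> 0" "real_of_int \<bar>b\<bar> \<le> Bd"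
  shows "(\<Sum>(t1,t2)\<in>T1\<times>T2. norm (\<Sum>v\<in>{v\<in>{1..V}. coprime v (d * \<sigma> * (t1 * t2))}. ec (d * \<sigma> * (t1 * t2)) (b * minv (d * \<sigma> * (t1 * t2)) v)))
     \<le> u\<^sup>2 * real V + 14 * u ^ 4 * real d * sqrt (real \<sigma>) * \<tau> ^ 3 * of_int (gcd b (int \<sigma>))"
proof -
  \<comment> \<open>One cutoff for the frequencies, above every modulus that occurs.\<close>
  define C where "C = nat \<lfloor>Bd\<rfloor>"
  have pos: "d > 0" "\<sigma> > 0" "\<And>t. t \<in> T1 \<union> T2 \<Longrightarrow> t > 0" using sf sfp_pos by blast+
  have ds1: "real (d * \<sigma>) \<ge> 1" using pos by (simp add: Suc_leI nat_less_real_le flip: of_nat_mult)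
  have \<tau>2: "\<tau>\<^sup>2 \<ge> 1" "\<tau> \<le> \<tau>\<^sup>2" using le(4) one_le_power[of \<tau> 2] power_increasing[of 1 2 \<tau>] by simp_all
  have "1 * \<tau>\<^sup>2 \<le> real (d * \<sigma>) * \<tau>\<^sup>2" using ds1 by (intro mult_right_mono) auto
  hence Bt: "\<tau>\<^sup>2 \<le> Bd" using le2 by linarith
  have "real (d * \<sigma>) * 1 \<le> real (d * \<sigma>) * \<tau>\<^sup>2" using \<tau>2 by (intro mult_left_mono) auto
  hence Bds: "real (d * \<sigma>) \<le> Bd" using le2 by linarith
  have "1 * real \<sigma> \<le> real d * real \<sigma>" using pos by (intro mult_right_mono) auto
  hence B\<sigma>: "real \<sigma> \<le> Bd" using Bds by simp
  have Bd1: "Bd \<ge> 1" using Bt \<tau>2 by linarith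
  have C: "real C \<le> Bd" unfolding C_def using Bd1 by (simp add: of_nat_nat)
  have tt: "real (t1 * t2) \<le> \<tau>\<^sup>2" if "t1 \<in> T1" "t2 \<in> T2" for t1 t2
    using le(1)[OF that(1)] le(2)[OF that(2)] le(4) by (auto simp: power2_eq_square intro!: mult_mono)
  have one: "norm (\<Sum>v\<in>{v\<in>{1..V}. coprime v (d * \<sigma> * (t1 * t2))}. ec (d * \<sigma> * (t1 * t2)) (b * minv (d * \<sigma> * (t1 * t2)) v))
     \<le> real V * (of_int (gcd b (int (t1 * t2))) / real (t1 * t2)) 
       + (\<Sum>y\<in>{1..C}. 1 / (2 * real y) * norm (kloosterman b (1 * int y) (d * \<sigma> * (t1 * t2))))
       + (\<Sum>y\<in>{1..C}. 1 / (2 * real y) * norm (kloosterman b (- 1 * int y) (d * \<sigma> * (t1 * t2))))"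
    if t: "t1 \<in> T1" "t2 \<in> T2" for t1 t2
  proof -
    define c where "c = d * \<sigma> * (t1 * t2)"
    have c0: "c > 0" using pos t by (auto simp: c_def)
    have tpos: "t1 * t2 > 0" using pos t by auto
    have "sfp P (t1 * t2)" using sf cop t by (intro sfp_mult) auto
    moreover have "sfp P (d * \<sigma>)" using sf cop by (intro sfp_mult) auto
    ultimately have "sfp P c" unfolding c_def using cop t by (intro sfp_mult[of "d * \<sigma>" "t1 * t2"]) auto
    hence sfc: "squarefree c" by (simp add: sfp_def)
    have "real c \<le> Bd"
    proof -
      have "real c = real (d * \<sigma>) * real (t1 * t2)" by (simp add: c_def)
      also have "\<dots> \<le> real (d * \<sigma>) * \<tau>\<^sup>2" using tt[OF t] by (intro mult_left_mono) auto
      finally show ?thesis using le2 by linarith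
    qed
    hence "c \<le> C" unfolding C_def by (simp add: le_nat_iff le_floor_iff)
    have "real V / real c * norm (kloosterman b 0 c) \<le> real V * (of_int (gcd b (int (t1 * t2))) / real (t1 * t2))"
    proof -
      have "gcd b (int c) dvd gcd b (int (d * \<sigma>)) * gcd b (int (t1 * t2))" 
        unfolding c_def of_nat_mult[of "d * \<sigma>"] by (rule gcd_mult_dvd_mult_gcd)
      hence "gcd b (int c) \<le> gcd b (int (d * \<sigma>)) * gcd b (int (t1 * t2))" using b by (intro zdvd_imp_le mult_pos_pos) (simp_all add: gcd_pos_int)
      also have "\<dots> \<le> int (d * \<sigma>) * gcd b (int (t1 * t2))"
      proof (rule mult_right_mono)
        have "d * \<sigma> > 0" using pos by simp
        thus "gcd b (int (d * \<sigma>)) \<le> int (d * \<sigma>)" by (intro zdvd_imp_le gcd_dvd2) (simp only: of_nat_0_less_iff)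
      qed simp
      finally have "real_of_int (gcd b (int c)) \<le> real_of_int (int (d * \<sigma>) * gcd b (int (t1 * t2)))" by (simp only: of_int_le_iff)
      hence "norm (kloosterman b 0 c) \<le> real (d * \<sigma>) * of_int (gcd b (int (t1 * t2)))"
        using ramanujan_bound[OF sfc, of b] by simp
      hence "real V / real c * norm (kloosterman b 0 c) \<le> real V / real c * (real (d * \<sigma>) * of_int (gcd b (int (t1 * t2))))"
        by (intro mult_left_mono) auto
      also have "\<dots> = real V * (of_int (gcd b (int (t1 * t2))) / real (t1 * t2))" using pos tpos by (simp add: c_def)
      finally show ?thesis .
    qed
    moreover note kloosterman_completion[OF c0 \<open>c \<le> C\<close>, where V = V and b = b]
    moreover have "(\<Sum>y\<in>{1..C}. 1 / (2 * real y) * (norm (kloosterman b (int y) c) + norm (kloosterman b (- int y) c)))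
       = (\<Sum>y\<in>{1..C}. 1 / (2 * real y) * norm (kloosterman b (1 * int y) c)) + (\<Sum>y\<in>{1..C}. 1 / (2 * real y) * norm (kloosterman b (- 1 * int y) c))"
      by (simp add: distrib_left sum.distrib)
    ultimately show ?thesis unfolding c_def by linarith
  qed
  have "(\<Sum>(t1,t2)\<in>T1\<times>T2. norm (\<Sum>v\<in>{v\<in>{1..V}. coprime v (d * \<sigma> * (t1 * t2))}. ec (d * \<sigma> * (t1 * t2)) (b * minv (d * \<sigma> * (t1 * t2)) v)))
    \<le> (\<Sum>(t1,t2)\<in>T1\<times>T2. real V * (of_int (gcd b (int (t1 * t2))) / real (t1 * t2)) 
       + (\<Sum>y\<in>{1..C}. 1 / (2 * real y) * norm (kloosterman b (1 * int y) (d * \<sigma> * (t1 * t2))))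
       + (\<Sum>y\<in>{1..C}. 1 / (2 * real y) * norm (kloosterman b (- 1 * int y) (d * \<sigma> * (t1 * t2)))))"
    by (intro sum_mono) (use one in auto)
  also have "\<dots> = real V * (\<Sum>t\<in>T1\<times>T2. of_int (gcd b (int ((\<lambda>(t1,t2). t1 * t2) t))) / real ((\<lambda>(t1,t2). t1 * t2) t)) 
       + (\<Sum>(t1,t2)\<in>T1\<times>T2. \<Sum>y\<in>{1..C}. 1 / (2 * real y) * norm (kloosterman b (1 * int y) (d * \<sigma> * (t1 * t2))))
       + (\<Sum>(t1,t2)\<in>T1\<times>T2. \<Sum>y\<in>{1..C}. 1 / (2 * real y) * norm (kloosterman b (- 1 * int y) (d * \<sigma> * (t1 * t2))))"
    by (simp only: case_prod_unfold sum.distrib sum_distrib_left)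
  also have "\<dots> \<le> real V * u\<^sup>2 + 7 * u ^ 4 * real d * sqrt (real \<sigma>) * \<tau> ^ 3 * of_int (gcd b (int \<sigma>))
       + 7 * u ^ 4 * real d * sqrt (real \<sigma>) * \<tau> ^ 3 * of_int (gcd b (int \<sigma>))"
  proof (intro add_mono mult_left_mono kloosterman_average_one_sign)
    show "(\<Sum>t\<in>T1\<times>T2. of_int (gcd b (int ((\<lambda>(t1,t2). t1 * t2) t))) / real ((\<lambda>(t1,t2). t1 * t2) t)) \<le> u\<^sup>2"
    proof (rule gcd_reciprocal_sum[OF _ inj])
      fix t assume t: "t \<in> T1 \<times> T2"
      thus "sfp P ((\<lambda>(t1,t2). t1 * t2) t)" using sf cop by (auto intro!: sfp_mult)
      have "real ((\<lambda>(t1,t2). t1 * t2) t) \<le> \<tau>\<^sup>2" using t tt by auto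
      thus "real ((\<lambda>(t1,t2). t1 * t2) t) \<le> Bd" using Bt by linarith
    qed (use fin b in auto)
  qed (use fin sf le cop inj b C pos B\<sigma> Bt \<tau>2 in \<open>auto\<close>)
  finally show ?thesis by (simp add: algebra_simps)
qed

end

section \<open>A bilinear form with Kloosterman fractions\<close>

lemma square_sum_dispersion:
  fixes f :: "'x \<Rightarrow> 'i \<Rightarrow> complex"
  shows "(\<Sum>x\<in>X. (norm (\<Sum>i\<in>I. f x i))\<^sup>2) \<le> (\<Sum>i\<in>I. \<Sum>j\<in>I. norm (\<Sum>x\<in>X. f x i * cnj (f x j)))"
proof -
  have "complex_of_real (\<Sum>x\<in>X. (norm (\<Sum>i\<in>I. f x i))\<^sup>2) = (\<Sum>x\<in>X. \<Sum>i\<in>I. \<Sum>j\<in>I. f x i * cnj (f x j))"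
    unfolding of_real_sum complex_norm_square_sum ..
  also have "\<dots> = (\<Sum>i\<in>I. \<Sum>x\<in>X. \<Sum>j\<in>I. f x i * cnj (f x j))" by (rule sum.swap)
  also have "\<dots> = (\<Sum>i\<in>I. \<Sum>j\<in>I. \<Sum>x\<in>X. f x i * cnj (f x j))" by (intro sum.cong refl sum.swap)
  finally have e: "complex_of_real (\<Sum>x\<in>X. (norm (\<Sum>i\<in>I. f x i))\<^sup>2) = (\<Sum>i\<in>I. \<Sum>j\<in>I. \<Sum>x\<in>X. f x i * cnj (f x j))" .
  have "(\<Sum>x\<in>X. (norm (\<Sum>i\<in>I. f x i))\<^sup>2) = norm (complex_of_real (\<Sum>x\<in>X. (norm (\<Sum>i\<in>I. f x i))\<^sup>2))"
    unfolding norm_of_real by (simp add: sum_nonneg)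
  also have "\<dots> \<le> (\<Sum>i\<in>I. \<Sum>j\<in>I. norm (\<Sum>x\<in>X. f x i * cnj (f x j)))"
    unfolding e by (intro sum_norm_le norm_sum order_trans[OF norm_sum])
  finally show ?thesis .
qed

lemma minv_mod_divisor:
  assumes "c' dvd c" "coprime v c"
  shows "[minv c v = minv c' v] (mod int c')"
proof -
  have "coprime v c'" using assms by (meson coprime_divisors dvd_refl)
  hence "[int v * minv c' v = 1] (mod int c')" by (rule minv_cong)
  moreover have "[int v * minv c v = 1] (mod int c')"
    using minv_cong[OF assms(2)] assms(1) by (meson cong_dvd_modulus int_dvd_int_iff)
  ultimately show ?thesis using unit_pairs_inverse_unique by blast
qed

lemma ec_scale: "k > 0 \<Longrightarrow> ec (k * c) (int k * n) = ec c n"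
  by (simp add: ec_def)

text \<open>Common denominator: \<open>d * (s1 * s1')\<close> is the least common multiple of s and
  s', and an inverse modulo the larger modulus is also one modulo its divisors.\<close>

lemma ec_pair_combine:
  fixes s s' t v :: nat and r r' j :: int
  assumes "s > 0" "s' > 0" "t > 0"
  defines "d \<equiv> gcd s s'"
  defines "s1 \<equiv> s div d" and "s1' \<equiv> s' div d"
  assumes "coprime v (d * (s1 * s1') * t)"
  shows "ec (s * t) (r * j * minv (s * t) v) * cnj (ec (s' * t) (r' * j * minv (s' * t) v)) =
     ec (d * (s1 * s1') * t) (j * (r * int s1' - r' * int s1) * minv (d * (s1 * s1') * t) v)"
proof -
  have d: "d > 0" "s = d * s1" "s' = d * s1'" using assms by (auto simp: d_def s1_def s1'_def)
  have p: "s1 > 0" "s1' > 0" using assms(1,2) d by auto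
  define c where "c = d * (s1 * s1') * t"
  have c1: "c = s1' * (s * t)" and c2: "c = s1 * (s' * t)" by (simp_all add: c_def d mult_ac)
  have cv: "coprime v c" using assms(7) by (simp only: c_def)
  have m1: "[minv c v = minv (s * t) v] (mod int (s * t))"
    by (rule minv_mod_divisor[OF _ cv]) (simp only: c1 dvd_triv_right)
  have m2: "[minv c v = minv (s' * t) v] (mod int (s' * t))"
    by (rule minv_mod_divisor[OF _ cv]) (simp only: c2 dvd_triv_right)
  have "ec (s * t) (r * j * minv (s * t) v) = ec (s * t) (r * j * minv c v)"
    by (intro ec_cong cong_mult[OF cong_refl] cong_sym[OF m1])
  also have "\<dots> = ec c (int s1' * (r * j * minv c v))" unfolding c1 using p ec_scale by metis
  finally have 1: "ec (s * t) (r * j * minv (s * t) v) = ec c (int s1' * (r * j * minv c v))" .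
  have "ec (s' * t) (r' * j * minv (s' * t) v) = ec (s' * t) (r' * j * minv c v)"
    by (intro ec_cong cong_mult[OF cong_refl] cong_sym[OF m2])
  also have "\<dots> = ec c (int s1 * (r' * j * minv c v))" unfolding c2 using p ec_scale by metis
  finally have 2: "ec (s' * t) (r' * j * minv (s' * t) v) = ec c (int s1 * (r' * j * minv c v))" .
  have "int s1' * (r * j * minv c v) - int s1 * (r' * j * minv c v) = j * (r * int s1' - r' * int s1) * minv c v"
    by (simp add: algebra_simps)
  thus ?thesis unfolding 1 2 ec_diff[symmetric] c_def[symmetric] by simp
qed

context divisor_bounded
begin

text \<open>The average over moduli is applied with d the gcd and \<sigma> = s1 s1'. Since d^2
  \<sigma> = s s', the factor d sqrt \<sigma> is at most S, so the trivial treatment of d is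
  harmless. The gcd of the new numerator with \<sigma> is bounded by a product of a term in (r, s)
  and a term in (r', s'), which later turns the double sum over pairs into a square.\<close>

lemma kloosterman_pair_average:
  fixes r r' j :: int
  assumes fin: "finite T1" "finite T2"
    and sf: "\<And>t. t \<in> T1 \<Longrightarrow> sfp P t" "\<And>t. t \<in> T2 \<Longrightarrow> sfp P t" "sfp P s" "sfp P s'"
    and le: "\<And>t. t \<in> T1 \<Longrightarrow> real t \<le> \<tau>" "\<And>t. t \<in> T2 \<Longrightarrow> real t \<le> \<tau>" "real s \<le> S" "real s' \<le> S" "S \<le> \<tau>" "\<tau> \<ge> 1"
    and cop: "\<And>t. t \<in> T1 \<union> T2 \<Longrightarrow> coprime s t" "\<And>t. t \<in> T1 \<union> T2 \<Longrightarrow> coprime s' t"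
       "\<And>t1 t2. t1 \<in> T1 \<Longrightarrow> t2 \<in> T2 \<Longrightarrow> coprime t1 t2"
    and inj: "inj_on (\<lambda>(t1,t2). t1 * t2) (T1 \<times> T2)"
    and b: "j \<noteq> 0" "r * int s' \<noteq> r' * int s" "real_of_int \<bar>r\<bar> \<le> R0" "real_of_int \<bar>r'\<bar> \<le> R0" 
      "\<bar>real_of_int j\<bar> * (2 * R0 * S) \<le> Bd" "S\<^sup>2 * \<tau>\<^sup>2 \<le> Bd"
  shows "(\<Sum>t\<in>T1\<times>T2. norm (\<Sum>v\<in>{v\<in>{1..V}. coprime v (s * (fst t * snd t)) \<and> coprime v (s' * (fst t * snd t))}.
            ec (s * (fst t * snd t)) (r * j * minv (s * (fst t * snd t)) v) * 
            cnj (ec (s' * (fst t * snd t)) (r' * j * minv (s' * (fst t * snd t)) v))))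
     \<le> u\<^sup>2 * real V + 14 * u ^ 4 * S * \<tau> ^ 3 * (of_int (gcd (j * r) (int s)) * of_int (gcd (j * r') (int s')))"
proof -
  define d s1 s1' where "d = gcd s s'" and "s1 = s div d" and "s1' = s' div d"
  have pos: "s > 0" "s' > 0" using sf sfp_pos by auto
  have tpos: "t > 0" if "t \<in> T1 \<union> T2" for t using that sf(1,2) sfp_pos by blast
  have d: "d > 0" "s = d * s1" "s' = d * s1'" using pos by (auto simp: d_def s1_def s1'_def)
  have p: "s1 > 0" "s1' > 0" using pos d by auto
  have cs: "coprime s1 s1'" unfolding s1_def s1'_def d_def using pos by (intro div_gcd_coprime) auto
  have sfd: "sfp P d" "sfp P s1" "sfp P s1'" using sf(3,4) d by (metis dvd_triv_left dvd_triv_right sfp_dvd)+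
  \<comment> \<open>A common factor would divide s or s' to the second power.\<close>
  have sq: "coprime d s1" "coprime d s1'" 
  proof -
    have sqc: "coprime a b" if "squarefree (a * b)" for a b :: nat
    proof (rule coprimeI)
      fix x assume "x dvd a" "x dvd b"
      hence "x\<^sup>2 dvd a * b" by (simp add: power2_eq_square mult_dvd_mono)
      thus "is_unit x" using that by (simp only: squarefree_def)
    qed
    have "squarefree (d * s1)" "squarefree (d * s1')" using sf d by (auto simp: sfp_def)
    thus "coprime d s1" "coprime d s1'" by (auto intro: sqc)
  qed
  define \<sigma> where "\<sigma> = s1 * s1'"
  define b where "b = j * (r * int s1' - r' * int s1)"
  have sfs: "sfp P \<sigma>" unfolding \<sigma>_def using sfd cs by (intro sfp_mult)
  have b0: "b \<noteq> 0"
  proof -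
    have "int d * (r * int s1' - r' * int s1) = r * int s' - r' * int s" by (simp add: d algebra_simps)
    hence "r * int s1' - r' * int s1 \<noteq> 0" using b(2) by auto
    thus ?thesis using b(1) by (simp add: b_def)
  qed
  have d1: "d dvd s" "d dvd s'" "s1 dvd s" "s1' dvd s'" using d by auto
  have "s1 \<le> s" "s1' \<le> s'" using d1 pos by (auto intro: dvd_imp_le)
  hence s1le: "real s1 \<le> S" "real s1' \<le> S" using le(3,4) by linarith+
  have S0: "S \<ge> 0" using le(3) by linarith
  have R0: "R0 \<ge> 0" using b(3) by linarith
  have bBd: "real_of_int \<bar>b\<bar> \<le> Bd"
  proof -
    have "\<bar>real_of_int (r * int s1' - r' * int s1)\<bar> \<le> \<bar>real_of_int r\<bar> * real s1' + \<bar>real_of_int r'\<bar> * real s1"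
    proof -
      have "\<bar>real_of_int (r * int s1' - r' * int s1)\<bar> = \<bar>real_of_int r * real s1' - real_of_int r' * real s1\<bar>" by simp
      also have "\<dots> \<le> \<bar>real_of_int r * real s1'\<bar> + \<bar>real_of_int r' * real s1\<bar>" by (rule abs_triangle_ineq4)
      finally show ?thesis by (simp add: abs_mult)
    qed
    also have "\<dots> \<le> R0 * S + R0 * S" using b(3,4) s1le S0 R0 by (intro add_mono mult_mono) auto
    finally have "\<bar>real_of_int (r * int s1' - r' * int s1)\<bar> \<le> 2 * R0 * S" by simp
    hence "\<bar>real_of_int j\<bar> * \<bar>real_of_int (r * int s1' - r' * int s1)\<bar> \<le> \<bar>real_of_int j\<bar> * (2 * R0 * S)" by (intro mult_left_mono) auto
    thus ?thesis using b(5) by (simp add: b_def abs_mult)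
  qed
  have dsd: "d * \<sigma> \<le> s * s'" unfolding \<sigma>_def d using d(1) by simp
  have ss: "real (s * s') \<le> S\<^sup>2" using le(3,4) S0 by (auto simp: power2_eq_square intro!: mult_mono)
  have dsS: "real (d * \<sigma>) \<le> S\<^sup>2" using dsd ss by (metis of_nat_le_iff order_trans)
  have "\<sigma> \<le> d * \<sigma>" using d(1) by simp
  hence \<sigma>S: "real \<sigma> \<le> S\<^sup>2" using dsS by (metis of_nat_le_iff order_trans)
  have St: "S\<^sup>2 \<le> \<tau>\<^sup>2" using S0 le(5) by (intro power_mono)
  have copd: "coprime d t" "coprime \<sigma> t" if "t \<in> T1 \<union> T2" for t
    using cop(1)[OF that] cop(2)[OF that] d1 unfolding \<sigma>_def
    by (auto intro: coprime_divisors[OF _ dvd_refl])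
  have eqset: "{v\<in>{1..V}. coprime v (s * t) \<and> coprime v (s' * t)} = {v\<in>{1..V}. coprime v (d * \<sigma> * t)}" for t
    by (auto simp: d \<sigma>_def)
  have "(\<Sum>t\<in>T1\<times>T2. norm (\<Sum>v\<in>{v\<in>{1..V}. coprime v (s * (fst t * snd t)) \<and> coprime v (s' * (fst t * snd t))}.
            ec (s * (fst t * snd t)) (r * j * minv (s * (fst t * snd t)) v) * 
            cnj (ec (s' * (fst t * snd t)) (r' * j * minv (s' * (fst t * snd t)) v))))
     = (\<Sum>(t1,t2)\<in>T1\<times>T2. norm (\<Sum>v\<in>{v\<in>{1..V}. coprime v (d * \<sigma> * (t1 * t2))}. ec (d * \<sigma> * (t1 * t2)) (b * minv (d * \<sigma> * (t1 * t2)) v)))"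
    unfolding case_prod_unfold eqset
  proof (intro sum.cong refl arg_cong[where f = norm])
    fix t v assume t: "t \<in> T1 \<times> T2" and v: "v \<in> {v\<in>{1..V}. coprime v (d * \<sigma> * (fst t * snd t))}"
    have "fst t * snd t > 0" using t tpos by auto
    from ec_pair_combine[OF pos this, of v r j r'] v
    show "ec (s * (fst t * snd t)) (r * j * minv (s * (fst t * snd t)) v) * 
            cnj (ec (s' * (fst t * snd t)) (r' * j * minv (s' * (fst t * snd t)) v)) =
          ec (d * \<sigma> * (fst t * snd t)) (b * minv (d * \<sigma> * (fst t * snd t)) v)"
      by (simp add: d_def s1_def s1'_def \<sigma>_def b_def)
  qed
  also have "\<dots> \<le> u\<^sup>2 * real V + 14 * u ^ 4 * real d * sqrt (real \<sigma>) * \<tau> ^ 3 * of_int (gcd b (int \<sigma>))"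
  proof (rule kloosterman_average)
    show "real (d * \<sigma>) * \<tau>\<^sup>2 \<le> Bd"
    proof -
      have "real (d * \<sigma>) * \<tau>\<^sup>2 \<le> S\<^sup>2 * \<tau>\<^sup>2" using dsS by (intro mult_right_mono) auto
      thus ?thesis using b(6) by linarith
    qed
    show "coprime d \<sigma>" using sq by (simp add: \<sigma>_def)
    show "real \<sigma> \<le> \<tau>\<^sup>2" using \<sigma>S St by linarith
  qed (use fin sf sfd sfs le \<sigma>S St copd cop inj b0 bBd in auto)
  also have "\<dots> \<le> u\<^sup>2 * real V + 14 * u ^ 4 * S * \<tau> ^ 3 * (of_int (gcd (j * r) (int s)) * of_int (gcd (j * r') (int s')))"
  proof -
    have "(real d * sqrt (real \<sigma>))\<^sup>2 = real (s * s')" by (simp add: \<sigma>_def d power_mult_distrib power2_eq_square)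
    hence "(real d * sqrt (real \<sigma>))\<^sup>2 \<le> S\<^sup>2" using ss by simp
    hence dS: "real d * sqrt (real \<sigma>) \<le> S" using S0 by (rule power2_le_imp_le)
    \<comment> \<open>Modulo s1 the numerator is j r s1', where s1' is a unit; the same holds with
      the roles of s1 and s1' exchanged.\<close>
    have gb: "gcd b (int \<sigma>) \<le> gcd (j * r) (int s) * gcd (j * r') (int s')"
    proof -
      have g1: "gcd b (int s1) dvd gcd (j * r) (int s)"
      proof (rule gcd_greatest)
        have "gcd b (int s1) dvd b + j * r' * int s1" by (intro dvd_add dvd_mult) auto
        also have "b + j * r' * int s1 = (j * r) * int s1'" by (simp add: b_def algebra_simps)
        finally have "gcd b (int s1) dvd (j * r) * int s1'" .
        moreover have "coprime (gcd b (int s1)) (int s1')" using cs by (meson coprime_divisors coprime_int_iff dvd_refl gcd_dvd2)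
        ultimately show "gcd b (int s1) dvd j * r" by (simp add: coprime_dvd_mult_left_iff)
        show "gcd b (int s1) dvd int s" using d1(3) by (meson dvd_trans gcd_dvd2 int_dvd_int_iff)
      qed
      have g2: "gcd b (int s1') dvd gcd (j * r') (int s')"
      proof (rule gcd_greatest)
        have "gcd b (int s1') dvd j * r * int s1' - b" by (intro dvd_diff dvd_mult) auto
        also have "j * r * int s1' - b = (j * r') * int s1" by (simp add: b_def algebra_simps)
        finally have "gcd b (int s1') dvd (j * r') * int s1" .
        moreover have "coprime (gcd b (int s1')) (int s1)" using cs by (meson coprime_commute coprime_divisors coprime_int_iff dvd_refl gcd_dvd2)
        ultimately show "gcd b (int s1') dvd j * r'" by (simp add: coprime_dvd_mult_left_iff)
        show "gcd b (int s1') dvd int s'" using d1(4) by (meson dvd_trans gcd_dvd2 int_dvd_int_iff)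
      qed
      have "gcd b (int \<sigma>) dvd gcd b (int s1) * gcd b (int s1')"
        unfolding \<sigma>_def of_nat_mult by (rule gcd_mult_dvd_mult_gcd)
      also have "\<dots> dvd gcd (j * r) (int s) * gcd (j * r') (int s')" by (intro mult_dvd_mono g1 g2)
      finally show ?thesis using pos by (intro zdvd_imp_le mult_pos_pos) auto
    qed
    hence gb': "real_of_int (gcd b (int \<sigma>)) \<le> of_int (gcd (j * r) (int s)) * of_int (gcd (j * r') (int s'))"
      by (metis of_int_le_iff of_int_mult)
    have "14 * u ^ 4 * real d * sqrt (real \<sigma>) * \<tau> ^ 3 * of_int (gcd b (int \<sigma>)) = 14 * u ^ 4 * (real d * sqrt (real \<sigma>)) * \<tau> ^ 3 * of_int (gcd b (int \<sigma>))"
      by (simp add: mult_ac)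
    also have "\<dots> \<le> 14 * u ^ 4 * S * \<tau> ^ 3 * (of_int (gcd (j * r) (int s)) * of_int (gcd (j * r') (int s')))"
      using u_ge_1 le(6) S0 by (intro mult_mono dS gb' mult_nonneg_nonneg) auto
    finally show ?thesis by simp
  qed
  finally show ?thesis .
qed

text \<open>Cauchy's inequality with (v, t1, t2) outside and (r, s) inside. Both members of a pair
  then share t1 t2, so their common modulus stays below S^2 \<tau>^2 and still factors; by
  positivity v may run over the whole interval, which makes completion possible. Having s inside
  lengthens the inner sum, so that the diagonal r s' = r' s is a small part of it.\<close>

lemma kloosterman_bilinear:
  fixes j :: int and w :: "int \<Rightarrow> complex" and \<omega> :: "int \<Rightarrow> real"
  assumes fin: "finite T1" "finite T2" "finite Ss" "finite R"
    and sf: "\<And>t. t \<in> T1 \<Longrightarrow> sfp P t" "\<And>t. t \<in> T2 \<Longrightarrow> sfp P t" "\<And>s. s \<in> Ss \<Longrightarrow> sfp P s"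
    and le: "\<And>t. t \<in> T1 \<Longrightarrow> real t \<le> \<tau>" "\<And>t. t \<in> T2 \<Longrightarrow> real t \<le> \<tau>" "\<And>s. s \<in> Ss \<Longrightarrow> real s \<le> S" "S \<le> \<tau>" "\<tau> \<ge> 1" "S \<ge> 0"
    and cop: "\<And>s t. s \<in> Ss \<Longrightarrow> t \<in> T1 \<union> T2 \<Longrightarrow> coprime s t" 
       "\<And>t1 t2. t1 \<in> T1 \<Longrightarrow> t2 \<in> T2 \<Longrightarrow> coprime t1 t2"
    and inj: "inj_on (\<lambda>(t1,t2). t1 * t2) (T1 \<times> T2)"
    and R: "0 \<notin> R" "\<And>r. r \<in> R \<Longrightarrow> real_of_int \<bar>r\<bar> \<le> R0" "\<And>r. r \<in> R \<Longrightarrow> norm (w r) \<le> \<omega> r" "\<And>r. r \<in> R \<Longrightarrow> \<omega> r \<le> M"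
    and j: "j \<noteq> 0" "\<bar>real_of_int j\<bar> * (2 * R0 * S) \<le> Bd" "S\<^sup>2 * \<tau>\<^sup>2 \<le> Bd" "\<bar>real_of_int j\<bar> * R0 \<le> Bd" "R0 * S \<le> Bd"
    and Vs: "Vs \<subseteq> {1..V}"
  shows "(norm (\<Sum>r\<in>R. w r * (\<Sum>v\<in>Vs. \<Sum>(s,t1,t2)\<in>{(s,t1,t2)\<in>Ss\<times>T1\<times>T2. coprime v (s * (t1 * t2))}. 
             ec (s * (t1 * t2)) (r * j * minv (s * (t1 * t2)) v))))\<^sup>2
    \<le> real V * \<tau>\<^sup>2 * (real V * \<tau>\<^sup>2 * u * M * S * sum \<omega> R + u\<^sup>2 * real V * S\<^sup>2 * (sum \<omega> R)\<^sup>2 + 14 * u ^ 6 * S ^ 3 * \<tau> ^ 3 * (sum \<omega> R)\<^sup>2)"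
proof -
  define \<Omega> where "\<Omega> = sum \<omega> R"
  define I where "I = R \<times> Ss"
  define X where "X = {1..V} \<times> (T1 \<times> T2)"
  define q where "q t = fst t * snd t" for t :: "nat \<times> nat"
  define f where "f = (\<lambda>(v, t). \<lambda>(r, s). if coprime v (s * q t) then w r * ec (s * q t) (r * j * minv (s * q t) v) else 0)"
  have \<omega>0: "\<omega> r \<ge> 0" if "r \<in> R" for r using R(3)[OF that] norm_ge_zero order_trans by blast
  have spos: "s > 0" if "s \<in> Ss" for s using that sf(3) sfp_pos by blast
  have finI: "finite I" and finX: "finite X" using fin by (auto simp: I_def X_def)
  have card_le: "real (card T) \<le> y" if "finite T" "\<And>t. t \<in> T \<Longrightarrow> t > 0" "\<And>t. t \<in> T \<Longrightarrow> real t \<le> y" "y \<ge> 0" for T y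
  proof -
    have "T \<subseteq> {1..nat \<lfloor>y\<rfloor>}"
    proof
      fix x assume x: "x \<in> T"
      thus "x \<in> {1..nat \<lfloor>y\<rfloor>}" using that(2)[OF x] that(3)[OF x] by (simp add: le_nat_iff le_floor_iff Suc_le_eq)
    qed
    hence "card T \<le> nat \<lfloor>y\<rfloor>" using card_mono[of "{1..nat \<lfloor>y\<rfloor>}" T] by simp
    hence "real (card T) \<le> real (nat \<lfloor>y\<rfloor>)" by simp
    also have "\<dots> \<le> y" using that(4) by (simp add: of_nat_nat)
    finally show ?thesis .
  qed
  have cardT: "real (card (T1 \<times> T2)) \<le> \<tau>\<^sup>2"
    unfolding card_cartesian_product power2_eq_square of_nat_mult using fin le
    by (intro mult_mono card_le) (auto intro: sfp_pos[OF sf(1)] sfp_pos[OF sf(2)])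
  have cardS: "real (card Ss) \<le> S" using fin le by (intro card_le) (auto intro: sfp_pos[OF sf(3)])
  have cardX: "real (card X) \<le> real V * \<tau>\<^sup>2"
    using cardT by (simp add: X_def card_cartesian_product mult_left_mono del: of_nat_mult) (simp add: mult_left_mono)
  have R0: "R0 \<ge> 0" if "R \<noteq> {}" using that R(2) by (metis abs_ge_zero all_not_in_conv of_int_0_le_iff order_trans)
  have "norm (\<Sum>r\<in>R. w r * (\<Sum>v\<in>Vs. \<Sum>(s,t1,t2)\<in>{(s,t1,t2)\<in>Ss\<times>T1\<times>T2. coprime v (s * (t1 * t2))}. 
             ec (s * (t1 * t2)) (r * j * minv (s * (t1 * t2)) v))) \<le> (\<Sum>x\<in>X. norm (\<Sum>i\<in>I. f x i))"
  proof -
    have inner: "w r * (\<Sum>(s,t1,t2)\<in>{(s,t1,t2)\<in>Ss\<times>T1\<times>T2. coprime v (s * (t1 * t2))}. ec (s * (t1 * t2)) (r * j * minv (s * (t1 * t2)) v))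
      = (\<Sum>s\<in>Ss. \<Sum>t\<in>T1\<times>T2. f (v,t) (r,s))" for r v
    proof -
      let ?A = "{(s,t1,t2)\<in>Ss\<times>T1\<times>T2. coprime v (s * (t1 * t2))}"
      have "w r * (\<Sum>(s,t1,t2)\<in>?A. ec (s * (t1 * t2)) (r * j * minv (s * (t1 * t2)) v))
        = (\<Sum>x\<in>{x\<in>Ss\<times>(T1\<times>T2). coprime v (fst x * q (snd x))}. w r * ec (fst x * q (snd x)) (r * j * minv (fst x * q (snd x)) v))"
        unfolding sum_distrib_left by (intro sum.cong) (auto simp: q_def)
      also have "\<dots> = (\<Sum>x\<in>Ss\<times>(T1\<times>T2). f (v, snd x) (r, fst x))"
        using fin by (subst sum.inter_filter) (auto simp: f_def)
      also have "\<dots> = (\<Sum>s\<in>Ss. \<Sum>t\<in>T1\<times>T2. f (v,t) (r,s))" by (simp add: sum.cartesian_product case_prod_unfold)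
      finally show "w r * (\<Sum>(s,t1,t2)\<in>?A. ec (s * (t1 * t2)) (r * j * minv (s * (t1 * t2)) v)) = (\<Sum>s\<in>Ss. \<Sum>t\<in>T1\<times>T2. f (v,t) (r,s))" .
    qed
    have "(\<Sum>r\<in>R. w r * (\<Sum>v\<in>Vs. \<Sum>(s,t1,t2)\<in>{(s,t1,t2)\<in>Ss\<times>T1\<times>T2. coprime v (s * (t1 * t2))}. 
             ec (s * (t1 * t2)) (r * j * minv (s * (t1 * t2)) v)))
       = (\<Sum>r\<in>R. \<Sum>v\<in>Vs. w r * (\<Sum>(s,t1,t2)\<in>{(s,t1,t2)\<in>Ss\<times>T1\<times>T2. coprime v (s * (t1 * t2))}. ec (s * (t1 * t2)) (r * j * minv (s * (t1 * t2)) v)))"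
      by (intro sum.cong refl sum_distrib_left)
    also have "\<dots> = (\<Sum>r\<in>R. \<Sum>v\<in>Vs. \<Sum>s\<in>Ss. \<Sum>t\<in>T1\<times>T2. f (v,t) (r,s))" by (simp only: inner)
    also have "\<dots> = (\<Sum>v\<in>Vs. \<Sum>r\<in>R. \<Sum>s\<in>Ss. \<Sum>t\<in>T1\<times>T2. f (v,t) (r,s))" by (rule sum.swap)
    also have "\<dots> = (\<Sum>v\<in>Vs. \<Sum>i\<in>I. \<Sum>t\<in>T1\<times>T2. f (v,t) i)" by (simp only: I_def sum.cartesian_product')
    also have "\<dots> = (\<Sum>v\<in>Vs. \<Sum>t\<in>T1\<times>T2. \<Sum>i\<in>I. f (v,t) i)" by (intro sum.cong refl sum.swap)
    also have "\<dots> = (\<Sum>x\<in>Vs\<times>(T1\<times>T2). \<Sum>i\<in>I. f x i)" by (simp only: sum.cartesian_product')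
    also have "norm \<dots> \<le> (\<Sum>x\<in>Vs\<times>(T1\<times>T2). norm (\<Sum>i\<in>I. f x i))" by (rule norm_sum)
    also have "\<dots> \<le> (\<Sum>x\<in>X. norm (\<Sum>i\<in>I. f x i))" using finX Vs by (intro sum_mono2) (auto simp: X_def)
    finally show ?thesis .
  qed
  hence "(norm (\<Sum>r\<in>R. w r * (\<Sum>v\<in>Vs. \<Sum>(s,t1,t2)\<in>{(s,t1,t2)\<in>Ss\<times>T1\<times>T2. coprime v (s * (t1 * t2))}. 
             ec (s * (t1 * t2)) (r * j * minv (s * (t1 * t2)) v))))\<^sup>2 \<le> (\<Sum>x\<in>X. norm (\<Sum>i\<in>I. f x i))\<^sup>2"
    by (intro power_mono) auto
  also have "\<dots> \<le> real (card X) * (\<Sum>x\<in>X. (norm (\<Sum>i\<in>I. f x i))\<^sup>2)"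
    using Cauchy_Schwarz_ineq_sum[of "\<lambda>_. 1" "\<lambda>x. norm (\<Sum>i\<in>I. f x i)" X] by simp
  also have "\<dots> \<le> (real V * \<tau>\<^sup>2) * (\<Sum>x\<in>X. (norm (\<Sum>i\<in>I. f x i))\<^sup>2)"
    using cardX by (intro mult_right_mono sum_nonneg) auto
  also have "(\<Sum>x\<in>X. (norm (\<Sum>i\<in>I. f x i))\<^sup>2) \<le> (\<Sum>i\<in>I. \<Sum>k\<in>I. norm (\<Sum>x\<in>X. f x i * cnj (f x k)))"
    by (rule square_sum_dispersion)
  also have "\<dots> \<le> (\<Sum>i\<in>I. \<Sum>k\<in>I. \<omega> (fst i) * \<omega> (fst k) * ((if fst i * int (snd k) = fst k * int (snd i) then real V * \<tau>\<^sup>2 else 0)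
       + (u\<^sup>2 * real V + 14 * u ^ 4 * S * \<tau> ^ 3 * (of_int (gcd (j * fst i) (int (snd i))) * of_int (gcd (j * fst k) (int (snd k)))))))"
  proof (intro sum_mono)
    fix i k assume ik: "i \<in> I" "k \<in> I"
    obtain r s where i: "i = (r,s)" by (cases i)
    obtain r' s' where k: "k = (r',s')" by (cases k)
    have m: "r \<in> R" "r' \<in> R" "s \<in> Ss" "s' \<in> Ss" using ik by (auto simp: I_def i k)
    define E where "E t v = ec (s * q t) (r * j * minv (s * q t) v) * cnj (ec (s' * q t) (r' * j * minv (s' * q t) v))" for t v
    define A where "A t = {v\<in>{1..V}. coprime v (s * q t) \<and> coprime v (s' * q t)}" for t
    have "(\<Sum>x\<in>X. f x i * cnj (f x k)) = (\<Sum>v\<in>{1..V}. \<Sum>t\<in>T1\<times>T2. f (v,t) i * cnj (f (v,t) k))"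
      by (simp only: X_def sum.cartesian_product')
    also have "\<dots> = (\<Sum>t\<in>T1\<times>T2. \<Sum>v\<in>{1..V}. f (v,t) i * cnj (f (v,t) k))" by (rule sum.swap)
    also have "\<dots> = (\<Sum>t\<in>T1\<times>T2. \<Sum>v\<in>A t. w r * cnj (w r') * E t v)"
    proof (rule sum.cong[OF refl])
      fix t
      have "(\<Sum>v\<in>A t. w r * cnj (w r') * E t v) = (\<Sum>v\<in>{1..V}. if coprime v (s * q t) \<and> coprime v (s' * q t) then w r * cnj (w r') * E t v else 0)"
        unfolding A_def by (rule sum.inter_filter) simp
      also have "\<dots> = (\<Sum>v\<in>{1..V}. f (v,t) i * cnj (f (v,t) k))"
        unfolding f_def i k E_def by (intro sum.cong refl) (simp only: prod.case, simp add: mult_ac del: coprime_mult_right_iff)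
      finally show "(\<Sum>v\<in>{1..V}. f (v,t) i * cnj (f (v,t) k)) = (\<Sum>v\<in>A t. w r * cnj (w r') * E t v)" ..
    qed
    also have "\<dots> = w r * cnj (w r') * (\<Sum>t\<in>T1\<times>T2. \<Sum>v\<in>A t. E t v)" by (simp add: sum_distrib_left)
    finally have e: "norm (\<Sum>x\<in>X. f x i * cnj (f x k)) = norm (w r) * norm (w r') * norm (\<Sum>t\<in>T1\<times>T2. \<Sum>v\<in>A t. E t v)"
      by (simp add: norm_mult)
    define H where "H = u\<^sup>2 * real V + 14 * u ^ 4 * S * \<tau> ^ 3 * (of_int (gcd (j * r) (int s)) * of_int (gcd (j * r') (int s')))"
    have H0: "H \<ge> 0" unfolding H_def using u_ge_1 le by (intro add_nonneg_nonneg mult_nonneg_nonneg) auto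
    have bound: "norm (\<Sum>t\<in>T1\<times>T2. \<Sum>v\<in>A t. E t v) \<le> (if r * int s' = r' * int s then real V * \<tau>\<^sup>2 else 0) + H"
    proof (cases "r * int s' = r' * int s")
      case True
      have "norm (\<Sum>t\<in>T1\<times>T2. \<Sum>v\<in>A t. E t v) \<le> (\<Sum>t\<in>T1\<times>T2. real V)"
      proof (rule sum_norm_le)
        fix t
        have "norm (\<Sum>v\<in>A t. E t v) \<le> (\<Sum>v\<in>A t. 1)" by (rule sum_norm_le) (simp add: E_def norm_mult)
        also have "\<dots> \<le> real V"
        proof -
          have "A t \<subseteq> {1..V}" by (auto simp: A_def)
          from card_mono[OF _ this] show ?thesis by simp
        qed
        finally show "norm (\<Sum>v\<in>A t. E t v) \<le> real V" .
      qed
      also have "\<dots> = real V * real (card (T1 \<times> T2))" by simp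
      also have "\<dots> \<le> real V * \<tau>\<^sup>2" using cardT by (intro mult_left_mono) auto
      finally show ?thesis using True H0 by simp
    next
      case False
      have "norm (\<Sum>t\<in>T1\<times>T2. \<Sum>v\<in>A t. E t v) \<le> (\<Sum>t\<in>T1\<times>T2. norm (\<Sum>v\<in>A t. E t v))" by (rule norm_sum)
      also have "\<dots> \<le> H" unfolding E_def A_def q_def H_def
        by (rule kloosterman_pair_average) (use fin sf m le cop inj j False R in auto)
      finally show ?thesis using False by simp
    qed
    have "norm (w r) * norm (w r') * norm (\<Sum>t\<in>T1\<times>T2. \<Sum>v\<in>A t. E t v) \<le> \<omega> r * \<omega> r' * ((if r * int s' = r' * int s then real V * \<tau>\<^sup>2 else 0) + H)"
      using m R(3) \<omega>0 by (intro mult_mono bound mult_nonneg_nonneg) auto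
    thus "norm (\<Sum>x\<in>X. f x i * cnj (f x k)) \<le> \<omega> (fst i) * \<omega> (fst k) * ((if fst i * int (snd k) = fst k * int (snd i) then real V * \<tau>\<^sup>2 else 0)
       + (u\<^sup>2 * real V + 14 * u ^ 4 * S * \<tau> ^ 3 * (of_int (gcd (j * fst i) (int (snd i))) * of_int (gcd (j * fst k) (int (snd k))))))"
      unfolding e H_def by (simp add: i k)
  qed
  also have "\<dots> = (\<Sum>i\<in>I. \<Sum>k\<in>I. \<omega> (fst i) * \<omega> (fst k) * (if fst i * int (snd k) = fst k * int (snd i) then real V * \<tau>\<^sup>2 else 0))
      + u\<^sup>2 * real V * (\<Sum>i\<in>I. \<omega> (fst i))\<^sup>2 + 14 * u ^ 4 * S * \<tau> ^ 3 * (\<Sum>i\<in>I. \<omega> (fst i) * of_int (gcd (j * fst i) (int (snd i))))\<^sup>2"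
  proof -
    have 1: "u\<^sup>2 * real V * (\<Sum>i\<in>I. \<omega> (fst i))\<^sup>2 = (\<Sum>i\<in>I. \<Sum>k\<in>I. \<omega> (fst i) * \<omega> (fst k) * (u\<^sup>2 * real V))"
      unfolding power2_eq_square[of "sum _ _"] sum_product by (simp add: sum_distrib_left mult_ac)
    have 2: "14 * u ^ 4 * S * \<tau> ^ 3 * (\<Sum>i\<in>I. \<omega> (fst i) * of_int (gcd (j * fst i) (int (snd i))))\<^sup>2
       = (\<Sum>i\<in>I. \<Sum>k\<in>I. \<omega> (fst i) * \<omega> (fst k) * (14 * u ^ 4 * S * \<tau> ^ 3 * (of_int (gcd (j * fst i) (int (snd i))) * of_int (gcd (j * fst k) (int (snd k))))))"
      unfolding power2_eq_square[of "sum _ _"] sum_product by (simp add: sum_distrib_left mult_ac)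
    show ?thesis unfolding 1 2 sum.distrib[symmetric] by (intro sum.cong refl) (simp only: distrib_left add.assoc)
  qed
  also have "\<dots> \<le> (real V * \<tau>\<^sup>2) * (M * u * (S * \<Omega>)) + u\<^sup>2 * real V * (S * \<Omega>)\<^sup>2 + 14 * u ^ 4 * S * \<tau> ^ 3 * (u * S * \<Omega>)\<^sup>2"
  proof (intro add_mono mult_left_mono power_mono)
    have s1: "(\<Sum>i\<in>I. \<omega> (fst i)) = real (card Ss) * \<Omega>"
      by (simp add: I_def \<Omega>_def sum.cartesian_product' sum_distrib_left)
    have \<Omega>0: "\<Omega> \<ge> 0" unfolding \<Omega>_def using \<omega>0 by (intro sum_nonneg)
    have s2: "(\<Sum>i\<in>I. \<omega> (fst i)) \<le> S * \<Omega>" unfolding s1 using cardS \<Omega>0 by (intro mult_right_mono) auto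
    thus "(\<Sum>i\<in>I. \<omega> (fst i)) \<le> S * \<Omega>" .
    show "0 \<le> (\<Sum>i\<in>I. \<omega> (fst i))" using \<omega>0 by (intro sum_nonneg) (auto simp: I_def)
    show "0 \<le> (\<Sum>i\<in>I. \<omega> (fst i) * of_int (gcd (j * fst i) (int (snd i))))" using \<omega>0 by (intro sum_nonneg mult_nonneg_nonneg) (auto simp: I_def)
    have "(\<Sum>i\<in>I. \<omega> (fst i) * of_int (gcd (j * fst i) (int (snd i)))) = (\<Sum>r\<in>R. \<omega> r * (\<Sum>s\<in>Ss. of_int (gcd (j * r) (int s))))"
      by (simp add: I_def sum.cartesian_product' sum_distrib_left)
    also have "\<dots> \<le> (\<Sum>r\<in>R. \<omega> r * (u * S))"
    proof (intro sum_mono mult_left_mono \<omega>0 gcd_sum)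
      fix r assume r: "r \<in> R"
      show "j * r \<noteq> 0" using j r R(1) by auto
      have "\<bar>real_of_int j\<bar> * real_of_int \<bar>r\<bar> \<le> \<bar>real_of_int j\<bar> * R0" using R(2)[OF r] by (intro mult_left_mono) auto
      thus "real_of_int \<bar>j * r\<bar> \<le> Bd" using j(4) by (simp add: abs_mult)
    qed (use fin sf le in auto)
    also have "\<dots> = u * S * \<Omega>" by (simp add: \<Omega>_def sum_distrib_left mult_ac)
    finally show "(\<Sum>i\<in>I. \<omega> (fst i) * of_int (gcd (j * fst i) (int (snd i)))) \<le> u * S * \<Omega>" .
    have "(\<Sum>i\<in>I. \<Sum>k\<in>I. \<omega> (fst i) * \<omega> (fst k) * (if fst i * int (snd k) = fst k * int (snd i) then real V * \<tau>\<^sup>2 else 0))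
      = (real V * \<tau>\<^sup>2) * (\<Sum>i\<in>I. \<Sum>k\<in>I. \<omega> (fst i) * \<omega> (fst k) * (if fst i * int (snd k) = fst k * int (snd i) then 1 else 0))"
      unfolding sum_distrib_left by (intro sum.cong refl) auto
    also have "(\<Sum>i\<in>I. \<Sum>k\<in>I. \<omega> (fst i) * \<omega> (fst k) * (if fst i * int (snd k) = fst k * int (snd i) then 1 else 0))
       = (\<Sum>r\<in>R. \<Sum>s\<in>Ss. \<Sum>r'\<in>R. \<Sum>s'\<in>Ss. \<omega> r * \<omega> r' * (if r * int s' = r' * int s then 1 else 0))"
      by (simp add: I_def sum.cartesian_product')
    also have "\<dots> = (\<Sum>r\<in>R. \<Sum>s\<in>Ss. \<Sum>s'\<in>Ss. \<Sum>r'\<in>R. \<omega> r * \<omega> r' * (if r * int s' = r' * int s then 1 else 0))"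
      by (intro sum.cong refl sum.swap)
    also have "\<dots> = (\<Sum>r\<in>R. \<Sum>s'\<in>Ss. \<Sum>s\<in>Ss. \<Sum>r'\<in>R. \<omega> r * \<omega> r' * (if r * int s' = r' * int s then 1 else 0))"
      by (intro sum.cong refl sum.swap)
    \<comment> \<open>Diagonal: for given r and s' the number s divides r s', which leaves at most
      \<open>u\<close> choices, and r' is then determined.\<close>
    also have "\<dots> \<le> (\<Sum>r\<in>R. \<Sum>s'\<in>Ss. M * u * \<omega> r)"
    proof (intro sum_mono)
      fix r s' assume r: "r \<in> R" and s': "s' \<in> Ss"
      have M0: "M \<ge> 0" using \<omega>0[OF r] R(4)[OF r] by linarith
      let ?n = "nat \<bar>r * int s'\<bar>"
      have n0: "?n > 0" using r R(1) spos[OF s'] by auto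
      have "real ?n = real_of_int \<bar>r\<bar> * real s'" by (simp add: abs_mult)
      also have "\<dots> \<le> R0 * S" using R(2)[OF r] le(3)[OF s'] R0 r by (intro mult_mono) auto
      finally have nB: "real ?n \<le> Bd" using j(5) by linarith
      have "(\<Sum>s\<in>Ss. \<Sum>r'\<in>R. \<omega> r * \<omega> r' * (if r * int s' = r' * int s then 1 else 0)) \<le> (\<Sum>s\<in>Ss. if s dvd ?n then \<omega> r * M else 0)"
      proof (intro sum_mono)
        fix s assume s: "s \<in> Ss"
        show "(\<Sum>r'\<in>R. \<omega> r * \<omega> r' * (if r * int s' = r' * int s then 1 else 0)) \<le> (if s dvd ?n then \<omega> r * M else 0)"
        proof (cases "\<exists>r0\<in>R. r * int s' = r0 * int s")
          case True
          then obtain r0 where r0: "r0 \<in> R" "r * int s' = r0 * int s" by blast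
          have iff: "r * int s' = r' * int s \<longleftrightarrow> r' = r0" for r' using r0(2) spos[OF s] by auto
          have "int s dvd r * int s'" using r0 by simp
          hence "int s dvd int ?n" by (simp only: int_nat_eq abs_ge_zero if_True dvd_abs_iff)
          hence "s dvd ?n" by (simp only: int_dvd_int_iff)
          moreover have "(\<Sum>r'\<in>R. \<omega> r * \<omega> r' * (if r * int s' = r' * int s then 1 else 0)) = \<omega> r * \<omega> r0"
          proof -
            have "(\<Sum>r'\<in>R. \<omega> r * \<omega> r' * (if r * int s' = r' * int s then 1 else 0)) = (\<Sum>r'\<in>R. if r' = r0 then \<omega> r * \<omega> r0 else 0)"
              by (intro sum.cong refl) (simp add: iff)
            thus ?thesis using r0(1) fin(4) by simp
          qed
          moreover have "\<omega> r * \<omega> r0 \<le> \<omega> r * M" using R(4)[OF r0(1)] \<omega>0[OF r] by (intro mult_left_mono)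
          ultimately show ?thesis by simp
        next
          case False
          hence "(\<Sum>r'\<in>R. \<omega> r * \<omega> r' * (if r * int s' = r' * int s then 1 else 0)) = 0" by (intro sum.neutral) auto
          thus ?thesis using \<omega>0[OF r] M0 by simp
        qed
      qed
      also have "\<dots> = real (card {s\<in>Ss. s dvd ?n}) * (\<omega> r * M)"
        using fin(3) by (subst sum.inter_filter[symmetric]) auto
      also have "\<dots> \<le> u * (\<omega> r * M)"
      proof (rule mult_right_mono)
        have "card {s\<in>Ss. s dvd ?n} \<le> card {d. d dvd ?n \<and> sfp P d}"
          using sf(3) n0 by (intro card_mono finite_subset[OF _ finite_divisors_nat[OF n0]]) auto
        thus "real (card {s\<in>Ss. s dvd ?n}) \<le> u" using div_bound[OF n0 nB] by linarith
      qed (use \<omega>0[OF r] M0 in auto)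
      finally show "(\<Sum>s\<in>Ss. \<Sum>r'\<in>R. \<omega> r * \<omega> r' * (if r * int s' = r' * int s then 1 else 0)) \<le> M * u * \<omega> r" by (simp add: mult_ac)
    qed
    also have "\<dots> = M * u * (real (card Ss) * \<Omega>)"
      unfolding \<Omega>_def sum_distrib_left by (intro sum.cong refl) simp
    also have "\<dots> \<le> M * u * (S * \<Omega>)"
    proof (cases "R = {}")
      case True thus ?thesis by (simp add: \<Omega>_def)
    next
      case False
      then obtain r where "r \<in> R" by blast
      hence "M \<ge> 0" using \<omega>0[of r] R(4)[of r] by linarith
      thus ?thesis using cardS \<Omega>0 u_ge_1 by (intro mult_left_mono mult_right_mono) auto
    qed
    finally show "(\<Sum>i\<in>I. \<Sum>k\<in>I. \<omega> (fst i) * \<omega> (fst k) * (if fst i * int (snd k) = fst k * int (snd i) then real V * \<tau>\<^sup>2 else 0)) \<le> (real V * \<tau>\<^sup>2) * (M * u * (S * \<Omega>))"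
      by (simp add: mult_left_mono)
  qed (use u_ge_1 le in auto)
  also have "\<dots> = real V * \<tau>\<^sup>2 * u * M * S * \<Omega> + u\<^sup>2 * real V * S\<^sup>2 * \<Omega>\<^sup>2 + 14 * u ^ 6 * S ^ 3 * \<tau> ^ 3 * \<Omega>\<^sup>2"
    by (simp add: power_mult_distrib power2_eq_square power3_eq_cube eval_nat_numeral mult_ac)
  finally show ?thesis by (simp add: \<Omega>_def mult_left_mono)
qed

end

section \<open>Multiples of a well approximable number\<close>

locale good_approximation =
  fixes \<alpha> :: real and q :: nat and a :: int
  assumes q_pos: "q > 0" and coprime_aq: "coprime a (int q)"
    and approx: "\<bar>\<alpha> - of_int a / real q\<bar> < 1 / (real q)\<^sup>2"
begin

lemma dn_rational_ge:
  assumes "\<not> int q dvd m"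
  shows "dn (of_int m / real q) \<ge> 1 / real q"
proof -
  obtain n where n: "dn (of_int m / real q) = \<bar>of_int m / real q - of_int n\<bar>" by (rule dn_obtain)
  have "m - n * int q \<noteq> 0" using assms by auto
  hence "1 \<le> \<bar>m - n * int q\<bar>" by linarith
  hence "1 \<le> \<bar>real_of_int (m - n * int q)\<bar>" by linarith
  hence "1 / real q \<le> \<bar>real_of_int (m - n * int q)\<bar> / real q" by (intro divide_right_mono) auto
  also have "\<dots> = dn (of_int m / real q)" 
  proof -
    have "of_int m / real q - of_int n = real_of_int (m - n * int q) / real q" using q_pos by (simp add: diff_divide_distrib)
    thus ?thesis unfolding n by simp
  qed
  finally show ?thesis .
qed

text \<open>Since q does not divide m, the fraction m a/q has distance at least 1/q from the
  integers, and passing from a/q to \<alpha> moves it by less than 1/(2q).\<close>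

lemma dn_small_multiple:
  assumes "m \<ge> 1" "real m \<le> real q / 2"
  shows "dn (real m * \<alpha>) > 1 / (2 * real q)"
proof -
  have "\<not> int q dvd int m * a"
  proof
    assume "int q dvd int m * a"
    hence "int q dvd int m" using coprime_aq by (simp add: coprime_dvd_mult_left_iff coprime_commute)
    hence "int q \<le> int m" using assms(1) by (intro zdvd_imp_le) auto
    thus False using assms(2) q_pos by linarith
  qed
  hence "1 / real q \<le> dn (of_int (int m * a) / real q)" by (rule dn_rational_ge)
  also have "of_int (int m * a) / real q = real m * \<alpha> + real m * (of_int a / real q - \<alpha>)"
    using q_pos by (simp add: field_simps)
  also have "dn \<dots> \<le> dn (real m * \<alpha>) + \<bar>real m * (of_int a / real q - \<alpha>)\<bar>" by (rule dn_triangle)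
  also have "\<bar>real m * (of_int a / real q - \<alpha>)\<bar> < real q / 2 * (1 / (real q)\<^sup>2)"
    unfolding abs_mult using assms approx q_pos
    by (intro mult_le_less_imp_less) (auto simp: abs_minus_commute)
  also have "real q / 2 * (1 / (real q)\<^sup>2) = 1 / (2 * real q)" using q_pos by (simp add: power2_eq_square)
  finally show ?thesis by (simp add: field_simps)
qed

text \<open>Over q consecutive multiples, i a runs through the residues modulo q without repetition,
  and replacing \<alpha> by a/q in the increment costs at most 1/q.\<close>

lemma block_count:
  assumes "\<Delta> \<ge> 0"
  shows "real (card {i\<in>{..<q}. dn (real (m0 + i) * \<alpha>) \<le> \<Delta>}) \<le> 2 * \<Delta> * real q + 3"
proof -
  define f where "f i = nat ((int i * a) mod int q)" for i
  define y where "y = - (real m0 * \<alpha>)"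
  let ?A = "{i\<in>{..<q}. dn (real (m0 + i) * \<alpha>) \<le> \<Delta>}"
  let ?B = "{i\<in>{..<q}. dn (real i / real q - y) \<le> \<Delta> + 1 / real q}"
  have "card ?A \<le> card ?B"
  proof (rule card_inj_on_le[of f])
    show "inj_on f ?A"
    proof (rule inj_onI)
      fix i k assume ik: "i \<in> ?A" "k \<in> ?A" "f i = f k"
      have "(int i * a) mod int q = (int k * a) mod int q" using ik(3) q_pos by (simp add: f_def nat_eq_iff)
      hence "[int i * a = int k * a] (mod int q)" by (simp add: cong_def)
      hence "[int i = int k] (mod int q)" using coprime_aq by (simp add: cong_mult_rcancel)
      thus "i = k" using ik(1,2) by (simp add: cong_def)
    qed
    show "f ` ?A \<subseteq> ?B"
    proof (rule image_subsetI)
      fix i assume i: "i \<in> ?A"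
      have "real (f i) = of_int ((int i * a) mod int q)" using q_pos by (simp add: f_def)
      also have "\<dots> = real i * of_int a - of_int ((int i * a) div int q) * real q"
        by (simp flip: minus_div_mult_eq_mod)
      finally have fe: "real (f i) = real i * of_int a - of_int ((int i * a) div int q) * real q" .
      have "real (f i) / real q - y - (real i * (of_int a / real q) + real m0 * \<alpha>) = of_int (- ((int i * a) div int q))"
        unfolding fe using q_pos by (simp add: y_def diff_divide_distrib)
      hence "dn (real (f i) / real q - y) = dn (real i * (of_int a / real q) + real m0 * \<alpha>)" by (intro dn_cong) simp
      also have "real i * (of_int a / real q) + real m0 * \<alpha> = real (m0 + i) * \<alpha> + real i * (of_int a / real q - \<alpha>)"
        by (simp add: algebra_simps)
      also have "dn \<dots> \<le> dn (real (m0 + i) * \<alpha>) + \<bar>real i * (of_int a / real q - \<alpha>)\<bar>" by (rule dn_triangle)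
      also have "\<dots> \<le> \<Delta> + 1 / real q"
      proof (rule add_mono)
        have "\<bar>real i * (of_int a / real q - \<alpha>)\<bar> \<le> real q * (1 / (real q)\<^sup>2)"
          unfolding abs_mult using i approx by (intro mult_mono) (auto simp: abs_minus_commute)
        thus "\<bar>real i * (of_int a / real q - \<alpha>)\<bar> \<le> 1 / real q" using q_pos by (simp add: power2_eq_square)
      qed (use i in auto)
      finally have "dn (real (f i) / real q - y) \<le> \<Delta> + 1 / real q" .
      moreover have "f i < q" using q_pos by (simp add: f_def nat_less_iff)
      ultimately show "f i \<in> ?B" by simp
    qed
  qed simp
  also have "real (card ?B) \<le> 2 * (\<Delta> + 1 / real q) * real q + 1" using assms by (intro card_grid_le q_pos) auto
  also have "\<dots> = 2 * \<Delta> * real q + 3" using q_pos by (simp add: distrib_right)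
  finally show ?thesis by simp
qed

lemma multiples_count:
  assumes "\<Delta> \<ge> 0" "X \<ge> 0"
  shows "finite {m::nat. 1 \<le> m \<and> real m \<le> X \<and> dn (real m * \<alpha>) \<le> \<Delta>}"
    "real (card {m::nat. 1 \<le> m \<and> real m \<le> X \<and> dn (real m * \<alpha>) \<le> \<Delta>}) \<le> (X / real q + 1) * (2 * \<Delta> * real q + 3)"
proof -
  let ?A = "{m::nat. 1 \<le> m \<and> real m \<le> X \<and> dn (real m * \<alpha>) \<le> \<Delta>}"
  define N where "N = nat \<lfloor>X / real q\<rfloor>"
  define Bk where "Bk b = (\<lambda>i. b * q + i) ` {i\<in>{..<q}. dn (real (b * q + i) * \<alpha>) \<le> \<Delta>}" for b
  have sub: "?A \<subseteq> (\<Union>b\<in>{..N}. Bk b)"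
  proof
    fix m assume m: "m \<in> ?A"
    have "real (m div q) \<le> real m / real q" by (rule of_nat_div_le_of_nat)
    also have "\<dots> \<le> X / real q" using m by (intro divide_right_mono) auto
    finally have "m div q \<le> N" by (simp add: N_def le_nat_iff le_floor_iff)
    moreover have "m \<in> Bk (m div q)" unfolding Bk_def
    proof (rule image_eqI[of _ _ "m mod q"])
      show "m = m div q * q + m mod q" by simp
      show "m mod q \<in> {i\<in>{..<q}. dn (real (m div q * q + i) * \<alpha>) \<le> \<Delta>}"
      proof -
        have "dn (real (m div q * q + m mod q) * \<alpha>) \<le> \<Delta>" using m by (simp only: div_mult_mod_eq mem_Collect_eq)
        thus ?thesis using q_pos by (simp only: mem_Collect_eq lessThan_iff mod_less_divisor)
      qed
    qed
    ultimately show "m \<in> (\<Union>b\<in>{..N}. Bk b)" by blast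
  qed
  have fin: "finite (\<Union>b\<in>{..N}. Bk b)" by (auto simp: Bk_def)
  show "finite ?A" using finite_subset[OF sub fin] .
  have "card ?A \<le> card (\<Union>b\<in>{..N}. Bk b)" by (rule card_mono[OF fin sub])
  also have "\<dots> \<le> (\<Sum>b\<in>{..N}. card (Bk b))" by (rule card_UN_le) simp
  finally have "real (card ?A) \<le> real (\<Sum>b\<in>{..N}. card (Bk b))" by (simp only: of_nat_le_iff)
  also have "\<dots> = (\<Sum>b\<in>{..N}. real (card (Bk b)))" by (simp only: of_nat_sum)
  also have "\<dots> \<le> (\<Sum>b\<in>{..N}. 2 * \<Delta> * real q + 3)"
  proof (rule sum_mono)
    fix b
    have "real (card (Bk b)) \<le> real (card {i\<in>{..<q}. dn (real (b * q + i) * \<alpha>) \<le> \<Delta>})"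
      unfolding Bk_def by (simp only: of_nat_le_iff, rule card_image_le) simp
    also have "\<dots> \<le> 2 * \<Delta> * real q + 3" by (rule block_count[OF assms(1)])
    finally show "real (card (Bk b)) \<le> 2 * \<Delta> * real q + 3" .
  qed
  also have "\<dots> = (real N + 1) * (2 * \<Delta> * real q + 3)" by simp
  also have "\<dots> \<le> (X / real q + 1) * (2 * \<Delta> * real q + 3)"
  proof (rule mult_right_mono)
    have "0 \<le> X / real q" using assms by simp
    thus "real N + 1 \<le> X / real q + 1" unfolding N_def by (simp add: of_nat_nat)
  qed (use assms in auto)
  finally show "real (card ?A) \<le> (X / real q + 1) * (2 * \<Delta> * real q + 3)" .
qed

text \<open>For small X and \<Delta> there is no such multiple at all; otherwise X/q or \<Delta> q
  is at least 1/2 and absorbs the constants of the previous bound. The bound is homogeneous of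
  degree 2: in \<open>card_near_zero\<close> both X and \<Delta> grow in proportion to g, and the
  square offsets the factor 1/g^2 for pairs of multiples of g.\<close>

lemma multiples_count_sharp:
  assumes "\<Delta> \<ge> 0" "X \<ge> 0"
  shows "real (card {m::nat. 1 \<le> m \<and> real m \<le> X \<and> dn (real m * \<alpha>) \<le> \<Delta>}) \<le> 23 * ((X / real q)\<^sup>2 + (\<Delta> * real q)\<^sup>2)"
proof (cases "X \<le> real q / 2 \<and> \<Delta> \<le> 1 / (2 * real q)")
  case True
  have "{m::nat. 1 \<le> m \<and> real m \<le> X \<and> dn (real m * \<alpha>) \<le> \<Delta>} = {}"
  proof -
    have False if "1 \<le> m" "real m \<le> X" "dn (real m * \<alpha>) \<le> \<Delta>" for m
      using dn_small_multiple[of m] that True by linarith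
    thus ?thesis by blast
  qed
  thus ?thesis by (simp only: card.empty of_nat_0) simp
next
  case False
  define x y where "x = X / real q" and "y = \<Delta> * real q"
  have xy: "x \<ge> 0" "y \<ge> 0" using assms by (auto simp: x_def y_def)
  have m: "x \<ge> 1/2 \<or> y \<ge> 1/2" using False q_pos by (auto simp: x_def y_def field_simps)
  define M where "M = max x y"
  have M: "M \<ge> 1/2" "x \<le> M" "y \<le> M" using m by (auto simp: M_def)
  have M2: "M\<^sup>2 \<le> x\<^sup>2 + y\<^sup>2" by (auto simp: M_def max_def)
  have "1/2 * M \<le> M * M" using M by (intro mult_right_mono) auto
  hence M3: "M \<le> 2 * M\<^sup>2" by (simp add: power2_eq_square)
  have "(x + 1) * (2 * y + 3) = 2 * (x * y) + 3 * x + 2 * y + 3" by (simp add: algebra_simps)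
  also have "\<dots> \<le> (x\<^sup>2 + y\<^sup>2) + 3 * M + 2 * M + 6 * M"
    using sum_squares_bound[of x y] M by simp
  also have "\<dots> = (x\<^sup>2 + y\<^sup>2) + 11 * M" by simp
  also have "\<dots> \<le> (x\<^sup>2 + y\<^sup>2) + 11 * (2 * (x\<^sup>2 + y\<^sup>2))"
    using M2 M3 by (intro add_left_mono mult_left_mono) auto
  also have "\<dots> = 23 * (x\<^sup>2 + y\<^sup>2)" by simp
  finally have "(x + 1) * (2 * y + 3) \<le> 23 * (x\<^sup>2 + y\<^sup>2)" .
  thus ?thesis using multiples_count(2)[OF assms] by (simp add: x_def y_def mult.assoc)
qed

section \<open>Dirichlet kernels at multiples of \<alpha>\<close>

definition kernel_sum :: "nat \<Rightarrow> nat \<Rightarrow> real" where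
  "kernel_sum M m = norm (\<Sum>k\<in>{1..M}. ee (real k * (real m * \<alpha>)))"

lemma kernel_sum_bounds: "0 \<le> kernel_sum M m" "kernel_sum M m \<le> real M"
proof -
  have "kernel_sum M m \<le> (\<Sum>k\<in>{1..M}. 1)" unfolding kernel_sum_def by (rule sum_norm_le) simp
  thus "kernel_sum M m \<le> real M" by simp
qed (simp add: kernel_sum_def)

text \<open>Dyadic splitting by the distance of m \<alpha> to the nearest integer. From one level to
  the next the bound for the kernel halves while the q-dependent part of the count doubles, so that
  part contributes equally on all I + 1 levels; the constant part sums geometrically.\<close>

lemma kernel_sum_total:
  assumes "M > 0" "real M \<le> 2 ^ I"
  shows "(\<Sum>m\<in>{1..D}. kernel_sum M m) \<le> (real D / real q + 1) * (2 * real q * (real I + 1) + 6 * real M)"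
proof -
  have pt: "kernel_sum M m \<le> (\<Sum>i\<in>{..I}. if dn (real m * \<alpha>) \<le> 2 ^ i / real M then real M / 2 ^ i else 0)" for m
  proof -
    define x where "x = dn (real m * \<alpha>)"
    have ex: "x \<le> 2 ^ I / real M"
    proof -
      have "x \<le> 1" using dn_le_half[of "real m * \<alpha>"] by (simp add: x_def)
      also have "1 \<le> 2 ^ I / real M" using assms by simp
      finally show ?thesis .
    qed
    define i where "i = (LEAST i. x \<le> 2 ^ i / real M)"
    have i: "x \<le> 2 ^ i / real M" "i \<le> I" unfolding i_def using ex by (auto intro: LeastI Least_le)
    have le: "kernel_sum M m \<le> real M / 2 ^ i"
    proof (cases i)
      case 0 thus ?thesis using kernel_sum_bounds by simp
    next
      case (Suc i')
      have "\<not> x \<le> 2 ^ i' / real M" using Suc not_less_Least[of i' "\<lambda>i. x \<le> 2 ^ i / real M"] by (simp add: i_def)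
      hence x: "x > 2 ^ i' / real M" by simp
      moreover have "0 < 2 ^ i' / real M" using assms by simp
      ultimately have x0: "x > 0" by linarith
      have "kernel_sum M m \<le> 1 / (2 * x)" unfolding kernel_sum_def x_def using x0 by (intro geometric_ee_bound1) (simp add: x_def)
      also have "\<dots> \<le> 1 / (2 * (2 ^ i' / real M))" using x x0 \<open>0 < 2 ^ i' / real M\<close> by (intro divide_left_mono mult_pos_pos) auto
      also have "\<dots> = real M / 2 ^ i" by (simp add: Suc)
      finally show ?thesis .
    qed
    also have "real M / 2 ^ i = (if x \<le> 2 ^ i / real M then real M / 2 ^ i else 0)" using i by simp
    also have "\<dots> \<le> (\<Sum>i\<in>{..I}. if x \<le> 2 ^ i / real M then real M / 2 ^ i else 0)"
      using i(2) by (intro member_le_sum) auto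
    finally show ?thesis by (simp add: x_def)
  qed
  have "(\<Sum>m\<in>{1..D}. kernel_sum M m) \<le> (\<Sum>m\<in>{1..D}. \<Sum>i\<in>{..I}. if dn (real m * \<alpha>) \<le> 2 ^ i / real M then real M / 2 ^ i else 0)"
    by (intro sum_mono pt)
  also have "\<dots> = (\<Sum>i\<in>{..I}. \<Sum>m\<in>{1..D}. if dn (real m * \<alpha>) \<le> 2 ^ i / real M then real M / 2 ^ i else 0)" by (rule sum.swap)
  also have "\<dots> = (\<Sum>i\<in>{..I}. real (card {m\<in>{1..D}. dn (real m * \<alpha>) \<le> 2 ^ i / real M}) * (real M / 2 ^ i))"
    by (intro sum.cong refl, subst sum.inter_filter[symmetric]) auto
  also have "\<dots> \<le> (\<Sum>i\<in>{..I}. (real D / real q + 1) * (2 * real q + 3 * real M * (1/2) ^ i))"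
  proof (intro sum_mono)
    fix i
    have "{m\<in>{1..D}. dn (real m * \<alpha>) \<le> 2 ^ i / real M} = {m. 1 \<le> m \<and> real m \<le> real D \<and> dn (real m * \<alpha>) \<le> 2 ^ i / real M}" by auto
    hence "real (card {m\<in>{1..D}. dn (real m * \<alpha>) \<le> 2 ^ i / real M}) \<le> (real D / real q + 1) * (2 * (2 ^ i / real M) * real q + 3)"
      using multiples_count(2)[of "2 ^ i / real M" "real D"] by simp
    hence "real (card {m\<in>{1..D}. dn (real m * \<alpha>) \<le> 2 ^ i / real M}) * (real M / 2 ^ i) \<le> (real D / real q + 1) * (2 * (2 ^ i / real M) * real q + 3) * (real M / 2 ^ i)"
      by (intro mult_right_mono) auto
    also have "\<dots> = (real D / real q + 1) * ((2 * (2 ^ i / real M) * real q + 3) * (real M / 2 ^ i))" by (simp only: mult.assoc)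
    also have "(2 * (2 ^ i / real M) * real q + 3) * (real M / 2 ^ i) = 2 * real q + 3 * real M * (1/2) ^ i"
      using assms by (simp add: field_simps power_divide)
    finally show "real (card {m\<in>{1..D}. dn (real m * \<alpha>) \<le> 2 ^ i / real M}) * (real M / 2 ^ i) \<le> (real D / real q + 1) * (2 * real q + 3 * real M * (1/2) ^ i)" .
  qed
  also have "\<dots> = (real D / real q + 1) * (2 * real q * (real I + 1) + 3 * real M * (\<Sum>i\<le>I. (1/2) ^ i))"
  proof -
    have "(\<Sum>i\<in>{..I}. 2 * real q + 3 * real M * (1/2) ^ i) = 2 * real q * (real I + 1) + 3 * real M * (\<Sum>i\<le>I. (1/2) ^ i)"
      unfolding sum.distrib sum_distrib_left[symmetric] by (simp add: algebra_simps)
    thus ?thesis by (simp only: sum_distrib_left[symmetric])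
  qed
  also have "\<dots> \<le> (real D / real q + 1) * (2 * real q * (real I + 1) + 3 * real M * 2)"
  proof -
    have "(\<Sum>i\<le>I. (1/2::real) ^ i) \<le> 2" by (simp add: sum_gp0)
    thus ?thesis by (intro mult_left_mono add_left_mono) auto
  qed
  finally show ?thesis by simp
qed

end

section \<open>Pairs of multiples close to integers\<close>

text \<open>In the notation t, t', j of the proof, g x minus the fraction is congruent to - t/l1,
  and - t/l1 = - j/(l1 l1') - t'/l1'. So it lies in two intervals of half-length \<delta>/L1,
  centred at 0 and at - j/(l1 l1'). Their intersection shrinks as |j| grows, and replacing l1 l1' by
  its upper bound \<kappa> L1^2 encloses it in an interval free of l and l'. For j = 0 the integer b
  is divisible by l1, so g x itself is close to the integer b/l1.\<close>

lemma pair_geometry: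
  fixes l l' :: nat and x \<delta> L0 \<kappa> :: real
  assumes l: "l > 0" "l' > 0" and L0: "L0 > 0" "L0 \<le> real l" "L0 \<le> real l'" "real l * real l' \<le> \<kappa> * L0\<^sup>2"
    and d: "dn (real l * x) \<le> \<delta>" "dn (real l' * x) \<le> \<delta>"
  defines "g \<equiv> gcd l l'"
  defines "l1 \<equiv> l div g" and "l1' \<equiv> l' div g" and "L1 \<equiv> L0 / real g"
  shows "dn (real g * x) \<le> real g * \<delta> / L0 \<or> 
    (\<exists>j::int. j \<noteq> 0 \<and> \<bar>real_of_int j\<bar> \<le> \<delta> * (real l1 + real l1') \<and> 
       dn (real g * x - of_int (j * minv l1 l1') / real l1 - (- (of_int j / (2 * \<kappa> * L1\<^sup>2)))) \<le> \<delta> / L1 - \<bar>of_int j\<bar> / (2 * \<kappa> * L1\<^sup>2))"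
proof -
  have g: "g > 0" using l by (simp add: g_def)
  have ll: "l = g * l1" "l' = g * l1'" by (simp_all add: l1_def l1'_def g_def)
  have p: "l1 > 0" "l1' > 0" using l ll by auto
  have cop: "coprime l1 l1'" unfolding l1_def l1'_def g_def using l by (intro div_gcd_coprime) auto
  have L1: "L1 > 0" "L1 \<le> real l1" "L1 \<le> real l1'" "real l1 * real l1' \<le> \<kappa> * L1\<^sup>2"
  proof -
    show "L1 > 0" using L0 g by (simp add: L1_def)
    show "L1 \<le> real l1" "L1 \<le> real l1'" using L0(2,3) g by (simp_all add: L1_def ll field_simps)
    have "(real g)\<^sup>2 * (real l1 * real l1') \<le> \<kappa> * L0\<^sup>2" using L0(4) by (simp add: ll power2_eq_square mult_ac)
    thus "real l1 * real l1' \<le> \<kappa> * L1\<^sup>2" using g by (simp add: L1_def power_divide field_simps)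
  qed
  have \<delta>0: "\<delta> \<ge> 0" using d(1) dn_nonneg order_trans by blast
  obtain b where b: "dn (real l * x) = \<bar>real l * x - of_int b\<bar>" by (rule dn_obtain)
  obtain b' where b': "dn (real l' * x) = \<bar>real l' * x - of_int b'\<bar>" by (rule dn_obtain)
  define t t' where "t = of_int b - real l * x" and "t' = of_int b' - real l' * x"
  have t: "\<bar>t\<bar> \<le> \<delta>" "\<bar>t'\<bar> \<le> \<delta>" using d b b' by (auto simp: t_def t'_def abs_minus_commute)
  define j where "j = b * int l1' - b' * int l1"
  have je: "real_of_int j = real l1' * t - real l1 * t'"
    by (simp add: j_def t_def t'_def ll algebra_simps)
  show ?thesis
  proof (cases "j = 0")
    case True
    have "int l1 dvd b * int l1'" using True by (simp add: j_def)
    hence "int l1 dvd b" using cop by (simp add: coprime_dvd_mult_left_iff)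
    then obtain i where i: "b = int l1 * i" by (rule dvdE)
    have "real l1 * (real g * x - of_int i) = - t" by (simp add: t_def i ll algebra_simps)
    hence "real l1 * \<bar>real g * x - of_int i\<bar> = \<bar>t\<bar>" 
    proof -
      assume "real l1 * (real g * x - of_int i) = - t"
      hence "\<bar>real l1 * (real g * x - of_int i)\<bar> = \<bar>t\<bar>" by simp
      thus ?thesis by (simp only: abs_mult abs_of_nat)
    qed
    hence "\<bar>real g * x - of_int i\<bar> = \<bar>t\<bar> / real l1" using p by (simp add: field_simps)
    hence "dn (real g * x) \<le> \<bar>t\<bar> / real l1" using dn_le[of "real g * x" i] by simp
    also have "\<dots> \<le> \<delta> / L1" using t L1 by (intro frac_le) auto
    finally show ?thesis using g by (simp add: L1_def mult.commute)
  next
    case False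
    have jb: "\<bar>real_of_int j\<bar> \<le> \<delta> * (real l1 + real l1')"
    proof -
      have "\<bar>real_of_int j\<bar> \<le> \<bar>real l1' * t\<bar> + \<bar>real l1 * t'\<bar>" unfolding je by (rule abs_triangle_ineq4)
      also have "\<dots> = real l1' * \<bar>t\<bar> + real l1 * \<bar>t'\<bar>" by (simp add: abs_mult)
      also have "\<dots> \<le> real l1' * \<delta> + real l1 * \<delta>" using t by (intro add_mono mult_left_mono) auto
      finally show ?thesis by (simp add: algebra_simps)
    qed
    have "[int l1' * minv l1 l1' = 1] (mod int l1)" using cop by (intro minv_cong) (simp add: coprime_commute)
    hence "[j * (int l1' * minv l1 l1') = j * 1] (mod int l1)" by (rule cong_mult[OF cong_refl])
    moreover have "[j = b * int l1'] (mod int l1)" by (simp add: j_def cong_iff_dvd_diff)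
    ultimately have "[int l1' * (j * minv l1 l1') = int l1' * b] (mod int l1)"
    proof -
      assume a: "[j * (int l1' * minv l1 l1') = j * 1] (mod int l1)" "[j = b * int l1'] (mod int l1)"
      have "[j * (int l1' * minv l1 l1') = b * int l1'] (mod int l1)" using a by (auto intro: cong_trans)
      thus ?thesis by (simp only: mult_ac)
    qed
    hence "[j * minv l1 l1' = b] (mod int l1)" using cop by (simp add: cong_mult_lcancel coprime_commute)
    hence "int l1 dvd b - j * minv l1 l1'" by (simp add: cong_iff_dvd_diff dvd_diff_commute)
    then obtain i where i: "b - j * minv l1 l1' = int l1 * i" by (rule dvdE)
    define c where "c = 1 / (2 * \<kappa> * L1\<^sup>2)"
    define y where "y = of_int j * c"
    have "b = j * minv l1 l1' + int l1 * i" using i by simp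
    hence "real_of_int b = real_of_int (j * minv l1 l1' + int l1 * i)" by (rule arg_cong)
    hence b_eq: "real_of_int b = of_int (j * minv l1 l1') + real l1 * of_int i" by simp
    have "real g * x - of_int (j * minv l1 l1') / real l1 - of_int i = - t / real l1"
    proof -
      have "real l1 * (real g * x - of_int (j * minv l1 l1') / real l1 - of_int i) = real l1 * (real g * x) - (of_int (j * minv l1 l1') + real l1 * of_int i)"
        using p by (simp add: algebra_simps)
      also have "\<dots> = - t" unfolding b_eq[symmetric] by (simp add: t_def ll algebra_simps)
      finally show ?thesis using p by (simp add: field_simps)
    qed
    hence e: "real g * x - of_int (j * minv l1 l1') / real l1 - (- y) = (- t / real l1 + y) + of_int i" by simp
    have "dn (real g * x - of_int (j * minv l1 l1') / real l1 - (- y)) = dn (- t / real l1 + y)" unfolding e by (rule dn_add_int) simp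
    also have "\<dots> \<le> \<bar>- t / real l1 + y\<bar>" using dn_le[of _ 0] by simp
    also have "\<dots> \<le> \<delta> / L1 - \<bar>of_int j\<bar> * c"
    proof -
      have llpos: "real l1 * real l1' > 0" using p by simp
      hence kpos: "\<kappa> * L1\<^sup>2 > 0" using L1(4) by linarith
      have c0: "c \<ge> 0" using kpos by (simp add: c_def mult.assoc)
      have c2: "2 * c \<le> 1 / (real l1 * real l1')"
      proof -
        have "2 * c = 1 / (\<kappa> * L1\<^sup>2)" by (simp add: c_def)
        also have "\<dots> \<le> 1 / (real l1 * real l1')" using L1(4) llpos kpos by (intro divide_left_mono) auto
        finally show ?thesis .
      qed
      have te: "- t / real l1 = - (of_int j / (real l1 * real l1')) - t' / real l1'"
        using p je by (simp add: field_simps)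
      have t1: "\<bar>t / real l1\<bar> \<le> \<delta> / L1" unfolding abs_divide using t L1 by (intro frac_le) auto
      have t2: "\<bar>t' / real l1'\<bar> \<le> \<delta> / L1" unfolding abs_divide using t L1 by (intro frac_le) auto
      have jc: "\<bar>real_of_int j\<bar> * (2 * c) \<le> \<bar>real_of_int j\<bar> / (real l1 * real l1')"
        using mult_left_mono[OF c2, of "\<bar>real_of_int j\<bar>"] by simp
      have t1': "- t / real l1 \<le> \<delta> / L1" "- (\<delta> / L1) \<le> - t / real l1" using t1 unfolding minus_divide_left[symmetric] by linarith+
      have t2': "- (t' / real l1') \<le> \<delta> / L1" "- (\<delta> / L1) \<le> - (t' / real l1')" using t2 by linarith+
      show ?thesis
      proof (cases "j > 0")
        case True
        hence jn: "\<bar>real_of_int j\<bar> = real_of_int j" by simp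
        have jy: "\<bar>real_of_int j\<bar> * c = y" "\<bar>real_of_int j\<bar> * (2 * c) = 2 * y" unfolding jn y_def by simp_all
        have "- t / real l1 \<le> - (2 * y) + \<delta> / L1" using te t2' jc unfolding jy unfolding jn by linarith
        thus ?thesis using t1' unfolding jy abs_le_iff by (intro conjI; linarith)
      next
        case F: False
        hence jn: "\<bar>real_of_int j\<bar> = - real_of_int j" by simp
        have jy: "\<bar>real_of_int j\<bar> * c = - y" "\<bar>real_of_int j\<bar> * (2 * c) = - (2 * y)" unfolding jn y_def by simp_all
        have "- t / real l1 \<ge> - (2 * y) - \<delta> / L1" using te t2' jc unfolding jy unfolding jn minus_divide_left[symmetric] by linarith
        thus ?thesis using t1' unfolding jy abs_le_iff by (intro conjI; linarith)
      qed
    qed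
    finally show ?thesis using False jb unfolding y_def c_def by (intro disjI2 exI[of _ j]) simp
  qed
qed

text \<open>Comparison with the area of a triangle: the terms are bounded by the decrease over unit
  steps of the squared positive part of A - \<beta> t divided by 2 \<beta>. The constant has to be
  sharp, as this sum becomes the main term of the second moment.\<close>

lemma trapezoid_sum:
  fixes A \<beta> :: real
  assumes "\<beta> > 0" "A \<ge> 0"
  shows "(\<Sum>j\<in>{1..N::nat}. max 0 (A - \<beta> * real j)) \<le> A\<^sup>2 / (2 * \<beta>)"
proof -
  define F where "F t = (max 0 (A - \<beta> * real t))\<^sup>2 / (2 * \<beta>)" for t :: nat
  have step: "max 0 (A - \<beta> * real (Suc t)) \<le> F t - F (Suc t)" for t
  proof (cases "A - \<beta> * real (Suc t) > 0")
    case True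
    define w where "w = A - \<beta> * real (Suc t)"
    have "A - \<beta> * real t = w + \<beta>" by (simp add: w_def algebra_simps)
    hence "F t - F (Suc t) = ((w + \<beta>)\<^sup>2 - w\<^sup>2) / (2 * \<beta>)" using True assms by (simp add: F_def w_def diff_divide_distrib)
    also have "\<dots> = w + \<beta> / 2" using assms by (simp add: power2_eq_square field_simps)
    finally show ?thesis using True assms by (simp add: w_def)
  next
    case False
    hence "F (Suc t) = 0" by (simp add: F_def)
    moreover have "F t \<ge> 0" using assms by (simp add: F_def)
    ultimately show ?thesis using False by simp
  qed
  have "(\<Sum>j\<in>{1..N}. max 0 (A - \<beta> * real j)) \<le> F 0 - F N"
  proof (induction N)
    case (Suc N)
    have "(\<Sum>j\<in>{1..Suc N}. max 0 (A - \<beta> * real j)) = (\<Sum>j\<in>{1..N}. max 0 (A - \<beta> * real j)) + max 0 (A - \<beta> * real (Suc N))"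
      by simp
    thus ?case using step[of N] Suc by linarith
  qed simp
  also have "\<dots> \<le> A\<^sup>2 / (2 * \<beta>)" using assms by (simp add: F_def)
  finally show ?thesis .
qed

lemma sum_symmetric_int:
  fixes f :: "nat \<Rightarrow> real"
  shows "(\<Sum>r\<in>{- int D..int D} - {0}. f (nat \<bar>r\<bar>)) = 2 * (\<Sum>r\<in>{1..D}. f r)"
proof -
  have e: "{- int D..int D} - {0} = {1..int D} \<union> {- int D..-1}" by auto
  have "(\<Sum>r\<in>{- int D..int D} - {0}. f (nat \<bar>r\<bar>)) = (\<Sum>r\<in>{1..int D}. f (nat \<bar>r\<bar>)) + (\<Sum>r\<in>{- int D..-1}. f (nat \<bar>r\<bar>))"
    unfolding e by (rule sum.union_disjoint) auto
  also have "(\<Sum>r\<in>{1..int D}. f (nat \<bar>r\<bar>)) = (\<Sum>r\<in>{1..D}. f r)"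
    by (rule sum.reindex_bij_witness[of _ int nat]) auto
  also have "(\<Sum>r\<in>{- int D..-1}. f (nat \<bar>r\<bar>)) = (\<Sum>r\<in>{1..D}. f r)"
    by (rule sum.reindex_bij_witness[of _ "\<lambda>r. - int r" "\<lambda>r. nat (- r)"]) auto
  finally show ?thesis by simp
qed

lemma trapezoid_sum_int:
  fixes A \<beta> :: real
  assumes "\<beta> > 0" "A \<ge> 0" "finite J" "0 \<notin> J"
  shows "(\<Sum>j\<in>J. max 0 (A - \<beta> * \<bar>real_of_int j\<bar>)) \<le> A\<^sup>2 / \<beta>"
proof -
  obtain N :: nat where N: "\<And>j. j \<in> J \<Longrightarrow> \<bar>j\<bar> \<le> int N"
  proof
    fix j assume "j \<in> J"
    hence "nat \<bar>j\<bar> \<le> Max ((\<lambda>j. nat \<bar>j\<bar>) ` J)" using assms(3) by (intro Max_ge) auto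
    thus "\<bar>j\<bar> \<le> int (Max ((\<lambda>j. nat \<bar>j\<bar>) ` J))" by linarith
  qed
  have "(\<Sum>j\<in>J. max 0 (A - \<beta> * \<bar>real_of_int j\<bar>)) \<le> (\<Sum>j\<in>{- int N..int N} - {0}. max 0 (A - \<beta> * \<bar>real_of_int j\<bar>))"
  proof (intro sum_mono2)
    show "J \<subseteq> {- int N..int N} - {0}"
    proof
      fix j assume j: "j \<in> J"
      thus "j \<in> {- int N..int N} - {0}" using N[OF j] assms(4) by (cases "j = 0") auto
    qed
  qed auto
  also have "\<dots> = (\<Sum>j\<in>{- int N..int N} - {0}. max 0 (A - \<beta> * real (nat \<bar>j\<bar>)))" by simp
  also have "\<dots> = 2 * (\<Sum>j\<in>{1..N}. max 0 (A - \<beta> * real j))" by (rule sum_symmetric_int)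
  also have "\<dots> \<le> 2 * (A\<^sup>2 / (2 * \<beta>))" using assms by (intro mult_left_mono trapezoid_sum) auto
  finally show ?thesis by simp
qed

section \<open>Integers composed of primes from disjoint sets\<close>

lemma sfp_coprime:
  assumes "sfp A x" "sfp B y" "A \<inter> B = {}"
  shows "coprime x y"
proof (rule ccontr)
  assume "\<not> coprime x y"
  hence "gcd x y \<noteq> 1" using coprime_iff_gcd_eq_1 by blast
  then obtain p where p: "prime p" "p dvd gcd x y" using prime_factor_nat by blast
  hence d: "p dvd x" "p dvd y" by (auto intro: dvd_trans)
  have "p \<in> prime_factors x" "p \<in> prime_factors y"
    using p(1) d sfp_pos[OF assms(1)] sfp_pos[OF assms(2)] by (simp_all add: prime_factors_dvd)
  hence "p \<in> A" "p \<in> B" using assms(1,2) unfolding sfp_def by blast+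
  thus False using assms(3) by blast
qed

lemma sfp_mono: "sfp A x \<Longrightarrow> A \<subseteq> B \<Longrightarrow> sfp B x"
  by (auto simp: sfp_def)

lemma triple_product_inj:
  assumes "A \<inter> B = {}" "A \<inter> C = {}" "B \<inter> C = {}"
    "sfp A s" "sfp B t" "sfp C w" "sfp A s'" "sfp B t'" "sfp C w'" "s * (t * w) = s' * (t' * w')"
  shows "s = s'" "t = t'" "w = w'"
proof -
  have c: "coprime s t'" "coprime s w'" "coprime s' t" "coprime s' w" "coprime t w'" "coprime t' w"
    using sfp_coprime[OF assms(4,8,1)] sfp_coprime[OF assms(4,9,2)] sfp_coprime[OF assms(7,5,1)]
      sfp_coprime[OF assms(7,6,2)] sfp_coprime[OF assms(5,9,3)] sfp_coprime[OF assms(8,6,3)] by simp_all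
  have "s dvd s' * (t' * w')" unfolding assms(10)[symmetric] by simp
  hence 1: "s dvd s'" using c by (simp add: coprime_dvd_mult_left_iff)
  have "s' dvd s * (t * w)" unfolding assms(10) by simp
  hence 2: "s' dvd s" using c by (simp add: coprime_dvd_mult_left_iff)
  show s: "s = s'" using 1 2 dvd_antisym by blast
  hence e: "t * w = t' * w'" using assms(10) sfp_pos[OF assms(4)] by simp
  have "t dvd t' * w'" unfolding e[symmetric] by simp
  hence 1: "t dvd t'" using c by (simp add: coprime_dvd_mult_left_iff)
  have "t' dvd t * w" unfolding e by simp
  hence 2: "t' dvd t" using c by (simp add: coprime_dvd_mult_left_iff)
  show t: "t = t'" using 1 2 dvd_antisym by blast
  thus "w = w'" using e sfp_pos[OF assms(5)] by simp
qed

section \<open>First moment\<close>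

lemma sum_fibre_le:
  fixes F :: "'b \<Rightarrow> real"
  assumes "finite A" "finite B" "f ` A \<subseteq> B" "\<And>b. b \<in> B \<Longrightarrow> 0 \<le> F b" 
    "\<And>b. b \<in> B \<Longrightarrow> real (card {a\<in>A. f a = b}) \<le> K"
  shows "(\<Sum>a\<in>A. F (f a)) \<le> K * (\<Sum>b\<in>B. F b)"
proof -
  have "(\<Sum>a\<in>A. F (f a)) = (\<Sum>b\<in>B. \<Sum>a | a \<in> A \<and> f a = b. F (f a))"
    by (rule sum.group[symmetric]) (use assms in auto)
  also have "\<dots> = (\<Sum>b\<in>B. real (card {a\<in>A. f a = b}) * F b)" by (intro sum.cong refl) simp
  also have "\<dots> \<le> (\<Sum>b\<in>B. K * F b)" using assms by (intro sum_mono mult_right_mono) auto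
  finally show ?thesis by (simp add: sum_distrib_left)
qed

text \<open>Bernoulli's inequality bounds (1 - x)^6 from below, and (1 + x)^6 (1 - x)^6 \<le> 1
  converts this into an upper bound.\<close>

lemma one_plus_power6_le:
  fixes x :: real
  assumes "0 \<le> x" "x \<le> 1/42"
  shows "(1 + x) ^ 6 \<le> 1 + 7 * x"
proof -
  have "1 + real 6 * (- x) \<le> (1 + - x) ^ 6" by (rule Bernoulli_inequality) (use assms in auto)
  hence b: "1 - 6 * x \<le> (1 - x) ^ 6" by simp
  have "(1 + x) ^ 6 * (1 - 6 * x) \<le> (1 + x) ^ 6 * (1 - x) ^ 6" using assms b by (intro mult_left_mono) auto
  also have "\<dots> = (1 - x\<^sup>2) ^ 6" by (simp add: power_mult_distrib[symmetric] power2_eq_square algebra_simps)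
  also have "\<dots> \<le> 1" using assms by (intro power_le_one) (auto simp: power2_eq_square mult_le_one)
  also have "1 \<le> (1 + 7 * x) * (1 - 6 * x)"
  proof -
    have "42 * (x * x) \<le> x" using assms mult_right_mono[of "42 * x" 1 x] by simp
    thus ?thesis by (simp add: algebra_simps)
  qed
  finally show ?thesis using assms by (simp add: mult_le_cancel_right)
qed

text \<open>The sizes balance the error terms, with room for a bounded power of \<open>u\<close>
  to be lost in each step. Restricting the factors to windows of ratio \<open>1 + 1/u^2\<close> makes all \<open>l\<close> nearly equal,
  without which the second moment would not be asymptotically sharp.\<close>

locale smooth_setup = good_approximation \<alpha> q a + divisor_bounded P u Bd
  for \<alpha> :: real and q :: nat and a :: int and P :: "nat set" and u Bd :: real +
  fixes PS P1 P2 Ss T1 T2 :: "nat set" and s0 t10 t20 :: real and M I :: nat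
  assumes u_big: "u \<ge> 1000000"
    and Bd_eq: "Bd = u ^ 200000" and q_eq: "real q = u ^ 46000"
    and M_eq: "M = nat \<lfloor>u ^ 43940\<rfloor>"
    and I_ge: "u ^ 50000 \<le> 2 ^ I" and I_le: "real I + 1 \<le> u"
    and P_sub: "PS \<subseteq> P" "P1 \<subseteq> P" "P2 \<subseteq> P"
    and disj: "PS \<inter> P1 = {}" "PS \<inter> P2 = {}" "P1 \<inter> P2 = {}"
    and fin: "finite Ss" "finite T1" "finite T2"
    and sfS: "\<And>s. s \<in> Ss \<Longrightarrow> sfp PS s" and sfT1: "\<And>t. t \<in> T1 \<Longrightarrow> sfp P1 t" and sfT2: "\<And>t. t \<in> T2 \<Longrightarrow> sfp P2 t"
    and leS: "\<And>s. s \<in> Ss \<Longrightarrow> real s \<le> u ^ 6020" and leT1: "\<And>t. t \<in> T1 \<Longrightarrow> real t \<le> u ^ 9020" and leT2: "\<And>t. t \<in> T2 \<Longrightarrow> real t \<le> u ^ 9020"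
    and pos0: "s0 > 0" "t10 > 0" "t20 > 0"
    and winS: "\<And>s. s \<in> Ss \<Longrightarrow> s0 \<le> real s \<and> real s \<le> (1 + 1/u\<^sup>2) * s0"
    and winT1: "\<And>t. t \<in> T1 \<Longrightarrow> t10 \<le> real t \<and> real t \<le> (1 + 1/u\<^sup>2) * t10"
    and winT2: "\<And>t. t \<in> T2 \<Longrightarrow> t20 \<le> real t \<and> real t \<le> (1 + 1/u\<^sup>2) * t20"
    and cardS: "u ^ 6016 \<le> real (card Ss)" and cardT1: "u ^ 9016 \<le> real (card T1)" and cardT2: "u ^ 9016 \<le> real (card T2)"
begin

section \<open>The moduli \<open>LL\<close>: sizes, multiples and divisors\<close>

definition \<delta> :: real where "\<delta> = 1 / u ^ 24000"
definition LL :: "nat set" where "LL = (\<lambda>(s,t1,t2). s * (t1 * t2)) ` (Ss \<times> T1 \<times> T2)"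
definition L0 :: real where "L0 = s0 * (t10 * t20)"

lemma u_pos: "u > 0" and u1: "u \<ge> 1" using u_big by auto

lemma pw: "m \<le> n \<Longrightarrow> u ^ m \<le> u ^ n" using u1 by (rule power_increasing[rotated])

lemma upow_mult_mono:
  assumes "x \<le> u ^ m" "y \<le> u ^ n" "0 \<le> y"
  shows "x * y \<le> u ^ (m + n)"
  using assms u_pos by (simp add: power_add mult_mono)

lemma const_le: "c \<le> u ^ n" if "c \<le> 1000000" "n > 0"
proof -
  have "u ^ 1 \<le> u ^ n" using that by (intro pw) auto
  thus ?thesis using u_big that by simp
qed

lemma const_upow: "c * u ^ n \<le> u ^ (n + 1)" if "c \<le> 1000000"
  using mult_right_mono[of c u "u ^ n"] u_big u_pos that by simp

lemma \<delta>_pos: "\<delta> > 0" using u_pos by (simp add: \<delta>_def)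

lemma M_le: "real M \<le> u ^ 43940" unfolding M_eq using u_pos by (simp add: of_nat_nat)

lemma M_ge: "u ^ 43939 \<le> real M"
proof -
  have "u ^ 43940 - 1 \<le> of_int \<lfloor>u ^ 43940\<rfloor>" by linarith
  also have "\<dots> = real M" unfolding M_eq using u_pos by (simp add: of_nat_nat)
  finally have "u ^ 43940 \<le> real M + 1" by simp
  moreover have "2 * u ^ 43939 \<le> u ^ 43940" using const_upow[of 2 43939] by simp
  moreover have "1 \<le> u ^ 43939" using u1 by simp
  ultimately show ?thesis by linarith
qed

lemma M_pos: "M > 0" using M_ge u_pos zero_less_power[OF u_pos, of 43939] by (intro Nat.gr0I) auto

lemma finite_LL: "finite LL" using fin by (simp add: LL_def)

lemma LL_E:
  assumes "l \<in> LL"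
  obtains s t1 t2 where "s \<in> Ss" "t1 \<in> T1" "t2 \<in> T2" "l = s * (t1 * t2)"
  using assms by (auto simp: LL_def)

lemma coprime_st:
  assumes "s \<in> Ss" "t1 \<in> T1" "t2 \<in> T2"
  shows "coprime s t1" "coprime s t2" "coprime t1 t2"
  using sfp_coprime[OF sfS[OF assms(1)] sfT1[OF assms(2)] disj(1)] sfp_coprime[OF sfS[OF assms(1)] sfT2[OF assms(3)] disj(2)]
    sfp_coprime[OF sfT1[OF assms(2)] sfT2[OF assms(3)] disj(3)] by auto

lemma sfp_LL: "l \<in> LL \<Longrightarrow> sfp P l"
proof (elim LL_E)
  fix s t1 t2 assume a: "s \<in> Ss" "t1 \<in> T1" "t2 \<in> T2" "l = s * (t1 * t2)"
  have "sfp P s" "sfp P t1" "sfp P t2"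
    using sfp_mono[OF sfS[OF a(1)] P_sub(1)] sfp_mono[OF sfT1[OF a(2)] P_sub(2)] sfp_mono[OF sfT2[OF a(3)] P_sub(3)] by auto
  hence "sfp P (s * (t1 * t2))" using coprime_st[OF a(1-3)] by (intro sfp_mult) auto
  thus "sfp P l" using a(4) by simp
qed

lemma LL_pos: "l \<in> LL \<Longrightarrow> l > 0" using sfp_LL sfp_pos by blast

lemma inv_u2: "0 \<le> 1/u\<^sup>2" "1/u\<^sup>2 \<le> 1/1000000"
proof -
  have "1000000 * 1 \<le> u * u" using u_big by (intro mult_mono) auto
  thus "1/u\<^sup>2 \<le> 1/1000000" by (intro divide_left_mono) (auto simp: power2_eq_square u_pos)
qed simp

lemma L0_pos: "L0 > 0" using pos0 by (simp add: L0_def)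

lemma LL_window:
  assumes "l \<in> LL"
  shows "L0 \<le> real l" "real l \<le> (1 + 1/u\<^sup>2) ^ 3 * L0" "real l \<le> 2 * L0" "real l \<le> u ^ 24060"
proof -
  from assms obtain s t1 t2 where a: "s \<in> Ss" "t1 \<in> T1" "t2 \<in> T2" "l = s * (t1 * t2)" by (rule LL_E)
  define k where "k = 1 + 1/u\<^sup>2"
  have k: "k \<ge> 1" using inv_u2 by (simp add: k_def)
  have w: "s0 \<le> real s" "real s \<le> k * s0" "t10 \<le> real t1" "real t1 \<le> k * t10" "t20 \<le> real t2" "real t2 \<le> k * t20"
    using winS[OF a(1)] winT1[OF a(2)] winT2[OF a(3)] by (auto simp: k_def)
  show "L0 \<le> real l" unfolding a(4) L0_def of_nat_mult using w pos0 by (intro mult_mono) auto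
  have "real l \<le> (k * s0) * ((k * t10) * (k * t20))" unfolding a(4) of_nat_mult using w pos0 k by (intro mult_mono) auto
  also have "\<dots> = k ^ 3 * L0" by (simp add: L0_def power3_eq_cube mult_ac)
  finally show 1: "real l \<le> (1 + 1/u\<^sup>2) ^ 3 * L0" by (simp add: k_def)
  have "(1 + 1/u\<^sup>2) ^ 3 \<le> (1 + 1/u\<^sup>2) ^ 6" using inv_u2 by (intro power_increasing) auto
  also have "\<dots> \<le> 1 + 7 * (1/u\<^sup>2)" using inv_u2 by (intro one_plus_power6_le) auto
  also have "\<dots> \<le> 2" using inv_u2 by auto
  finally have "(1 + 1/u\<^sup>2) ^ 3 * L0 \<le> 2 * L0" using L0_pos by (intro mult_right_mono) auto
  thus "real l \<le> 2 * L0" using 1 by linarith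
  have "real s * (real t1 * real t2) \<le> u ^ (6020 + (9020 + 9020))"
    using leS[OF a(1)] leT1[OF a(2)] leT2[OF a(3)] by (intro upow_mult_mono) auto
  thus "real l \<le> u ^ 24060" using a(4) by simp
qed

lemma card_LL: "card LL = card Ss * (card T1 * card T2)"
proof -
  have "inj_on (\<lambda>(s,t1,t2). s * (t1 * t2)) (Ss \<times> T1 \<times> T2)"
  proof (rule inj_onI)
    fix x y assume xy: "x \<in> Ss \<times> T1 \<times> T2" "y \<in> Ss \<times> T1 \<times> T2" "(\<lambda>(s,t1,t2). s * (t1 * t2)) x = (\<lambda>(s,t1,t2). s * (t1 * t2)) y"
    obtain s t w where x: "x = (s,t,w)" by (cases x)
    obtain s' t' w' where y: "y = (s',t',w')" by (cases y)
    have "s = s'" "t = t'" "w = w'"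
      using xy triple_product_inj[OF disj, of s t w s' t' w'] sfS sfT1 sfT2 by (auto simp: x y)
    thus "x = y" by (simp add: x y)
  qed
  thus ?thesis unfolding LL_def by (simp add: card_image card_cartesian_product)
qed

lemma card_LL_ge: "u ^ 24048 \<le> real (card LL)"
proof -
  have "u ^ 6016 * (u ^ 9016 * u ^ 9016) \<le> real (card Ss) * (real (card T1) * real (card T2))"
    using cardS cardT1 cardT2 u_pos by (intro mult_mono) auto
  thus ?thesis by (simp add: card_LL flip: power_add)
qed

lemma card_LL_multiples: "g > 0 \<Longrightarrow> real (card {l\<in>LL. g dvd l}) \<le> 2 * L0 / real g"
proof -
  assume g: "g > 0"
  have "card {l\<in>LL. g dvd l} \<le> card {1..nat \<lfloor>2 * L0 / real g\<rfloor>}"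
  proof (rule card_inj_on_le[of "\<lambda>l. l div g"])
    show "inj_on (\<lambda>l. l div g) {l\<in>LL. g dvd l}" by (rule inj_onI) (auto elim!: dvdE simp: g)
    show "(\<lambda>l. l div g) ` {l\<in>LL. g dvd l} \<subseteq> {1..nat \<lfloor>2 * L0 / real g\<rfloor>}"
    proof (rule image_subsetI)
      fix l assume l: "l \<in> {l\<in>LL. g dvd l}"
      then obtain k where k: "l = g * k" by auto
      have "k > 0" using LL_pos[of l] l k by (auto intro!: Nat.gr0I)
      moreover have "real k \<le> 2 * L0 / real g" using LL_window(3)[of l] l k g by (simp add: field_simps)
      ultimately show "l div g \<in> {1..nat \<lfloor>2 * L0 / real g\<rfloor>}" using g k by (simp add: le_nat_iff le_floor_iff)
    qed
  qed simp
  hence "real (card {l\<in>LL. g dvd l}) \<le> real (nat \<lfloor>2 * L0 / real g\<rfloor>)" by simp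
  also have "\<dots> \<le> 2 * L0 / real g" using L0_pos by (simp add: of_nat_nat)
  finally show ?thesis .
qed

text \<open>The elements of \<open>LL\<close> are distinct positive integers up to 2 L0, so their
  number forces L0 to be large.\<close>

lemma L0_ge: "u ^ 24047 \<le> L0"
proof -
  have "u ^ 24048 \<le> 2 * L0" using card_LL_ge card_LL_multiples[of 1] by simp
  moreover have "2 * u ^ 24047 \<le> u ^ 24048" using const_upow[of 2 24047] by simp
  ultimately show ?thesis by linarith
qed

lemma LL_nonempty: "LL \<noteq> {}"
  using card_LL_ge zero_less_power[OF u_pos, of 24048] by auto

lemma L0_le: "L0 \<le> u ^ 24060"
  using LL_nonempty LL_window(1,4) by (metis all_not_in_conv order_trans)

lemma kernel_sum_int:
  "norm (\<Sum>k\<in>{1..M}. ee (of_int r * (real k * (real m * \<alpha>)))) = kernel_sum M (nat \<bar>r\<bar> * m)"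
proof (cases "r \<ge> 0")
  case True
  thus ?thesis by (simp add: kernel_sum_def mult_ac)
next
  case False
  have "(\<Sum>k\<in>{1..M}. ee (of_int r * (real k * (real m * \<alpha>)))) = cnj (\<Sum>k\<in>{1..M}. ee (real k * (real (nat \<bar>r\<bar> * m) * \<alpha>)))"
    using False by (simp add: mult_ac flip: ee_minus)
  thus ?thesis by (simp only: kernel_sum_def complex_mod_cnj)
qed

text \<open>As M is smaller than q, each block of q frequencies contributes about q times the number
  of dyadic levels; about u^2070 blocks occur.\<close>

lemma kernel_sum_upto:
  assumes "real D \<le> u ^ 48070"
  shows "(\<Sum>m\<in>{1..D}. kernel_sum M m) \<le> u ^ 48072"
proof -
  have "u ^ 43940 \<le> u ^ 50000" by (rule pw) simp
  hence "real M \<le> 2 ^ I" using M_le I_ge by linarith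
  hence "(\<Sum>m\<in>{1..D}. kernel_sum M m) \<le> (real D / real q + 1) * (2 * real q * (real I + 1) + 6 * real M)"
    by (rule kernel_sum_total[OF M_pos])
  also have "\<dots> \<le> (2 * u ^ 2070) * (8 * u ^ 46001)"
  proof (rule mult_mono)
    have "real D / real q \<le> u ^ 48070 / u ^ 46000" unfolding q_eq using assms u_pos by (intro divide_right_mono) auto
    also have "\<dots> = u ^ 2070" using u_pos by (simp flip: power_diff)
    finally show "real D / real q + 1 \<le> 2 * u ^ 2070" using one_le_power[OF u1, of 2070] by linarith
    have "real q * (real I + 1) \<le> u ^ 46000 * u" unfolding q_eq using I_le u_pos by (intro mult_left_mono) auto
    also have "u ^ 46000 * u = u ^ 46001" using power_Suc2[of u 46000] by simp
    finally have 1: "real q * (real I + 1) \<le> u ^ 46001" .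
    have "u ^ 43940 \<le> u ^ 46001" by (rule pw) simp
    hence "real M \<le> u ^ 46001" using M_le by linarith
    thus "2 * real q * (real I + 1) + 6 * real M \<le> 8 * u ^ 46001" using 1 by (simp add: mult.assoc)
  qed (use u_pos in auto)
  also have "\<dots> = 16 * u ^ 48071" by (simp flip: power_add)
  also have "\<dots> \<le> u ^ 48072" using const_upow[of 16 48071] by simp
  finally show ?thesis .
qed

lemma card_LL_divisors:
  assumes "m > 0" "real m \<le> Bd"
  shows "real (card {l\<in>LL. l dvd m}) \<le> u"
proof -
  have "card {l\<in>LL. l dvd m} \<le> card {d. d dvd m \<and> sfp P d}"
    using assms(1) sfp_LL by (intro card_mono finite_subset[OF _ finite_divisors_nat[OF assms(1)]]) auto
  thus ?thesis using div_bound[OF assms] by linarith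
qed

text \<open>The products r l are grouped by their value m, which has at most \<open>u\<close>
  divisors in \<open>LL\<close>.\<close>

lemma kernel_sum_pairs:
  assumes "real D \<le> u ^ 24006"
  shows "(\<Sum>r\<in>{1..D}. \<Sum>l\<in>LL. kernel_sum M (r * l)) \<le> u ^ 48073"
proof -
  define N where "N = nat \<lfloor>u ^ 48066\<rfloor>"
  have N: "real N \<le> u ^ 48066" unfolding N_def using u_pos by (simp add: of_nat_nat)
  have "(\<Sum>r\<in>{1..D}. \<Sum>l\<in>LL. kernel_sum M (r * l)) = (\<Sum>x\<in>{1..D}\<times>LL. kernel_sum M ((\<lambda>(r,l). r * l) x))"
    by (simp add: sum.cartesian_product')
  also have "\<dots> \<le> u * (\<Sum>m\<in>{1..N}. kernel_sum M m)"
  proof (rule sum_fibre_le)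
    show "(\<lambda>(r,l). r * l) ` ({1..D} \<times> LL) \<subseteq> {1..N}"
    proof clarify
      fix r l assume rl: "r \<in> {1..D}" "l \<in> LL"
      have "r * l > 0" using rl LL_pos by auto
      moreover have "real r * real l \<le> u ^ (24006 + 24060)"
        using rl assms LL_window(4)[OF rl(2)] by (intro upow_mult_mono) auto
      hence "r * l \<le> N" unfolding N_def by (simp add: le_nat_iff le_floor_iff)
      ultimately show "r * l \<in> {1..N}" by simp
    qed
    fix m assume m: "m \<in> {1..N}"
    have "card {x\<in>{1..D}\<times>LL. (\<lambda>(r,l). r * l) x = m} \<le> card {l\<in>LL. l dvd m}"
    proof (rule card_inj_on_le[of snd])
      show "inj_on snd {x\<in>{1..D}\<times>LL. (\<lambda>(r,l). r * l) x = m}"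
        using m by (auto simp: inj_on_def)
    qed (use finite_LL in auto)
    moreover have "real m \<le> Bd"
    proof -
      have "real m \<le> real N" using m by simp
      also have "\<dots> \<le> u ^ 200000" using N pw[of 48066 200000] by simp
      finally show ?thesis by (simp add: Bd_eq)
    qed
    ultimately show "real (card {x\<in>{1..D}\<times>LL. (\<lambda>(r,l). r * l) x = m}) \<le> u"
      using card_LL_divisors[of m] m by simp
  qed (use finite_LL kernel_sum_bounds in auto)
  also have "\<dots> \<le> u * u ^ 48072"
  proof (intro mult_left_mono kernel_sum_upto)
    show "real N \<le> u ^ 48070" using N pw[of 48066 48070] by simp
  qed (use u_pos in auto)
  also have "\<dots> = u ^ 48073" using power_Suc[of u 48072] by simp
  finally show ?thesis .
qed

definition cnt :: "nat \<Rightarrow> nat" where "cnt k = card {l\<in>LL. dn (real k * (real l * \<alpha>)) \<le> \<delta>}"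

text \<open>The points k l \<alpha> are equidistributed on the scale \<delta>/u^2 for reasons of
  size alone: the total of the exponential sums is about u^48000, far below the number of points,
  about u^68000.\<close>

lemma first_moment:
  "(\<Sum>k\<in>{1..M}. real (cnt k)) \<ge> 2 * \<delta> * real M * real (card LL) * (1 - 4 / u\<^sup>2)"
proof -
  define Z where "Z = {1..M} \<times> LL"
  define z where "z = (\<lambda>(k,l). real k * (real l * \<alpha>))"
  define \<eta> where "\<eta> = \<delta> / u\<^sup>2"
  \<comment> \<open>As \<eta> = u^(-24002), this makes 2 \<eta> B exceed u, so that every power of
    it in the tail bound gains a factor u.\<close>
  define B where "B = nat \<lceil>u ^ 24003\<rceil>"
  \<comment> \<open>The tail, at most u^24006/u^(2m), has to be below \<delta>/u^2 =
    u^(-24002).\<close>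
  define m where "m = (40000::nat)"
  have finZ: "finite Z" using finite_LL by (simp add: Z_def)
  have cZ: "real (card Z) = real M * real (card LL)" by (simp add: Z_def card_cartesian_product)
  have up: "u ^ n > 0" for n using u_pos by simp
  have Bge: "u ^ 24003 \<le> real B" unfolding B_def by (rule real_nat_ceiling_ge)
  have Bpos: "B > 0" using Bge up[of 24003] by (intro Nat.gr0I) auto
  have Ble: "real B \<le> u ^ 24004"
  proof -
    have "real B \<le> u ^ 24003 + 1" unfolding B_def using up[of 24003] by (simp add: of_nat_nat)
    also have "\<dots> \<le> 2 * u ^ 24003" using one_le_power[OF u1, of 24003] by simp
    also have "\<dots> \<le> u ^ 24004" using const_upow[of 2 24003] by simp
    finally show ?thesis .
  qed
  have mB: "real (m * B) \<le> u ^ 24005" "real m * real B + 1 \<le> u ^ 24006"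
  proof -
    have "real (m * B) \<le> 40000 * u ^ 24004" using Ble by (simp add: m_def)
    also have "\<dots> \<le> u ^ 24005" using const_upow[of 40000 24004] by simp
    finally show 1: "real (m * B) \<le> u ^ 24005" .
    have "u ^ 24005 + 1 \<le> 2 * u ^ 24005" using one_le_power[OF u1, of 24005] by simp
    also have "\<dots> \<le> u ^ 24006" using const_upow[of 2 24005] by simp
    finally show "real m * real B + 1 \<le> u ^ 24006" using 1 by simp
  qed
  have \<eta>B: "2 * \<eta> * real B \<ge> u"
  proof -
    have "\<eta> = 1 / u ^ 24002" by (simp add: \<eta>_def \<delta>_def flip: power_add)
    hence "2 * \<eta> * real B \<ge> 2 * (1 / u ^ 24002) * u ^ 24003" using Bge u_pos by (intro mult_mono) auto
    also have "2 * (1 / u ^ 24002) * u ^ 24003 = 2 * u" 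
    proof -
      have "u ^ 24003 = u ^ 24002 * u" using power_Suc2[of u 24002] by simp
      thus ?thesis using up[of 24002] by simp
    qed
    finally show ?thesis using u_pos by linarith
  qed
  define \<tau> where "\<tau> = (real m * real B + 1) / (2 * \<eta> * real B) ^ (2 * m)"
  have \<tau>: "\<tau> \<le> \<delta> / u\<^sup>2"
  proof -
    have "\<tau> \<le> u ^ 24006 / u ^ 80000" unfolding \<tau>_def
    proof (rule frac_le)
      have "u ^ 80000 \<le> (2 * \<eta> * real B) ^ 80000" using \<eta>B u_pos by (intro power_mono) auto
      thus "u ^ 80000 \<le> (2 * \<eta> * real B) ^ (2 * m)" by (simp add: m_def)
    qed (use mB u_pos in auto)
    also have "\<dots> \<le> 1 / u ^ 24002"
    proof -
      have "u ^ 24006 * u ^ 24002 \<le> u ^ 80000" unfolding power_add[symmetric] by (rule pw) simp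
      thus ?thesis using u_pos by (simp add: field_simps)
    qed
    also have "\<dots> = \<delta> / u\<^sup>2" by (simp add: \<delta>_def flip: power_add)
    finally show ?thesis .
  qed
  have E: "fourier_error (m * B) z Z \<le> real (card Z) / u\<^sup>2"
  proof -
    have "fourier_error (m * B) z Z \<le> (\<Sum>r\<in>{- int (m * B)..int (m * B)} - {0}. \<Sum>l\<in>LL. kernel_sum M (nat \<bar>r\<bar> * l))"
      unfolding fourier_error_def
    proof (intro sum_mono)
      fix r :: int
      have "(\<Sum>i\<in>Z. ee (of_int r * z i)) = (\<Sum>l\<in>LL. \<Sum>k\<in>{1..M}. ee (of_int r * (real k * (real l * \<alpha>))))"
        unfolding Z_def z_def sum.cartesian_product' prod.case by (rule sum.swap)
      also have "norm \<dots> \<le> (\<Sum>l\<in>LL. kernel_sum M (nat \<bar>r\<bar> * l))"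
        by (rule sum_norm_le) (simp only: kernel_sum_int order_refl)
      finally show "norm (\<Sum>i\<in>Z. ee (of_int r * z i)) \<le> (\<Sum>l\<in>LL. kernel_sum M (nat \<bar>r\<bar> * l))" .
    qed
    also have "\<dots> = 2 * (\<Sum>r\<in>{1..m * B}. \<Sum>l\<in>LL. kernel_sum M (r * l))"
      by (rule sum_symmetric_int[where f = "\<lambda>r. \<Sum>l\<in>LL. kernel_sum M (r * l)"])
    also have "\<dots> \<le> 2 * u ^ 48073"
      using mB(1) pw[of 24005 24006] by (intro mult_left_mono kernel_sum_pairs) auto
    also have "\<dots> \<le> u ^ 48074" using const_upow[of 2 48073] by simp
    also have "\<dots> \<le> real (card Z) / u\<^sup>2"
    proof -
      have "u ^ 48074 * u\<^sup>2 \<le> u ^ 43939 * u ^ 24048" unfolding power_add[symmetric] by (rule pw) simp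
      also have "\<dots> \<le> real M * real (card LL)" using M_ge card_LL_ge up by (intro mult_mono) (auto intro: less_imp_le)
      finally show ?thesis using u_pos by (simp add: cZ field_simps)
    qed
    finally show ?thesis .
  qed
  have u2: "u\<^sup>2 \<ge> 4" using inv_u2(2) u_pos by (simp add: field_simps)
  have le1: "real (card Z) / u\<^sup>2 \<le> real (card Z)" using u2 by (simp add: divide_le_eq mult_le_cancel_left1)
  have "(2 * \<delta> - 4 * \<eta>) * (real (card Z) - fourier_error (m * B) z Z) \<le>
        real (card {i\<in>Z. dn (z i - 0) \<le> \<delta>}) + \<tau> * real (card Z)"
    unfolding \<tau>_def
  proof (rule erdos_turan_lower[OF finZ Bpos])
    show "\<eta> > 0" using \<delta>_pos u_pos by (simp add: \<eta>_def)
    show "2 * \<eta> \<le> \<delta>"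
    proof -
      have "\<delta> * 2 \<le> \<delta> * u\<^sup>2" using u2 \<delta>_pos by (intro mult_left_mono) auto
      thus ?thesis using u_pos by (simp add: \<eta>_def field_simps)
    qed
    have "\<delta> \<le> 1 / 1000000" unfolding \<delta>_def using const_le[of 1000000 24000] by (intro divide_left_mono) (auto simp: u_pos)
    thus "\<delta> < 1/2" by simp
    show "fourier_error (m * B) z Z \<le> real (card Z)" using E le1 by linarith
  qed (simp add: m_def)
  hence "(2 * \<delta> - 4 * \<eta>) * (real (card Z) - fourier_error (m * B) z Z) - \<tau> * real (card Z) \<le> real (card {i\<in>Z. dn (z i) \<le> \<delta>})"
    by simp
  moreover have "(2 * \<delta> - 4 * \<eta>) * (real (card Z) - fourier_error (m * B) z Z) \<ge> (2 * \<delta> - 4 * \<eta>) * (real (card Z) - real (card Z) / u\<^sup>2)"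
  proof (rule mult_left_mono)
    have "\<delta> * 4 \<le> \<delta> * (2 * u\<^sup>2)" using u2 \<delta>_pos by (intro mult_left_mono) auto
    thus "0 \<le> 2 * \<delta> - 4 * \<eta>" using u_pos by (simp add: \<eta>_def field_simps)
  qed (use E in auto)
  moreover have "\<tau> * real (card Z) \<le> \<delta> / u\<^sup>2 * real (card Z)" using \<tau> by (intro mult_right_mono) auto
  \<comment> \<open>Against the main term 2, the narrowed arc loses 4 x, the Fourier error 2 x and
    the tail x, where x = 1/u^2; the sum 7 x is covered by 8 x.\<close>
  moreover have "2 * \<delta> * real (card Z) * (1 - 4 / u\<^sup>2) \<le> (2 * \<delta> - 4 * \<eta>) * (real (card Z) - real (card Z) / u\<^sup>2) - \<delta> / u\<^sup>2 * real (card Z)"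
  proof -
    define x where "x = 1 / u\<^sup>2"
    have x: "x \<ge> 0" by (simp add: x_def)
    have "(2 * \<delta> - 4 * \<eta>) * (real (card Z) - real (card Z) / u\<^sup>2) - \<delta> / u\<^sup>2 * real (card Z) = \<delta> * real (card Z) * ((2 - 4 * x) * (1 - x) - x)"
      by (simp add: \<eta>_def x_def algebra_simps)
    moreover have "2 * \<delta> * real (card Z) * (1 - 4 / u\<^sup>2) = \<delta> * real (card Z) * (2 - 8 * x)" by (simp add: x_def algebra_simps)
    moreover have "2 - 8 * x \<le> (2 - 4 * x) * (1 - x) - x" using x by (simp add: algebra_simps)
    hence "\<delta> * real (card Z) * (2 - 8 * x) \<le> \<delta> * real (card Z) * ((2 - 4 * x) * (1 - x) - x)"
      using \<delta>_pos by (intro mult_left_mono) auto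
    ultimately show ?thesis by linarith
  qed
  moreover have "(\<Sum>k\<in>{1..M}. real (cnt k)) = real (card {i\<in>Z. dn (z i) \<le> \<delta>})"
  proof -
    have "{i\<in>Z. dn (z i) \<le> \<delta>} = (SIGMA k:{1..M}. {l\<in>LL. dn (real k * (real l * \<alpha>)) \<le> \<delta>})" by (auto simp: Z_def z_def)
    hence "card {i\<in>Z. dn (z i) \<le> \<delta>} = (\<Sum>k\<in>{1..M}. cnt k)" using finite_LL by (simp add: cnt_def)
    thus ?thesis by simp
  qed
  ultimately show ?thesis by (simp add: cZ mult.assoc)
qed

end

section \<open>Second moment\<close>

lemma gcd_mult_coprime_nat:
  fixes g x y :: nat
  assumes "coprime x y"
  shows "gcd g (x * y) = gcd g x * gcd g y"
proof (rule dvd_antisym)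
  have "int (gcd g (x * y)) dvd int (gcd g x * gcd g y)"
    using gcd_mult_dvd_mult_gcd[of "int g" "int x" "int y"]
    by (simp only: gcd_int_int_eq of_nat_mult[symmetric])
  thus "gcd g (x * y) dvd gcd g x * gcd g y" by (simp only: int_dvd_int_iff)
  have "coprime (gcd g x) (gcd g y)" using assms by (meson coprime_divisors gcd_dvd2)
  thus "gcd g x * gcd g y dvd gcd g (x * y)" by (intro divides_mult) auto
qed

context smooth_setup
begin

section \<open>Pairs of moduli with vanishing determinant j\<close>

definition near_zero :: "(nat \<times> nat \<times> nat) set" where
  "near_zero = {(k,l,l')\<in>{1..M} \<times> LL \<times> LL. dn (real (gcd l l') * (real k * \<alpha>)) \<le> real (gcd l l') * \<delta> / L0}"

text \<open>A value m = g k occurs at most \<open>u\<close> times, as g is one of its divisors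
  composed of primes from \<open>P\<close>. In the dyadic block of g near 2^i the bound for m grows
  like 4^i by \<open>multiples_count_sharp\<close>, while the pairs with both members divisible by g
  number at most of order (L0/2^i)^2. So all blocks have the same bound, and there are only I + 1
  \<le> u of them.\<close>

lemma card_near_zero: "real (card near_zero) \<le> \<delta>\<^sup>2 * real M * (real (card LL))\<^sup>2 / u\<^sup>2"
proof -
  have up: "u ^ n > 0" for n using u_pos by simp
  define Lm where "Lm = nat \<lfloor>2 * L0\<rfloor>"
  define Gs where "Gs = {g\<in>{1..Lm}. sfp P g}"
  define n where "n g = card {k\<in>{1..M}. dn (real g * (real k * \<alpha>)) \<le> real g * \<delta> / L0}" for g
  \<comment> \<open>For positive g this is the binary logarithm rounded down.\<close>
  define ix where "ix g = (LEAST i. g < 2 ^ Suc i)" for g :: nat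
  have finG: "finite Gs" by (simp add: Gs_def)
  have Lm: "real Lm \<le> 2 * L0" unfolding Lm_def using L0_pos by (simp add: of_nat_nat)
  have ix: "g < 2 ^ Suc (ix g)" "2 ^ ix g \<le> g" if "g > 0" for g
  proof -
    have "g < 2 ^ g" by (rule less_exp)
    hence "g < 2 ^ Suc g" unfolding power_Suc by linarith
    thus "g < 2 ^ Suc (ix g)" unfolding ix_def by (rule LeastI)
    show "2 ^ ix g \<le> g"
    proof (cases "ix g")
      case (Suc i)
      hence "\<not> g < 2 ^ Suc i" using not_less_Least[of i "\<lambda>i. g < 2 ^ Suc i"] by (simp add: ix_def)
      thus ?thesis using Suc by simp
    qed (use that in simp)
  qed
  have ixI: "ix g \<le> I" if "g \<in> Gs" for g
  proof -
    have "real g \<le> 2 * L0" using that Lm by (auto simp: Gs_def)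
    also have "\<dots> \<le> 2 * u ^ 24060" using L0_le by simp
    also have "\<dots> \<le> u ^ 24061" using const_upow[of 2 24060] by simp
    also have "\<dots> \<le> 2 ^ I" using I_ge pw[of 24061 50000] by simp
    also have "(2::real) ^ I = real (2 ^ I)" by simp
    finally have "g \<le> 2 ^ I" by (simp only: of_nat_le_iff)
    moreover have "(0::nat) < 2 ^ I" by simp
    ultimately have "g < 2 ^ Suc I" unfolding power_Suc by linarith
    thus ?thesis unfolding ix_def by (rule Least_le)
  qed
  define X where "X i = 2 ^ Suc i * real M" for i :: nat
  define \<Delta> where "\<Delta> i = 2 ^ Suc i * \<delta> / L0" for i :: nat
  define Q where "Q = (real M / real q)\<^sup>2 + (\<delta> * real q / L0)\<^sup>2"
  have cnt_i: "(\<Sum>g\<in>{g\<in>Gs. ix g = i}. real (n g)) \<le> u * (23 * 4 * 4 ^ i * Q)" if i: "i \<le> I" for i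
  proof -
    let ?A = "SIGMA g:{g\<in>Gs. ix g = i}. {k\<in>{1..M}. dn (real g * (real k * \<alpha>)) \<le> real g * \<delta> / L0}"
    let ?B = "{m::nat. 1 \<le> m \<and> real m \<le> X i \<and> dn (real m * \<alpha>) \<le> \<Delta> i}"
    have D0: "\<Delta> i \<ge> 0" "X i \<ge> 0" using \<delta>_pos L0_pos by (auto simp: \<Delta>_def X_def)
    have "(\<Sum>g\<in>{g\<in>Gs. ix g = i}. real (n g)) = real (card ?A)" using finG by (simp add: n_def)
    also have "\<dots> = (\<Sum>x\<in>?A. (\<lambda>_. 1) ((\<lambda>(g,k). g * k) x))" by simp
    also have "\<dots> \<le> u * (\<Sum>m\<in>?B. 1)"
    proof (rule sum_fibre_le)
      show "finite ?A" using finG by auto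
      show "finite ?B" using multiples_count(1)[OF D0] .
      show "(\<lambda>(g,k). g * k) ` ?A \<subseteq> ?B"
      proof (rule image_subsetI)
        fix x assume x: "x \<in> ?A"
        obtain g k where xx: "x = (g,k)" by (cases x)
        have gk: "g \<in> Gs" "ix g = i" "1 \<le> k" "k \<le> M" "dn (real g * (real k * \<alpha>)) \<le> real g * \<delta> / L0" using x xx by auto
        have g0: "g > 0" using gk(1) by (auto simp: Gs_def)
        have g1: "real g \<le> 2 ^ Suc i" using ix(1)[OF g0] gk(2) by (metis less_imp_le of_nat_le_iff of_nat_numeral of_nat_power)
        have "real (g * k) \<le> X i" unfolding X_def of_nat_mult using g1 gk(4) by (intro mult_mono) auto
        moreover have "dn (real (g * k) * \<alpha>) \<le> \<Delta> i"
        proof -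
          have "dn (real (g * k) * \<alpha>) \<le> real g * \<delta> / L0" using gk(5) by (simp add: mult.assoc)
          also have "\<dots> \<le> 2 ^ Suc i * \<delta> / L0" using g1 \<delta>_pos L0_pos by (intro divide_right_mono mult_right_mono) auto
          finally show ?thesis by (simp add: \<Delta>_def)
        qed
        ultimately show "(\<lambda>(g,k). g * k) x \<in> ?B" using g0 gk(3) by (simp add: xx Suc_le_eq)
      qed
      fix m assume m: "m \<in> ?B"
      show "real (card {x\<in>?A. (\<lambda>(g,k). g * k) x = m}) \<le> u"
      proof (cases "{x\<in>?A. (\<lambda>(g,k). g * k) x = m} = {}")
        case True
        thus ?thesis using u_pos by (simp only: card.empty)
      next
        case False
        then obtain g k where gk: "g \<in> Gs" "k \<le> M" "m = g * k" by auto
        have "real g \<le> u ^ 24061"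
        proof -
          have "real g \<le> 2 * L0" using gk(1) Lm by (auto simp: Gs_def)
          also have "\<dots> \<le> 2 * u ^ 24060" using L0_le by simp
          also have "\<dots> \<le> u ^ 24061" using const_upow[of 2 24060] by simp
          finally show ?thesis .
        qed
        moreover have "real k \<le> u ^ 43940" using gk(2) M_le by linarith
        ultimately have "real g * real k \<le> u ^ (24061 + 43940)" by (intro upow_mult_mono) auto
        also have "\<dots> \<le> u ^ 200000" by (rule pw) simp
        finally have mB: "real m \<le> Bd" by (simp add: gk(3) Bd_eq)
        have "card {x\<in>?A. (\<lambda>(g,k). g * k) x = m} \<le> card {d. d dvd m \<and> sfp P d}"
        proof (rule card_inj_on_le[of fst])
          show "inj_on fst {x\<in>?A. (\<lambda>(g,k). g * k) x = m}" using m by (auto simp: inj_on_def)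
          show "finite {d. d dvd m \<and> sfp P d}" using m by (intro finite_subset[OF _ finite_divisors_nat[of m]]) auto
        qed (auto simp: Gs_def)
        thus ?thesis using div_bound[OF _ mB] m by auto
      qed
    qed simp
    also have "\<dots> = u * real (card ?B)" by simp
    also have "\<dots> \<le> u * (23 * ((X i / real q)\<^sup>2 + (\<Delta> i * real q)\<^sup>2))"
      using u_pos by (intro mult_left_mono multiples_count_sharp D0) auto
    also have "\<dots> = u * (23 * 4 * 4 ^ i * Q)"
    proof -
      have "((2::real) ^ Suc i)\<^sup>2 = 4 * 4 ^ i" by (simp add: power2_eq_square power_mult_distrib[symmetric])
      hence "(X i / real q)\<^sup>2 + (\<Delta> i * real q)\<^sup>2 = 4 * 4 ^ i * Q"
        unfolding X_def \<Delta>_def Q_def by (simp add: power_mult_distrib power_divide algebra_simps del: power_Suc)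
      thus ?thesis by simp
    qed
    finally show ?thesis .
  qed
  \<comment> \<open>The balance behind the size of q: L0 M/q is at most u^22000, and \<delta> q
    equals u^22000.\<close>
  have LQ: "L0\<^sup>2 * Q \<le> 2 * u ^ 44000"
  proof -
    have e: "L0\<^sup>2 * Q = (L0 * real M / real q)\<^sup>2 + (\<delta> * real q)\<^sup>2"
      using L0_pos by (simp add: Q_def power_mult_distrib power_divide algebra_simps)
    have "L0 * real M / real q \<le> u ^ 22000"
    proof -
      have "L0 * real M \<le> u ^ (24060 + 43940)" using L0_le M_le by (intro upow_mult_mono) auto
      also have "\<dots> = u ^ 22000 * u ^ 46000" by (simp flip: power_add)
      finally show ?thesis unfolding q_eq using up[of 46000] by (simp add: divide_le_eq)
    qed
    hence "(L0 * real M / real q)\<^sup>2 \<le> (u ^ 22000)\<^sup>2" using L0_pos by (intro power_mono) auto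
    moreover have "\<delta> * real q = u ^ 22000" unfolding \<delta>_def q_eq using u_pos by (simp flip: power_diff)
    ultimately have "(L0 * real M / real q)\<^sup>2 + (\<delta> * real q)\<^sup>2 \<le> (u ^ 22000)\<^sup>2 + (u ^ 22000)\<^sup>2" by simp
    also have "\<dots> = 2 * u ^ 44000" by (simp flip: power_mult)
    finally show ?thesis unfolding e .
  qed
  define W where "W g = {k\<in>{1..M}. dn (real g * (real k * \<alpha>)) \<le> real g * \<delta> / L0} \<times> {l\<in>LL. g dvd l} \<times> {l\<in>LL. g dvd l}" for g
  have sub: "near_zero \<subseteq> (\<Union>g\<in>Gs. W g)"
  proof
    fix x assume x: "x \<in> near_zero"
    obtain k l l' where xx: "x = (k,l,l')" by (cases x)
    have kl: "k \<in> {1..M}" "l \<in> LL" "l' \<in> LL" "dn (real (gcd l l') * (real k * \<alpha>)) \<le> real (gcd l l') * \<delta> / L0"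
      using x by (auto simp: near_zero_def xx)
    have "gcd l l' \<le> l" using LL_pos[OF kl(2)] by (intro dvd_imp_le) auto
    hence "real (gcd l l') \<le> 2 * L0" using LL_window(3)[OF kl(2)] by linarith
    hence "gcd l l' \<le> Lm" unfolding Lm_def by (simp add: le_nat_iff le_floor_iff)
    moreover have "gcd l l' > 0" using LL_pos[OF kl(2)] by simp
    moreover have "sfp P (gcd l l')" using sfp_dvd[OF sfp_LL[OF kl(2)]] by simp
    ultimately have "gcd l l' \<in> Gs" by (simp add: Gs_def Suc_le_eq)
    moreover have "x \<in> W (gcd l l')" using kl by (simp add: W_def xx)
    ultimately show "x \<in> (\<Union>g\<in>Gs. W g)" by blast
  qed
  have finW: "finite (W g)" for g using finite_LL by (simp add: W_def)
  have "card near_zero \<le> card (\<Union>g\<in>Gs. W g)" using finG finW by (intro card_mono[OF _ sub]) auto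
  also have "\<dots> \<le> (\<Sum>g\<in>Gs. card (W g))" by (rule card_UN_le[OF finG])
  finally have "real (card near_zero) \<le> real (\<Sum>g\<in>Gs. card (W g))" by (simp only: of_nat_le_iff)
  also have "\<dots> = (\<Sum>g\<in>Gs. real (n g) * (real (card {l\<in>LL. g dvd l}))\<^sup>2)"
    by (simp add: W_def n_def card_cartesian_product power2_eq_square)
  also have "\<dots> \<le> (\<Sum>g\<in>Gs. real (n g) * (2 * L0 / 2 ^ ix g)\<^sup>2)"
  proof (intro sum_mono mult_left_mono power_mono)
    fix g assume g: "g \<in> Gs"
    have g0: "g > 0" using g by (auto simp: Gs_def)
    have "(2::real) ^ ix g \<le> real g" using ix(2)[OF g0] by (metis of_nat_le_iff of_nat_numeral of_nat_power)
    hence "2 * L0 / real g \<le> 2 * L0 / 2 ^ ix g" using L0_pos g0 by (intro divide_left_mono) auto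
    thus "real (card {l\<in>LL. g dvd l}) \<le> 2 * L0 / 2 ^ ix g" using card_LL_multiples[OF g0] by linarith
  qed auto
  also have "\<dots> = (\<Sum>i\<in>{..I}. \<Sum>g | g \<in> Gs \<and> ix g = i. real (n g) * (2 * L0 / 2 ^ ix g)\<^sup>2)"
    by (rule sum.group[symmetric]) (use finG ixI in auto)
  also have "\<dots> \<le> (\<Sum>i\<in>{..I}. 368 * u * (L0\<^sup>2 * Q))"
  proof (rule sum_mono)
    fix i assume i: "i \<in> {..I}"
    have "(\<Sum>g | g \<in> Gs \<and> ix g = i. real (n g) * (2 * L0 / 2 ^ ix g)\<^sup>2) = (\<Sum>g\<in>{g\<in>Gs. ix g = i}. real (n g)) * (2 * L0 / 2 ^ i)\<^sup>2"
      unfolding sum_distrib_right by (intro sum.cong) auto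
    also have "\<dots> \<le> u * (23 * 4 * 4 ^ i * Q) * (2 * L0 / 2 ^ i)\<^sup>2"
      using cnt_i[of i] i by (intro mult_right_mono) auto
    also have "\<dots> = 368 * u * (L0\<^sup>2 * Q)"
    proof -
      have "((2::real) ^ i)\<^sup>2 = 4 ^ i" by (simp add: power2_eq_square power_mult_distrib[symmetric])
      hence "(2 * L0 / 2 ^ i)\<^sup>2 = 4 * L0\<^sup>2 / 4 ^ i" by (simp add: power_divide power_mult_distrib)
      thus ?thesis by simp
    qed
    finally show "(\<Sum>g | g \<in> Gs \<and> ix g = i. real (n g) * (2 * L0 / 2 ^ ix g)\<^sup>2) \<le> 368 * u * (L0\<^sup>2 * Q)" .
  qed
  also have "\<dots> = (real I + 1) * (368 * u * (L0\<^sup>2 * Q))" by simp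
  also have "\<dots> \<le> u * (368 * u * (2 * u ^ 44000))"
  proof (rule mult_mono[OF I_le])
    show "368 * u * (L0\<^sup>2 * Q) \<le> 368 * u * (2 * u ^ 44000)" using u_pos LQ by (intro mult_left_mono) auto
  qed (use u_pos Q_def in auto)
  also have "\<dots> = 736 * (u * u * u ^ 44000)" by simp
  also have "u * u * u ^ 44000 = u ^ 44002" using power_add[of u 2 44000] by (simp add: power2_eq_square)
  also have "736 * u ^ 44002 \<le> u ^ 44003" using const_upow[of 736 44002] by simp
  also have "\<dots> \<le> \<delta>\<^sup>2 * real M * (real (card LL))\<^sup>2 / u\<^sup>2"
  proof -
    \<comment> \<open>The exponents are 92005 on the left and 43939 + 48096 = 92035 on the
      right.\<close>
    have "u ^ 44003 * u\<^sup>2 * u ^ 48000 \<le> u ^ 43939 * (u ^ 24048)\<^sup>2"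
      unfolding power_add[symmetric] power_mult[symmetric] by (rule pw) simp
    also have "\<dots> \<le> real M * (real (card LL))\<^sup>2" using M_ge card_LL_ge u_pos by (intro mult_mono power_mono) auto
    finally have "u ^ 44003 \<le> real M * (real (card LL))\<^sup>2 / u ^ 48000 / u\<^sup>2"
      using up[of 48000] up[of 2] by (simp only: pos_le_divide_eq)
    also have "\<dots> = \<delta>\<^sup>2 * real M * (real (card LL))\<^sup>2 / u\<^sup>2" by (simp add: \<delta>_def power_divide flip: power_mult)
    finally show ?thesis .
  qed
  finally show ?thesis .
qed


section \<open>Pairs of moduli with a prescribed gcd\<close>

definition PG :: "nat \<Rightarrow> (nat \<times> nat) set" where "PG g = {(l,l')\<in>LL \<times> LL. gcd l l' = g}"

lemma finite_PG [simp]: "finite (PG g)"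
  by (rule finite_subset[of _ "LL \<times> LL"]) (auto simp: PG_def finite_LL)

text \<open>Since g splits along the three disjoint sets of primes, l/g keeps a factorisation into
  three parts. The second member is left as a plain integer v, since it is the variable to be
  completed, and the condition on the gcd becomes coprimality. The quantifier over F comes last so
  that the same sets serve all frequencies.\<close>

lemma sum_PG_factor:
  assumes ne: "PG g \<noteq> {}"
  obtains Ss' T1' T2' Vs where
    "finite Ss'" "finite T1'" "finite T2'"
    "\<And>s. s \<in> Ss' \<Longrightarrow> sfp PS s \<and> real s \<le> u ^ 6020" "\<And>t. t \<in> T1' \<Longrightarrow> sfp P1 t \<and> real t \<le> u ^ 9020" "\<And>t. t \<in> T2' \<Longrightarrow> sfp P2 t \<and> real t \<le> u ^ 9020"
    "Vs \<subseteq> {1..nat \<lfloor>2 * L0\<rfloor>}"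
    "\<forall>F :: nat \<Rightarrow> nat \<Rightarrow> complex. (\<Sum>(l,l')\<in>PG g. F (l div g) (l' div g)) = 
       (\<Sum>v\<in>Vs. \<Sum>(s,t1,t2)\<in>{(s,t1,t2)\<in>Ss'\<times>T1'\<times>T2'. coprime v (s * (t1 * t2))}. F (s * (t1 * t2)) v)"
proof -
  from ne obtain l0 l0' where l0: "l0 \<in> LL" "l0' \<in> LL" "gcd l0 l0' = g" by (auto simp: PG_def)
  have g0: "g > 0" using l0 LL_pos[OF l0(1)] by (metis gcd_pos_nat less_numeral_extra(3))
  have gl0: "g dvd l0" using l0(3) by (metis gcd_dvd1)
  obtain sa ta wa where st: "sa \<in> Ss" "ta \<in> T1" "wa \<in> T2" "l0 = sa * (ta * wa)" using l0(1) by (rule LL_E)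
  \<comment> \<open>Each part collects the primes of g from one of the three sets, so the splitting
    does not depend on the choice of l0.\<close>
  define gs g1 g2 where "gs = gcd g sa" and "g1 = gcd g ta" and "g2 = gcd g wa"
  have copst: "coprime sa ta" "coprime sa wa" "coprime ta wa" using coprime_st[OF st(1-3)] by auto
  have geq: "g = gs * (g1 * g2)"
  proof -
    have "g = gcd g (sa * (ta * wa))" using gl0 st(4) by (simp add: gcd_proj1_iff)
    also have "\<dots> = gcd g sa * (gcd g ta * gcd g wa)" using copst by (simp add: gcd_mult_coprime_nat)
    finally show ?thesis by (simp add: gs_def g1_def g2_def)
  qed
  have gpos: "gs > 0" "g1 > 0" "g2 > 0" using g0 geq by (auto intro!: Nat.gr0I)
  have sfg: "sfp PS gs" "sfp P1 g1" "sfp P2 g2"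
    using sfp_dvd[OF sfS[OF st(1)]] sfp_dvd[OF sfT1[OF st(2)]] sfp_dvd[OF sfT2[OF st(3)]] by (auto simp: gs_def g1_def g2_def)
  \<comment> \<open>Each part of g is coprime to the two factors built from the other sets of
    primes, so it divides the third.\<close>
  have dv: "gs dvd s" "g1 dvd t" "g2 dvd w" if "s \<in> Ss" "t \<in> T1" "w \<in> T2" "g dvd s * (t * w)" for s t w
  proof -
    have c: "coprime gs t" "coprime gs w" "coprime s g1" "coprime s g2" "coprime g1 w" "coprime t g2"
      using sfp_coprime[OF sfg(1) sfT1[OF that(2)] disj(1)] sfp_coprime[OF sfg(1) sfT2[OF that(3)] disj(2)]
        sfp_coprime[OF sfS[OF that(1)] sfg(2) disj(1)] sfp_coprime[OF sfS[OF that(1)] sfg(3) disj(2)]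
        sfp_coprime[OF sfg(2) sfT2[OF that(3)] disj(3)] sfp_coprime[OF sfT1[OF that(2)] sfg(3) disj(3)] by auto
    have "gs dvd s * (t * w)" "g1 dvd s * (t * w)" "g2 dvd s * (t * w)" using that(4) geq by (auto intro: dvd_trans[rotated])
    thus "gs dvd s" using c by (simp add: coprime_dvd_mult_left_iff)
    have "g1 dvd t * w" using \<open>g1 dvd s * (t * w)\<close> c(3) by (simp add: coprime_dvd_mult_right_iff coprime_commute)
    thus "g1 dvd t" using c(5) by (simp add: coprime_dvd_mult_left_iff)
    have "g2 dvd t * w" using \<open>g2 dvd s * (t * w)\<close> c(4) by (simp add: coprime_dvd_mult_right_iff coprime_commute)
    thus "g2 dvd w" using c(6) by (simp add: coprime_dvd_mult_right_iff coprime_commute)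
  qed
  define Ss' T1' T2' Vs where "Ss' = {s. gs * s \<in> Ss}" and "T1' = {t. g1 * t \<in> T1}" and "T2' = {t. g2 * t \<in> T2}" and "Vs = {v. g * v \<in> LL}"
  have fin': "finite {x. k * x \<in> A}" if "finite A" "k > 0" for A and k :: nat
    using finite_vimageI[OF that(1), of "\<lambda>x. k * x"] that(2) by (simp add: vimage_def inj_on_def)
  have lek: "real x \<le> real (k * x)" if "k > 0" for k x :: nat
    using that by (intro of_nat_mono) simp
  show ?thesis
  proof (rule that[of Ss' T1' T2' Vs])
    show "finite Ss'" "finite T1'" "finite T2'" unfolding Ss'_def T1'_def T2'_def using fin gpos by (auto intro: fin')
    show "sfp PS s \<and> real s \<le> u ^ 6020" if "s \<in> Ss'" for s
      using that sfp_dvd[OF sfS[of "gs * s"], of s] leS[of "gs * s"] lek[OF gpos(1), of s] by (auto simp: Ss'_def)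
    show "sfp P1 t \<and> real t \<le> u ^ 9020" if "t \<in> T1'" for t
      using that sfp_dvd[OF sfT1[of "g1 * t"], of t] leT1[of "g1 * t"] lek[OF gpos(2), of t] by (auto simp: T1'_def)
    show "sfp P2 t \<and> real t \<le> u ^ 9020" if "t \<in> T2'" for t
      using that sfp_dvd[OF sfT2[of "g2 * t"], of t] leT2[of "g2 * t"] lek[OF gpos(3), of t] by (auto simp: T2'_def)
    show "Vs \<subseteq> {1..nat \<lfloor>2 * L0\<rfloor>}"
    proof
      fix v assume v: "v \<in> Vs"
      hence vl: "g * v \<in> LL" by (simp add: Vs_def)
      have "v > 0" using LL_pos[OF vl] by (auto intro!: Nat.gr0I)
      moreover have "real v \<le> 2 * L0" using LL_window(3)[OF vl] lek[OF g0, of v] by linarith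
      ultimately show "v \<in> {1..nat \<lfloor>2 * L0\<rfloor>}" by (simp add: le_nat_iff le_floor_iff)
    qed
    show "\<forall>F :: nat \<Rightarrow> nat \<Rightarrow> complex. (\<Sum>(l,l')\<in>PG g. F (l div g) (l' div g)) = 
       (\<Sum>v\<in>Vs. \<Sum>(s,t1,t2)\<in>{(s,t1,t2)\<in>Ss'\<times>T1'\<times>T2'. coprime v (s * (t1 * t2))}. F (s * (t1 * t2)) v)"
    proof
    fix F :: "nat \<Rightarrow> nat \<Rightarrow> complex"
    define A where "A v = {(s,t1,t2)\<in>Ss'\<times>T1'\<times>T2'. coprime v (s * (t1 * t2))}" for v
    define h where "h = (\<lambda>(v, s, t1, t2). (g * (s * (t1 * t2)), g * v :: nat))"
    have finVs: "finite Vs" unfolding Vs_def using finite_LL g0 by (rule fin')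
    have finA: "finite (A v)" for v
      by (rule finite_subset[of _ "Ss'\<times>T1'\<times>T2'"]) (use \<open>finite Ss'\<close> \<open>finite T1'\<close> \<open>finite T2'\<close> in \<open>auto simp: A_def\<close>)
    have sf': "sfp PS s" "sfp P1 t" "sfp P2 w" if "s \<in> Ss'" "t \<in> T1'" "w \<in> T2'" for s t w
      using that sfp_dvd[OF sfS[of "gs * s"], of s] sfp_dvd[OF sfT1[of "g1 * t"], of t] sfp_dvd[OF sfT2[of "g2 * w"], of w]
      by (auto simp: Ss'_def T1'_def T2'_def)
    have inj: "inj_on h (Sigma Vs A)"
    proof (rule inj_onI)
      fix x y assume xy: "x \<in> Sigma Vs A" "y \<in> Sigma Vs A" "h x = h y"
      obtain v s t w where x: "x = (v,s,t,w)" by (metis surj_pair)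
      obtain v' s' t' w' where y: "y = (v',s',t',w')" by (metis surj_pair)
      have e: "s * (t * w) = s' * (t' * w')" "v = v'" using xy(3) g0 by (auto simp: h_def x y)
      have m: "s \<in> Ss'" "t \<in> T1'" "w \<in> T2'" "s' \<in> Ss'" "t' \<in> T1'" "w' \<in> T2'" using xy by (auto simp: x y A_def)
      have "s = s'" "t = t'" "w = w'" using triple_product_inj[OF disj sf'[OF m(1-3)] sf'[OF m(4-6)] e(1)] by auto
      thus "x = y" using e by (simp add: x y)
    qed
    have img: "h ` Sigma Vs A = PG g"
    proof (intro equalityI subsetI)
      fix p assume "p \<in> h ` Sigma Vs A"
      then obtain v s t w where vst: "v \<in> Vs" "s \<in> Ss'" "t \<in> T1'" "w \<in> T2'" "coprime v (s * (t * w))" "p = (g * (s * (t * w)), g * v)"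
        by (auto simp: h_def A_def)
      have "g * (s * (t * w)) = (gs * s) * ((g1 * t) * (g2 * w))" by (simp add: geq mult_ac)
      hence "g * (s * (t * w)) \<in> LL" using vst(2-4) unfolding LL_def Ss'_def T1'_def T2'_def
        by (intro image_eqI[of _ _ "(gs * s, g1 * t, g2 * w)"]) auto
      moreover have "gcd (g * (s * (t * w))) (g * v) = g"
      proof -
        have "gcd (g * (s * (t * w))) (g * v) = g * gcd (s * (t * w)) v" by (simp only: gcd_mult_distrib_nat)
        also have "gcd (s * (t * w)) v = 1" using vst(5) by (simp only: coprime_iff_gcd_eq_1 gcd.commute)
        finally show ?thesis by simp
      qed
      ultimately show "p \<in> PG g" using vst(1) by (simp add: PG_def vst(6) Vs_def)
    next
      fix p assume p: "p \<in> PG g"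
      obtain l l' where pp: "p = (l,l')" by (cases p)
      have ll: "l \<in> LL" "l' \<in> LL" "gcd l l' = g" using p by (auto simp: PG_def pp)
      obtain s t w where stw: "s \<in> Ss" "t \<in> T1" "w \<in> T2" "l = s * (t * w)" using ll(1) by (rule LL_E)
      have "g dvd l" "g dvd l'" using ll(3) by auto
      hence d: "gs dvd s" "g1 dvd t" "g2 dvd w" using dv[OF stw(1-3)] stw(4) by auto
      then obtain s' t' w' where e: "s = gs * s'" "t = g1 * t'" "w = g2 * w'" by (elim dvdE) auto
      obtain v where v: "l' = g * v" using \<open>g dvd l'\<close> by auto
      have le: "l = g * (s' * (t' * w'))" by (simp add: stw(4) e geq mult_ac)
      have "gcd (g * (s' * (t' * w'))) (g * v) = g" using ll(3) le v by simp
      hence "g * gcd (s' * (t' * w')) v = g" by (simp only: gcd_mult_distrib_nat)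
      hence "gcd (s' * (t' * w')) v = 1" using g0 by simp
      hence "coprime v (s' * (t' * w'))" by (simp only: coprime_iff_gcd_eq_1 gcd.commute)
      hence "(v,s',t',w') \<in> Sigma Vs A" using stw e ll v by (simp add: A_def Ss'_def T1'_def T2'_def Vs_def)
      moreover have "p = h (v,s',t',w')" by (simp add: h_def pp le v)
      ultimately show "p \<in> h ` Sigma Vs A" by blast
    qed
    have "(\<Sum>(l,l')\<in>PG g. F (l div g) (l' div g)) = (\<Sum>x\<in>Sigma Vs A. (case h x of (l,l') \<Rightarrow> F (l div g) (l' div g)))"
      unfolding img[symmetric] by (rule sum.reindex[OF inj, unfolded o_def])
    also have "\<dots> = (\<Sum>(v,x)\<in>Sigma Vs A. case x of (s,t1,t2) \<Rightarrow> F (s * (t1 * t2)) v)"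
      using g0 by (intro sum.cong refl) (auto simp: h_def)
    also have "\<dots> = (\<Sum>v\<in>Vs. \<Sum>x\<in>A v. case x of (s,t1,t2) \<Rightarrow> F (s * (t1 * t2)) v)"
      using finVs finA by (intro sum.Sigma[symmetric]) auto
    finally show "(\<Sum>(l,l')\<in>PG g. F (l div g) (l' div g)) = 
       (\<Sum>v\<in>Vs. \<Sum>(s,t1,t2)\<in>{(s,t1,t2)\<in>Ss'\<times>T1'\<times>T2'. coprime v (s * (t1 * t2))}. F (s * (t1 * t2)) v)"
      by (simp only: A_def)
    qed
  qed
qed

text \<open>Absolute values are absorbed into coefficients bounded by the kernel sums at r g. What
  enters the bilinear estimate is their maximum, at most M, and their total, about u^48000 because
  the r g are distinct multiples below u^48070.\<close>

lemma kloosterman_error: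
  fixes j :: int
  assumes g: "g > 0" and j: "j \<noteq> 0" "\<bar>real_of_int j\<bar> \<le> u ^ 61" and D: "real (D * g) \<le> u ^ 48070"
  shows "(\<Sum>r\<in>{- int D..int D} - {0}. kernel_sum M (nat \<bar>r\<bar> * g) * 
      norm (\<Sum>(l,l')\<in>PG g. ec (l div g) (r * j * minv (l div g) (l' div g)))) \<le> u ^ 91690"
proof (cases "PG g = {}")
  case True thus ?thesis using u_pos by simp
next
  case False
  obtain Ss' T1' T2' Vs where F:
    "finite Ss'" "finite T1'" "finite T2'"
    "\<And>s. s \<in> Ss' \<Longrightarrow> sfp PS s \<and> real s \<le> u ^ 6020" "\<And>t. t \<in> T1' \<Longrightarrow> sfp P1 t \<and> real t \<le> u ^ 9020" "\<And>t. t \<in> T2' \<Longrightarrow> sfp P2 t \<and> real t \<le> u ^ 9020"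
    "Vs \<subseteq> {1..nat \<lfloor>2 * L0\<rfloor>}"
    "\<forall>F :: nat \<Rightarrow> nat \<Rightarrow> complex. (\<Sum>(l,l')\<in>PG g. F (l div g) (l' div g)) = 
       (\<Sum>v\<in>Vs. \<Sum>(s,t1,t2)\<in>{(s,t1,t2)\<in>Ss'\<times>T1'\<times>T2'. coprime v (s * (t1 * t2))}. F (s * (t1 * t2)) v)"
  proof (rule sum_PG_factor[OF False], goal_cases)
    case (1 Ss' T1' T2' Vs)
    show ?thesis by (rule that; fact 1)
  qed
  have up: "u ^ n > 0" for n using u_pos by simp
  define R where "R = {- int D..int D} - {0}"
  define X where "X r = (\<Sum>v\<in>Vs. \<Sum>(s,t1,t2)\<in>{(s,t1,t2)\<in>Ss'\<times>T1'\<times>T2'. coprime v (s * (t1 * t2))}. ec (s * (t1 * t2)) (r * j * minv (s * (t1 * t2)) v))" for r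
  define \<omega> where "\<omega> r = kernel_sum M (nat \<bar>r\<bar> * g)" for r
  \<comment> \<open>Rotates X r onto its modulus, with the rotation 1 as default where X r
    vanishes.\<close>
  define w where "w r = of_real (\<omega> r) * (if X r = 0 then 1 else cnj (X r) / of_real (norm (X r)))" for r
  define V where "V = nat \<lfloor>2 * L0\<rfloor>"
  have Xeq: "(\<Sum>(l,l')\<in>PG g. ec (l div g) (r * j * minv (l div g) (l' div g))) = X r" for r
    unfolding X_def using spec[OF F(8), of "\<lambda>x y. ec x (r * j * minv x y)"] .
  have \<omega>0: "\<omega> r \<ge> 0" "\<omega> r \<le> real M" for r using kernel_sum_bounds by (auto simp: \<omega>_def)
  have wX: "w r * X r = of_real (\<omega> r * norm (X r))" for r
  proof (cases "X r = 0")
    case False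
    have "cnj (X r) * X r = of_real ((norm (X r))\<^sup>2)" by (simp only: complex_norm_square mult.commute)
    thus ?thesis using False by (simp add: w_def power2_eq_square field_simps)
  qed simp
  have wn: "norm (w r) \<le> \<omega> r" for r using \<omega>0[of r] by (simp add: w_def norm_mult norm_divide)
  have V: "real V \<le> u ^ 24061"
  proof -
    have "real V \<le> 2 * L0" unfolding V_def using L0_pos by (simp add: of_nat_nat)
    also have "\<dots> \<le> 2 * u ^ 24060" using L0_le by simp
    also have "\<dots> \<le> u ^ 24061" using const_upow[of 2 24060] by simp
    finally show ?thesis .
  qed
  have Dle: "real D \<le> u ^ 48070"
  proof -
    have "D \<le> D * g" using g by simp
    thus ?thesis using D by (metis of_nat_le_iff order_trans)
  qed
  have Om: "sum \<omega> R \<le> u ^ 48073"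
  proof -
    have "sum \<omega> R = 2 * (\<Sum>r\<in>{1..D}. kernel_sum M (r * g))"
      unfolding R_def \<omega>_def by (rule sum_symmetric_int[where f = "\<lambda>r. kernel_sum M (r * g)"])
    also have "(\<Sum>r\<in>{1..D}. kernel_sum M (r * g)) = (\<Sum>m\<in>(\<lambda>r. r * g) ` {1..D}. kernel_sum M m)"
      using g by (subst sum.reindex) (auto simp: inj_on_def)
    also have "\<dots> \<le> (\<Sum>m\<in>{1..D * g}. kernel_sum M m)"
      using g kernel_sum_bounds by (intro sum_mono2) (auto simp: Suc_le_eq)
    also have "\<dots> \<le> u ^ 48072" by (rule kernel_sum_upto[OF D])
    also have "2 * u ^ 48072 \<le> u ^ 48073" using const_upow[of 2 48072] by simp
    finally show ?thesis by simp
  qed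
  have Om0: "sum \<omega> R \<ge> 0" using \<omega>0 by (intro sum_nonneg) auto
  define E where "E = (\<Sum>r\<in>R. \<omega> r * norm (X r))"
  have E0: "E \<ge> 0" unfolding E_def using \<omega>0 by (intro sum_nonneg mult_nonneg_nonneg) auto
  have "(\<Sum>r\<in>R. w r * X r) = of_real E" by (simp add: wX E_def)
  hence En: "norm (\<Sum>r\<in>R. w r * X r) = E" using E0 by simp
  have "E\<^sup>2 \<le> real V * (u ^ 9020)\<^sup>2 * (real V * (u ^ 9020)\<^sup>2 * u * real M * u ^ 6020 * sum \<omega> R + u\<^sup>2 * real V * (u ^ 6020)\<^sup>2 * (sum \<omega> R)\<^sup>2 + 14 * u ^ 6 * (u ^ 6020) ^ 3 * (u ^ 9020) ^ 3 * (sum \<omega> R)\<^sup>2)"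
    unfolding En[symmetric] X_def
  proof (rule kloosterman_bilinear[where ?R0.0 = "u ^ 48070"])
    show "sfp P t" if "t \<in> T1'" for t using F(5)[OF that] sfp_mono P_sub by blast
    show "sfp P t" if "t \<in> T2'" for t using F(6)[OF that] sfp_mono P_sub by blast
    show "sfp P s" if "s \<in> Ss'" for s using F(4)[OF that] sfp_mono P_sub by blast
    show "coprime s t" if "s \<in> Ss'" "t \<in> T1' \<union> T2'" for s t
      using that F(4)[OF that(1)] F(5)[of t] F(6)[of t] disj sfp_coprime by blast
    show "coprime t1 t2" if "t1 \<in> T1'" "t2 \<in> T2'" for t1 t2
      using F(5)[OF that(1)] F(6)[OF that(2)] disj(3) sfp_coprime by blast
    show "inj_on (\<lambda>(t1,t2). t1 * t2) (T1' \<times> T2')"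
    proof (rule inj_onI)
      fix x y assume xy: "x \<in> T1' \<times> T2'" "y \<in> T1' \<times> T2'" "(\<lambda>(t1,t2). t1 * t2) x = (\<lambda>(t1,t2). t1 * t2) y"
      obtain t k where x: "x = (t,k)" by (cases x)
      obtain t' k' where y: "y = (t',k')" by (cases y)
      have one: "sfp PS 1" by (simp add: sfp_def)
      have m: "sfp P1 t" "sfp P2 k" "sfp P1 t'" "sfp P2 k'" using xy F(5,6) by (auto simp: x y)
      have "1 * (t * k) = 1 * (t' * k')" using xy by (simp add: x y)
      from triple_product_inj(2,3)[OF disj one m(1,2) one m(3,4) this] show "x = y" by (simp add: x y)
    qed
    show "u ^ 6020 \<le> u ^ 9020" by (rule pw) simp
    show "1 \<le> u ^ 9020" using u1 by simp
    show "real_of_int \<bar>r\<bar> \<le> u ^ 48070" if "r \<in> R" for r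
    proof -
      have "\<bar>r\<bar> \<le> int D" using that by (auto simp: R_def)
      thus ?thesis using Dle by linarith
    qed
    have "2 * u ^ 48070 \<le> u ^ 48071" using const_upow[of 2 48070] by simp
    hence h: "2 * u ^ 48070 * u ^ 6020 \<le> u ^ (48071 + 6020)" using u_pos by (intro upow_mult_mono) auto
    have "\<bar>real_of_int j\<bar> * (2 * u ^ 48070 * u ^ 6020) \<le> u ^ (61 + (48071 + 6020))"
      by (rule upow_mult_mono[OF j(2) h]) (use u_pos in simp)
    also have "\<dots> \<le> Bd" unfolding Bd_eq by (rule pw) simp
    finally show "\<bar>real_of_int j\<bar> * (2 * u ^ 48070 * u ^ 6020) \<le> Bd" .
    show "(u ^ 6020)\<^sup>2 * (u ^ 9020)\<^sup>2 \<le> Bd" unfolding Bd_eq power_mult[symmetric] power_add[symmetric] by (rule pw) simp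
    have "\<bar>real_of_int j\<bar> * u ^ 48070 \<le> u ^ (61 + 48070)" by (rule upow_mult_mono[OF j(2) order_refl]) (use u_pos in simp)
    also have "\<dots> \<le> Bd" unfolding Bd_eq by (rule pw) simp
    finally show "\<bar>real_of_int j\<bar> * u ^ 48070 \<le> Bd" .
    show "u ^ 48070 * u ^ 6020 \<le> Bd" unfolding Bd_eq power_add[symmetric] by (rule pw) simp
    show "Vs \<subseteq> {1..V}" using F(7) by (simp add: V_def)
    show "norm (w r) \<le> \<omega> r" "\<omega> r \<le> real M" for r using wn \<omega>0 by auto
  qed (use F u_pos j in \<open>auto simp: R_def\<close>)
  also have "\<dots> \<le> u ^ 24061 * (u ^ 9020)\<^sup>2 * (u ^ 24061 * (u ^ 9020)\<^sup>2 * u ^ 1 * u ^ 43940 * u ^ 6020 * u ^ 48073 + u\<^sup>2 * u ^ 24061 * (u ^ 6020)\<^sup>2 * (u ^ 48073)\<^sup>2 + u ^ 1 * u ^ 6 * (u ^ 6020) ^ 3 * (u ^ 9020) ^ 3 * (u ^ 48073)\<^sup>2)"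
    by (intro mult_mono add_mono mult_nonneg_nonneg add_nonneg_nonneg order_refl zero_le_power V M_le Om Om0 power_mono) 
      (use u_pos u_big in simp_all)
  \<comment> \<open>The three exponents belong to the diagonal, to the zero frequency of the
    completion and to the Kloosterman sums; the last dominates. The total, 183375, stays within 2 *
    91690 = 183380.\<close>
  also have "\<dots> = u ^ 24061 * u ^ 18040 * (u ^ 140135 + u ^ 132249 + u ^ 141273)"
    by (simp only: power_mult[symmetric] power_add[symmetric]) simp
  also have "\<dots> \<le> u ^ 24061 * u ^ 18040 * (3 * u ^ 141273)"
  proof (intro mult_left_mono)
    have "u ^ 140135 \<le> u ^ 141273" "u ^ 132249 \<le> u ^ 141273" by (rule pw; simp)+
    thus "u ^ 140135 + u ^ 132249 + u ^ 141273 \<le> 3 * u ^ 141273" by linarith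
  qed (use u_pos in auto)
  also have "\<dots> = 3 * u ^ 183374" by (simp flip: power_add)
  also have "\<dots> \<le> u ^ 183375" using const_upow[of 3 183374] by simp
  also have "\<dots> \<le> (u ^ 91690)\<^sup>2" unfolding power_mult[symmetric] by (rule pw) simp
  finally have "E \<le> u ^ 91690" using u_pos by (intro power2_le_imp_le[of E]) auto
  thus ?thesis by (simp only: E_def R_def \<omega>_def Xeq)
qed


section \<open>Pairs of moduli with nonzero determinant j\<close>

definition \<kappa> :: real where "\<kappa> = (1 + 1/u\<^sup>2) ^ 6"

definition phase :: "nat \<Rightarrow> int \<Rightarrow> nat \<times> nat \<times> nat \<Rightarrow> real" where
  "phase g j = (\<lambda>(k,l,l'). real g * (real k * \<alpha>) - of_int (j * minv (l div g) (l' div g)) / real (l div g))"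

text \<open>In the notation of the introduction, with \<open>t = b - l x\<close> and \<open>t' = b' - l' x\<close>, one has \<open>j = (l' t - l t')/g\<close> and
  \<open>g x - j (l'/g)^(-1)/(l/g)\<close> is congruent to \<open>- t/(l/g)\<close>. As \<open>t\<close> and \<open>t'\<close> are at most \<open>\<delta>\<close>, this confines it, for fixed \<open>j\<close>, to an
  interval whose centre and length do not depend on \<open>l\<close> and \<open>l'\<close>.\<close>

definition radius :: "nat \<Rightarrow> int \<Rightarrow> real" where
  "radius g j = \<delta> / (L0 / real g) - \<bar>of_int j\<bar> / (2 * \<kappa> * (L0 / real g)\<^sup>2)"

definition near_fraction :: "nat \<Rightarrow> int \<Rightarrow> (nat \<times> nat \<times> nat) set" where
  "near_fraction g j = {x\<in>{1..M} \<times> PG g. dn (phase g j x - (- (of_int j / (2 * \<kappa> * (L0 / real g)\<^sup>2)))) \<le> radius g j}"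

lemma \<kappa>_bounds: "\<kappa> \<ge> 1" "\<kappa> \<le> 1 + 7 * (1/u\<^sup>2)"
proof -
  show "\<kappa> \<ge> 1" unfolding \<kappa>_def using inv_u2 by (intro one_le_power) auto
  show "\<kappa> \<le> 1 + 7 * (1/u\<^sup>2)" unfolding \<kappa>_def using inv_u2 by (intro one_plus_power6_le) auto
qed

text \<open>L0 exceeds 1/\<delta> by at most u^60, so the pairs with nonzero j involve few values of
  g and of j, and their error terms can be added up trivially.\<close>

lemma \<delta>_L0: "4 * \<delta> * L0 \<le> u ^ 61"
proof -
  have "u ^ 24060 = u ^ 60 * u ^ 24000" by (simp flip: power_add)
  hence "\<delta> * L0 \<le> u ^ 60" using L0_le u_pos by (simp add: \<delta>_def field_simps)
  moreover have "4 * u ^ 60 \<le> u ^ 61" using const_upow[of 4 60] by simp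
  ultimately show ?thesis by linarith
qed

text \<open>The phase is a term in k plus a term in (l, l'), so each exponential sum factors into a
  Dirichlet kernel and a sum of Kloosterman fractions.\<close>

lemma fourier_error_phase:
  assumes "g > 0" "j \<noteq> 0" "\<bar>real_of_int j\<bar> \<le> u ^ 61" "real (D * g) \<le> u ^ 48070"
  shows "fourier_error D (phase g j) ({1..M} \<times> PG g) \<le> u ^ 91690"
proof -
  have e: "norm (\<Sum>i\<in>{1..M} \<times> PG g. ee (of_int r * phase g j i)) = kernel_sum M (nat \<bar>r\<bar> * g) * 
      norm (\<Sum>(l,l')\<in>PG g. ec (l div g) (r * (- j) * minv (l div g) (l' div g)))" for r :: int
  proof -
    have t: "ee (of_int r * phase g j (k,l,l')) = ee (of_int r * (real k * (real g * \<alpha>))) * ec (l div g) (r * (- j) * minv (l div g) (l' div g))" for k l l'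
      unfolding phase_def ec_def by (simp add: algebra_simps flip: ee_add)
    have "(\<Sum>i\<in>{1..M} \<times> PG g. ee (of_int r * phase g j i)) = 
        (\<Sum>k\<in>{1..M}. \<Sum>p\<in>PG g. ee (of_int r * (real k * (real g * \<alpha>))) * (case p of (l,l') \<Rightarrow> ec (l div g) (r * (- j) * minv (l div g) (l' div g))))"
      unfolding sum.cartesian_product by (intro sum.cong refl) (auto simp: t)
    also have "\<dots> = (\<Sum>k\<in>{1..M}. ee (of_int r * (real k * (real g * \<alpha>)))) * (\<Sum>(l,l')\<in>PG g. ec (l div g) (r * (- j) * minv (l div g) (l' div g)))"
      by (rule sum_product[symmetric])
    finally show ?thesis by (simp only: norm_mult kernel_sum_int)
  qed
  show ?thesis unfolding fourier_error_def e using assms by (intro kloosterman_error) auto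
qed

text \<open>The smoothing scale \<delta> g/(L0 u^2) is a fraction 1/u^2 of the largest radius
  \<delta> g/L0. A negative radius means that no point qualifies, which is why the main term is
  truncated at 0.\<close>

lemma card_near_fraction:
  assumes g: "g > 0" "real g \<le> 4 * \<delta> * L0" and j: "j \<noteq> 0" "\<bar>real_of_int j\<bar> \<le> 4 * \<delta> * L0 / real g"
  shows "(1 - 1/u\<^sup>2) * real (card (near_fraction g j)) \<le> 
    (max 0 (2 * radius g j) + 4 * (\<delta> * real g / (L0 * u\<^sup>2))) * (real M * real (card (PG g)) + u ^ 91690)"
proof (cases "radius g j \<ge> 0")
  case False
  have "near_fraction g j = {}" using False dn_nonneg by (auto simp: near_fraction_def intro: order_trans)
  thus ?thesis using \<delta>_pos L0_pos u_pos by simp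
next
  case True
  have up: "u ^ n > 0" for n using u_pos by simp
  define \<eta> where "\<eta> = \<delta> * real g / (L0 * u\<^sup>2)"
  define m where "m = (40000::nat)"
  \<comment> \<open>The inverse of \<eta> up to a factor u; with it the products of frequencies and
    g stay below u^48065 whatever g is.\<close>
  define B where "B = nat \<lceil>u ^ 3 * L0 / (\<delta> * real g)\<rceil>"
  define Z where "Z = {1..M} \<times> PG g"
  have \<eta>0: "\<eta> > 0" using \<delta>_pos L0_pos g u_pos by (simp add: \<eta>_def)
  have g61: "real g \<le> u ^ 61" using g(2) \<delta>_L0 by linarith
  have b0: "u ^ 3 * L0 / (\<delta> * real g) > 0" using \<delta>_pos L0_pos g u_pos by simp
  have Bge: "u ^ 3 * L0 / (\<delta> * real g) \<le> real B" unfolding B_def by (rule real_nat_ceiling_ge)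
  have Bpos: "B > 0" using Bge b0 by (intro Nat.gr0I) auto
  have Bg: "real B * real g \<le> u ^ 48064"
  proof -
    have "real B \<le> u ^ 3 * L0 / (\<delta> * real g) + 1" unfolding B_def using b0 by (simp add: of_nat_nat)
    hence "real B * real g \<le> (u ^ 3 * L0 / (\<delta> * real g) + 1) * real g" by (intro mult_right_mono) auto
    also have "\<dots> = u ^ 3 * L0 / \<delta> + real g" using g(1) by (simp add: field_simps)
    also have "u ^ 3 * L0 / \<delta> = L0 * u ^ 24003" by (simp add: \<delta>_def flip: power_add)
    also have "L0 * u ^ 24003 \<le> u ^ (24060 + 24003)" using u_pos by (intro upow_mult_mono[OF L0_le]) auto
    also have "u ^ (24060 + 24003) + real g \<le> 2 * u ^ 48063" using g61 pw[of 61 48063] by simp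
    also have "\<dots> \<le> u ^ 48064" using const_upow[of 2 48063] by simp
    finally show ?thesis by simp
  qed
  have mBg: "real (m * B * g) \<le> u ^ 48065"
  proof -
    have "real (m * B * g) = 40000 * (real B * real g)" by (simp add: m_def)
    also have "\<dots> \<le> 40000 * u ^ 48064" using Bg by simp
    also have "\<dots> \<le> u ^ 48065" using const_upow[of 40000 48064] by simp
    finally show ?thesis .
  qed
  have mB: "real m * real B + 1 \<le> u ^ 48066"
  proof -
    have "m * B * 1 \<le> m * B * g" using g(1) by (intro mult_le_mono) auto
    hence "real (m * B) \<le> real (m * B * g)" by (simp only: of_nat_le_iff mult_1_right)
    hence "real m * real B \<le> u ^ 48065" using mBg by simp
    moreover have "u ^ 48065 + 1 \<le> 2 * u ^ 48065" using one_le_power[OF u1, of 48065] by simp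
    moreover have "2 * u ^ 48065 \<le> u ^ 48066" using const_upow[of 2 48065] by simp
    ultimately show ?thesis by linarith
  qed
  have \<eta>B: "2 * \<eta> * real B \<ge> u"
  proof -
    have "\<eta> * (u ^ 3 * L0 / (\<delta> * real g)) = u"
      using \<delta>_pos L0_pos g u_pos by (simp add: \<eta>_def field_simps power3_eq_cube power2_eq_square)
    hence "u \<le> \<eta> * real B" using mult_left_mono[OF Bge, of \<eta>] \<eta>0 by simp
    thus ?thesis using u_pos by linarith
  qed
  define \<tau> where "\<tau> = (real m * real B + 1) / (2 * \<eta> * real B) ^ (2 * m)"
  have \<tau>: "\<tau> \<le> 1 / u\<^sup>2"
  proof -
    have "\<tau> \<le> u ^ 48066 / u ^ 80000" unfolding \<tau>_def
    proof (rule frac_le)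
      have "u ^ 80000 \<le> (2 * \<eta> * real B) ^ 80000" using \<eta>B u_pos by (intro power_mono) auto
      thus "u ^ 80000 \<le> (2 * \<eta> * real B) ^ (2 * m)" by (simp add: m_def)
    qed (use mB u_pos in auto)
    also have "\<dots> \<le> 1 / u\<^sup>2"
    proof -
      have "u ^ 48066 * u\<^sup>2 \<le> u ^ 80000" unfolding power_add[symmetric] by (rule pw) simp
      thus ?thesis using u_pos by (simp add: field_simps)
    qed
    finally show ?thesis .
  qed
  have E: "fourier_error (m * B) (phase g j) Z \<le> u ^ 91690"
    unfolding Z_def
  proof (rule fourier_error_phase[OF g(1) j(1)])
    have "4 * \<delta> * L0 / real g \<le> 4 * \<delta> * L0 / 1" using g(1) \<delta>_pos L0_pos by (intro divide_left_mono) auto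
    thus "\<bar>real_of_int j\<bar> \<le> u ^ 61" using j(2) \<delta>_L0 by linarith
    show "real (m * B * g) \<le> u ^ 48070" using mBg pw[of 48065 48070] by linarith
  qed
  have finZ: "finite Z" by (simp add: Z_def)
  have "(1 - 1/u\<^sup>2) * real (card (near_fraction g j)) \<le> (1 - \<tau>) * real (card (near_fraction g j))"
    using \<tau> by (intro mult_right_mono) auto
  also have "\<dots> \<le> (2 * radius g j + 4 * \<eta>) * (real (card Z) + fourier_error (m * B) (phase g j) Z)"
    unfolding \<tau>_def near_fraction_def Z_def[symmetric]
    by (rule erdos_turan_upper[OF finZ Bpos _ \<eta>0 True]) (simp add: m_def)
  also have "\<dots> \<le> (max 0 (2 * radius g j) + 4 * \<eta>) * (real M * real (card (PG g)) + u ^ 91690)"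
  proof (rule mult_mono)
    show "real (card Z) + fourier_error (m * B) (phase g j) Z \<le> real M * real (card (PG g)) + u ^ 91690"
      using E by (simp add: Z_def card_cartesian_product)
    show "0 \<le> real (card Z) + fourier_error (m * B) (phase g j) Z"
      unfolding fourier_error_def by (intro add_nonneg_nonneg sum_nonneg) auto
  qed (use True \<eta>0 in auto)
  finally show ?thesis by (simp add: \<eta>_def)
qed

definition Js :: "nat \<Rightarrow> int set" where "Js g = {j. j \<noteq> 0 \<and> \<bar>real_of_int j\<bar> \<le> 4 * \<delta> * L0 / real g}"

lemma Js_finite: "finite (Js g)" and Js_card: "real (card (Js g)) \<le> 8 * \<delta> * L0 / real g"
proof -
  define n where "n = nat \<lfloor>4 * \<delta> * L0 / real g\<rfloor>"
  have x0: "4 * \<delta> * L0 / real g \<ge> 0" using \<delta>_pos L0_pos by simp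
  have n: "real n \<le> 4 * \<delta> * L0 / real g" using x0 by (simp add: n_def of_nat_nat)
  have sub: "Js g \<subseteq> {- int n..int n} - {0}"
  proof
    fix j assume j: "j \<in> Js g"
    hence "of_int \<bar>j\<bar> \<le> 4 * \<delta> * L0 / real g" by (simp add: Js_def)
    hence "\<bar>j\<bar> \<le> \<lfloor>4 * \<delta> * L0 / real g\<rfloor>" by (simp only: le_floor_iff)
    also have "\<dots> = int n" using x0 by (simp add: n_def)
    finally show "j \<in> {- int n..int n} - {0}" using j by (auto simp: Js_def)
  qed
  thus "finite (Js g)" by (rule finite_subset) simp
  have "card (Js g) \<le> card ({- int n..int n} - {0})" using sub by (intro card_mono) auto
  also have "\<dots> = 2 * n" by (subst card_Diff_singleton) auto
  finally have "real (card (Js g)) \<le> 2 * real n" by linarith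
  thus "real (card (Js g)) \<le> 8 * \<delta> * L0 / real g" using n by simp
qed

text \<open>The trapezoids add up to 4 \<delta>^2 \<kappa>, where 4 \<delta>^2 = (2 \<delta>)^2 is
  the expected density of pairs and \<kappa> costs 7/u^2. Smoothing loses 32 \<delta>^2/u^2, another
  8/u^2 in relative terms, whence 15.\<close>

lemma sum_radius:
  assumes g: "g > 0"
  shows "(\<Sum>j\<in>Js g. max 0 (2 * radius g j) + 4 * (\<delta> * real g / (L0 * u\<^sup>2))) \<le> 4 * \<delta>\<^sup>2 * (1 + 15 * (1/u\<^sup>2))"
proof -
  define L1 where "L1 = L0 / real g"
  have L1: "L1 > 0" using g L0_pos by (simp add: L1_def)
  have k0: "\<kappa> > 0" using \<kappa>_bounds by linarith
  have e: "2 * radius g j = 2 * \<delta> / L1 - 1 / (\<kappa> * L1\<^sup>2) * \<bar>real_of_int j\<bar>" for j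
    unfolding radius_def L1_def[symmetric] using L1 k0 by (simp add: field_simps)
  have "(\<Sum>j\<in>Js g. max 0 (2 * radius g j)) \<le> (2 * \<delta> / L1)\<^sup>2 / (1 / (\<kappa> * L1\<^sup>2))"
    unfolding e using L1 k0 \<delta>_pos Js_finite by (intro trapezoid_sum_int) (auto simp: Js_def)
  also have "\<dots> = 4 * \<delta>\<^sup>2 * \<kappa>" using L1 k0 by (simp add: power2_eq_square field_simps)
  also have "\<dots> \<le> 4 * \<delta>\<^sup>2 * (1 + 7 * (1/u\<^sup>2))" using \<kappa>_bounds by (intro mult_left_mono) auto
  finally have 1: "(\<Sum>j\<in>Js g. max 0 (2 * radius g j)) \<le> 4 * \<delta>\<^sup>2 * (1 + 7 * (1/u\<^sup>2))" .
  have "(\<Sum>j\<in>Js g. 4 * (\<delta> * real g / (L0 * u\<^sup>2))) = real (card (Js g)) * (4 * (\<delta> * real g / (L0 * u\<^sup>2)))" by simp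
  also have "\<dots> \<le> 8 * \<delta> * L0 / real g * (4 * (\<delta> * real g / (L0 * u\<^sup>2)))"
    using Js_card \<delta>_pos L0_pos by (intro mult_right_mono) auto
  also have "\<dots> = 32 * \<delta>\<^sup>2 * (1/u\<^sup>2)" using g L0_pos u_pos by (simp add: power2_eq_square field_simps)
  finally have 2: "(\<Sum>j\<in>Js g. 4 * (\<delta> * real g / (L0 * u\<^sup>2))) \<le> 32 * \<delta>\<^sup>2 * (1/u\<^sup>2)" .
  have "4 * \<delta>\<^sup>2 * (1 + 7 * (1/u\<^sup>2)) + 32 * \<delta>\<^sup>2 * (1/u\<^sup>2) = 4 * \<delta>\<^sup>2 * (1 + 15 * (1/u\<^sup>2))" by (simp add: field_simps)
  thus ?thesis unfolding sum.distrib using 1 2 by linarith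
qed

lemma pair_classification:
  assumes k: "k \<in> {1..M}" and l: "l \<in> LL" "l' \<in> LL"
    and d: "dn (real k * (real l * \<alpha>)) \<le> \<delta>" "dn (real k * (real l' * \<alpha>)) \<le> \<delta>"
  shows "(k,l,l') \<in> near_zero \<union> (\<Union>g\<in>{1..nat \<lfloor>4 * \<delta> * L0\<rfloor>}. \<Union>j\<in>Js g. near_fraction g j)"
proof -
  define g where "g = gcd l l'"
  have lp: "l > 0" "l' > 0" using LL_pos l by auto
  have g0: "g > 0" using lp by (simp add: g_def)
  \<comment> \<open>Each member lies in a window of ratio (1 + 1/u^2)^3, which explains the exponent
    6 in \<kappa>.\<close>
  have kap: "real l * real l' \<le> \<kappa> * L0\<^sup>2"
  proof -
    have "real l * real l' \<le> ((1 + 1/u\<^sup>2) ^ 3 * L0) * ((1 + 1/u\<^sup>2) ^ 3 * L0)"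
      using LL_window[OF l(1)] LL_window[OF l(2)] inv_u2 L0_pos by (intro mult_mono) auto
    also have "\<dots> = ((1 + 1/u\<^sup>2) ^ 3 * (1 + 1/u\<^sup>2) ^ 3) * L0\<^sup>2" by (simp add: power2_eq_square)
    also have "(1 + 1/u\<^sup>2) ^ 3 * (1 + 1/u\<^sup>2) ^ 3 = \<kappa>" unfolding \<kappa>_def power_add[symmetric] by simp
    finally show ?thesis .
  qed
  have d': "dn (real l * (real k * \<alpha>)) \<le> \<delta>" "dn (real l' * (real k * \<alpha>)) \<le> \<delta>" using d by (simp_all only: mult.left_commute)
  from pair_geometry[OF lp L0_pos LL_window(1)[OF l(1)] LL_window(1)[OF l(2)] kap d', folded g_def]
  show ?thesis
  proof
    assume "dn (real g * (real k * \<alpha>)) \<le> real g * \<delta> / L0"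
    thus ?thesis using k l by (simp add: near_zero_def g_def)
  next
    assume "\<exists>j::int. j \<noteq> 0 \<and> \<bar>real_of_int j\<bar> \<le> \<delta> * (real (l div g) + real (l' div g)) \<and> 
       dn (real g * (real k * \<alpha>) - of_int (j * minv (l div g) (l' div g)) / real (l div g) - (- (of_int j / (2 * \<kappa> * (L0 / real g)\<^sup>2)))) \<le> \<delta> / (L0 / real g) - \<bar>of_int j\<bar> / (2 * \<kappa> * (L0 / real g)\<^sup>2)"
    then obtain j :: int where j: "j \<noteq> 0" "\<bar>real_of_int j\<bar> \<le> \<delta> * (real (l div g) + real (l' div g))"
       "dn (real g * (real k * \<alpha>) - of_int (j * minv (l div g) (l' div g)) / real (l div g) - (- (of_int j / (2 * \<kappa> * (L0 / real g)\<^sup>2)))) \<le> \<delta> / (L0 / real g) - \<bar>of_int j\<bar> / (2 * \<kappa> * (L0 / real g)\<^sup>2)"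
      by blast
    have "real (l div g) \<le> 2 * L0 / real g" "real (l' div g) \<le> 2 * L0 / real g"
      using LL_window(3)[OF l(1)] LL_window(3)[OF l(2)] g0
      by (auto simp: real_of_nat_div g_def intro!: divide_right_mono)
    hence "\<delta> * (real (l div g) + real (l' div g)) \<le> \<delta> * (2 * L0 / real g + 2 * L0 / real g)"
      using \<delta>_pos by (intro mult_left_mono add_mono) auto
    hence jle: "\<bar>real_of_int j\<bar> \<le> 4 * \<delta> * L0 / real g" using j(2) by (simp add: field_simps)
    \<comment> \<open>A nonzero j excludes large gcds.\<close>
    have "1 \<le> \<bar>real_of_int j\<bar>" using j(1) by linarith
    hence "1 \<le> 4 * \<delta> * L0 / real g" using jle by linarith
    hence "real g \<le> 4 * \<delta> * L0" using g0 by (simp add: field_simps)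
    hence "g \<in> {1..nat \<lfloor>4 * \<delta> * L0\<rfloor>}" using g0 by (simp add: le_nat_iff le_floor_iff)
    moreover have "j \<in> Js g" using j(1) jle by (simp add: Js_def)
    moreover have "(k,l,l') \<in> near_fraction g j"
      using j(3) k l by (simp add: near_fraction_def phase_def radius_def PG_def g_def)
    ultimately show ?thesis by blast
  qed
qed

lemma sum_card_PG: "(\<Sum>g\<in>G. real (card (PG g))) \<le> (real (card LL))\<^sup>2" if "finite G"
proof -
  have "(\<Sum>g\<in>G. card (PG g)) = card (\<Union>g\<in>G. PG g)"
  proof (rule card_UN_disjoint[symmetric, OF that])
    show "\<forall>g\<in>G. finite (PG g)" by simp
    show "\<forall>g\<in>G. \<forall>h\<in>G. g \<noteq> h \<longrightarrow> PG g \<inter> PG h = {}" by (auto simp: PG_def)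
  qed
  also have "\<dots> \<le> card (LL \<times> LL)" by (intro card_mono) (auto simp: PG_def finite_LL)
  finally have "real (\<Sum>g\<in>G. card (PG g)) \<le> real (card (LL \<times> LL))" by (simp only: of_nat_le_iff)
  thus ?thesis by (simp add: card_cartesian_product power2_eq_square)
qed

text \<open>For every g the sum over j yields the same density 4 \<delta>^2, and the sets
  \<open>PG g\<close> are disjoint, so summing over g gives at most the expected count for all
  pairs. The Kloosterman errors, at most u^61 values of g times u^91690, are smaller than the count
  M |LL|^2 beside them by more than u^2.\<close>

lemma second_moment: "(\<Sum>k\<in>{1..M}. (real (cnt k))\<^sup>2) \<le> 4 * \<delta>\<^sup>2 * real M * (real (card LL))\<^sup>2 * (1 + 19 / u\<^sup>2)"
proof -
  define \<nu> where "\<nu> = 1 / u\<^sup>2"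
  define G where "G = {1..nat \<lfloor>4 * \<delta> * L0\<rfloor>}"
  define X where "X = real M * (real (card LL))\<^sup>2"
  define A where "A k = {l\<in>LL. dn (real k * (real l * \<alpha>)) \<le> \<delta>}" for k
  define W where "W = (SIGMA k:{1..M}. A k \<times> A k)"
  have \<nu>: "\<nu> \<ge> 0" "\<nu> \<le> 1/1000000" using inv_u2 by (auto simp: \<nu>_def)
  have finA: "finite (A k)" for k using finite_LL by (simp add: A_def)
  have SW: "(\<Sum>k\<in>{1..M}. (real (cnt k))\<^sup>2) = real (card W)"
    using finA by (simp add: W_def cnt_def A_def power2_eq_square card_cartesian_product)
  have W1: "(1 - \<nu>) * real (card W) \<le> \<delta>\<^sup>2 * X * \<nu> + 4 * \<delta>\<^sup>2 * (1 + 15 * \<nu>) * (X + X * \<nu>)"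
  proof -
    have finN: "finite (near_fraction g j)" for g j by (simp add: near_fraction_def)
    have finZ: "finite near_zero"
      by (rule finite_subset[of _ "{1..M} \<times> LL \<times> LL"]) (auto simp: near_zero_def finite_LL)
    have "W \<subseteq> near_zero \<union> (\<Union>g\<in>G. \<Union>j\<in>Js g. near_fraction g j)"
    proof
      fix x assume "x \<in> W"
      then obtain k l l' where "x = (k,l,l')" "k \<in> {1..M}" "l \<in> A k" "l' \<in> A k" by (auto simp: W_def)
      thus "x \<in> near_zero \<union> (\<Union>g\<in>G. \<Union>j\<in>Js g. near_fraction g j)"
        unfolding G_def using pair_classification[of k l l'] by (simp add: A_def)
    qed
    hence "card W \<le> card (near_zero \<union> (\<Union>g\<in>G. \<Union>j\<in>Js g. near_fraction g j))"
      using finZ finN Js_finite by (intro card_mono) (auto simp: G_def)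
    also have "\<dots> \<le> card near_zero + card (\<Union>g\<in>G. \<Union>j\<in>Js g. near_fraction g j)" by (rule card_Un_le)
    also have "card (\<Union>g\<in>G. \<Union>j\<in>Js g. near_fraction g j) \<le> (\<Sum>g\<in>G. card (\<Union>j\<in>Js g. near_fraction g j))"
      by (rule card_UN_le) (simp add: G_def)
    also have "\<dots> \<le> (\<Sum>g\<in>G. \<Sum>j\<in>Js g. card (near_fraction g j))"
      by (intro sum_mono card_UN_le Js_finite)
    finally have "real (card W) \<le> real (card near_zero + (\<Sum>g\<in>G. \<Sum>j\<in>Js g. card (near_fraction g j)))"
      by (simp only: of_nat_le_iff add_left_mono)
    hence "(1 - \<nu>) * real (card W) \<le> (1 - \<nu>) * (real (card near_zero) + (\<Sum>g\<in>G. \<Sum>j\<in>Js g. real (card (near_fraction g j))))"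
      using \<nu> by (intro mult_left_mono) auto
    also have "\<dots> = (1 - \<nu>) * real (card near_zero) + (\<Sum>g\<in>G. \<Sum>j\<in>Js g. (1 - \<nu>) * real (card (near_fraction g j)))"
      by (simp add: distrib_left sum_distrib_left)
    also have "(1 - \<nu>) * real (card near_zero) \<le> 1 * real (card near_zero)" using \<nu> by (intro mult_right_mono) auto
    also have "1 * real (card near_zero) \<le> \<delta>\<^sup>2 * X * \<nu>" using card_near_zero by (simp add: X_def \<nu>_def mult.assoc)
    also have "(\<Sum>g\<in>G. \<Sum>j\<in>Js g. (1 - \<nu>) * real (card (near_fraction g j))) \<le> 
        (\<Sum>g\<in>G. \<Sum>j\<in>Js g. (max 0 (2 * radius g j) + 4 * (\<delta> * real g / (L0 * u\<^sup>2))) * (real M * real (card (PG g)) + u ^ 91690))"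
    proof (intro sum_mono)
      fix g j assume gj: "g \<in> G" "j \<in> Js g"
      have "real g \<le> real (nat \<lfloor>4 * \<delta> * L0\<rfloor>)" using gj(1) unfolding G_def by (intro of_nat_mono) auto
      also have "\<dots> \<le> 4 * \<delta> * L0" using \<delta>_pos L0_pos by (simp add: of_nat_nat)
      finally have "real g \<le> 4 * \<delta> * L0" .
      moreover have "g > 0" using gj(1) by (auto simp: G_def)
      ultimately show "(1 - \<nu>) * real (card (near_fraction g j)) \<le> (max 0 (2 * radius g j) + 4 * (\<delta> * real g / (L0 * u\<^sup>2))) * (real M * real (card (PG g)) + u ^ 91690)"
        unfolding \<nu>_def using gj(2) by (intro card_near_fraction) (auto simp: Js_def)
    qed
    also have "\<dots> = (\<Sum>g\<in>G. (\<Sum>j\<in>Js g. max 0 (2 * radius g j) + 4 * (\<delta> * real g / (L0 * u\<^sup>2))) * (real M * real (card (PG g)) + u ^ 91690))"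
      by (simp only: sum_distrib_right)
    also have "\<dots> \<le> (\<Sum>g\<in>G. 4 * \<delta>\<^sup>2 * (1 + 15 * \<nu>) * (real M * real (card (PG g)) + u ^ 91690))"
      unfolding \<nu>_def using u_pos by (intro sum_mono mult_right_mono sum_radius) (auto simp: G_def)
    also have "\<dots> = 4 * \<delta>\<^sup>2 * (1 + 15 * \<nu>) * (real M * (\<Sum>g\<in>G. real (card (PG g))) + real (card G) * u ^ 91690)"
      by (simp add: sum.distrib flip: sum_distrib_left)
    also have "\<dots> \<le> 4 * \<delta>\<^sup>2 * (1 + 15 * \<nu>) * (X + X * \<nu>)"
    proof (intro mult_left_mono add_mono)
      show "real M * (\<Sum>g\<in>G. real (card (PG g))) \<le> X"
        unfolding X_def by (intro mult_left_mono sum_card_PG) (auto simp: G_def)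
      have "real (card G) \<le> 4 * \<delta> * L0" using \<delta>_pos L0_pos by (simp add: G_def of_nat_nat)
      hence "real (card G) * u ^ 91690 \<le> u ^ (61 + 91690)" using \<delta>_L0 u_pos by (intro upow_mult_mono) auto
      also have "\<dots> \<le> X * \<nu>"
      proof -
        have "u ^ (61 + 91690) * u\<^sup>2 \<le> u ^ 43939 * (u ^ 24048)\<^sup>2"
          unfolding power_add[symmetric] power_mult[symmetric] by (rule pw) simp
        also have "\<dots> \<le> X" unfolding X_def using M_ge card_LL_ge u_pos by (intro mult_mono power_mono) auto
        finally show ?thesis unfolding \<nu>_def using u_pos by (simp add: pos_le_divide_eq)
      qed
      finally show "real (card G) * u ^ 91690 \<le> X * \<nu>" .
    qed (use \<nu> in auto)
    finally show ?thesis by simp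
  qed
  \<comment> \<open>In units of \<delta>^2 X the two sides are 4 + 65 \<nu> and 4 + 72 \<nu> to
    first order; \<nu> is small enough for the quadratic terms to fit into the difference.\<close>
  have W2: "\<delta>\<^sup>2 * X * \<nu> + 4 * \<delta>\<^sup>2 * (1 + 15 * \<nu>) * (X + X * \<nu>) \<le> (1 - \<nu>) * (4 * \<delta>\<^sup>2 * X * (1 + 19 * \<nu>))"
  proof -
    have nn: "\<nu> * \<nu> \<le> \<nu> * (1/1000000)" using \<nu> by (intro mult_left_mono) auto
    have "\<nu> + 4 * (1 + 15 * \<nu>) * (1 + \<nu>) \<le> (1 - \<nu>) * (4 * (1 + 19 * \<nu>))"
      using nn \<nu> by (simp add: algebra_simps)
    hence "\<delta>\<^sup>2 * X * (\<nu> + 4 * (1 + 15 * \<nu>) * (1 + \<nu>)) \<le> \<delta>\<^sup>2 * X * ((1 - \<nu>) * (4 * (1 + 19 * \<nu>)))"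
      by (intro mult_left_mono) (auto simp: X_def)
    thus ?thesis by (simp add: algebra_simps)
  qed
  have "(1 - \<nu>) * (\<Sum>k\<in>{1..M}. (real (cnt k))\<^sup>2) \<le> (1 - \<nu>) * (4 * \<delta>\<^sup>2 * X * (1 + 19 * \<nu>))"
    unfolding SW by (rule order_trans[OF W1 W2])
  hence "(\<Sum>k\<in>{1..M}. (real (cnt k))\<^sup>2) \<le> 4 * \<delta>\<^sup>2 * X * (1 + 19 * \<nu>)" using \<nu> by simp
  thus ?thesis by (simp add: X_def \<nu>_def mult.assoc)
qed

text \<open>If the counts vanished on K, Cauchy's inequality over the remaining k would gain the
  factor 1 - 1/u. Errors of order 1/u^2 cannot compensate this: 1/u \<le> (8 + 19)/u^2 would force u
  \<le> 27.\<close>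

lemma solution_exists:
  assumes K: "K \<subseteq> {1..M}" "real M \<le> u * real (card K)"
  shows "\<exists>k\<in>K. \<exists>l\<in>LL. dn (real k * (real l * \<alpha>)) \<le> \<delta>"
proof (rule ccontr)
  assume "\<not> ?thesis"
  hence e: "\<And>k. k \<in> K \<Longrightarrow> {l\<in>LL. dn (real k * (real l * \<alpha>)) \<le> \<delta>} = {}" by blast
  have z: "cnt k = 0" if "k \<in> K" for k unfolding cnt_def e[OF that] by simp
  define \<nu> where "\<nu> = 1 / u\<^sup>2"
  have \<nu>: "\<nu> \<ge> 0" "\<nu> \<le> 1/1000000" using inv_u2 by (auto simp: \<nu>_def)
  define m where "m = real M"
  define c where "c = real (card LL)"
  have m0: "m > 0" using M_pos by (simp add: m_def)
  have c0: "c > 0" using LL_nonempty finite_LL by (simp add: c_def card_gt_0_iff)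
  have finK: "finite K" using K(1) by (rule finite_subset) simp
  have cK: "real (card ({1..M} - K)) = m - real (card K)"
  proof -
    have "card ({1..M} - K) = M - card K" using K(1) finK by (simp add: card_Diff_subset)
    moreover have "card K \<le> M" using card_mono[OF _ K(1)] by simp
    ultimately show ?thesis by (simp add: m_def of_nat_diff)
  qed
  define S1 where "S1 = (\<Sum>k\<in>{1..M}. real (cnt k))"
  define S2 where "S2 = (\<Sum>k\<in>{1..M}. (real (cnt k))\<^sup>2)"
  have s1: "S1 = (\<Sum>k\<in>{1..M} - K. 1 * real (cnt k))"
    unfolding S1_def using z by (intro sum.mono_neutral_cong_right) auto
  have s2: "S2 = (\<Sum>k\<in>{1..M} - K. (real (cnt k))\<^sup>2)"
    unfolding S2_def using z by (intro sum.mono_neutral_right) auto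
  have "S1\<^sup>2 \<le> (\<Sum>k\<in>{1..M} - K. 1\<^sup>2) * (\<Sum>k\<in>{1..M} - K. (real (cnt k))\<^sup>2)"
    unfolding s1 by (rule Cauchy_Schwarz_ineq_sum)
  also have "\<dots> = (m - real (card K)) * S2" unfolding s2 cK[symmetric] by simp
  also have "\<dots> \<le> (m * (1 - 1/u)) * (4 * \<delta>\<^sup>2 * m * c\<^sup>2 * (1 + 19 * \<nu>))"
  proof (rule mult_mono)
    show "m - real (card K) \<le> m * (1 - 1/u)" using K(2) u_pos by (simp add: m_def field_simps)
    show "S2 \<le> 4 * \<delta>\<^sup>2 * m * c\<^sup>2 * (1 + 19 * \<nu>)" using second_moment by (simp add: S2_def m_def c_def \<nu>_def)
    show "0 \<le> m * (1 - 1/u)" using m0 u1 by simp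
    show "0 \<le> S2" unfolding S2_def by (intro sum_nonneg) auto
  qed
  finally have up: "S1\<^sup>2 \<le> (m * (1 - 1/u)) * (4 * \<delta>\<^sup>2 * m * c\<^sup>2 * (1 + 19 * \<nu>))" .
  have "2 * \<delta> * m * c * (1 - 4 * \<nu>) \<le> S1" using first_moment by (simp add: S1_def m_def c_def \<nu>_def)
  hence "(2 * \<delta> * m * c * (1 - 4 * \<nu>))\<^sup>2 \<le> S1\<^sup>2"
    using \<delta>_pos m0 c0 \<nu> by (intro power_mono) auto
  also note up
  also have "(2 * \<delta> * m * c * (1 - 4 * \<nu>))\<^sup>2 = (4 * \<delta>\<^sup>2 * m\<^sup>2 * c\<^sup>2) * (1 - 4 * \<nu>)\<^sup>2" by (simp add: power_mult_distrib)
  also have "(m * (1 - 1/u)) * (4 * \<delta>\<^sup>2 * m * c\<^sup>2 * (1 + 19 * \<nu>)) = (4 * \<delta>\<^sup>2 * m\<^sup>2 * c\<^sup>2) * ((1 - 1/u) * (1 + 19 * \<nu>))"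
    by (simp only: power2_eq_square mult_ac)
  finally have "(4 * \<delta>\<^sup>2 * m\<^sup>2 * c\<^sup>2) * (1 - 4 * \<nu>)\<^sup>2 \<le> (4 * \<delta>\<^sup>2 * m\<^sup>2 * c\<^sup>2) * ((1 - 1/u) * (1 + 19 * \<nu>))" .
  moreover have "4 * \<delta>\<^sup>2 * m\<^sup>2 * c\<^sup>2 > 0" using \<delta>_pos m0 c0 by simp
  ultimately have "(1 - 4 * \<nu>)\<^sup>2 \<le> (1 - 1/u) * (1 + 19 * \<nu>)" by (simp only: mult_le_cancel_left_pos)
  moreover have "(1 - 4 * \<nu>)\<^sup>2 \<ge> 1 - 8 * \<nu>" by (simp add: power2_eq_square algebra_simps)
  moreover have "(1 - 1/u) * (1 + 19 * \<nu>) \<le> 1 - 1/u + 19 * \<nu>" using \<nu> u_pos by (simp add: algebra_simps)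
  ultimately have "1/u \<le> 27 * \<nu>" by linarith
  hence "u \<le> 27" using u_pos by (simp add: \<nu>_def power2_eq_square field_simps)
  thus False using u_big by simp
qed

end

section \<open>Chebyshev's lower bound and sets of smooth numbers\<close>

lemma card_multiples_upto: "d > 0 \<Longrightarrow> card {m\<in>{1..n}. d dvd m} = n div d" for d n :: nat
proof -
  assume d: "d > 0"
  have "{m\<in>{1..n}. d dvd m} = (\<lambda>k. d * k) ` {1..n div d}"
  proof (intro equalityI subsetI)
    fix m assume m: "m \<in> {m\<in>{1..n}. d dvd m}"
    then obtain k where k: "m = d * k" by auto
    have "k \<le> n div d" using m k d by (simp add: less_eq_div_iff_mult_less_eq mult.commute)
    moreover have "k \<ge> 1" using m k by (cases k) auto
    ultimately show "m \<in> (\<lambda>k. d * k) ` {1..n div d}" using k by auto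
  next
    fix m assume "m \<in> (\<lambda>k. d * k) ` {1..n div d}"
    then obtain k where k: "m = d * k" "1 \<le> k" "k \<le> n div d" by (metis atLeastAtMost_iff imageE)
    hence "k * d \<le> n" using d by (simp add: less_eq_div_iff_mult_less_eq)
    thus "m \<in> {m\<in>{1..n}. d dvd m}" using k d by (simp add: mult.commute Suc_le_eq)
  qed
  thus ?thesis using d by (simp add: card_image inj_on_def)
qed

text \<open>Legendre's formula: each logarithm is a sum of \<open>mangoldt\<close> over divisors,
  and the order of summation is exchanged.\<close>

lemma ln_fact_mangoldt: "ln (fact n :: real) = (\<Sum>d\<in>{1..n}. mangoldt d * real (n div d))"
proof -
  have "ln (fact n :: real) = (\<Sum>m\<in>{1..n}. ln (real m))"
    unfolding fact_prod of_nat_prod by (rule ln_prod) auto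
  also have "\<dots> = (\<Sum>m\<in>{1..n}. \<Sum>d\<in>{1..n}. if d dvd m then mangoldt d else 0)"
  proof (intro sum.cong refl)
    fix m assume m: "m \<in> {1..n}"
    have "ln (real m) = (\<Sum>d | d dvd m. mangoldt d)" using mangoldt_sum[of m, where 'a = real] m by simp
    also have "{d. d dvd m} = {d\<in>{1..n}. d dvd m}" using m by (auto intro!: Nat.gr0I simp: Suc_le_eq dest: dvd_imp_le)
    also have "(\<Sum>d\<in>{d\<in>{1..n}. d dvd m}. mangoldt d) = (\<Sum>d\<in>{1..n}. if d dvd m then mangoldt d else (0::real))"
      by (rule sum.inter_filter) simp
    finally show "ln (real m) = (\<Sum>d\<in>{1..n}. if d dvd m then mangoldt d else 0)" .
  qed
  also have "\<dots> = (\<Sum>d\<in>{1..n}. \<Sum>m\<in>{1..n}. if d dvd m then mangoldt d else 0)" by (rule sum.swap)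
  also have "\<dots> = (\<Sum>d\<in>{1..n}. mangoldt d * real (n div d))"
  proof (intro sum.cong refl)
    fix d assume d: "d \<in> {1..n}"
    have "(\<Sum>m\<in>{1..n}. if d dvd m then mangoldt d else (0::real)) = (\<Sum>m\<in>{m\<in>{1..n}. d dvd m}. mangoldt d)"
      by (rule sum.inter_filter[symmetric]) simp
    also have "\<dots> = mangoldt d * real (n div d)" using card_multiples_upto[of d n] d by simp
    finally show "(\<Sum>m\<in>{1..n}. if d dvd m then mangoldt d else (0::real)) = mangoldt d * real (n div d)" .
  qed
  finally show ?thesis .
qed

text \<open>If e powers of a prime p are at most N, their total weight e ln p is at most ln
  N.\<close>

lemma sum_mangoldt_le: "(\<Sum>d\<in>{1..N}. mangoldt d :: real) \<le> real (card {p. prime p \<and> p \<le> N}) * ln (real N)"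
proof -
  define Q where "Q = {p. prime p \<and> p \<le> N}"
  define e where "e p = nat \<lfloor>ln (real N) / ln (real p)\<rfloor>" for p :: nat
  define h where "h = (\<lambda>(p, k). p ^ k :: nat)"
  have finQ: "finite Q" unfolding Q_def by (rule finite_subset[of _ "{..N}"]) auto
  have lnp: "ln (real p) > 0" if "p \<in> Q" for p using that prime_gt_1_nat[of p] by (simp add: Q_def)
  have N1: "N \<ge> 1" if "p \<in> Q" for p using that prime_gt_0_nat[of p] by (simp add: Q_def)
  have "(\<Sum>d\<in>{1..N}. mangoldt d :: real) = (\<Sum>d\<in>{d\<in>{1..N}. primepow d}. mangoldt d)"
    by (intro sum.mono_neutral_right) (auto simp: mangoldt_def)
  also have "\<dots> \<le> (\<Sum>d\<in>h ` (SIGMA p:Q. {1..e p}). mangoldt d)"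
  proof (rule sum_mono2)
    show "{d\<in>{1..N}. primepow d} \<subseteq> h ` (SIGMA p:Q. {1..e p})"
    proof
      fix d assume d: "d \<in> {d\<in>{1..N}. primepow d}"
      then obtain p k where pk: "prime p" "k > 0" "d = p ^ k" by (auto simp: primepow_def)
      have "p ^ 1 \<le> p ^ k" using pk prime_gt_0_nat[OF pk(1)] by (intro power_increasing) auto
      hence pQ: "p \<in> Q" using pk d by (simp add: Q_def)
      have "ln (real p ^ k) \<le> ln (real N)"
      proof (subst ln_le_cancel_iff)
        show "real p ^ k \<le> real N" using d pk(3) by (simp flip: of_nat_power)
      qed (use prime_gt_0_nat[OF pk(1)] N1[OF pQ] in auto)
      hence "real k * ln (real p) \<le> ln (real N)" using prime_gt_0_nat[OF pk(1)] by (simp add: ln_realpow)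
      hence "real k \<le> ln (real N) / ln (real p)" using lnp[OF pQ] by (simp add: pos_le_divide_eq)
      hence "k \<le> e p" by (simp add: e_def le_nat_iff le_floor_iff)
      thus "d \<in> h ` (SIGMA p:Q. {1..e p})" using pk pQ by (auto simp: h_def intro!: image_eqI[of _ _ "(p,k)"])
    qed
  qed (use finQ mangoldt_nonneg in auto)
  also have "\<dots> \<le> (\<Sum>x\<in>(SIGMA p:Q. {1..e p}). mangoldt (h x))"
    by (rule sum_image_le[unfolded o_def]) (use finQ mangoldt_nonneg in auto)
  also have "\<dots> = (\<Sum>p\<in>Q. \<Sum>k\<in>{1..e p}. mangoldt (p ^ k))"
    using finQ by (subst sum.Sigma) (auto simp: h_def intro!: sum.cong)
  also have "\<dots> = (\<Sum>p\<in>Q. real (e p) * ln (real p))"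
    by (intro sum.cong refl) (auto simp: Q_def)
  also have "\<dots> \<le> (\<Sum>p\<in>Q. ln (real N))"
  proof (rule sum_mono)
    fix p assume p: "p \<in> Q"
    have "real (e p) \<le> ln (real N) / ln (real p)" unfolding e_def using lnp[OF p] N1[OF p] by (simp add: of_nat_nat)
    thus "real (e p) * ln (real p) \<le> ln (real N)" using lnp[OF p] by (simp add: pos_le_divide_eq)
  qed
  finally show ?thesis by (simp add: Q_def)
qed

text \<open>Chebyshev's argument with the central binomial coefficient: in its logarithm
  \<open>mangoldt d\<close> carries the weight floor(2n/d) - 2 floor(n/d), which is at most
  1.\<close>

lemma chebyshev_lower:
  assumes "n > 0"
  shows "real n * ln 4 - ln (2 * real n) \<le> real (card {p. prime p \<and> p \<le> 2 * n}) * ln (2 * real n)"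
proof -
  have fl: "real (2 * n div d) - 2 * real (n div d) \<le> 1" if "d > 0" for d
  proof -
    have "n < Suc (n div d) * d" using that dividend_less_div_times[of d n] by simp
    hence "2 * n < (2 * (n div d) + 2) * d" by (simp add: algebra_simps)
    hence "2 * n div d < 2 * (n div d) + 2" by (rule less_mult_imp_div_less)
    thus ?thesis by linarith
  qed
  have "4 ^ n / (2 * real n) \<le> real ((2 * n) choose n)" using central_binomial_lower_bound[OF assms] by simp
  hence "ln (4 ^ n / (2 * real n)) \<le> ln (real ((2 * n) choose n))" using assms by (subst ln_le_cancel_iff) auto
  hence 1: "real n * ln 4 - ln (2 * real n) \<le> ln (real ((2 * n) choose n))" using assms by (simp add: ln_div ln_realpow)
  have "real ((2 * n) choose n) = fact (2 * n) / (fact n * fact n)" using binomial_fact[of n "2 * n", where 'a = real] by simp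
  hence "ln (real ((2 * n) choose n)) = ln (fact (2 * n)) - 2 * ln (fact n)" by (simp add: ln_div ln_mult)
  also have "ln (fact n :: real) = (\<Sum>d\<in>{1..2 * n}. mangoldt d * real (n div d))"
    unfolding ln_fact_mangoldt by (intro sum.mono_neutral_left) auto
  also have "ln (fact (2 * n) :: real) - 2 * (\<Sum>d\<in>{1..2 * n}. mangoldt d * real (n div d)) = 
      (\<Sum>d\<in>{1..2 * n}. mangoldt d * (real (2 * n div d) - 2 * real (n div d)))"
    unfolding ln_fact_mangoldt by (simp add: sum_distrib_left sum_subtractf[symmetric] algebra_simps)
  also have "\<dots> \<le> (\<Sum>d\<in>{1..2 * n}. mangoldt d * 1)"
    using fl by (intro sum_mono mult_left_mono mangoldt_nonneg) auto
  also have "\<dots> \<le> real (card {p. prime p \<and> p \<le> 2 * n}) * ln (2 * real n)" using sum_mangoldt_le[of "2 * n"] by simp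
  finally show ?thesis using 1 by linarith
qed

text \<open>The primes up to sqrt y are dropped at trivial cost. Those that remain are large, as the
  divisor bounds require.\<close>

lemma card_primes_between:
  fixes y :: real
  assumes "y \<ge> 4"
  shows "(y / 2 - 1) * ln 4 / ln y - 1 - sqrt y \<le> real (card {p. prime p \<and> sqrt y < real p \<and> real p \<le> y})"
proof -
  define n where "n = nat \<lfloor>y / 2\<rfloor>"
  have n: "real n \<le> y / 2" "y / 2 - 1 \<le> real n" "n > 0" using assms unfolding n_def by (auto simp: of_nat_nat; linarith)+
  have ly: "ln y > 0" using assms by simp
  have l2: "ln (2 * real n) \<le> ln y" using n by (subst ln_le_cancel_iff) auto
  define Q where "Q = {p::nat. prime p \<and> p \<le> 2 * n}"
  define Q' where "Q' = {p::nat. prime p \<and> sqrt y < real p \<and> real p \<le> y}"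
  have finQ: "finite Q'" unfolding Q'_def by (rule finite_subset[of _ "{..nat \<lfloor>y\<rfloor>}"]) (auto simp: le_nat_iff le_floor_iff)
  have sub: "Q \<subseteq> Q' \<union> {1..nat \<lfloor>sqrt y\<rfloor>}"
  proof
    fix p assume p: "p \<in> Q"
    have "real p \<le> 2 * real n" using p by (simp add: Q_def flip: of_nat_le_iff[where 'a = real])
    hence py: "real p \<le> y" using n by linarith
    have pp: "prime p" "p \<ge> 1" using p prime_gt_0_nat[of p] by (auto simp: Q_def)
    show "p \<in> Q' \<union> {1..nat \<lfloor>sqrt y\<rfloor>}"
    proof (cases "sqrt y < real p")
      case True thus ?thesis using pp py by (simp add: Q'_def)
    next
      case False
      hence "int p \<le> \<lfloor>sqrt y\<rfloor>" by (simp add: le_floor_iff)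
      hence "p \<le> nat \<lfloor>sqrt y\<rfloor>" by linarith
      thus ?thesis using pp by simp
    qed
  qed
  have "card Q \<le> card (Q' \<union> {1..nat \<lfloor>sqrt y\<rfloor>})" using finQ by (intro card_mono[OF _ sub]) auto
  also have "\<dots> \<le> card Q' + card {1..nat \<lfloor>sqrt y\<rfloor>}" by (rule card_Un_le)
  finally have "real (card Q) \<le> real (card Q') + real (nat \<lfloor>sqrt y\<rfloor>)" by simp
  also have "real (nat \<lfloor>sqrt y\<rfloor>) \<le> sqrt y" using assms by (simp add: of_nat_nat)
  finally have cQ: "real (card Q) - sqrt y \<le> real (card Q')" by simp
  have "(y / 2 - 1) * ln 4 \<le> real n * ln 4" using n by (intro mult_right_mono) auto
  also have "\<dots> \<le> real (card Q) * ln (2 * real n) + ln (2 * real n)" using chebyshev_lower[OF n(3)] by (simp add: Q_def)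
  also have "\<dots> \<le> real (card Q) * ln y + ln y" using l2 by (intro add_mono mult_left_mono) auto
  finally have "(y / 2 - 1) * ln 4 \<le> (real (card Q) + 1) * ln y" by (simp add: algebra_simps)
  hence "(y / 2 - 1) * ln 4 / ln y \<le> real (card Q) + 1" using ly by (simp add: pos_divide_le_eq)
  thus ?thesis using cQ by (simp add: Q'_def)
qed

section \<open>Squarefree products of primes and multiplicative windows\<close>

lemma prime_factors_prod_primes:
  fixes B :: "nat set"
  assumes "finite B" "\<And>p. p \<in> B \<Longrightarrow> prime p"
  shows "squarefree (\<Prod>B)" "prime_factors (\<Prod>B) = B"
proof -
  show "prime_factors (\<Prod>B) = B"
  proof (intro equalityI subsetI)
    fix p assume "p \<in> prime_factors (\<Prod>B)"
    hence p: "prime p" "p dvd \<Prod>B" by (auto simp: prime_factors_dvd)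
    then obtain r where "r \<in> B" "p dvd r" using prime_dvd_prod_iff[OF assms(1) p(1), of "\<lambda>x. x"] by auto
    thus "p \<in> B" using p(1) assms(2) primes_dvd_imp_eq by metis
  next
    fix p assume p: "p \<in> B"
    have "\<Prod>B \<noteq> 0" using assms prime_gt_0_nat by (auto simp: prod_zero_iff)
    thus "p \<in> prime_factors (\<Prod>B)" using p assms by (auto simp: prime_factors_dvd intro: dvd_prodI)
  qed
  show "squarefree (\<Prod>B)"
    by (rule squarefree_prod_coprime) (use assms squarefree_prime in \<open>auto intro!: primes_coprime\<close>)
qed

text \<open>Products of K distinct primes from A, with K as large as y^K \<le> u^e permits; there
  are at least (|A|/K)^K of them. The loss of one power of u has two sources: rounding K costs at
  most a factor y \<le> sqrt u, and thinning the primes to y^(1 - \<eta>) costs y^(\<eta> K) \<le>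
  sqrt u, as e \<eta> \<le> 1/2.\<close>

lemma squarefree_products:
  fixes A :: "nat set" and y u \<eta> :: real and e :: nat
  assumes A: "finite A" "\<And>p. p \<in> A \<Longrightarrow> prime p \<and> real p \<le> y" and y: "exp 1 \<le> y" "y\<^sup>2 \<le> u" and \<eta>: "0 < \<eta>" "\<eta> < 1" "real e * \<eta> \<le> 1/2"
    and e: "e > 0" and cA: "real e * ln u * y powr (1 - \<eta>) \<le> real (card A)"
  obtains X where "finite X" "\<And>x. x \<in> X \<Longrightarrow> sfp A x \<and> real x \<le> u ^ e" "u ^ (e - 1) \<le> real (card X)"
proof -
  define K where "K = nat \<lfloor>real e * ln u / ln y\<rfloor>"
  define X where "X = (\<lambda>B. \<Prod>B) ` {B. B \<subseteq> A \<and> card B = K}"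
  have y1: "y > 1" using y(1) exp_gt_one[of 1] by linarith
  have ly: "ln y \<ge> 1" using y(1) y1 ln_ge_iff[of y 1] by simp
  have yu: "y \<le> u" 
  proof -
    have "y * 1 \<le> y * y" using y1 by (intro mult_left_mono) auto
    thus ?thesis using y(2) by (simp add: power2_eq_square)
  qed
  have u1: "u > 1" using yu y1 by linarith
  have lu: "ln u \<ge> ln y" using yu y1 u1 by simp
  have x0: "real e * ln u / ln y \<ge> 1"
  proof -
    have "1 * ln y \<le> real e * ln u" using e lu ly by (intro mult_mono) auto
    thus ?thesis using ly by (simp add: pos_le_divide_eq)
  qed
  have K: "real K \<le> real e * ln u / ln y" "real e * ln u / ln y - 1 \<le> real K" "K \<ge> 1"
    unfolding K_def using x0 by (auto simp: of_nat_nat le_nat_iff le_floor_iff; linarith)+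
  have Kle: "real K \<le> real e * ln u"
  proof -
    have "real e * ln u / ln y \<le> real e * ln u / 1" using ly lu e by (intro divide_left_mono) auto
    thus ?thesis using K(1) by simp
  qed
  have yp: "y powr (1 - \<eta>) \<ge> 1" using y1 \<eta> by (simp add: ge_one_powr_ge_zero)
  have kA: "real K * y powr (1 - \<eta>) \<le> real (card A)"
    using mult_right_mono[OF Kle, of "y powr (1 - \<eta>)"] cA yp by linarith
  have KA: "K \<le> card A"
  proof -
    have "real K * 1 \<le> real K * y powr (1 - \<eta>)" using yp by (intro mult_left_mono) auto
    hence "real K \<le> real (card A)" using kA by linarith
    thus ?thesis by simp
  qed
  have prA: "finite B" "\<And>p. p \<in> B \<Longrightarrow> prime p" if "B \<subseteq> A" for B using that A finite_subset by auto
  have inj: "inj_on (\<lambda>B. \<Prod>B) {B. B \<subseteq> A \<and> card B = K}"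
  proof (rule inj_onI)
    fix B B' assume b: "B \<in> {B. B \<subseteq> A \<and> card B = K}" "B' \<in> {B. B \<subseteq> A \<and> card B = K}" "\<Prod>B = \<Prod>B'"
    have s: "B \<subseteq> A" "B' \<subseteq> A" using b by auto
    have "prime_factors (\<Prod>B) = B" by (rule prime_factors_prod_primes(2)) (blast intro: prA[OF s(1)])+
    moreover have "prime_factors (\<Prod>B') = B'" by (rule prime_factors_prod_primes(2)) (blast intro: prA[OF s(2)])+
    ultimately show "B = B'" using b(3) by metis
  qed
  show ?thesis
  proof (rule that[of X])
    show "finite X" unfolding X_def using A(1) by simp
    show "sfp A x \<and> real x \<le> u ^ e" if "x \<in> X" for x
    proof -
      from that obtain B where B: "B \<subseteq> A" "card B = K" "x = \<Prod>B" by (auto simp: X_def)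
      have "sfp A x" unfolding sfp_def B(3) using prime_factors_prod_primes[of B] prA[OF B(1)] B(1) by auto
      moreover have "real x \<le> y ^ K"
      proof -
        have "real x = (\<Prod>p\<in>B. real p)" using B(3) by simp
        also have "\<dots> \<le> (\<Prod>p\<in>B. y)" using A(2) B(1) by (intro prod_mono) auto
        also have "\<dots> = y ^ K" using B(2) by simp
        finally show ?thesis .
      qed
      moreover have "y ^ K \<le> u ^ e"
      proof (subst ln_le_cancel_iff[symmetric])
        have "real K * ln y \<le> real e * ln u" using K(1) ly by (simp add: pos_le_divide_eq)
        thus "ln (y ^ K) \<le> ln (u ^ e)" using y1 u1 by (simp add: ln_realpow)
      qed (use y1 u1 in auto)
      ultimately show ?thesis by linarith
    qed
    have "u ^ (e - 1) \<le> (y powr (1 - \<eta>)) ^ K"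
    proof (subst ln_le_cancel_iff[symmetric])
      have l2: "2 * ln y \<le> ln u"
      proof -
        have "ln (y\<^sup>2) \<le> ln u" using y(2) y1 u1 by (subst ln_le_cancel_iff) auto
        thus ?thesis using y1 by (simp add: ln_realpow)
      qed
      have "(real e * ln u / ln y - 1) * ln y \<le> real K * ln y" using K(2) ly by (intro mult_right_mono) auto
      hence k1: "real e * ln u - ln y \<le> real K * ln y" using ly by (simp add: algebra_simps)
      have "real (e - 1) * ln u = real e * ln u - ln u" using e by (simp add: of_nat_diff algebra_simps)
      also have "\<dots> \<le> (1 - \<eta>) * (real e * ln u - ln y)"
      proof -
        have "(real e * \<eta>) * ln u \<le> 1/2 * ln u" using \<eta>(3) lu ly by (intro mult_right_mono) auto
        moreover have "0 \<le> \<eta> * ln y" using \<eta> ly by simp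
        ultimately show ?thesis using l2 by (simp add: algebra_simps)
      qed
      also have "\<dots> \<le> (1 - \<eta>) * (real K * ln y)" using k1 \<eta> by (intro mult_left_mono) auto
      finally have "real (e - 1) * ln u \<le> real K * ((1 - \<eta>) * ln y)" by (simp add: algebra_simps)
      thus "ln (u ^ (e - 1)) \<le> ln ((y powr (1 - \<eta>)) ^ K)" using y1 u1 by (simp add: ln_realpow ln_powr)
    qed (use y1 u1 in auto)
    also have "\<dots> \<le> (real (card A) / real K) ^ K"
      using kA K(3) yp by (intro power_mono) (auto simp: pos_le_divide_eq mult.commute)
    also have "\<dots> \<le> real (card A choose K)" by (rule binomial_ge_n_over_k_pow_k[OF KA])
    also have "\<dots> = real (card X)" unfolding X_def card_image[OF inj] n_subsets[OF A(1)] by simp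
    finally show "u ^ (e - 1) \<le> real (card X)" .
  qed
qed

lemma exists_large_fibre:
  assumes "finite A" "finite B" "f ` A \<subseteq> B" "real (card B) \<le> N" "N > 0" "A \<noteq> {}"
  shows "\<exists>b\<in>B. real (card A) \<le> N * real (card {a\<in>A. f a = b})"
proof (rule ccontr)
  assume "\<not> ?thesis"
  hence l: "N * real (card {a\<in>A. f a = b}) < real (card A)" if "b \<in> B" for b using that by force
  have ne: "B \<noteq> {}" using assms by auto
  have "card A = (\<Sum>b\<in>B. card {a\<in>A. f a = b})"
    using sum.group[of A B f "\<lambda>_. 1::nat"] assms by simp
  hence "N * real (card A) = (\<Sum>b\<in>B. N * real (card {a\<in>A. f a = b}))" by (simp add: sum_distrib_left)
  also have "\<dots> < (\<Sum>b\<in>B. real (card A))" using l ne assms(2) by (intro sum_strict_mono) auto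
  also have "\<dots> \<le> N * real (card A)" using assms(4) by (simp add: mult_right_mono)
  finally show False by simp
qed

text \<open>Pigeonhole on a logarithmic scale: fewer than u^3 windows of ratio 1 + 1/u^2 cover the
  range up to u^e, which explains e - 4 = (e - 1) - 3.\<close>

lemma window_subset:
  fixes u :: real and e :: nat
  assumes X: "finite X" "\<And>x. x \<in> X \<Longrightarrow> 1 \<le> x \<and> real x \<le> u ^ e" "u ^ (e - 1) \<le> real (card X)"
    and u: "u \<ge> 1" "2 * real e * ln u + 2 \<le> u" and e: "e \<ge> 4"
  obtains X' x0 where "X' \<subseteq> X" "x0 > 0" "\<And>x. x \<in> X' \<Longrightarrow> x0 \<le> real x \<and> real x \<le> (1 + 1/u\<^sup>2) * x0" "u ^ (e - 4) \<le> real (card X')"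
proof -
  define \<nu> where "\<nu> = 1 / u\<^sup>2"
  define b where "b = ln (1 + \<nu>)"
  define f where "f x = nat \<lfloor>ln (real x) / b\<rfloor>" for x :: nat
  define R where "R = nat \<lfloor>real e * ln u / b\<rfloor>"
  have u2: "u\<^sup>2 \<ge> 1" using u(1) by (simp add: one_le_power)
  have \<nu>: "\<nu> > 0" "\<nu> \<le> 1" using u u2 by (auto simp: \<nu>_def divide_le_eq_1)
  have bge: "b \<ge> \<nu> / 2"
  proof -
    have "ln (1 / (1 + \<nu>)) \<le> 1 / (1 + \<nu>) - 1" using \<nu> by (intro ln_le_minus_one) auto
    hence "1 - 1 / (1 + \<nu>) \<le> b" using \<nu> by (simp add: b_def ln_div)
    moreover have "\<nu> / 2 \<le> \<nu> / (1 + \<nu>)" using \<nu> by (intro divide_left_mono) auto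
    moreover have "1 - 1 / (1 + \<nu>) = \<nu> / (1 + \<nu>)" using \<nu> by (simp add: field_simps)
    ultimately show ?thesis by linarith
  qed
  have b0: "b > 0" using bge \<nu> by linarith
  have lu: "ln u \<ge> 0" using u by simp
  have R: "real R + 1 \<le> u ^ 3"
  proof -
    have "real R \<le> real e * ln u / b" unfolding R_def using b0 lu by (simp add: of_nat_nat)
    also have "\<dots> \<le> real e * ln u / (\<nu> / 2)" using bge \<nu> lu b0 by (intro divide_left_mono) auto
    also have "\<dots> = 2 * real e * ln u * u\<^sup>2" by (simp add: \<nu>_def)
    also have "\<dots> \<le> (u - 2) * u\<^sup>2" using u(2) by (intro mult_right_mono) auto
    also have "\<dots> = u ^ 3 - 2 * u\<^sup>2" by (simp add: power3_eq_cube power2_eq_square algebra_simps)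
    finally show ?thesis using u2 by linarith
  qed
  have fle: "f ` X \<subseteq> {..R}"
  proof
    fix r assume "r \<in> f ` X"
    then obtain x where x: "x \<in> X" "r = f x" by auto
    have "ln (real x) \<le> ln (u ^ e)" using X(2)[OF x(1)] u(1) by (subst ln_le_cancel_iff) auto
    hence "ln (real x) \<le> real e * ln u" using u by (simp add: ln_realpow)
    hence "ln (real x) / b \<le> real e * ln u / b" using b0 by (intro divide_right_mono) auto
    thus "r \<in> {..R}" unfolding x(2) f_def R_def by (auto intro!: nat_mono floor_mono)
  qed
  have ne: "X \<noteq> {}" 
  proof
    assume "X = {}"
    hence "u ^ (e - 1) \<le> 0" using X(3) by simp
    moreover have "u ^ (e - 1) > 0" using u(1) by (intro zero_less_power) simp
    ultimately show False by linarith
  qed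
  have "real (card {..R}) \<le> u ^ 3" using R by simp
  moreover have "u ^ 3 > 0" using u(1) by simp
  ultimately obtain r where r: "real (card X) \<le> u ^ 3 * real (card {x\<in>X. f x = r})"
    using exists_large_fibre[OF X(1) finite_atMost fle, of "u ^ 3"] ne by auto
  define X' where "X' = {x\<in>X. f x = r}"
  define x0 where "x0 = exp (real r * b)"
  show ?thesis
  proof (rule that[of X' x0])
    show "X' \<subseteq> X" by (auto simp: X'_def)
    show "x0 > 0" by (simp add: x0_def)
    show "x0 \<le> real x \<and> real x \<le> (1 + 1/u\<^sup>2) * x0" if "x \<in> X'" for x
    proof -
      have x: "x \<in> X" "f x = r" using that by (auto simp: X'_def)
      have x1: "1 \<le> x" using X(2)[OF x(1)] by simp
      have l0: "ln (real x) / b \<ge> 0" using x1 b0 by simp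
      have "int r = \<lfloor>ln (real x) / b\<rfloor>" unfolding x(2)[symmetric] f_def using l0 by simp
      hence "real r = of_int \<lfloor>ln (real x) / b\<rfloor>" by linarith
      hence "real r \<le> ln (real x) / b" "ln (real x) / b < real r + 1" by linarith+
      hence l: "real r * b \<le> ln (real x)" "ln (real x) \<le> real r * b + b" using b0 by (auto simp: field_simps)
      have ex: "exp (ln (real x)) = real x" using x1 by simp
      have "x0 \<le> exp (ln (real x))" unfolding x0_def using l(1) by simp
      moreover have "exp (ln (real x)) \<le> exp (real r * b + b)" using l(2) by simp
      moreover have "exp (real r * b + b) = (1 + \<nu>) * x0" using \<nu> by (simp add: exp_add x0_def b_def)
      ultimately show ?thesis using ex by (simp add: \<nu>_def)
    qed
    have "u ^ 3 * u ^ (e - 4) = u ^ (e - 1)" using e by (simp flip: power_add)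
    also have "\<dots> \<le> u ^ 3 * real (card X')" using X(3) r by (simp add: X'_def)
    finally show "u ^ (e - 4) \<le> real (card X')" using u(1) by simp
  qed
qed

section \<open>Choice of parameters\<close>

lemma power_card_prime_divisors_le:
  fixes b :: nat and z :: real
  assumes "b > 0" "z \<ge> 1" "B \<subseteq> prime_factors b" "\<And>p. p \<in> B \<Longrightarrow> z \<le> real p"
  shows "z ^ card B \<le> real b"
proof -
  have mu: "multiplicity p b > 0" "prime p" if "p \<in> prime_factors b" for p
    using that assms(1) by (auto simp: prime_factors_multiplicity)
  have ge: "real p \<le> real p ^ multiplicity p b" if "p \<in> prime_factors b" for p
    using mu[OF that] prime_gt_0_nat[of p] by (intro self_le_power) auto
  have "z ^ card B = (\<Prod>p\<in>B. z)" by simp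
  also have "\<dots> \<le> (\<Prod>p\<in>B. real p ^ multiplicity p b)"
  proof (intro prod_mono conjI)
    fix p assume p: "p \<in> B"
    have "real p \<le> real p ^ multiplicity p b" using p assms(3) by (intro ge) auto
    thus "z \<le> real p ^ multiplicity p b" using assms(4)[OF p] by linarith
  qed (use assms(2) in simp)
  also have "\<dots> \<le> (\<Prod>p\<in>prime_factors b. real p ^ multiplicity p b)"
  proof (rule prod_mono2)
    show "1 \<le> real p ^ multiplicity p b" if "p \<in> prime_factors b - B" for p
      using that mu[of p] prime_gt_0_nat[of p] by (intro one_le_power) auto
  qed (use assms in auto)
  also have "\<dots> = real b" using prime_factorization_nat[OF assms(1)] by (simp flip: of_nat_power of_nat_prod)
  finally show ?thesis .
qed

lemma squarefree_eq_prod_prime_factors: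
  fixes d :: nat
  assumes "squarefree d"
  shows "d = \<Prod>(prime_factors d)"
proof -
  have d0: "d > 0" using assms by (auto intro!: Nat.gr0I)
  have "d = (\<Prod>p\<in>prime_factors d. p ^ multiplicity p d)" by (rule prime_factorization_nat[OF d0])
  also have "\<dots> = (\<Prod>p\<in>prime_factors d. p)"
  proof (intro prod.cong refl)
    fix p assume p: "p \<in> prime_factors d"
    have "multiplicity p d = 1"
      using squarefree_factorial_semiring''[of d] assms d0 p by (auto simp: prime_factors_multiplicity le_Suc_eq)
    thus "p ^ multiplicity p d = p" by simp
  qed
  finally show ?thesis .
qed

lemma harmonic_sum_le: "n > 0 \<Longrightarrow> (\<Sum>k\<in>{1..n}. 1 / real k) \<le> 1 + ln (real n)"
proof (induction n rule: nat_induct_non_zero)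
  case (Suc n)
  have "ln (real n / real (Suc n)) \<le> real n / real (Suc n) - 1" using Suc.hyps by (intro ln_le_minus_one) simp
  also have "\<dots> = - (1 / real (Suc n))" by (simp add: field_simps)
  finally have "1 / real (Suc n) \<le> ln (real (Suc n)) - ln (real n)" using Suc.hyps by (simp add: ln_div)
  thus ?case using Suc.IH by simp
qed simp

text \<open>A number up to u^200000 has at most 200000 ln u/ln z \<le> (ln u)/4 prime factors in P,
  and 12 \<le> exp 4. The base 12 comes from the fourth moment of Kloosterman sums; it covers the
  base 2 that counts squarefree divisors.\<close>

lemma divisor_bounded_primes:
  fixes P :: "nat set" and u z :: real
  assumes P: "\<And>p. p \<in> P \<Longrightarrow> z \<le> real p" and z: "exp 800000 \<le> z" and u: "u \<ge> 1" "1 + 200000 * ln u \<le> u"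
  shows "divisor_bounded P u (u ^ 200000)"
proof -
  have z1: "z \<ge> 1" using z one_le_exp_iff[of 800000] by linarith
  have lz: "ln z \<ge> 800000" using z z1 ln_ge_iff[of z 800000] by simp
  have key: "12 ^ card (prime_factors b \<inter> P) \<le> u" if b: "b > 0" "real b \<le> u ^ 200000" for b
  proof -
    define k where "k = card (prime_factors b \<inter> P)"
    have "z ^ k \<le> real b" unfolding k_def using P by (intro power_card_prime_divisors_le[OF b(1) z1]) auto
    hence "z ^ k \<le> u ^ 200000" using b(2) by linarith
    hence "ln (z ^ k) \<le> ln (u ^ 200000)" using z1 u by (subst ln_le_cancel_iff) auto
    hence "real k * ln z \<le> 200000 * ln u" using z1 u by (simp add: ln_realpow)
    moreover have "real k * 800000 \<le> real k * ln z" using lz by (intro mult_left_mono) auto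
    ultimately have k: "real k * 4 \<le> ln u" by linarith
    have "(12::real) \<le> exp 4" using exp_lower_Taylor_quadratic[of 4] by simp
    hence "(12::real) ^ k \<le> exp 4 ^ k" by (intro power_mono) auto
    also have "\<dots> = exp (real k * 4)" by (simp add: exp_of_nat_mult)
    also have "\<dots> \<le> exp (ln u)" using k by simp
    also have "\<dots> = u" using u by simp
    finally show ?thesis by (simp add: k_def)
  qed
  show ?thesis
  proof
    show "1 \<le> u" by (rule u(1))
    fix b :: nat assume b: "b > 0" "real b \<le> u ^ 200000"
    have "card {d. d dvd b \<and> sfp P d} \<le> card (Pow (prime_factors b \<inter> P))"
    proof (rule card_inj_on_le[of prime_factors])
      show "inj_on prime_factors {d. d dvd b \<and> sfp P d}"
        by (rule inj_onI) (metis (no_types, lifting) mem_Collect_eq sfp_def squarefree_eq_prod_prime_factors)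
      show "prime_factors ` {d. d dvd b \<and> sfp P d} \<subseteq> Pow (prime_factors b \<inter> P)"
        using b(1) by (auto simp: sfp_def prime_factors_dvd)
    qed simp
    also have "\<dots> = 2 ^ card (prime_factors b \<inter> P)" by (rule card_Pow) simp
    also have "\<dots> \<le> 12 ^ card (prime_factors b \<inter> P)" by (intro power_mono) auto
    finally have "real (card {d. d dvd b \<and> sfp P d}) \<le> real (12 ^ card (prime_factors b \<inter> P))" by (simp only: of_nat_le_iff)
    also have "\<dots> \<le> u" using key[OF b] by simp
    finally show "real (card {d. d dvd b \<and> sfp P d}) \<le> u" .
  next
    fix c assume c: "sfp P c" "real c \<le> u ^ 200000"
    have "prime_factors c \<inter> P = prime_factors c" using c(1) by (auto simp: sfp_def)
    thus "12 ^ omg c \<le> u" using key[OF sfp_pos[OF c(1)] c(2)] by (simp add: omg_def)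
  next
    fix n :: nat assume n: "real n \<le> u ^ 200000"
    show "(\<Sum>k\<in>{1..n}. 1 / real k) \<le> u"
    proof (cases "n = 0")
      case False
      have "ln (real n) \<le> ln (u ^ 200000)" using n False u by (subst ln_le_cancel_iff) auto
      hence "ln (real n) \<le> 200000 * ln u" using u by (simp add: ln_realpow)
      thus ?thesis using harmonic_sum_le[of n] False u(2) by linarith
    qed (use u in simp)
  qed
qed

lemma three_disjoint_subsets:
  fixes Q :: "'a set"
  assumes "finite Q" "3 * N \<le> card Q"
  obtains A B C where "A \<subseteq> Q" "B \<subseteq> Q" "C \<subseteq> Q" "A \<inter> B = {}" "A \<inter> C = {}" "B \<inter> C = {}" "card A = N" "card B = N" "card C = N"
proof -
  have sub: "\<exists>T\<subseteq>R. card T = N" if "N \<le> card R" for R :: "'a set"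
    using obtain_subset_with_card_n[OF that] by metis
  have "N \<le> card Q" using assms(2) by linarith
  then obtain A where A: "A \<subseteq> Q" "card A = N" using sub by blast
  have fA: "finite A" using A(1) assms(1) finite_subset by blast
  have cA: "card (Q - A) = card Q - N" using A fA by (simp add: card_Diff_subset)
  hence "N \<le> card (Q - A)" using assms(2) by linarith
  then obtain B where B: "B \<subseteq> Q - A" "card B = N" using sub by blast
  have fB: "finite B" using B(1) assms(1) finite_subset by blast
  have "card (Q - A - B) = card Q - N - N" using B fB cA by (simp add: card_Diff_subset)
  hence "N \<le> card (Q - A - B)" using assms(2) by linarith
  then obtain C where C: "C \<subseteq> Q - A - B" "card C = N" using sub by blast
  show ?thesis using A B C by (intro that[of A B C]) auto
qed

text \<open>The single value 1/100000 of \<eta> serves all exponents e up to 43940, since e \<eta>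
  stays below 1/2.\<close>

lemma window_products:
  fixes A :: "nat set" and y u :: real and e :: nat
  assumes A: "finite A" "\<And>p. p \<in> A \<Longrightarrow> prime p \<and> real p \<le> y" and y: "exp 1 \<le> y" "y\<^sup>2 \<le> u"
    and e: "4 \<le> e" "e \<le> 43940" and u: "200000 * ln u + 2 \<le> u"
    and cA: "43940 * ln u * y powr (1 - 1/100000) \<le> real (card A)"
  obtains X x0 where "finite X" "\<And>x. x \<in> X \<Longrightarrow> sfp A x" "\<And>x. x \<in> X \<Longrightarrow> real x \<le> u ^ e" "x0 > 0"
    "\<And>x. x \<in> X \<Longrightarrow> x0 \<le> real x \<and> real x \<le> (1 + 1/u\<^sup>2) * x0" "u ^ (e - 4) \<le> real (card X)"
proof -
  have y1: "y \<ge> 1" using y(1) one_le_exp_iff[of 1] by linarith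
  have u1: "u \<ge> 1" using y(2) one_le_power[OF y1, of 2] by linarith
  have lu: "ln u \<ge> 0" using u1 by simp
  have "real e * ln u * y powr (1 - 1/100000) \<le> 43940 * ln u * y powr (1 - 1/100000)"
    using e lu by (intro mult_right_mono) auto
  hence c: "real e * ln u * y powr (1 - 1/100000) \<le> real (card A)" using cA by linarith
  obtain X where X: "finite X" "\<And>x. x \<in> X \<Longrightarrow> sfp A x \<and> real x \<le> u ^ e" "u ^ (e - 1) \<le> real (card X)"
    by (rule squarefree_products[OF A y _ _ _ _ c]) (use e in auto)
  have X1: "1 \<le> x \<and> real x \<le> u ^ e" if "x \<in> X" for x
    using X(2)[OF that] sfp_pos[of A x] by auto
  have "2 * real e * ln u \<le> 200000 * ln u" using e lu by (intro mult_right_mono) auto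
  hence u2: "2 * real e * ln u + 2 \<le> u" using u by linarith
  obtain X' x0 where X': "X' \<subseteq> X" "x0 > 0" "\<And>x. x \<in> X' \<Longrightarrow> x0 \<le> real x \<and> real x \<le> (1 + 1/u\<^sup>2) * x0" "u ^ (e - 4) \<le> real (card X')"
    using window_subset[OF X(1) X1 X(3) u1 u2 e(1)] by blast
  show ?thesis using X X' finite_subset[OF X'(1) X(1)] by (intro that[of X' x0]) auto
qed

text \<open>Three disjoint sets of equally many primes supply s, t1 and t2. The multipliers k are
  built from \<open>PS\<close> once more: they have to be smooth and sufficiently dense, but may
  share primes with l.\<close>

lemma smooth_solution:
  fixes \<alpha> u y :: real
  assumes ga: "good_approximation \<alpha> q a" and q: "real q = u ^ 46000"
    and u: "u \<ge> 1000000" "200000 * ln u + 2 \<le> u" and y: "exp 1600000 \<le> y" "y\<^sup>2 \<le> u"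
    and cnt: "43940 * ln u * y powr (1 - 1/100000) \<le> ((y / 2 - 1) * ln 4 / ln y - 1 - sqrt y) / 3 - 1"
  shows "\<exists>n::nat. u \<le> real n \<and> real n \<le> u ^ 68000 \<and> (\<forall>p. prime p \<longrightarrow> p dvd n \<longrightarrow> real p \<le> y) \<and> dist_nearest_int (real n * \<alpha>) \<le> 1 / u ^ 24000"
proof -
  define Q where "Q = {p. prime p \<and> sqrt y < real p \<and> real p \<le> y}"
  define x where "x = 43940 * ln u * y powr (1 - 1/100000)"
  define N where "N = nat \<lceil>x\<rceil>"
  have lu: "ln u \<ge> 0" using u by simp
  have x0: "x \<ge> 0" using lu by (simp add: x_def)
  have N: "x \<le> real N" "real N \<le> x + 1" unfolding N_def using x0 by (auto simp: of_nat_nat; linarith)+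
  have y5: "exp 1 \<le> y" "4 \<le> y" "y \<ge> 1"
  proof -
    have "exp 1 \<le> exp (1600000::real)" by simp
    thus "exp 1 \<le> y" using y(1) by linarith
    have "1 + 1600000 \<le> exp (1600000::real)" by (rule exp_ge_add_one_self)
    thus "4 \<le> y" "y \<ge> 1" using y(1) by linarith+
  qed
  have finQ: "finite Q" unfolding Q_def by (rule finite_subset[of _ "{..nat \<lfloor>y\<rfloor>}"]) (auto simp: le_nat_iff le_floor_iff)
  have "3 * real N \<le> real (card Q)"
  proof -
    define r where "r = (y / 2 - 1) * ln 4 / ln y - 1 - sqrt y"
    have "r \<le> real (card Q)" unfolding r_def Q_def by (rule card_primes_between[OF y5(2)])
    moreover have "x \<le> r / 3 - 1" unfolding r_def x_def by (rule cnt)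
    ultimately show ?thesis using N(2) by linarith
  qed
  hence "3 * N \<le> card Q" by linarith
  then obtain PS P1 P2 where PP: "PS \<subseteq> Q" "P1 \<subseteq> Q" "P2 \<subseteq> Q" "PS \<inter> P1 = {}" "PS \<inter> P2 = {}" "P1 \<inter> P2 = {}" "card PS = N" "card P1 = N" "card P2 = N"
    using three_disjoint_subsets[OF finQ] by metis
  have fP: "finite PS" "finite P1" "finite P2" using PP finQ finite_subset by blast+
  have prQ: "prime p \<and> real p \<le> y" if "p \<in> Q" for p using that by (simp add: Q_def)
  have prP: "\<And>p. p \<in> PS \<Longrightarrow> prime p \<and> real p \<le> y" "\<And>p. p \<in> P1 \<Longrightarrow> prime p \<and> real p \<le> y" "\<And>p. p \<in> P2 \<Longrightarrow> prime p \<and> real p \<le> y"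
    using PP prQ by blast+
  have cP: "43940 * ln u * y powr (1 - 1/100000) \<le> real (card PS)" "43940 * ln u * y powr (1 - 1/100000) \<le> real (card P1)" "43940 * ln u * y powr (1 - 1/100000) \<le> real (card P2)"
    using N(1) PP by (simp_all add: x_def)
  obtain Ss s0 where S: "finite Ss" "\<And>s. s \<in> Ss \<Longrightarrow> sfp PS s" "\<And>s. s \<in> Ss \<Longrightarrow> real s \<le> u ^ 6020" "s0 > 0"
    "\<And>s. s \<in> Ss \<Longrightarrow> s0 \<le> real s \<and> real s \<le> (1 + 1/u\<^sup>2) * s0" "u ^ (6020 - 4) \<le> real (card Ss)"
    by (rule window_products[OF fP(1) prP(1) y5(1) y(2) _ _ u(2) cP(1), of 6020]) auto
  obtain T1 t10 where T1: "finite T1" "\<And>s. s \<in> T1 \<Longrightarrow> sfp P1 s" "\<And>s. s \<in> T1 \<Longrightarrow> real s \<le> u ^ 9020" "t10 > 0"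
    "\<And>s. s \<in> T1 \<Longrightarrow> t10 \<le> real s \<and> real s \<le> (1 + 1/u\<^sup>2) * t10" "u ^ (9020 - 4) \<le> real (card T1)"
    by (rule window_products[OF fP(2) prP(2) y5(1) y(2) _ _ u(2) cP(2), of 9020]) auto
  obtain T2 t20 where T2: "finite T2" "\<And>s. s \<in> T2 \<Longrightarrow> sfp P2 s" "\<And>s. s \<in> T2 \<Longrightarrow> real s \<le> u ^ 9020" "t20 > 0"
    "\<And>s. s \<in> T2 \<Longrightarrow> t20 \<le> real s \<and> real s \<le> (1 + 1/u\<^sup>2) * t20" "u ^ (9020 - 4) \<le> real (card T2)"
    by (rule window_products[OF fP(3) prP(3) y5(1) y(2) _ _ u(2) cP(3), of 9020]) auto
  obtain K where K: "finite K" "\<And>x. x \<in> K \<Longrightarrow> sfp PS x \<and> real x \<le> u ^ 43940" "u ^ (43940 - 1) \<le> real (card K)"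
    by (rule squarefree_products[OF fP(1) prP(1) y5(1) y(2), of "1/100000" 43940]) (use cP in auto)
  \<comment> \<open>2^I exceeds all lengths that are split dyadically, while I stays of order ln
    u.\<close>
  define I where "I = nat \<lceil>50000 * ln u / ln 2\<rceil>"
  have l2: "ln (2::real) > 0" by simp
  have I: "50000 * ln u / ln 2 \<le> real I" "real I \<le> 50000 * ln u / ln 2 + 1"
    unfolding I_def using lu l2 by (auto simp: of_nat_nat; linarith)+
  have Ige: "u ^ 50000 \<le> 2 ^ I"
  proof (subst ln_le_cancel_iff[symmetric])
    have "50000 * ln u \<le> real I * ln 2" using I(1) l2 by (simp add: pos_divide_le_eq)
    thus "ln (u ^ 50000) \<le> ln (2 ^ I)" using u by (simp add: ln_realpow)
  qed (use u in auto)
  have Ile: "real I + 1 \<le> u"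
  proof -
    have "50000 * ln u / ln 2 \<le> 50000 * ln u / (1/2)" using ln2_ge_two_thirds lu by (intro divide_left_mono) auto
    hence "50000 * ln u / ln 2 \<le> 100000 * ln u" by simp
    hence "real I \<le> 100000 * ln u + 1" using I(2) by (rule order_trans[rotated, OF add_right_mono])
    thus ?thesis using u(2) lu by linarith
  qed
  \<comment> \<open>All primes in use exceed sqrt y, whence the threshold exp 1600000 for y.\<close>
  have zle: "exp 800000 \<le> sqrt y"
  proof (rule real_le_rsqrt)
    have "(exp (800000::real))\<^sup>2 = exp 1600000" by (simp flip: exp_double)
    thus "(exp 800000)\<^sup>2 \<le> y" using y(1) by simp
  qed
  have db: "divisor_bounded Q u (u ^ 200000)"
    by (rule divisor_bounded_primes[of Q "sqrt y"]) (use zle u in \<open>auto simp: Q_def\<close>)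
  interpret smooth_setup \<alpha> q a Q u "u ^ 200000" PS P1 P2 Ss T1 T2 s0 t10 t20 "nat \<lfloor>u ^ 43940\<rfloor>" I
  proof (rule smooth_setup.intro[OF ga db], unfold_locales)
    show "u ^ 6016 \<le> real (card Ss)" using S(6) by simp
    show "u ^ 9016 \<le> real (card T1)" using T1(6) by simp
    show "u ^ 9016 \<le> real (card T2)" using T2(6) by simp
  qed (use u q Ige Ile PP S T1 T2 in \<open>simp_all\<close>)
  have KM: "K \<subseteq> {1..nat \<lfloor>u ^ 43940\<rfloor>}"
  proof
    fix k assume k: "k \<in> K"
    have "int k \<le> \<lfloor>u ^ 43940\<rfloor>" using K(2)[OF k] by (simp add: le_floor_iff)
    hence "k \<le> nat \<lfloor>u ^ 43940\<rfloor>" by linarith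
    thus "k \<in> {1..nat \<lfloor>u ^ 43940\<rfloor>}" using K(2)[OF k] sfp_pos[of PS k] by (simp add: Suc_le_eq)
  qed
  have cK: "real (nat \<lfloor>u ^ 43940\<rfloor>) \<le> u * real (card K)"
  proof -
    have "u ^ 43940 = u * u ^ 43939" using power_Suc[of u 43939] by simp
    also have "\<dots> \<le> u * real (card K)" using K(3) u by (intro mult_left_mono) auto
    finally show ?thesis using M_le by linarith
  qed
  obtain k l where kl: "k \<in> K" "l \<in> LL" "dn (real k * (real l * \<alpha>)) \<le> \<delta>"
    using solution_exists[OF KM cK] by blast
  have k0: "k > 0" using K(2)[OF kl(1)] sfp_pos by blast
  show ?thesis
  proof (intro exI[of _ "k * l"] conjI allI impI)
    have "u ^ 1 \<le> u ^ 24047" by (rule pw) simp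
    hence "u \<le> real l" using L0_ge LL_window(1)[OF kl(2)] by simp
    moreover have "real l \<le> real (k * l)" using k0 by (intro of_nat_mono) simp
    ultimately show "u \<le> real (k * l)" by linarith
    have "real k * real l \<le> u ^ (43940 + 24060)"
      using K(2)[OF kl(1)] LL_window(4)[OF kl(2)] by (intro upow_mult_mono) auto
    thus "real (k * l) \<le> u ^ 68000" by simp
    show "dist_nearest_int (real (k * l) * \<alpha>) \<le> 1 / u ^ 24000" using kl(3) by (simp add: \<delta>_def mult.assoc)
    fix p assume p: "prime p" "p dvd k * l"
    hence "p dvd k \<or> p dvd l" by (simp add: prime_dvd_mult_iff)
    hence "p \<in> prime_factors k \<or> p \<in> prime_factors l" using p(1) k0 LL_pos[OF kl(2)] by (auto simp: prime_factors_dvd)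
    hence "p \<in> Q" using K(2)[OF kl(1)] sfp_LL[OF kl(2)] PP(1) unfolding sfp_def by blast
    thus "real p \<le> y" by (simp add: Q_def)
  qed
qed

text \<open>The origin of the exponent 2000000: for y = (ln u)^2000000 the factor ln u is
  y^(1/2000000). As 1/2000000 < 1/100000, the left side is smaller than y by a fixed power of y,
  whereas the right side loses only a logarithm.\<close>

lemma eventually_prime_count:
  "\<forall>\<^sub>F y :: real in at_top. 43940 * y powr (1 / 2000000) * y powr (1 - 1/100000) \<le> ((y / 2 - 1) * ln 4 / ln y - 1 - sqrt y) / 3 - 1"
  by real_asymp

lemma eventually_smooth_parameters:
  "\<forall>\<^sub>F u :: real in at_top. u \<ge> 1000000 \<and> 200000 * ln u + 2 \<le> u \<and> exp 1600000 \<le> ln u powr 2000000 \<and> (ln u powr 2000000)\<^sup>2 \<le> u \<and> 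
     43940 * ln u * (ln u powr 2000000) powr (1 - 1/100000) \<le> ((ln u powr 2000000 / 2 - 1) * ln 4 / ln (ln u powr 2000000) - 1 - sqrt (ln u powr 2000000)) / 3 - 1"
proof (intro eventually_conj)
  show "\<forall>\<^sub>F u :: real in at_top. u \<ge> 1000000" by (rule eventually_ge_at_top)
  show "\<forall>\<^sub>F u :: real in at_top. 200000 * ln u + 2 \<le> u" by real_asymp
  have l: "filterlim (\<lambda>u :: real. ln u powr 2000000) at_top at_top" by real_asymp
  show "\<forall>\<^sub>F u :: real in at_top. exp 1600000 \<le> ln u powr 2000000"
    using l by (simp add: filterlim_at_top)
  have "\<forall>\<^sub>F u :: real in at_top. ln u powr 4000000 \<le> u" by real_asymp
  thus "\<forall>\<^sub>F u :: real in at_top. (ln u powr 2000000)\<^sup>2 \<le> u"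
    by eventually_elim (simp add: power2_eq_square flip: powr_add)
  have "\<forall>\<^sub>F u :: real in at_top. ln u > 0" by real_asymp
  moreover from eventually_compose_filterlim[OF eventually_prime_count l]
  have "\<forall>\<^sub>F u :: real in at_top. 43940 * (ln u powr 2000000) powr (1 / 2000000) * (ln u powr 2000000) powr (1 - 1/100000) \<le> ((ln u powr 2000000 / 2 - 1) * ln 4 / ln (ln u powr 2000000) - 1 - sqrt (ln u powr 2000000)) / 3 - 1" .
  ultimately show "\<forall>\<^sub>F u :: real in at_top. 43940 * ln u * (ln u powr 2000000) powr (1 - 1/100000) \<le> ((ln u powr 2000000 / 2 - 1) * ln 4 / ln (ln u powr 2000000) - 1 - sqrt (ln u powr 2000000)) / 3 - 1"
  proof eventually_elim
    case (elim u)
    have "(ln u powr 2000000) powr (1 / 2000000) = ln u" unfolding powr_powr using elim(1) by simp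
    thus ?case using elim(2) by (simp only:)
  qed
qed

theorem theorem1p1:
  shows "\<exists>C::real. C > 0 \<and>
    (\<forall>(\<alpha>::real) (\<theta>::real) (Y :: nat \<Rightarrow> real).
       \<alpha> \<notin> \<rat> \<longrightarrow> 0 < \<theta> \<longrightarrow> \<theta> < 6 / 17 \<longrightarrow>
       (\<forall>\<^sub>F n in sequentially. ln (real n) powr C \<le> Y n \<and> Y n \<le> real n) \<longrightarrow>
       infinite {n::nat. smooth_number (Y n) n \<and>
                         dist_nearest_int (real n * \<alpha>) < real n powr (- \<theta>)})"
proof (intro exI[of _ 2000000] conjI allI impI notI)
  fix \<alpha> \<theta> :: real and Y :: "nat \<Rightarrow> real"
  assume \<alpha>: "\<alpha> \<notin> \<rat>" and \<theta>: "0 < \<theta>" "\<theta> < 6 / 17"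
    and Y: "\<forall>\<^sub>F n in sequentially. ln (real n) powr 2000000 \<le> Y n \<and> Y n \<le> real n"
  let ?S = "{n::nat. smooth_number (Y n) n \<and> dist_nearest_int (real n * \<alpha>) < real n powr (- \<theta>)}"
  assume fin: "finite ?S"
  obtain n0 where n0: "\<And>n. n \<ge> n0 \<Longrightarrow> ln (real n) powr 2000000 \<le> Y n"
    using Y unfolding eventually_sequentially by blast
  obtain N where N: "\<And>n. n \<in> ?S \<Longrightarrow> n \<le> N" using fin finite_nat_set_iff_bounded_le by auto
  from eventually_smooth_parameters obtain u0 where u0:
    "\<And>u::real. u \<ge> u0 \<Longrightarrow> u \<ge> 1000000 \<and> 200000 * ln u + 2 \<le> u \<and> exp 1600000 \<le> ln u powr 2000000 \<and> (ln u powr 2000000)\<^sup>2 \<le> u \<and> 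
     43940 * ln u * (ln u powr 2000000) powr (1 - 1/100000) \<le> ((ln u powr 2000000 / 2 - 1) * ln 4 / ln (ln u powr 2000000) - 1 - sqrt (ln u powr 2000000)) / 3 - 1"
    unfolding eventually_at_top_linorder by blast
  \<comment> \<open>N bounds all solutions by assumption, so a new solution n \<ge> u > N is a
    contradiction; n0 makes the lower bound on Y available at n.\<close>
  define U where "U = max (max u0 (real n0)) (real N + 1)"
  \<comment> \<open>Dirichlet's theorem: an irrational number has reduced approximations h/k within
    1/k^2 of arbitrarily large denominator.\<close>
  have "infinite (approx_set \<alpha>)" using \<alpha> rational_iff_finite_approx_set by blast
  then obtain h k where hk: "(h,k) \<in> approx_set \<alpha>" "k > \<lceil>U ^ 46000\<rceil>" using infinite_approx_set by blast
  have hk': "k > 0" "coprime h k" "\<bar>\<alpha> - of_int h / of_int k\<bar> < 1 / (of_int k)\<^sup>2" using hk(1) by (auto simp: approx_set_def)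
  define q where "q = nat k"
  have q: "int q = k" "real q = of_int k" "q > 0" using hk'(1) by (auto simp: q_def)
  have ga: "good_approximation \<alpha> q h"
  proof
    show "coprime h (int q)" unfolding q(1) by (rule hk'(2))
    show "\<bar>\<alpha> - of_int h / real q\<bar> < 1 / (real q)\<^sup>2" unfolding q(2) by (rule hk'(3))
  qed (rule q(3))
  \<comment> \<open>As u is real, every denominator is exactly a power u^46000, so all
    approximations can be used.\<close>
  define u where "u = root 46000 (real q)"
  have uq: "real q = u ^ 46000" unfolding u_def by (rule real_root_pow_pos2[symmetric]) auto
  have u0': "u \<ge> 0" by (simp add: u_def)
  have "U < u"
  proof (rule power_less_imp_less_base[OF _ u0'])
    have "U ^ 46000 \<le> of_int \<lceil>U ^ 46000\<rceil>" by (rule le_of_int_ceiling)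
    also have "\<dots> < of_int k" using hk(2) by simp
    also have "\<dots> = u ^ 46000" using q(2) uq by simp
    finally show "U ^ 46000 < u ^ 46000" .
  qed
  hence uU: "u \<ge> u0" "u \<ge> real n0" "u \<ge> real N + 1" by (auto simp: U_def)
  note pu = u0[OF uU(1)]
  obtain n where n: "u \<le> real n" "real n \<le> u ^ 68000" "\<And>p. prime p \<Longrightarrow> p dvd n \<Longrightarrow> real p \<le> ln u powr 2000000" "dist_nearest_int (real n * \<alpha>) \<le> 1 / u ^ 24000"
    using smooth_solution[OF ga uq, of "ln u powr 2000000"] pu by blast
  have u1: "u > 1" using pu by linarith
  have n1: "n > 1" using n(1) u1 by linarith
  \<comment> \<open>The smoothness bound was fixed in terms of u before n was known; n \<ge> u makes
    it comparable with Y n.\<close>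
  have "ln u powr 2000000 \<le> ln (real n) powr 2000000" using n(1) u1 by (intro powr_mono2) auto
  also have "\<dots> \<le> Y n" using n(1) uU(2) by (intro n0) linarith
  finally have yY: "ln u powr 2000000 \<le> Y n" .
  have "smooth_number (Y n) n"
  proof -
    let ?D = "{p. prime p \<and> p dvd n}"
    have "finite ?D" using n1 by (intro finite_subset[OF _ finite_divisors_nat[of n]]) auto
    moreover have "?D \<noteq> {}" using prime_factor_nat[of n] n1 by auto
    ultimately have "Max ?D \<in> ?D" by (rule Max_in)
    hence "real (Max ?D) \<le> Y n" using n(3)[of "Max ?D"] yY by auto
    thus ?thesis using n1 by (simp add: smooth_number_def largest_prime_divisor_def)
  qed
  moreover have "dist_nearest_int (real n * \<alpha>) < real n powr (- \<theta>)"
  proof -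
    \<comment> \<open>The assumption on \<theta> says 68000 \<theta> < 24000, which also makes the
      final inequality strict.\<close>
    have "real n powr \<theta> \<le> (u ^ 68000) powr \<theta>" using n \<theta> by (intro powr_mono2) auto
    also have "u ^ 68000 = u powr 68000" using u1 by simp
    also have "(u powr 68000) powr \<theta> = u powr (68000 * \<theta>)" by (rule powr_powr)
    also have "\<dots> < u powr 24000" using u1 \<theta> by (intro powr_less_mono) auto
    also have "\<dots> = u ^ 24000" using u1 by simp
    finally have "1 / u ^ 24000 < 1 / real n powr \<theta>" using n1 u1 by (intro divide_strict_left_mono) auto
    thus ?thesis using n(4) by (simp add: powr_minus divide_inverse)
  qed
  ultimately have "n \<le> N" by (intro N) simp
  thus False using n(1) uU(3) by linarith
qed simp

end
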